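(* Let $\alpha$ be an exponentially closed ordinal. The following are equivalent: (1) $\text{COMP}^{\alpha}_{\text{wITRM}}\subseteq\text{RECOG}^{\alpha}_{\text{wITRM}}$. (2) $0\in\text{RECOG}^{\alpha}_{\text{wITRM}}$ (i.e., $0=\emptyset$ is $\alpha$-wITRM-recognizable). (3) $\text{COMP}^{\alpha}_{\text{wITRM}}\cap\text{RECOG}^{\alpha}_{\text{wITRM}}\neq\emptyset$ (i.e., some $\alpha$-wITRM-computable subset of $\alpha$ is $\alpha$-wITRM-recognizable). (4) $\alpha$ is not $u$-weak. (5) $\alpha$ is wITRM-searchable.
   Context: An (infinite) ordinal $\alpha$ is exponentially closed if $\beta^{\gamma}<\alpha$ for all $\beta,\gamma<\alpha$ (ordinal exponentiation). Machines. An $\alpha$-register machine program is an ordinary register machine program: a finite list of numbered lines using finitely many registers, each register containing an ordinal $<\alpha$. Commands: increment a register by $1$; copy one register to another; jump to a given line if two register contents agree (otherwise go to the next line); oracle command: for an oracle $x\subseteq\alpha$, replace the content $\iota$ of register $j$ by $1$ if $\iota\in x$ and by $0$ otherwise. Computations run along the ordinals: at successor times the active command is carried out; at limit times the index of the active program line and each register content are the inferior limits of the sequences of their earlier values. If such an inferior limit of register contents equals $\alpha$ (overflow), the computation of an $\alpha$-wITRM is undefined. Inputs and parameters are written in the first registers, all other registers start with $0$. $P^{x}(\vec\xi)\downarrow=c$ means that $P$ with oracle $x$ and input $\vec\xi$ halts with $c$ in the output register. A set $x\subseteq\alpha$ is $\alpha$-wITRM-computable if there are an $\alpha$-wITRM-program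 $P$ and a parameter $\rho<\alpha$ such that $P(\iota,\rho)\downarrow=\chi_{x}(\iota)$ for all $\iota<\alpha$. It is $\alpha$-wITRM-recognizable if there are an $\alpha$-wITRM-program $P$ and a parameter $\xi<\alpha$ such that, for all $y\subseteq\alpha$, $P^{y}(\xi)$ is defined and halts with output $1$ if $y=x$ and with output $0$ if $y\neq x$. $\text{COMP}^{\alpha}_{\text{wITRM}}$ and $\text{RECOG}^{\alpha}_{\text{wITRM}}$ are the sets of $\alpha$-wITRM-computable and $\alpha$-wITRM-recognizable subsets of $\alpha$, respectively. $\alpha$ is $u$-weak if every halting $\alpha$-wITRM-computation in the empty input halts in less than $\alpha$ many steps. $\alpha$ is wITRM-searchable if there is a halting $\alpha$-wITRM-program $P$ (run in some parameter $<\alpha$) such that the first register used by $P$ contains each element of $\alpha$ at least once before $P$ stops.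
   Formalization: In the definition of u-weak, "computation in the empty input" is read as a computation with no input but with an arbitrary parameter below α allowed; without parameters the equivalence of (4) and (5) fails, e.g. for the least epsilon number above ω₁. *)

theory Defs
  imports Main
begin

unbundle cardinal_syntax

text \<open>
  An ordinal \<open>\<alpha>\<close> is represented by a type \<open>'a\<close> of class \<^class>\<open>wellorder\<close>: the elements of
  \<open>'a\<close> are the ordinals below \<open>\<alpha>\<close>, and subsets of \<open>\<alpha>\<close> have type \<^typ>\<open>'a set\<close>.
\<close>

definition ord_zero :: "'a::wellorder" where
  "ord_zero = (LEAST a. True)"

text \<open>Only meaningful if \<open>a\<close> is not the largest element.\<close>
definition ord_suc :: "'a::wellorder \<Rightarrow> 'a" where
  "ord_suc a = (LEAST b. a < b)"

definition ord_one :: "'a::wellorder" where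
  "ord_one = ord_suc ord_zero"


section \<open>Exponentially closed ordinals\<close>

text \<open>The well-order of \<open>\<alpha>\<close> itself, as a relation.\<close>
definition ord_rel :: "('a::wellorder) rel" where
  "ord_rel = {(a, b). a \<le> b}"

text \<open>
  Ordinal exponentiation: \<open>\<beta>\<^sup>\<gamma>\<close> is the order type of the functions from \<open>\<gamma>\<close> to \<open>\<beta>\<close> with finite
  support, compared at the largest argument at which they differ. Functions are made
  \<^const>\<open>undefined\<close> outside \<open>\<gamma>\<close> by \<^const>\<open>Func\<close>.
\<close>
definition fin_supp_funs :: "'a::wellorder \<Rightarrow> 'a \<Rightarrow> ('a \<Rightarrow> 'a) set" where
  "fin_supp_funs \<beta> \<gamma> = {f \<in> Func {..<\<gamma>} {..<\<beta>}. finite {x. x < \<gamma> \<and> f x \<noteq> ord_zero}}"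

definition ord_exp :: "'a::wellorder \<Rightarrow> 'a \<Rightarrow> ('a \<Rightarrow> 'a) rel" where
  "ord_exp \<beta> \<gamma> = {(f, g). f \<in> fin_supp_funs \<beta> \<gamma> \<and> g \<in> fin_supp_funs \<beta> \<gamma> \<and>
     (f = g \<or> (let m = Max {x. f x \<noteq> g x} in f m < g m))}"

definition exponentially_closed :: "'a::wellorder itself \<Rightarrow> bool" where
  "exponentially_closed _ \<longleftrightarrow> infinite (UNIV :: 'a set) \<and>
     (\<forall>\<beta> \<gamma> :: 'a. ord_exp \<beta> \<gamma> <o (ord_rel :: 'a rel))"


section \<open>Programs and configurations\<close>

datatype instr =
    Inc nat           \<comment> \<open>increment the register by 1\<close>
  | Copy nat nat      \<comment> \<open>copy the first register to the second\<close>
  | Jump nat nat nat  \<comment> \<open>if the two registers agree, go to the line given last\<close>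
  | Query nat         \<comment> \<open>oracle command\<close>

type_synonym program = "instr list"

text \<open>
  A configuration consists of the index of the active program line and the register contents.
  Lines are numbered from 0; a program has halted when the active line does not exist.
\<close>
type_synonym 'a config = "nat \<times> (nat \<Rightarrow> 'a)"

definition halted :: "program \<Rightarrow> 'a config \<Rightarrow> bool" where
  "halted P c \<longleftrightarrow> length P \<le> fst c"

fun exec :: "instr \<Rightarrow> 'a::wellorder set \<Rightarrow> 'a config \<Rightarrow> 'a config" where
  "exec (Inc i) x (l, R) = (Suc l, R(i := ord_suc (R i)))"
| "exec (Copy i j) x (l, R) = (Suc l, R(j := R i))"
| "exec (Jump i j k) x (l, R) = (if R i = R j then k else Suc l, R)"
| "exec (Query j) x (l, R) = (Suc l, R(j := if R j \<in> x then ord_one else ord_zero))"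

definition step :: "program \<Rightarrow> 'a::wellorder set \<Rightarrow> 'a config \<Rightarrow> 'a config" where
  "step P x c = (if halted P c then c else exec (P ! fst c) x c)"

text \<open>The inputs are in the first registers; all other registers contain 0.\<close>
definition init_config :: "'a::wellorder list \<Rightarrow> 'a config" where
  "init_config xs = (0, \<lambda>i. if i < length xs then xs ! i else ord_zero)"


section \<open>Computations\<close>

text \<open>
  The inferior limit of \<open>f s\<close> for \<open>s < t\<close>, that is, the supremum over \<open>s < t\<close> of the minimum of
  the values \<open>f r\<close> with \<open>s \<le> r < t\<close>. It is \<^const>\<open>None\<close> if there is no such supremum in \<open>'b\<close>,
  i.e. if the inferior limit equals the order type of \<open>'b\<close>.
\<close>
definition ord_liminf :: "'t::wellorder \<Rightarrow> ('t \<Rightarrow> 'b::wellorder) \<Rightarrow> 'b option" where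
  "ord_liminf t f =
     (let M = (\<lambda>s. LEAST v. \<exists>r. s \<le> r \<and> r < t \<and> v = f r) ` {..<t}
      in if \<exists>b. \<forall>v\<in>M. v \<le> b then Some (LEAST b. \<forall>v\<in>M. v \<le> b) else None)"

text \<open>
  The configuration at a limit time. It is undefined if an earlier one is, or if the inferior
  limit of some register overflows. The line indices that occur are bounded, so their inferior
  limit always exists.
\<close>
definition limit_config ::
  "'t::wellorder \<Rightarrow> ('t \<Rightarrow> 'a::wellorder config option) \<Rightarrow> 'a config option" where
  "limit_config t C =
     (if (\<exists>s<t. C s = None) \<or> (\<exists>i. ord_liminf t (\<lambda>s. snd (the (C s)) i) = None) then None
      else Some (the (ord_liminf t (\<lambda>s. fst (the (C s)))),
                 \<lambda>i. the (ord_liminf t (\<lambda>s. snd (the (C s)) i))))"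

text \<open>\<open>covers s t\<close>: the time \<open>t\<close> is the successor of \<open>s\<close>.\<close>
definition covers :: "'t::wellorder \<Rightarrow> 't \<Rightarrow> bool" where
  "covers s t \<longleftrightarrow> s < t \<and> (\<forall>r<t. r \<le> s)"

text \<open>
  \<open>run P x xs t\<close> is the configuration at time \<open>t\<close> of the computation of \<open>P\<close> with oracle \<open>x\<close> and
  inputs \<open>xs\<close>; \<^const>\<open>None\<close> means that there has been an overflow. Times may come from any
  well-ordered type \<open>'t\<close>, and a halted configuration is kept from then on.
\<close>
function run :: "program \<Rightarrow> 'a::wellorder set \<Rightarrow> 'a list \<Rightarrow> 't::wellorder \<Rightarrow> 'a config option" where
  "run P x xs t =
     (let C = (\<lambda>s. if s < t then run P x xs s else None)
      in if \<forall>s. \<not> s < t then Some (init_config xs)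
         else if \<exists>s. covers s t then map_option (step P x) (C (THE s. covers s t))
         else limit_config t C)"
  by pat_completeness auto
termination
  by (relation "inv_image {(s, t). s < t} (\<lambda>(P, x, xs, t). t)") (auto intro: wf)

declare run.simps [simp del]

text \<open>
  The times of full computations are the ordinals below the cardinal successor of the cardinality
  of \<open>\<alpha>\<close>. This is no restriction for infinite \<open>\<alpha>\<close>. A computation that neither overflows nor
  halts before that (regular) cardinal has some configuration \<open>c\<close> at two limit times such that line index and registers are
  never below those of \<open>c\<close> in between, so it repeats that segment and never halts.
\<close>
typedef (overloaded) 'a stage = "Field (cardSuc (card_of (UNIV :: 'a set)))"
proof -
  have "Field (cardSuc (card_of (UNIV :: 'a set))) \<noteq> {}"
  proof
    assume *: "Field (cardSuc (card_of (UNIV :: 'a set))) = {}"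
    have "card_of (UNIV :: 'a set) <o cardSuc (card_of (UNIV :: 'a set))"
      by (rule cardSuc_greater[OF card_of_Card_order])
    then obtain f where "embed (card_of (UNIV :: 'a set)) (cardSuc (card_of (UNIV :: 'a set))) f"
      unfolding ordLess_def embedS_def by blast
    then have "f ` Field (card_of (UNIV :: 'a set)) \<subseteq> Field (cardSuc (card_of (UNIV :: 'a set)))"
      by (rule embed_Field)
    with * show False by (simp add: Field_card_of)
  qed
  then show ?thesis by blast
qed

instantiation stage :: (type) linorder
begin

definition less_eq_stage :: "'a stage \<Rightarrow> 'a stage \<Rightarrow> bool" where
  "less_eq_stage s t \<longleftrightarrow> (Rep_stage s, Rep_stage t) \<in> cardSuc (card_of (UNIV :: 'a set))"

definition less_stage :: "'a stage \<Rightarrow> 'a stage \<Rightarrow> bool" where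
  "less_stage s t \<longleftrightarrow> s \<le> t \<and> s \<noteq> t"

instance
proof -
  let ?r = "cardSuc (card_of (UNIV :: 'a set))"
  have "Well_order ?r"
    using cardSuc_Card_order[OF card_of_Card_order] card_order_on_def by blast
  then have refl: "refl_on (Field ?r) ?r" and tr: "trans ?r" and anti: "antisym ?r"
    and tot: "total_on (Field ?r) ?r"
    unfolding order_on_defs well_order_on_def by auto
  show "OFCLASS('a stage, linorder_class)"
  proof
    fix s t u :: "'a stage"
    show "(s < t) = (s \<le> t \<and> \<not> t \<le> s)"
      using anti refl Rep_stage[of s] unfolding less_stage_def less_eq_stage_def
      by (metis antisymD Rep_stage_inject refl_onD)
    show "s \<le> s"
      using refl Rep_stage[of s] unfolding less_eq_stage_def by (auto dest: refl_onD)
    show "s \<le> t \<Longrightarrow> t \<le> u \<Longrightarrow> s \<le> u"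
      using tr unfolding less_eq_stage_def by (rule transD)
    show "s \<le> t \<Longrightarrow> t \<le> s \<Longrightarrow> s = t"
      using anti unfolding less_eq_stage_def by (metis antisymD Rep_stage_inject)
    show "s \<le> t \<or> t \<le> s"
      using tot refl Rep_stage[of s] Rep_stage[of t] unfolding less_eq_stage_def
      by (metis total_on_def refl_onD)
  qed
qed

end

instance stage :: (type) wellorder
proof
  fix P :: "'a stage \<Rightarrow> bool" and t :: "'a stage"
  assume step: "\<And>t. (\<And>s. s < t \<Longrightarrow> P s) \<Longrightarrow> P t"
  let ?r = "cardSuc (card_of (UNIV :: 'a set))"
  have "Well_order ?r"
    using cardSuc_Card_order[OF card_of_Card_order] card_order_on_def by blast
  then have wfr: "wf (?r - Id)"
    unfolding well_order_on_def by blast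
  have "{(s, t). s < t} \<subseteq> inv_image (?r - Id) (Rep_stage :: 'a stage \<Rightarrow> _)"
    by (auto simp: less_stage_def less_eq_stage_def Rep_stage_inject)
  then have "wf {(s :: 'a stage, t). s < t}"
    using wf_inv_image[OF wfr] wf_subset by blast
  then show "P t"
    by (induction t rule: wf_induct_rule) (auto intro: step)
qed

text \<open>The computation has come to a halt at time \<open>t\<close> or earlier.\<close>
definition halted_by :: "program \<Rightarrow> 'a::wellorder set \<Rightarrow> 'a list \<Rightarrow> 't::wellorder \<Rightarrow> bool" where
  "halted_by P x xs t \<longleftrightarrow> (\<exists>c. run P x xs t = Some c \<and> halted P c)"

definition halts :: "program \<Rightarrow> 'a::wellorder set \<Rightarrow> 'a list \<Rightarrow> bool" where
  "halts P x xs \<longleftrightarrow> (\<exists>t :: 'a stage. halted_by P x xs t)"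

text \<open>The output register is the first register.\<close>
definition halts_with :: "program \<Rightarrow> 'a::wellorder set \<Rightarrow> 'a list \<Rightarrow> 'a \<Rightarrow> bool" where
  "halts_with P x xs v \<longleftrightarrow>
     (\<exists>(t :: 'a stage) c. run P x xs t = Some c \<and> halted P c \<and> snd c 0 = v)"


section \<open>Computability, recognizability, weakness and searchability\<close>

text \<open>Computations without an oracle use the empty oracle.\<close>
definition wITRM_computable :: "'a::wellorder set \<Rightarrow> bool" where
  "wITRM_computable x \<longleftrightarrow>
     (\<exists>P \<rho>. \<forall>\<iota>. halts_with P {} [\<iota>, \<rho>] (if \<iota> \<in> x then ord_one else ord_zero))"

definition wITRM_recognizable :: "'a::wellorder set \<Rightarrow> bool" where
  "wITRM_recognizable x \<longleftrightarrow>
     (\<exists>P \<xi>. \<forall>y. halts_with P y [\<xi>] (if y = x then ord_one else ord_zero))"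

definition COMP :: "'a::wellorder set set" where
  "COMP = {x. wITRM_computable x}"

definition RECOG :: "'a::wellorder set set" where
  "RECOG = {x. wITRM_recognizable x}"

text \<open>
  A computation in the empty input has no input besides a parameter \<open>\<rho> < \<alpha>\<close>. Parameters are
  essential: without them every uncountable \<open>\<alpha>\<close> would be \<open>u\<close>-weak, as programs halting without
  parameters halt at a countable time. Halting in less than \<open>\<alpha>\<close> many
  steps means having halted at some time in \<open>'a\<close>.
\<close>
definition u_weak :: "'a::wellorder itself \<Rightarrow> bool" where
  "u_weak _ \<longleftrightarrow>
     (\<forall>P (\<rho> :: 'a). halts P {} [\<rho>] \<longrightarrow> (\<exists>t :: 'a. halted_by P {} [\<rho>] t))"

definition wITRM_searchable :: "'a::wellorder itself \<Rightarrow> bool" where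
  "wITRM_searchable _ \<longleftrightarrow>
     (\<exists>P (\<rho> :: 'a). halts P {} [\<rho>] \<and>
        (\<forall>\<iota>. \<exists>(t :: 'a stage) c. run P {} [\<rho>] t = Some c \<and> \<not> halted P c \<and> snd c 0 = \<iota>))"

end

theory Submission imports Defs begin

text \<open>
  (3) implies (5): let \<open>x\<close> be computable and recognized by \<open>Q\<close>. Run \<open>Q\<close> with the oracle \<open>x\<close>, where the
  queries are answered by computing \<open>x\<close>. Every ordinal below \<open>\<alpha>\<close> is queried, since otherwise \<open>Q\<close>
  could not distinguish \<open>x\<close> from a set differing from \<open>x\<close> only there.
  (5) implies (1): while the search program runs, compare the oracle with \<open>x\<close> at each value of its
  first register. (5) implies (4): if all ordinals occur in a computation of fewer than \<open>\<alpha>\<close> steps, then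
  the first time at which some register is at least \<open>\<iota>\<close> is strictly increasing in \<open>\<iota>\<close>, so
  \<open>\<alpha>\<close> embeds into a smaller ordinal.

  (4) implies (5): let \<open>P\<close> halt after more than \<open>\<alpha>\<close> steps, with configuration \<open>c\<close> at time \<open>\<alpha>\<close>. If \<open>c\<close>
  occurred cofinally often before \<open>\<alpha>\<close>, then \<open>P\<close> would loop forever. So from some time on, \<open>\<alpha>\<close> is the
  first time at which \<open>c\<close> occurs, and a counter incremented at each step of \<open>P\<close> can be stopped at \<open>\<alpha>\<close>.
  It remains to keep its inferior limit at \<open>\<alpha>\<close> from overflowing. If some register of \<open>P\<close> is cofinally
  often below its value in \<open>c\<close>, the counter is reset whenever the minimum of the later values of that
  register grows; as this minimum is bounded, the counter still takes all values, for otherwise \<open>\<alpha>\<close>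
  would embed into \<open>\<beta>\<^sup>2\<close> for some \<open>\<beta> < \<alpha>\<close>. If not, the counter is set to 0 for a moment whenever all
  components of the configuration have agreed with \<open>c\<close> at some time since this was last done. This
  happens cofinally often below \<open>\<alpha>\<close>, but not below any smaller limit, where \<open>c\<close> would occur again.
\<close>

section \<open>Lexicographic pairs below an exponentially closed ordinal\<close>

text \<open>The proof is shaped by limit times. The inferior limit of a register sees every
  transient value inside a loop, so knowing the contents at the loop heads is not enough. Structured
  programs are therefore verified together with the exact set of register contents they pass
  through, and the registers obey a discipline: those of a simulated program are written at most
  once per simulated step, scratch registers are 0 at every head of the simulation loop (so that
  their inferior limit is 0), and non-zero parameters and constants are never written there. Only
  the few registers that carry information from one round to the next need limit arguments of their
  own. The definitions grant a single parameter, but the programs need several; an enumeration of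
  pairs that a machine can run through packs them into one ordinal. This enumeration, the full range
  of the counters and the comparison of \<alpha> with shorter computations all rest on one fact:
  there is no strictly increasing map from \<alpha> into the lexicographic square of some \<beta> <
  \<alpha>.\<close>

lemma ord_zero_le [simp]: "ord_zero \<le> (a::'a::wellorder)"
  unfolding ord_zero_def by (rule Least_le) simp

lemma not_less_ord_zero [simp]: "\<not> a < (ord_zero::'a::wellorder)"
  by (simp add: not_less)

lemma neq_ord_zero_iff: "a \<noteq> ord_zero \<longleftrightarrow> ord_zero < (a::'a::wellorder)"
  by (auto simp: less_le)

lemma ord_suc_greater: "a < b \<Longrightarrow> a < ord_suc (a::'a::wellorder)"
  unfolding ord_suc_def by (rule LeastI)

lemma ord_suc_least: "a < b \<Longrightarrow> ord_suc a \<le> (b::'a::wellorder)"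
  unfolding ord_suc_def by (rule Least_le)

lemma covers_ord_suc: "a < b \<Longrightarrow> covers a (ord_suc (a::'a::wellorder))"
  unfolding covers_def using ord_suc_greater ord_suc_least by (metis not_less)

lemma covers_unique: "covers s t \<Longrightarrow> covers s' t \<Longrightarrow> s = s'"
  unfolding covers_def by (meson antisym)

lemma covers_imp_suc: "covers s t \<Longrightarrow> t = ord_suc s"
  unfolding covers_def by (meson leD not_less_iff_gr_or_eq ord_suc_greater ord_suc_least order_le_less)

lemma strict_mono_ge_id:
  fixes f :: "'a::wellorder \<Rightarrow> 'a"
  assumes "\<And>v w. v < w \<Longrightarrow> f v < f w"
  shows "v \<le> f v"
proof (rule ccontr)
  assume "\<not> v \<le> f v"
  then have ex: "f v < v" by simp
  define u where "u = (LEAST u. f u < u)"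
  have "f u < u" unfolding u_def by (rule LeastI) (rule ex)
  then have "f (f u) < f u" by (rule assms)
  then have "u \<le> f u" unfolding u_def by (rule Least_le)
  with \<open>f u < u\<close> show False by simp
qed

definition lexl :: "'a::wellorder \<times> 'a \<Rightarrow> 'a \<times> 'a \<Rightarrow> bool" where
  "lexl p q \<longleftrightarrow> fst p < fst q \<or> fst p = fst q \<and> snd p < snd q"

locale exp_closed =
  fixes ty :: "'a::wellorder itself"
  assumes ec: "exponentially_closed TYPE('a)"
begin

lemma inf_UNIV: "infinite (UNIV :: 'a set)"
  using ec by (simp add: exponentially_closed_def)

text \<open>The ordinals 0, 1 and 2, where 2 is the exponent of the square. That
  \<open>ord_suc\<close> is a proper successor everywhere is not yet available, since
  \<open>no_max\<close> follows from \<open>no_lex\<close> and that from this lemma; so each larger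
  element is extracted from the infinity of the type.\<close>

lemma two_elements: "\<exists>z u t :: 'a. z = ord_zero \<and> u = ord_suc z \<and> t = ord_suc u \<and> z < u \<and> u < t
    \<and> {..<t} = {z, u}"
proof -
  have "\<not> (UNIV :: 'a set) \<subseteq> {ord_zero}" using inf_UNIV by (metis finite.emptyI finite_insert finite_subset)
  then obtain a :: 'a where "ord_zero < a" using neq_ord_zero_iff by blast
  then have 1: "(ord_zero::'a) < ord_suc ord_zero" by (rule ord_suc_greater)
  have 0: "a = ord_zero \<or> ord_suc ord_zero \<le> a" for a :: 'a
    by (metis neq_ord_zero_iff ord_suc_least)
  have "\<not> (UNIV :: 'a set) \<subseteq> {ord_zero, ord_suc ord_zero}"
    using inf_UNIV by (metis finite.emptyI finite_insert finite_subset)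
  then obtain b :: 'a where "b \<noteq> ord_zero" "b \<noteq> ord_suc ord_zero" by blast
  then have "ord_suc ord_zero < b" using 0[of b] by simp
  then have 2: "(ord_suc ord_zero::'a) < ord_suc (ord_suc ord_zero)" by (rule ord_suc_greater)
  have "x < ord_suc (ord_suc ord_zero) \<longleftrightarrow> x = ord_zero \<or> x = ord_suc ord_zero" for x :: 'a
  proof -
    have "x \<le> ord_suc ord_zero" if "x < ord_suc (ord_suc ord_zero)"
    proof (rule ccontr)
      assume "\<not> x \<le> ord_suc ord_zero"
      then have "ord_suc ord_zero < x" by (simp only: not_le)
      from leD[OF ord_suc_least[OF this]] that show False by contradiction
    qed
    moreover have "x = ord_zero \<or> x = ord_suc ord_zero" if "x \<le> ord_suc ord_zero" using 0[of x] that by auto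
    ultimately show ?thesis using less_trans[OF 1 2] 2 by blast
  qed
  then have "{..<ord_suc (ord_suc ord_zero)} = {ord_zero, ord_suc ord_zero::'a}" by auto
  with 1 2 show ?thesis by blast
qed

text \<open>The only consequence of exponential closure that is used: \<open>\<beta>\<^sup>2 < \<alpha>\<close>.\<close>
lemma no_lex:
  fixes f g :: "'a \<Rightarrow> 'a"
  assumes bd: "\<And>v. f v < \<beta>" "\<And>v. g v < \<beta>"
    and lex: "\<And>v w. v < w \<Longrightarrow> lexl (f v, g v) (f w, g w)"
  shows False
proof -
  obtain z u t :: 'a where zut: "z = ord_zero" "z < u" "u < t" "{..<t} = {z, u}"
    using two_elements by blast
  \<comment> \<open>A pair becomes a function on 2: the argument 1, which \<open>ord_exp\<close>
    compares before the argument 0, holds the leading component.\<close>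
  define h where "h v = (\<lambda>y. if y = z then g v else if y = u then f v else undefined)" for v
  have dom: "x < t \<longleftrightarrow> x = z \<or> x = u" for x using zut(4) by auto
  have hin: "h v \<in> fin_supp_funs \<beta> t" for v
    unfolding fin_supp_funs_def Func_def h_def using bd dom zut
    by (auto intro: finite_subset[of _ "{z,u}"])
  have hlt: "(h v, h w) \<in> ord_exp \<beta> t \<and> h v \<noteq> h w" if "v < w" for v w
  proof -
    have uz: "u \<noteq> z" using zut by auto
    let ?D = "{x. h v x \<noteq> h w x}"
    have sub: "?D \<subseteq> {z, u}" unfolding h_def by auto
    from lex[OF that] have "?D \<noteq> {} \<and> h v (Max ?D) < h w (Max ?D)"
    proof (cases "f v = f w")
      case False
      then have fl: "f v < f w" using lex[OF that] by (simp add: lexl_def)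
      have "u \<in> ?D" using False uz by (simp add: h_def)
      then have "Max ?D = u" using sub zut
        by (intro Max_eqI) (auto intro: finite_subset[of _ "{z,u}"])
      with fl uz \<open>u \<in> ?D\<close> show ?thesis by (auto simp: h_def)
    next
      case True
      then have gl: "g v < g w" using lex[OF that] by (simp add: lexl_def)
      have "?D = {z}" using gl True by (auto simp: h_def)
      then show ?thesis using gl by (auto simp: h_def)
    qed
    then show ?thesis using hin unfolding ord_exp_def by (auto simp: Let_def)
  qed
  have "ord_exp \<beta> t <o (ord_rel :: 'a rel)" using ec by (simp add: exponentially_closed_def)
  then obtain e where wo: "Well_order (ord_exp \<beta> t)" "Well_order (ord_rel :: 'a rel)"
    and e: "embed (ord_exp \<beta> t) (ord_rel :: 'a rel) e"
      and nb: "\<not> bij_betw e (Field (ord_exp \<beta> t)) (Field (ord_rel :: 'a rel))"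
    unfolding ordLess_def embedS_def by auto
  have inj: "inj_on e (Field (ord_exp \<beta> t))" using embed_inj_on[OF wo(1) e] .
  have FU: "Field (ord_rel :: 'a rel) = UNIV" unfolding ord_rel_def Field_def by auto
  have "e ` Field (ord_exp \<beta> t) \<noteq> UNIV" using nb inj FU by (auto simp: bij_betw_def)
  \<comment> \<open>An embedding that is not onto misses some \<open>a\<close>, and its image is an
    initial segment, hence lies below \<open>a\<close>. Composed with \<open>h\<close> it becomes a
    strictly increasing map of \<alpha> into itself, whose value at \<open>a\<close> would have to
    be at least \<open>a\<close>.\<close>
  then obtain a where a: "a \<notin> e ` Field (ord_exp \<beta> t)" by blast
  have eb: "e p < a" if "p \<in> Field (ord_exp \<beta> t)" for p
  proof (rule ccontr)
    assume "\<not> e p < a"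
    then have "a \<in> under (ord_rel :: 'a rel) (e p)" by (simp add: under_def ord_rel_def)
    moreover have "e ` under (ord_exp \<beta> t) p = under ord_rel (e p)"
      using e that unfolding embed_def bij_betw_def by blast
    ultimately have "a \<in> e ` under (ord_exp \<beta> t) p" by blast
    then show False using a unfolding under_def Field_def by blast
  qed
  have hF: "h v \<in> Field (ord_exp \<beta> t)" for v
    using hin unfolding ord_exp_def Field_def by auto
  have "e (h v) < e (h w)" if "v < w" for v w
  proof -
    have "(e (h v), e (h w)) \<in> ord_rel"
      using embed_compat[OF e] hlt[OF that] unfolding compat_def by blast
    moreover have "e (h v) \<noteq> e (h w)" using inj hF hlt[OF that] by (metis inj_onD)
    ultimately show ?thesis by (simp add: ord_rel_def)
  qed
  then have "a \<le> e (h a)" by (rule strict_mono_ge_id)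
  with eb[OF hF, of a] show False by simp
qed

text \<open>With a largest element \<open>a\<close>, sending \<open>v < a\<close> to (0, v) and
  \<open>a\<close> to (1, 0) would be strictly increasing with all components below
  \<open>a\<close>, which \<open>no_lex\<close> forbids.\<close>

lemma no_max: "\<exists>b. (a::'a) < b"
proof (rule ccontr)
  assume "\<nexists>b. a < b"
  then have top: "v \<le> a" for v using not_less by blast
  obtain z u t :: 'a where zut: "z = ord_zero" "z < u" "u < t" "{..<t} = {z, u}"
    using two_elements by blast
  have ua: "z < a" "u < a" using top zut by (meson less_le_trans)+
  show False
  proof (rule no_lex[of "\<lambda>v. if v < a then z else u" a "\<lambda>v. if v < a then v else z"])
    fix v w :: 'a assume "v < w"
    then show "lexl (if v < a then z else u, if v < a then v else z)
       (if w < a then z else u, if w < a then w else z)"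
      using order.strict_trans2[OF \<open>v < w\<close> top[of w]] zut(2) by (cases "w < a") (simp_all add: lexl_def)
  qed (use ua in auto)
qed

lemma ord_suc_gt [simp]: "(a::'a) < ord_suc a"
  using no_max ord_suc_greater by blast

lemma less_ord_suc_iff: "(b::'a) < ord_suc a \<longleftrightarrow> b \<le> a"
  by (meson leD leI le_less_trans ord_suc_gt ord_suc_least)

lemma ord_suc_le_iff: "ord_suc a \<le> (b::'a) \<longleftrightarrow> a < b"
  by (meson less_le_trans ord_suc_gt ord_suc_least)

lemma ord_suc_mono: "(a::'a) < b \<Longrightarrow> ord_suc a < ord_suc b"
  by (simp add: less_ord_suc_iff ord_suc_le_iff)

lemma ord_suc_inj [simp]: "ord_suc (a::'a) = ord_suc b \<longleftrightarrow> a = b"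
  by (metis less_irrefl linorder_neqE ord_suc_mono)

definition num :: "nat \<Rightarrow> 'a" where "num n = (ord_suc ^^ n) ord_zero"

lemma num_0: "num 0 = ord_zero" and num_Suc: "num (Suc n) = ord_suc (num n)"
  by (simp_all add: num_def)

lemma num_1: "num (Suc 0) = ord_one"
  by (simp add: num_def ord_one_def)

lemma num_less_iff [simp]: "num m < num n \<longleftrightarrow> m < n"
proof -
  have "strict_mono num"
    by (rule strict_mono_Suc_iff[THEN iffD2]) (simp add: num_Suc)
  then show ?thesis by (simp add: strict_mono_less)
qed

lemma num_eq_iff [simp]: "num m = num n \<longleftrightarrow> m = n"
  by (metis linorder_neq_iff num_less_iff)

lemma num_le_iff [simp]: "num m \<le> num n \<longleftrightarrow> m \<le> n"
  by (metis not_less num_less_iff)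

lemma less_num_ex: "w < num n \<Longrightarrow> \<exists>m<n. w = num m"
proof (induction n)
  case (Suc n)
  then show ?case by (metis less_ord_suc_iff less_Suc_eq num_Suc order_le_less)
qed (simp add: num_0)

lemma zero_less_one [simp]: "(ord_zero::'a) < ord_one"
  unfolding ord_one_def by simp

lemma one_neq_zero [simp]: "(ord_one::'a) \<noteq> ord_zero" "(ord_zero::'a) \<noteq> ord_one"
  using zero_less_one by (metis less_irrefl)+

end

section \<open>Inferior limits of sequences of sets of values\<close>

text \<open>A relational inferior limit: everything below \<open>v\<close> is eventually exceeded,
  and values up to \<open>v\<close> recur cofinally. The sequence is set-valued because
  \<open>V u\<close> will collect all values that a register takes during round \<open>u\<close> of
  a loop. Overflow is the case that no such \<open>v\<close> exists.\<close>

definition is_lim :: "'t::wellorder \<Rightarrow> 't \<Rightarrow> ('t \<Rightarrow> 'b::wellorder set) \<Rightarrow> 'b \<Rightarrow> bool" where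
  "is_lim s t V v \<longleftrightarrow> (\<forall>w<v. \<exists>u. s \<le> u \<and> u < t \<and> (\<forall>r. u \<le> r \<and> r < t \<longrightarrow> (\<forall>y\<in>V r. w < y))) \<and>
     (\<forall>u. s \<le> u \<and> u < t \<longrightarrow> (\<exists>r y. u \<le> r \<and> r < t \<and> y \<in> V r \<and> y \<le> v))"

lemma is_limD1:
  assumes "is_lim s t V v" "w < v"
  shows "\<exists>u. s \<le> u \<and> u < t \<and> (\<forall>r y. u \<le> r \<longrightarrow> r < t \<longrightarrow> y \<in> V r \<longrightarrow> w < y)"
  using assms unfolding is_lim_def by meson

lemma is_limD2:
  assumes "is_lim s t V v" "s \<le> u" "u < t"
  obtains r y where "u \<le> r" "r < t" "y \<in> V r" "y \<le> v"
  using assms unfolding is_lim_def by meson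

lemma is_limI:
  assumes "\<And>w. w < v \<Longrightarrow> \<exists>u. s \<le> u \<and> u < t \<and> (\<forall>r. u \<le> r \<and> r < t \<longrightarrow> (\<forall>y\<in>V r. w < y))"
    and "\<And>u. s \<le> u \<Longrightarrow> u < t \<Longrightarrow> \<exists>r y. u \<le> r \<and> r < t \<and> y \<in> V r \<and> y \<le> v"
  shows "is_lim s t V v"
  using assms unfolding is_lim_def by simp

definition is_limit :: "'t::wellorder \<Rightarrow> bool" where
  "is_limit t \<longleftrightarrow> (\<exists>s. s < t) \<and> (\<forall>s. \<not> covers s t)"

lemma is_limit_between: "is_limit t \<Longrightarrow> s < t \<Longrightarrow> \<exists>r. s < r \<and> r < t"
  unfolding is_limit_def covers_def by (meson not_less)

lemma is_limit_suc: "is_limit t \<Longrightarrow> s < t \<Longrightarrow> ord_suc s < t"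
  by (meson is_limit_between le_less_trans ord_suc_least)

lemma is_lim_unique:
  assumes "is_lim s t V v" "is_lim s t V v'"
  shows "v = v'"
proof -
  have "\<not> a < b" if a: "is_lim s t V a" and b: "is_lim s t V b" for a b
  proof
    assume "a < b"
    from is_limD1[OF b this] obtain u where u: "s \<le> u" "u < t" "\<forall>r y. u \<le> r \<longrightarrow> r < t \<longrightarrow> y \<in> V r \<longrightarrow> a < y"
      by blast
    from a u(1,2) obtain r y where "u \<le> r" "r < t" "y \<in> V r" "y \<le> a" by (rule is_limD2)
    with u(3) show False by (meson leD)
  qed
  with assms show ?thesis by (metis linorder_neqE)
qed

text \<open>The least \<open>v\<close> such that values up to \<open>v\<close> recur cofinally also
  satisfies the other half of \<open>is_lim\<close>, by its minimality. This is the tool against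
  overflow: one bound that is met cofinally often suffices.\<close>

lemma is_lim_ex:
  assumes "\<And>u. s \<le> u \<Longrightarrow> u < t \<Longrightarrow> \<exists>r y. u \<le> r \<and> r < t \<and> y \<in> V r \<and> y \<le> b"
  shows "\<exists>v\<le>b. is_lim s t V v"
proof -
  let ?P = "\<lambda>v. \<forall>u. s \<le> u \<and> u < t \<longrightarrow> (\<exists>r y. u \<le> r \<and> r < t \<and> y \<in> V r \<and> y \<le> v)"
  define v where "v = (LEAST v. ?P v)"
  have Pb: "?P b" using assms by blast
  then have P: "?P v" unfolding v_def by (rule LeastI)
  have vb: "v \<le> b" unfolding v_def using Pb by (rule Least_le)
  have "is_lim s t V v"
  proof (rule is_limI)
    fix w assume wv: "w < v"
    have "\<not> ?P w" using not_less_Least[OF wv[unfolded v_def]] .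
    then obtain u where "s \<le> u" "u < t" "\<forall>r y. u \<le> r \<longrightarrow> r < t \<longrightarrow> y \<in> V r \<longrightarrow> \<not> y \<le> w" by blast
    then show "\<exists>u\<ge>s. u < t \<and> (\<forall>r. u \<le> r \<and> r < t \<longrightarrow> (\<forall>y\<in>V r. w < y))" by (intro exI[of _ u]) (auto simp: not_le)
  next
    fix u assume "s \<le> u" "u < t"
    with P show "\<exists>r y. u \<le> r \<and> r < t \<and> y \<in> V r \<and> y \<le> v" by simp
  qed
  with vb show ?thesis by auto
qed

lemma is_lim_tail:
  assumes L: "is_lim s t V v" and "s < t" "s' < t"
  shows "is_lim s' t V v"
proof (rule is_limI)
  fix w assume "w < v"
  from is_limD1[OF L this] obtain u where u: "s \<le> u" "u < t" "\<forall>r y. u \<le> r \<longrightarrow> r < t \<longrightarrow> y \<in> V r \<longrightarrow> w < y"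
    by blast
  then show "\<exists>u\<ge>s'. u < t \<and> (\<forall>r. u \<le> r \<and> r < t \<longrightarrow> (\<forall>y\<in>V r. w < y))"
    using assms by (intro exI[of _ "max u s'"]) auto
next
  fix u assume "s' \<le> u" "u < t"
  then have "s \<le> max u s" "max u s < t" using assms by auto
  with L obtain r y where "max u s \<le> r" "r < t" "y \<in> V r" "y \<le> v" by (rule is_limD2)
  then show "\<exists>r y. u \<le> r \<and> r < t \<and> y \<in> V r \<and> y \<le> v" by auto
qed

lemma is_lim_cong:
  assumes "\<And>u. s \<le> u \<Longrightarrow> u < t \<Longrightarrow> V u = W u"
  shows "is_lim s t V v \<longleftrightarrow> is_lim s t W v"
proof -
  have "is_lim s t W v" if L: "is_lim s t V v" and eq: "\<And>u. s \<le> u \<Longrightarrow> u < t \<Longrightarrow> V u = W u" for V W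
  proof (rule is_limI)
    fix w assume "w < v"
    from is_limD1[OF L this] obtain u where u: "s \<le> u" "u < t" "\<forall>r y. u \<le> r \<longrightarrow> r < t \<longrightarrow> y \<in> V r \<longrightarrow> w < y"
      by blast
    with eq show "\<exists>u\<ge>s. u < t \<and> (\<forall>r. u \<le> r \<and> r < t \<longrightarrow> (\<forall>y\<in>W r. w < y))"
      by (intro exI[of _ u]) (metis order_trans)
  next
    fix u assume u: "s \<le> u" "u < t"
    with L obtain r y where "u \<le> r" "r < t" "y \<in> V r" "y \<le> v" by (rule is_limD2)
    with eq[of r] u show "\<exists>r y. u \<le> r \<and> r < t \<and> y \<in> W r \<and> y \<le> v" by (intro exI[of _ r] exI[of _ y]) auto
  qed
  with assms show ?thesis by metis
qed

lemma is_lim_zero: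
  assumes "\<And>u. s \<le> u \<Longrightarrow> u < t \<Longrightarrow> \<exists>r. u \<le> r \<and> r < t \<and> ord_zero \<in> V r"
  shows "is_lim s t V ord_zero"
  unfolding is_lim_def using assms by fastforce

lemma is_lim_const:
  assumes "s < t" "\<And>u. s \<le> u \<Longrightarrow> u < t \<Longrightarrow> V u = {v}"
  shows "is_lim s t V v"
  unfolding is_lim_def using assms by fastforce

text \<open>A value occurring at \<open>u\<close> is either \<open>f u\<close> or \<open>f\<close>
  at the next index. Below a limit both indices lie in the same tails, up to a shift by one, so the
  extra values change neither half of \<open>is_lim\<close>.\<close>

lemma is_lim_two_valued:
  assumes t: "is_limit t" and V: "\<And>u. s \<le> u \<Longrightarrow> u < t \<Longrightarrow> f u \<in> V u"
    "\<And>u y. s \<le> u \<Longrightarrow> u < t \<Longrightarrow> y \<in> V u \<Longrightarrow> y = f u \<or> y = f (ord_suc u)"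
  shows "is_lim s t V v \<longleftrightarrow> is_lim s t (\<lambda>u. {f u}) v"
proof -
  have su: "u \<le> ord_suc u \<and> ord_suc u < t" if "u < t" for u
    using t that by (meson is_limit_suc less_imp_le ord_suc_greater)
  have 1: "(\<forall>r. u \<le> r \<and> r < t \<longrightarrow> (\<forall>y\<in>V r. w < y)) \<longleftrightarrow> (\<forall>r. u \<le> r \<and> r < t \<longrightarrow> (\<forall>y\<in>{f r}. w < y))"
    if "s \<le> u" "u < t" for u w
  proof (intro iffI allI impI ballI)
    fix r y assume H: "\<forall>r. u \<le> r \<and> r < t \<longrightarrow> (\<forall>y\<in>{f r}. w < y)" "u \<le> r \<and> r < t" "y \<in> V r"
    then have "y = f r \<or> y = f (ord_suc r)" using V(2)[of r y] that by auto
    with H su[of r] show "w < y" by (metis insertI1 order_trans)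
  next
    fix r y assume "\<forall>r. u \<le> r \<and> r < t \<longrightarrow> (\<forall>y\<in>V r. w < y)" "u \<le> r \<and> r < t" "y \<in> {f r}"
    then show "w < y" using V(1) that by auto
  qed
  have 2: "(\<exists>r y. u \<le> r \<and> r < t \<and> y \<in> V r \<and> y \<le> v) \<longleftrightarrow> (\<exists>r y. u \<le> r \<and> r < t \<and> y \<in> {f r} \<and> y \<le> v)"
    if "s \<le> u" "u < t" for u
  proof
    assume "\<exists>r y. u \<le> r \<and> r < t \<and> y \<in> V r \<and> y \<le> v"
    then obtain r y where r: "u \<le> r" "r < t" "y \<in> V r" "y \<le> v" by blast
    then have "y = f r \<or> y = f (ord_suc r)" using V(2)[of r y] that by auto
    with r su[of r] show "\<exists>r y. u \<le> r \<and> r < t \<and> y \<in> {f r} \<and> y \<le> v" by (metis insertI1 order_trans)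
  next
    assume "\<exists>r y. u \<le> r \<and> r < t \<and> y \<in> {f r} \<and> y \<le> v"
    then obtain r where r: "u \<le> r" "r < t" "f r \<le> v" by blast
    then show "\<exists>r y. u \<le> r \<and> r < t \<and> y \<in> V r \<and> y \<le> v"
      using V(1)[of r] that by (meson order_trans)
  qed
  have "(\<exists>u. s \<le> u \<and> u < t \<and> (\<forall>r. u \<le> r \<and> r < t \<longrightarrow> (\<forall>y\<in>V r. w < y))) \<longleftrightarrow>
      (\<exists>u. s \<le> u \<and> u < t \<and> (\<forall>r. u \<le> r \<and> r < t \<longrightarrow> (\<forall>y\<in>{f r}. w < y)))" for w
    using 1[of _ w] by (meson)
  moreover have "(\<forall>u. s \<le> u \<and> u < t \<longrightarrow> (\<exists>r y. u \<le> r \<and> r < t \<and> y \<in> V r \<and> y \<le> v)) \<longleftrightarrow>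
      (\<forall>u. s \<le> u \<and> u < t \<longrightarrow> (\<exists>r y. u \<le> r \<and> r < t \<and> y \<in> {f r} \<and> y \<le> v))"
    using 2 by meson
  ultimately show ?thesis unfolding is_lim_def by presburger
qed

lemma is_lim_le:
  assumes L: "is_lim s t V v" and "\<And>u y. s \<le> u \<Longrightarrow> u < t \<Longrightarrow> y \<in> V u \<Longrightarrow> y \<le> b"
    "\<And>u. s \<le> u \<Longrightarrow> u < t \<Longrightarrow> V u \<noteq> {}"
  shows "v \<le> b"
proof (rule ccontr)
  assume "\<not> v \<le> b"
  then have "b < v" by simp
  from is_limD1[OF L this] obtain u where u: "s \<le> u" "u < t" "\<forall>r y. u \<le> r \<longrightarrow> r < t \<longrightarrow> y \<in> V r \<longrightarrow> b < y"
    by blast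
  then obtain y where "y \<in> V u" using assms(3) by blast
  with u assms(2)[of u y] show False by (metis leD order_refl)
qed

lemma is_lim_ge:
  assumes L: "is_lim s t V v" "s \<le> u" "u < t" and ge: "\<And>r y. u \<le> r \<Longrightarrow> r < t \<Longrightarrow> y \<in> V r \<Longrightarrow> b \<le> y"
  shows "b \<le> v"
proof -
  from L obtain r y where "u \<le> r" "r < t" "y \<in> V r" "y \<le> v" by (rule is_limD2)
  with ge show ?thesis by (meson order_trans)
qed

text \<open>The minimum over a tail only grows when the tail shrinks, so the supremum of these
  minima may be computed from any starting point \<open>s\<close> below \<open>t\<close>.\<close>

lemma ord_liminf_iff:
  assumes st: "s < t"
  shows "ord_liminf t f = Some v \<longleftrightarrow> is_lim s t (\<lambda>u. {f u}) v"
proof -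
  define m where "m s = (LEAST v. \<exists>r. s \<le> r \<and> r < t \<and> v = f r)" for s
  have mex: "\<exists>r. s \<le> r \<and> r < t \<and> m s = f r" if "s < t" for s
    unfolding m_def by (rule LeastI[of _ "f s"]) (use that in auto)
  have mle: "m s \<le> f r" if "s \<le> r" "r < t" for s r
    unfolding m_def by (rule Least_le) (use that in auto)
  have eq: "ord_liminf t f = (if \<exists>b. \<forall>s<t. m s \<le> b then Some (LEAST b. \<forall>s<t. m s \<le> b) else None)"
  proof -
    have "(\<forall>v\<in>m ` {..<t}. v \<le> b) \<longleftrightarrow> (\<forall>s<t. m s \<le> b)" for b by auto
    then show ?thesis unfolding ord_liminf_def Let_def m_def[symmetric] by simp
  qed
  have lim_ub: "m s' \<le> v" if L: "is_lim s t (\<lambda>u. {f u}) v" and "s' < t" for s' v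
  proof -
    have "s \<le> max s s'" "max s s' < t" using st that by auto
    with L obtain r y where "max s s' \<le> r" "r < t" "y \<in> {f r}" "y \<le> v" by (rule is_limD2)
    then show ?thesis using mle[of s' r] by simp
  qed
  have lim_least: "v \<le> b" if L: "is_lim s t (\<lambda>u. {f u}) v" and b: "\<forall>s<t. m s \<le> b" for b v
  proof (rule ccontr)
    assume "\<not> v \<le> b"
    then have "b < v" by simp
    from is_limD1[OF L this] obtain u where u: "s \<le> u" "u < t" "\<forall>r y. u \<le> r \<longrightarrow> r < t \<longrightarrow> y \<in> {f r} \<longrightarrow> b < y"
      by blast
    with mex[of u] b show False by (metis insertI1 leD)
  qed
  show ?thesis
  proof
    assume L: "is_lim s t (\<lambda>u. {f u}) v"
    have "\<exists>b. \<forall>s<t. m s \<le> b" using lim_ub[OF L] by blast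
    moreover have "(LEAST b. \<forall>s<t. m s \<le> b) = v"
      by (rule Least_equality) (use lim_ub[OF L] lim_least[OF L] in auto)
    ultimately show "ord_liminf t f = Some v" unfolding eq by simp
  next
    assume "ord_liminf t f = Some v"
    then have ex: "\<exists>b. \<forall>s<t. m s \<le> b" and v: "v = (LEAST b. \<forall>s<t. m s \<le> b)"
      unfolding eq by (auto split: if_splits)
    have ub: "\<forall>s<t. m s \<le> v" unfolding v using LeastI_ex[OF ex] by simp
    have "\<exists>v'\<le>v. is_lim s t (\<lambda>u. {f u}) v'"
    proof (rule is_lim_ex)
      fix u assume "s \<le> u" "u < t"
      then show "\<exists>r y. u \<le> r \<and> r < t \<and> y \<in> {f r} \<and> y \<le> v" using mex[of u] ub by (metis insertI1)
    qed
    then obtain v' where v': "v' \<le> v" "is_lim s t (\<lambda>u. {f u}) v'" by blast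
    have "v \<le> v'" unfolding v by (rule Least_le) (use lim_ub[OF v'(2)] in auto)
    with v' show "is_lim s t (\<lambda>u. {f u}) v" by auto
  qed
qed

section \<open>The type of stages\<close>

context exp_closed begin

lemma stage_initial: "|{..<u :: 'a stage}| \<le>o |UNIV :: 'a set|"
proof -
  let ?r = "cardSuc (card_of (UNIV :: 'a set))"
  have C: "Card_order ?r" by (rule cardSuc_Card_order[OF card_of_Card_order])
  have "Rep_stage ` {..<u} \<subseteq> underS ?r (Rep_stage u)"
    by (auto simp: underS_def less_stage_def less_eq_stage_def Rep_stage_inject)
  moreover have "inj_on Rep_stage {..<u}" by (simp add: inj_on_def Rep_stage_inject)
  ultimately have "|{..<u}| \<le>o |underS ?r (Rep_stage u)|"
    by (meson card_of_ordLeqI image_subset_iff)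
  also have "|underS ?r (Rep_stage u)| <o ?r" by (rule card_of_underS[OF C Rep_stage])
  finally show ?thesis by (simp add: cardSuc_ordLeq_ordLess card_of_Card_order)
qed

text \<open>Regularity of the successor cardinal: an unbounded set of at most |\<alpha>| stages
  would cover all stages by |\<alpha>| initial segments of size at most |\<alpha>|. It guarantees
  that recursions producing stages, such as \<open>stg\<close> and the time map in
  \<open>simulation\<close>, never run out of stages.\<close>

lemma stage_bounded:
  assumes A: "|A :: 'a stage set| \<le>o |UNIV :: 'a set|"
  shows "\<exists>b. \<forall>a\<in>A. a < b"
proof (rule ccontr)
  assume "\<nexists>b. \<forall>a\<in>A. a < b"
  then have unb: "\<And>b. \<exists>a\<in>A. b \<le> a" by (meson not_less)
  let ?r = "cardSuc (card_of (UNIV :: 'a set))"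
  have C: "Card_order ?r" by (rule cardSuc_Card_order[OF card_of_Card_order])
  have U: "(UNIV :: 'a stage set) = A \<union> (\<Union>a\<in>A. {..<a})" using unb by (auto simp: order_le_less)
  have "|\<Union>a\<in>A. {..<a}| \<le>o |UNIV :: 'a set|"
    by (rule card_of_UNION_ordLeq_infinite[OF inf_UNIV A]) (use stage_initial in auto)
  then have "|UNIV :: 'a stage set| \<le>o |UNIV :: 'a set|"
    unfolding U using card_of_Un_ordLeq_infinite_Field[OF _ A _ card_of_Card_order] inf_UNIV
    by (simp add: Field_card_of)
  moreover have "|Field ?r| \<le>o |UNIV :: 'a stage set|"
    by (rule card_of_ordLeqI[of Abs_stage]) (auto simp: inj_on_def Abs_stage_inject)
  ultimately have "|Field ?r| \<le>o |UNIV :: 'a set|" using ordLeq_transitive by blast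
  then have "?r \<le>o |UNIV :: 'a set|" using card_of_Field_ordIso[OF C] ordIso_ordLeq_trans ordIso_symmetric by blast
  moreover have "|UNIV :: 'a set| <o ?r" by (rule cardSuc_greater[OF card_of_Card_order])
  ultimately show False using not_ordLess_ordLeq by blast
qed

lemma stage_bounded_image:
  assumes "|A :: 'b set| \<le>o |UNIV :: 'a set|"
  shows "\<exists>b :: 'a stage. \<forall>a\<in>A. f a < b"
  using stage_bounded[OF ordLeq_transitive[OF card_of_image assms], of f] by auto

lemma stage_no_max: "\<exists>b. (u :: 'a stage) < b"
proof -
  have "|{ord_zero :: 'a}| \<le>o |UNIV :: 'a set|" by (rule card_of_mono1) simp
  from stage_bounded_image[OF this, of "\<lambda>_. u"] show ?thesis by auto
qed

lemma stage_suc_gt [simp]: "(u :: 'a stage) < ord_suc u"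
  using stage_no_max ord_suc_greater by blast

lemma stage_suc_le_iff: "ord_suc u \<le> (v :: 'a stage) \<longleftrightarrow> u < v"
  by (meson less_le_trans ord_suc_least stage_suc_gt)

lemma stage_less_suc_iff: "v < ord_suc u \<longleftrightarrow> v \<le> (u :: 'a stage)"
  by (meson not_less stage_suc_le_iff)

lemma stage_suc_inj [simp]: "ord_suc u = ord_suc (v :: 'a stage) \<longleftrightarrow> u = v"
  by (metis stage_less_suc_iff antisym order_refl)

lemma stage_covers_iff: "covers s (t :: 'a stage) \<longleftrightarrow> t = ord_suc s"
  using covers_imp_suc covers_ord_suc[OF stage_suc_gt] by blast

lemma stage_limit_suc [simp]: "\<not> is_limit (ord_suc (u :: 'a stage))"
  unfolding is_limit_def stage_covers_iff by blast

lemma stage_cases: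
  fixes u :: "'a stage"
  assumes "s < u"
  obtains v where "s \<le> v" "u = ord_suc v" | "is_limit u"
proof (cases "is_limit u")
  case False
  then obtain v where "u = ord_suc v" using assms unfolding is_limit_def stage_covers_iff by blast
  then show ?thesis using assms that(1)[of v] by (simp add: stage_less_suc_iff)
qed

lemma stage_interval_induct [consumes 1, case_names start suc limit]:
  fixes u :: "'a stage"
  assumes "s \<le> u" and start: "P s"
    and suc: "\<And>u. s \<le> u \<Longrightarrow> P u \<Longrightarrow> P (ord_suc u)"
    and lim: "\<And>u. is_limit u \<Longrightarrow> s < u \<Longrightarrow> (\<And>v. s \<le> v \<Longrightarrow> v < u \<Longrightarrow> P v) \<Longrightarrow> P u"
  shows "P u"
  using assms(1)
proof (induction u rule: less_induct)
  case (less u)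
  show ?case
  proof (cases "s = u")
    case True then show ?thesis using start by simp
  next
    case False
    then have "s < u" using less.prems by simp
    then show ?thesis
    proof (cases rule: stage_cases)
      case (1 v)
      then show ?thesis using suc less.IH[of v] by simp
    next
      case 2
      then show ?thesis using lim \<open>s < u\<close> less.IH by blast
    qed
  qed
qed

text \<open>The copy of \<open>\<alpha>\<close> at the beginning of the stages.\<close>
definition stg :: "'a \<Rightarrow> 'a stage" where
  "stg = wfrec {(v, w). v < w} (\<lambda>f v. LEAST s. \<forall>w<v. f w < s)"

lemma stg_rec: "stg v = (LEAST s. \<forall>w<v. stg w < s)"
proof -
  have "wf {(v :: 'a, w). v < w}" by (rule wf)
  from wfrec[OF this, of "\<lambda>f v. LEAST s. \<forall>w<v. f w < s" v] show ?thesis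
    unfolding stg_def cut_def by simp
qed

lemma card_le_UNIV: "|A :: 'a set| \<le>o |UNIV :: 'a set|"
  by (rule card_of_mono1) simp

lemma stg_mono: "v < w \<Longrightarrow> stg v < stg w"
proof -
  assume vw: "v < w"
  have "\<exists>s. \<forall>v\<in>{..<w}. stg v < s" by (rule stage_bounded_image[OF card_le_UNIV])
  then have "\<exists>s. \<forall>v<w. stg v < s" by auto
  then have "\<forall>v<w. stg v < (LEAST s. \<forall>v<w. stg v < s)" by (rule LeastI_ex)
  with vw stg_rec[of w] show ?thesis by simp
qed

lemma stg_less_iff [simp]: "stg v < stg w \<longleftrightarrow> v < w"
  by (metis stg_mono less_irrefl linorder_neqE less_trans)

lemma stg_eq_iff [simp]: "stg v = stg w \<longleftrightarrow> v = w"
  by (metis stg_less_iff linorder_neq_iff)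

lemma stg_le_iff [simp]: "stg v \<le> stg w \<longleftrightarrow> v \<le> w"
  by (meson not_less stg_less_iff)

lemma stg_initial: "s < stg v \<Longrightarrow> \<exists>w<v. s = stg w"
proof (induction v rule: less_induct)
  case (less v)
  have "\<not> (\<forall>w<v. stg w < s)"
    using less.prems not_less_Least[of s "\<lambda>s. \<forall>w<v. stg w < s"] unfolding stg_rec[of v] by blast
  then obtain w where "w < v" "s \<le> stg w" by (meson not_less)
  then show ?case using less.IH[of w] by (metis less_trans order_le_less)
qed

text \<open>The stage of order type \<open>\<alpha>\<close>.\<close>
definition top_stage :: "'a stage" where "top_stage = (LEAST s. \<forall>v. stg v < s)"

lemma stg_less_top [simp]: "stg v < top_stage"
proof -
  have "\<exists>s. \<forall>v\<in>UNIV. stg v < s" by (rule stage_bounded_image[OF card_le_UNIV])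
  then have "\<exists>s. \<forall>v. stg v < s" by simp
  then have "\<forall>v. stg v < top_stage" unfolding top_stage_def by (rule LeastI_ex)
  then show ?thesis by blast
qed

lemma less_top_ex: "s < top_stage \<Longrightarrow> \<exists>v. s = stg v"
proof -
  assume "s < top_stage"
  then have "\<not> (\<forall>v. stg v < s)" unfolding top_stage_def by (rule not_less_Least)
  then obtain v where "s \<le> stg v" by (meson not_less)
  then show ?thesis using stg_initial by (metis order_le_less)
qed

lemma stg_suc: "stg (ord_suc v) = ord_suc (stg v)"
proof (rule antisym)
  show "ord_suc (stg v) \<le> stg (ord_suc v)" by (simp add: stage_suc_le_iff)
  show "stg (ord_suc v) \<le> ord_suc (stg v)"
  proof (rule ccontr)
    assume "\<not> ?thesis"
    then have "ord_suc (stg v) < stg (ord_suc v)" by simp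
    from stg_initial[OF this] obtain w where "w < ord_suc v" "ord_suc (stg v) = stg w" by blast
    then show False by (metis less_ord_suc_iff not_less stage_suc_gt stg_le_iff)
  qed
qed

lemma stg_zero: "stg ord_zero = ord_zero"
  using stg_initial[of ord_zero ord_zero] by (metis neq_ord_zero_iff not_less_ord_zero)

lemma top_is_limit: "is_limit top_stage"
  unfolding is_limit_def stage_covers_iff
proof (intro conjI allI notI)
  show "\<exists>s. s < top_stage" using stg_less_top by blast
next
  fix s assume s: "top_stage = ord_suc s"
  have "s < top_stage" unfolding s by (rule stage_suc_gt)
  then obtain v where "s = stg v" using less_top_ex by blast
  with s have "top_stage = stg (ord_suc v)" by (simp add: stg_suc)
  then show False using stg_less_top[of "ord_suc v"] by simp
qed

lemma is_limit_stg: "is_limit (stg v) \<longleftrightarrow> is_limit v"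
proof
  assume L: "is_limit v"
  then obtain w where "w < v" unfolding is_limit_def by blast
  moreover have False if "stg v = ord_suc s" for s
  proof -
    have "s < stg v" using that by simp
    then obtain w where "w < v" "s = stg w" using stg_initial by blast
    then have "v = ord_suc w" using that stg_suc by (metis stg_eq_iff)
    then show False using L covers_ord_suc[OF \<open>w < v\<close>] unfolding is_limit_def by blast
  qed
  ultimately show "is_limit (stg v)" unfolding is_limit_def stage_covers_iff using stg_less_iff by blast
next
  assume L: "is_limit (stg v)"
  then obtain s where "s < stg v" unfolding is_limit_def by blast
  then have "\<exists>w<v. s = stg w" by (rule stg_initial)
  moreover have False if "covers w v" for w
    using covers_imp_suc[OF that] L by (simp add: stg_suc)
  ultimately show "is_limit v" unfolding is_limit_def by blast
qed

end

section \<open>Computations as trajectories\<close>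

text \<open>The local rules of \<open>run\<close> without its initial configuration, so that a
  fragment of a program can be analysed from the time at which it is entered.\<close>

definition traj :: "program \<Rightarrow> 'a::wellorder set \<Rightarrow> ('t::wellorder \<Rightarrow> 'a config option) \<Rightarrow> bool" where
  "traj P x D \<longleftrightarrow> (\<forall>s t. covers s t \<longrightarrow> D t = map_option (step P x) (D s)) \<and>
     (\<forall>t. is_limit t \<longrightarrow> D t = limit_config t D)"

lemma ord_liminf_cong: "(\<And>s. s < t \<Longrightarrow> f s = g s) \<Longrightarrow> ord_liminf t f = ord_liminf t g"
proof -
  assume H: "\<And>s. s < t \<Longrightarrow> f s = g s"
  have "(\<exists>r. s \<le> r \<and> r < t \<and> v = f r) = (\<exists>r. s \<le> r \<and> r < t \<and> v = g r)" for s v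
    using H by auto
  then show ?thesis unfolding ord_liminf_def by simp
qed

lemma limit_config_cong: "(\<And>s. s < t \<Longrightarrow> C s = D s) \<Longrightarrow> limit_config t C = limit_config t D"
proof -
  assume H: "\<And>s. s < t \<Longrightarrow> C s = D s"
  have 1: "ord_liminf t (\<lambda>s. snd (the (C s)) i) = ord_liminf t (\<lambda>s. snd (the (D s)) i)" for i
    by (rule ord_liminf_cong) (simp add: H)
  have 2: "ord_liminf t (\<lambda>s. fst (the (C s))) = ord_liminf t (\<lambda>s. fst (the (D s)))"
    by (rule ord_liminf_cong) (simp add: H)
  have 3: "(\<exists>s<t. C s = None) = (\<exists>s<t. D s = None)" using H by auto
  show ?thesis unfolding limit_config_def 1 2 3 by simp
qed

lemma run_start: "(\<And>s. \<not> s < t) \<Longrightarrow> run P x xs t = Some (init_config xs)"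
  by (subst run.simps) simp

lemma run_covers:
  assumes "covers s t"
  shows "run P x xs t = map_option (step P x) (run P x xs s)"
proof -
  have "(THE s. covers s t) = s" using assms covers_unique by blast
  moreover have "s < t" using assms unfolding covers_def by blast
  ultimately show ?thesis using assms by (subst run.simps) (auto simp: Let_def)
qed

lemma run_limit:
  assumes "is_limit t"
  shows "run P x xs t = limit_config t (run P x xs)"
proof -
  let ?C = "\<lambda>s. if s < t then run P x xs s else None"
  have "run P x xs t = limit_config t ?C"
    using assms unfolding is_limit_def by (subst run.simps) (auto simp: Let_def)
  also have "\<dots> = limit_config t (run P x xs)" by (rule limit_config_cong) simp
  finally show ?thesis .
qed

lemma traj_run: "traj P x (run P x xs)"
  unfolding traj_def using run_covers run_limit by blast

lemma traj_covers: "traj P x D \<Longrightarrow> covers s t \<Longrightarrow> D t = map_option (step P x) (D s)"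
  and traj_limit: "traj P x D \<Longrightarrow> is_limit t \<Longrightarrow> D t = limit_config t D"
  unfolding traj_def by blast+

lemma traj_defined: "traj P x D \<Longrightarrow> D t \<noteq> None \<Longrightarrow> s < t \<Longrightarrow> D s \<noteq> None"
proof (induction t arbitrary: s rule: less_induct)
  case (less t)
  show ?case
  proof (cases "is_limit t")
    case True
    from traj_limit[OF less.prems(1) True] less.prems(2,3) show ?thesis
      unfolding limit_config_def by (auto split: if_splits)
  next
    case False
    then obtain r where r: "covers r t" using less.prems(3) unfolding is_limit_def by blast
    then have "D r \<noteq> None" using traj_covers[OF less.prems(1) r] less.prems(2) by auto
    moreover have "s \<le> r" "r < t" using r less.prems(3) unfolding covers_def by auto
    ultimately show ?thesis using less.IH[of r s] less.prems(1) by (auto simp: order_le_less)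
  qed
qed

lemma limit_configI:
  assumes "s0 < t" and def: "\<And>s. s < t \<Longrightarrow> C s \<noteq> None"
    and line: "is_lim s0 t (\<lambda>u. {fst (the (C u))}) l"
    and regs: "\<And>i. is_lim s0 t (\<lambda>u. {snd (the (C u)) i}) (R i)"
  shows "limit_config t C = Some (l, R)"
proof -
  have "ord_liminf t (\<lambda>u. fst (the (C u))) = Some l"
    using ord_liminf_iff[OF assms(1)] line by blast
  moreover have "ord_liminf t (\<lambda>u. snd (the (C u)) i) = Some (R i)" for i
    using ord_liminf_iff[OF assms(1)] regs by blast
  ultimately show ?thesis using def unfolding limit_config_def by auto
qed

lemma limit_configD:
  assumes "s0 < t" and C: "limit_config t C = Some (l, R)"
    and line: "\<And>u. s0 \<le> u \<Longrightarrow> u < t \<Longrightarrow> fst (the (C u)) \<le> n"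
  shows "is_lim s0 t (\<lambda>u. {fst (the (C u))}) l" "is_lim s0 t (\<lambda>u. {snd (the (C u)) i}) (R i)"
proof -
  from C have *: "\<forall>i. ord_liminf t (\<lambda>u. snd (the (C u)) i) \<noteq> None"
    "l = the (ord_liminf t (\<lambda>s. fst (the (C s))))" "R i = the (ord_liminf t (\<lambda>s. snd (the (C s)) i))"
    unfolding limit_config_def by (auto split: if_splits)
  then have "ord_liminf t (\<lambda>u. snd (the (C u)) i) = Some (R i)" by auto
  then show "is_lim s0 t (\<lambda>u. {snd (the (C u)) i}) (R i)" by (rule iffD1[OF ord_liminf_iff[OF assms(1)]])
  have "\<exists>v\<le>n. is_lim s0 t (\<lambda>u. {fst (the (C u))}) v"
    by (rule is_lim_ex) (use line in blast)
  then obtain v where v: "is_lim s0 t (\<lambda>u. {fst (the (C u))}) v" by blast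
  then have "ord_liminf t (\<lambda>u. fst (the (C u))) = Some v" by (rule iffD2[OF ord_liminf_iff[OF assms(1)]])
  with v * show "is_lim s0 t (\<lambda>u. {fst (the (C u))}) l" by simp
qed

lemma step_halted: "halted P c \<Longrightarrow> step P x c = c"
  by (simp add: step_def)

lemma step_config: "l < length P \<Longrightarrow> step P x (l, R) = exec (P ! l) x (l, R)"
  by (simp add: step_def halted_def)

context exp_closed begin

lemma traj_suc:
  fixes D :: "'a stage \<Rightarrow> 'a config option"
  shows "traj P x D \<Longrightarrow> D (ord_suc s) = map_option (step P x) (D s)"
  using traj_covers stage_covers_iff by blast

lemma traj_halted:
  fixes D :: "'a stage \<Rightarrow> 'a config option"
  assumes D: "traj P x D" and s: "D s = Some c" "halted P c"
  shows "s \<le> t \<Longrightarrow> D t = Some c"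
proof (induction t rule: stage_interval_induct)
  case (suc u)
  then show ?case using traj_suc[OF D] s(2) by (simp add: step_halted)
next
  case (limit u)
  have "limit_config u D = Some (fst c, snd c)"
  proof (rule limit_configI[of s])
    show "D v \<noteq> None" if "v < u" for v
    proof (cases "v < s")
      case True
      then show ?thesis using traj_defined[OF D] s by (metis option.distinct(1))
    next
      case False
      then show ?thesis using limit that by simp
    qed
  qed (use limit in \<open>auto intro!: is_lim_const\<close>)
  then show ?case using traj_limit[OF D limit(1)] by simp
qed (use s in auto)

text \<open>\<open>u_weak\<close> measures time in the type of \<alpha> itself, halting is defined
  by stages. As \<open>stg\<close> is an isomorphism onto an initial segment of the stages, tails
  correspond to tails and the inferior limits coincide.\<close>

lemma run_stg: "run P x xs (stg v) = run P x xs v"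
proof (induction v rule: less_induct)
  case (less v)
  show ?case
  proof (cases "is_limit v")
    case True
    then obtain w where w: "w < v" unfolding is_limit_def by blast
    have img: "(\<lambda>s. LEAST y. \<exists>r\<ge>s. r < stg v \<and> y = f r) ` {..<stg v}
        = (\<lambda>s. LEAST y. \<exists>r\<ge>s. r < v \<and> y = f (stg r)) ` {..<v}" for f :: "'a stage \<Rightarrow> 'c::wellorder"
    proof -
      have 1: "{..<stg v} = stg ` {..<v}" using stg_initial by auto
      have 2: "(\<exists>r\<ge>stg s. r < stg v \<and> y = f r) \<longleftrightarrow> (\<exists>r\<ge>s. r < v \<and> y = f (stg r))" for s y
        using stg_initial by (metis stg_le_iff stg_less_iff)
      show ?thesis unfolding 1 image_image 2 ..
    qed
    have lim: "ord_liminf (stg v) f = ord_liminf v (\<lambda>s. f (stg s))" for f :: "'a stage \<Rightarrow> 'c::wellorder"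
      unfolding ord_liminf_def img ..
    have n: "(\<exists>s<stg v. C s = None) \<longleftrightarrow> (\<exists>s<v. C (stg s) = None)" for C :: "'a stage \<Rightarrow> 'c option"
      using stg_initial by (metis stg_less_iff)
    have "limit_config (stg v) (run P x xs) = limit_config v (\<lambda>s. run P x xs (stg s))"
      unfolding limit_config_def lim n ..
    also have "\<dots> = limit_config v (run P x xs)" by (rule limit_config_cong) (rule less)
    finally show ?thesis using run_limit True is_limit_stg by metis
  next
    case False
    show ?thesis
    proof (cases "\<exists>w. covers w v")
      case True
      then obtain w where w: "covers w v" by blast
      then have "covers (stg w) (stg v)" using covers_imp_suc[OF w] by (simp add: stg_suc stage_covers_iff)
      then have "run P x xs (stg v) = map_option (step P x) (run P x xs (stg w))" by (rule run_covers)
      also have "run P x xs (stg w) = run P x xs w" using less[of w] w unfolding covers_def by simp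
      also have "map_option (step P x) (run P x xs w) = run P x xs v" by (rule run_covers[OF w, symmetric])
      finally show ?thesis .
    next
      case nc: False
      then have "\<not> w < v" for w using False unfolding is_limit_def by blast
      moreover from this have "\<not> s < stg v" for s using stg_initial by blast
      ultimately show ?thesis by (simp add: run_start)
    qed
  qed
qed

section \<open>Finding a coarse computation inside a fine one\<close>

lemma stage_le_suc: "u \<le> v \<Longrightarrow> u \<le> ord_suc (v :: 'a stage)"
  by (meson less_imp_le order_trans stage_suc_gt)

text \<open>Coarse time \<open>u\<close> is mapped to fine time \<open>\<tau> u\<close> by
  transfinite recursion. Below a limit the fine time from \<open>s0\<close> on is exactly tiled by
  the intervals from \<open>\<tau> v\<close> to \<open>\<tau> (ord_suc v)\<close>, and
  \<open>Q\<close> records what happens in each of them; this is all that the premise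
  \<open>lim\<close> may use to identify the configuration at the limit. It serves for loops, for
  shifted runs and for the repetition of a segment.\<close>

lemma simulation:
  fixes D :: "'a stage \<Rightarrow> 'a config option" and c :: "'a stage \<Rightarrow> 'a config"
  assumes u: "u1 \<le> u0" and start: "D s0 = Some (c u1)"
    and step: "\<And>u s. u1 \<le> u \<Longrightarrow> u < u0 \<Longrightarrow> D s = Some (c u) \<Longrightarrow>
      \<exists>s'>s. D s' = Some (c (ord_suc u)) \<and> Q u s s'"
    and lim: "\<And>l t \<tau>. is_limit l \<Longrightarrow> u1 < l \<Longrightarrow> l \<le> u0 \<Longrightarrow> is_limit t \<Longrightarrow> s0 < t \<Longrightarrow> \<tau> u1 = s0 \<Longrightarrow>
      (\<And>v. u1 \<le> v \<Longrightarrow> v < l \<Longrightarrow> \<tau> v < t \<and> D (\<tau> v) = Some (c v) \<and> Q v (\<tau> v) (\<tau> (ord_suc v))) \<Longrightarrow>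
      (\<And>v w. u1 \<le> v \<Longrightarrow> v < w \<Longrightarrow> w < l \<Longrightarrow> \<tau> v < \<tau> w) \<Longrightarrow>
      (\<And>r. s0 \<le> r \<Longrightarrow> r < t \<Longrightarrow> \<exists>v. u1 \<le> v \<and> v < l \<and> \<tau> v \<le> r \<and> r < \<tau> (ord_suc v)) \<Longrightarrow>
      D t = Some (c l)"
  shows "\<exists>\<tau>. \<tau> u1 = s0 \<and> (\<forall>u. u1 \<le> u \<longrightarrow> u \<le> u0 \<longrightarrow> D (\<tau> u) = Some (c u)) \<and>
    (\<forall>u v. u1 \<le> u \<longrightarrow> u < v \<longrightarrow> v \<le> u0 \<longrightarrow> \<tau> u < \<tau> v) \<and>
    (\<forall>u. u1 \<le> u \<longrightarrow> u < u0 \<longrightarrow> Q u (\<tau> u) (\<tau> (ord_suc u))) \<and>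
    (\<forall>u r. u1 \<le> u \<longrightarrow> u \<le> u0 \<longrightarrow> s0 \<le> r \<longrightarrow> r < \<tau> u \<longrightarrow>
       (\<exists>v. u1 \<le> v \<and> v < u \<and> \<tau> v \<le> r \<and> r < \<tau> (ord_suc v)))"
proof -
  define nxt where "nxt u s = (SOME s'. s < s' \<and> D s' = Some (c (ord_suc u)) \<and> Q u s s')" for u s
  have nxt: "s < nxt u s \<and> D (nxt u s) = Some (c (ord_suc u)) \<and> Q u s (nxt u s)"
    if "u1 \<le> u" "u < u0" "D s = Some (c u)" for u s
    unfolding nxt_def by (rule someI_ex) (use step[OF that] in blast)
  \<comment> \<open>One formula covers the start, successors and limits: the least stage from
    \<open>s0\<close> on that is not below any of the earlier end points.\<close>
  define F where "F = (\<lambda>f u. LEAST s. s0 \<le> s \<and> (\<forall>v. u1 \<le> v \<and> v < u \<longrightarrow> nxt v (f v) \<le> s))"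
  define \<tau> where "\<tau> = wfrec {(v, w). v < w} F"
  have rec: "\<tau> u = (LEAST s. s0 \<le> s \<and> (\<forall>v. u1 \<le> v \<and> v < u \<longrightarrow> nxt v (\<tau> v) \<le> s))" for u
  proof -
    have "wf {(v :: 'a stage, w). v < w}" by (rule wf)
    from wfrec[OF this, of F u] have "\<tau> u = F (cut \<tau> {(v, w). v < w} u) u" unfolding \<tau>_def .
    also have "\<dots> = F \<tau> u" unfolding F_def cut_def by (rule arg_cong[where f=Least]) auto
    finally show ?thesis unfolding F_def .
  qed
  have bd: "s0 \<le> \<tau> u \<and> (\<forall>v. u1 \<le> v \<and> v < u \<longrightarrow> nxt v (\<tau> v) \<le> \<tau> u)" for u
  proof -
    obtain b where "\<forall>v\<in>{..<u}. nxt v (\<tau> v) < b" 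
      using stage_bounded_image[OF stage_initial, of u "\<lambda>v. nxt v (\<tau> v)"] by blast
    then have "s0 \<le> max s0 b \<and> (\<forall>v. u1 \<le> v \<and> v < u \<longrightarrow> nxt v (\<tau> v) \<le> max s0 b)"
      by (metis lessThan_iff less_imp_le max.cobounded1 max.coboundedI2)
    then show ?thesis unfolding rec[of u] by (rule LeastI)
  qed
  have least: "\<tau> u \<le> s" if "s0 \<le> s" "\<And>v. u1 \<le> v \<Longrightarrow> v < u \<Longrightarrow> nxt v (\<tau> v) \<le> s" for u s
    unfolding rec[of u] by (rule Least_le) (use that in blast)
  let ?P = "\<lambda>u. D (\<tau> u) = Some (c u) \<and> (\<forall>v. u1 \<le> v \<longrightarrow> v < u \<longrightarrow> \<tau> v < \<tau> u \<and> Q v (\<tau> v) (\<tau> (ord_suc v)))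
     \<and> (\<forall>r. s0 \<le> r \<longrightarrow> r < \<tau> u \<longrightarrow> (\<exists>v. u1 \<le> v \<and> v < u \<and> \<tau> v \<le> r \<and> r < \<tau> (ord_suc v)))"
  have start': "\<tau> u1 = s0" using bd[of u1] least[of s0 u1] by auto
  have main: "u \<le> u0 \<longrightarrow> ?P u" if "u1 \<le> u" for u
    using that
  proof (induction u rule: stage_interval_induct)
    case start
    then show ?case using assms(2) start' by auto
  next
    case (suc u)
    show ?case
    proof
      assume le: "ord_suc u \<le> u0"
      then have ult: "u < u0" using stage_suc_le_iff by blast
      then have IH: "?P u" using suc.IH by auto
      note nx = nxt[OF suc.hyps ult conjunct1[OF IH]]
      have eq: "\<tau> (ord_suc u) = nxt u (\<tau> u)"
      proof (rule antisym)
        show "nxt u (\<tau> u) \<le> \<tau> (ord_suc u)" using bd[of "ord_suc u"] suc.hyps by simp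
        show "\<tau> (ord_suc u) \<le> nxt u (\<tau> u)"
        proof (rule least)
          show "s0 \<le> nxt u (\<tau> u)" using bd[of u] nx by auto
          fix v assume v: "u1 \<le> v" "v < ord_suc u"
          then show "nxt v (\<tau> v) \<le> nxt u (\<tau> u)"
          proof (cases "v = u")
            case False
            then have "v < u" using v by (simp add: stage_less_suc_iff)
            then show ?thesis using bd[of u] v nx by (meson less_imp_le order_trans)
          qed simp
        qed
      qed
      show "?P (ord_suc u)"
      proof (intro conjI allI impI)
        show "D (\<tau> (ord_suc u)) = Some (c (ord_suc u))" unfolding eq using nx by blast
      next
        fix v assume v: "u1 \<le> v" "v < ord_suc u"
        then show "\<tau> v < \<tau> (ord_suc u)"
          using IH nx unfolding eq stage_less_suc_iff by (metis less_trans order_le_less)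
      next
        fix v assume v: "u1 \<le> v" "v < ord_suc u"
        then show "Q v (\<tau> v) (\<tau> (ord_suc v))"
          using IH nx eq unfolding stage_less_suc_iff by (metis order_le_less)
      next
        fix r assume r: "s0 \<le> r" "r < \<tau> (ord_suc u)"
        show "\<exists>v. u1 \<le> v \<and> v < ord_suc u \<and> \<tau> v \<le> r \<and> r < \<tau> (ord_suc v)"
        proof (cases "r < \<tau> u")
          case True
          then obtain v where "u1 \<le> v \<and> v < u \<and> \<tau> v \<le> r \<and> r < \<tau> (ord_suc v)" using IH r by blast
          moreover from this have "v < ord_suc u" by (auto simp: stage_less_suc_iff)
          ultimately show ?thesis by blast
        next
          case False
          then show ?thesis using r suc.hyps by (intro exI[of _ u]) simp
        qed
      qed
    qed
  next
    case (limit l)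
    show ?case
    proof
      assume le: "l \<le> u0"
      have IH: "?P v" if "u1 \<le> v" "v < l" for v using limit(3)[OF that] le that by simp
      have ndef: "nxt v (\<tau> v) \<le> \<tau> l" "\<tau> v < nxt v (\<tau> v)" if "u1 \<le> v" "v < l" for v
        using bd[of l] nxt[of v "\<tau> v"] IH[OF that] that le by auto
      have lt: "\<tau> v < \<tau> l" if "u1 \<le> v" "v < l" for v using ndef[OF that] by simp
      \<comment> \<open>As \<open>\<tau> l\<close> is the least bound of the end points, they are
        cofinal in it; hence \<open>\<tau> l\<close> is a limit stage and the tiles leave no
        gap.\<close>
      have cof: "\<exists>v. u1 \<le> v \<and> v < l \<and> r < \<tau> v" if "s0 \<le> r" "r < \<tau> l" for r
      proof -
        have "\<exists>v. u1 \<le> v \<and> v < l \<and> \<not> nxt v (\<tau> v) \<le> r" using least[of r l] that by (meson leD)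
        then obtain v where v: "u1 \<le> v" "v < l" "r < nxt v (\<tau> v)" by (meson not_le)
        have sv: "u1 \<le> ord_suc v" "ord_suc v < l"
          using v is_limit_suc[OF limit(1)] by (auto intro: stage_le_suc)
        have "nxt v (\<tau> v) \<le> \<tau> (ord_suc v)" using bd[of "ord_suc v"] v by simp
        then show ?thesis using v sv by (intro exI[of _ "ord_suc v"]) simp
      qed
      have s0lt: "s0 < \<tau> l" using lt[of u1] start' limit by auto
      have limt: "is_limit (\<tau> l)"
        unfolding is_limit_def stage_covers_iff
      proof (intro conjI allI notI)
        show "\<exists>s. s < \<tau> l" using s0lt by blast
        fix s assume s: "\<tau> l = ord_suc s"
        then have "s < \<tau> l" "s0 \<le> s" using s0lt by (simp_all add: stage_less_suc_iff)
        then obtain v where "u1 \<le> v" "v < l" "s < \<tau> v" using cof by blast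
        then show False using lt[of v] s by (simp add: stage_less_suc_iff leD)
      qed
      have Qv: "Q v (\<tau> v) (\<tau> (ord_suc v))" if "u1 \<le> v" "v < l" for v
      proof -
        have "ord_suc v < l" using is_limit_suc[OF limit(1) that(2)] .
        moreover have "u1 \<le> ord_suc v" using that(1) by (meson less_imp_le order_trans stage_suc_gt)
        ultimately show ?thesis using IH[of "ord_suc v"] that by (simp add: stage_less_suc_iff)
      qed
      have cover: "\<exists>v. u1 \<le> v \<and> v < l \<and> \<tau> v \<le> r \<and> r < \<tau> (ord_suc v)" if r: "s0 \<le> r" "r < \<tau> l" for r
      proof -
        obtain w where "u1 \<le> w" "w < l" "r < \<tau> w" using cof[OF r] by blast
        then show ?thesis using IH[of w] r(1) by (meson less_trans)
      qed
      have "D (\<tau> l) = Some (c l)"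
      proof (rule lim[where \<tau> = \<tau>, OF limit(1,2) le limt s0lt start'])
        show "\<tau> v < \<tau> l \<and> D (\<tau> v) = Some (c v) \<and> Q v (\<tau> v) (\<tau> (ord_suc v))" if "u1 \<le> v" "v < l" for v
          using lt[OF that] Qv[OF that] IH[OF that] by blast
        show "\<tau> v < \<tau> w" if "u1 \<le> v" "v < w" "w < l" for v w
          using IH[of w] that by (meson less_imp_le order_trans)
      qed (rule cover)
      then show "?P l" using lt Qv cover by blast
    qed
  qed
  show ?thesis
  proof (intro exI[of _ \<tau>] conjI allI impI)
    show "\<tau> u1 = s0" by (rule start')
    show "D (\<tau> u) = Some (c u)" if "u1 \<le> u" "u \<le> u0" for u using main[OF that(1)] that by blast
    show "\<tau> u < \<tau> v" if "u1 \<le> u" "u < v" "v \<le> u0" for u v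
      using main[of v] that by (meson less_imp_le order_trans)
    show "Q u (\<tau> u) (\<tau> (ord_suc u))" if "u1 \<le> u" "u < u0" for u
    proof -
      have "u1 \<le> ord_suc u" "ord_suc u \<le> u0" using that
        by (auto simp: stage_suc_le_iff intro: stage_le_suc)
      then show ?thesis using main[of "ord_suc u"] that by (simp add: stage_less_suc_iff)
    qed
    show "\<exists>v\<ge>u1. v < u \<and> \<tau> v \<le> r \<and> r < \<tau> (ord_suc v)" if "u1 \<le> u" "u \<le> u0" "s0 \<le> r" "r < \<tau> u" for u r
      using main[of u] that by blast
  qed
qed

text \<open>\<open>V v\<close> consists of exactly the values of \<open>g\<close> on the tile of
  \<open>v\<close>. The tiles are consecutive, so tails of the coarse and of the fine sequence
  correspond up to one tile.\<close>

lemma is_lim_transfer: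
  fixes \<tau> :: "'a stage \<Rightarrow> 'a stage"
  assumes L: "is_lim u1 l V y" and l: "is_limit l" "u1 < l"
    and lt: "\<And>v. u1 \<le> v \<Longrightarrow> v < l \<Longrightarrow> \<tau> v < t" and "\<tau> u1 = s0"
    and mono: "\<And>v w. u1 \<le> v \<Longrightarrow> v < w \<Longrightarrow> w < l \<Longrightarrow> \<tau> v < \<tau> w"
    and cover: "\<And>r. s0 \<le> r \<Longrightarrow> r < t \<Longrightarrow> \<exists>v. u1 \<le> v \<and> v < l \<and> \<tau> v \<le> r \<and> r < \<tau> (ord_suc v)"
    and sub: "\<And>v r. u1 \<le> v \<Longrightarrow> v < l \<Longrightarrow> \<tau> v \<le> r \<Longrightarrow> r < \<tau> (ord_suc v) \<Longrightarrow> g r \<in> V v"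
    and sup: "\<And>v y. u1 \<le> v \<Longrightarrow> v < l \<Longrightarrow> y \<in> V v \<Longrightarrow> \<exists>r. \<tau> v \<le> r \<and> r < \<tau> (ord_suc v) \<and> g r = y"
  shows "is_lim s0 t (\<lambda>r. {g r}) y"
proof -
  have mono_le: "\<tau> v \<le> \<tau> w" if "u1 \<le> v" "v \<le> w" "w < l" for v w
    using mono[OF that(1) _ that(3)] that(2) by (auto simp: order_le_less)
  have suc: "u1 \<le> ord_suc v \<and> ord_suc v < l" if "u1 \<le> v" "v < l" for v
    using that is_limit_suc[OF l(1)] by (meson less_imp_le order_trans stage_suc_gt)
  show ?thesis
  proof (rule is_limI)
    fix w assume "w < y"
    from is_limD1[OF L this] obtain u where u: "u1 \<le> u" "u < l"
      "\<forall>r y. u \<le> r \<longrightarrow> r < l \<longrightarrow> y \<in> V r \<longrightarrow> w < y" by blast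
    have "w < g r" if r: "\<tau> u \<le> r" "r < t" for r
    proof -
      have "s0 \<le> r" using mono_le[of u1 u] u assms(5) r by simp
      then obtain v where v: "u1 \<le> v" "v < l" "\<tau> v \<le> r" "r < \<tau> (ord_suc v)" using cover r by blast
      have "u \<le> v"
      proof (rule ccontr)
        assume "\<not> u \<le> v"
        then have "ord_suc v \<le> u" by (simp add: stage_suc_le_iff)
        then have "\<tau> (ord_suc v) \<le> \<tau> u" using mono_le suc[of v] v u by blast
        then show False using v r by simp
      qed
      then show ?thesis using u(3) v sub by blast
    qed
    moreover have "s0 \<le> \<tau> u" "\<tau> u < t" using mono_le[of u1 u] u assms(5) lt by auto
    ultimately show "\<exists>u\<ge>s0. u < t \<and> (\<forall>r. u \<le> r \<and> r < t \<longrightarrow> (\<forall>y\<in>{g r}. w < y))" by auto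
  next
    fix r assume "s0 \<le> r" "r < t"
    then obtain v where v: "u1 \<le> v" "v < l" "\<tau> v \<le> r" "r < \<tau> (ord_suc v)" using cover by blast
    with suc have "u1 \<le> ord_suc v" "ord_suc v < l" by blast+
    with L obtain w y' where w: "ord_suc v \<le> w" "w < l" "y' \<in> V w" "y' \<le> y" by (rule is_limD2)
    have w1: "u1 \<le> w" using w \<open>u1 \<le> ord_suc v\<close> by simp
    obtain q where q: "\<tau> w \<le> q" "q < \<tau> (ord_suc w)" "g q = y'" using sup[OF w1 w(2,3)] by blast
    have "r \<le> q" using mono_le[of "ord_suc v" w] suc v w q by (meson less_imp_le order_trans)
    moreover have "q < t" using q lt[of "ord_suc w"] suc[OF w1 w(2)] by (meson less_trans)
    ultimately show "\<exists>q z. r \<le> q \<and> q < t \<and> z \<in> {g q} \<and> z \<le> y" using q w by blast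
  qed
qed

lemma traj_limitI:
  fixes D :: "'a stage \<Rightarrow> 'a config option"
  assumes D: "traj P x D" "is_limit t" and s0: "s0 < t"
    and def: "\<And>r. s0 \<le> r \<Longrightarrow> r < t \<Longrightarrow> D r \<noteq> None"
    and line: "is_lim s0 t (\<lambda>u. {fst (the (D u))}) l"
    and regs: "\<And>i. is_lim s0 t (\<lambda>u. {snd (the (D u)) i}) (R i)"
  shows "D t = Some (l, R)"
proof -
  have "D s \<noteq> None" if "s < t" for s
    using def[of s] def[of s0] traj_defined[OF D(1), of s0 s] s0 that by (cases "s0 \<le> s") auto
  then show ?thesis using traj_limit[OF D] limit_configI[OF s0 _ line regs] by simp
qed

lemma traj_limitD:
  fixes D :: "'a stage \<Rightarrow> 'a config option"
  assumes D: "traj P x D" "is_limit t" and s0: "s0 < t" and t: "D t = Some c"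
    and line: "\<And>u. s0 \<le> u \<Longrightarrow> u < t \<Longrightarrow> fst (the (D u)) \<le> n"
  shows "is_lim s0 t (\<lambda>u. {fst (the (D u))}) (fst c)" "is_lim s0 t (\<lambda>u. {snd (the (D u)) i}) (snd c i)"
proof -
  have "limit_config t D = Some (fst c, snd c)" using traj_limit[OF D] t by simp
  from limit_configD[OF s0 this line]
  show "is_lim s0 t (\<lambda>u. {fst (the (D u))}) (fst c)" "is_lim s0 t (\<lambda>u. {snd (the (D u)) i}) (snd c i)"
    by blast+
qed

text \<open>A computation does not depend on when it is started: from equal configurations the same
  program and oracle produce the same sequence. Here every tile of \<open>simulation\<close> is a
  single step, so that the last clause lists all fine stages passed on the way.\<close>

lemma traj_shift:
  fixes C D :: "'a stage \<Rightarrow> 'a config option"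
  assumes C: "traj P x C" and D: "traj P x D" and u: "u1 \<le> u0" and start: "D s0 = C u1"
    and def: "C u0 \<noteq> None" and line: "\<And>u. u1 \<le> u \<Longrightarrow> u < u0 \<Longrightarrow> fst (the (C u)) \<le> n"
  shows "\<exists>\<tau>. \<tau> u1 = s0 \<and> (\<forall>u. u1 \<le> u \<longrightarrow> u \<le> u0 \<longrightarrow> D (\<tau> u) = C u) \<and>
    (\<forall>u v. u1 \<le> u \<longrightarrow> u < v \<longrightarrow> v \<le> u0 \<longrightarrow> \<tau> u < \<tau> v) \<and>
    (\<forall>u r. u1 \<le> u \<longrightarrow> u \<le> u0 \<longrightarrow> s0 \<le> r \<longrightarrow> r < \<tau> u \<longrightarrow> (\<exists>v. u1 \<le> v \<and> v < u \<and> r = \<tau> v))"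
proof -
  define c where "c u = the (C u)" for u
  have Cc: "C u = Some (c u)" if "u \<le> u0" for u
    using traj_defined[OF C def, of u] def that unfolding c_def by (cases "u = u0") auto
  have "\<exists>\<tau>. \<tau> u1 = s0 \<and> (\<forall>u. u1 \<le> u \<longrightarrow> u \<le> u0 \<longrightarrow> D (\<tau> u) = Some (c u)) \<and>
    (\<forall>u v. u1 \<le> u \<longrightarrow> u < v \<longrightarrow> v \<le> u0 \<longrightarrow> \<tau> u < \<tau> v) \<and>
    (\<forall>u. u1 \<le> u \<longrightarrow> u < u0 \<longrightarrow> \<tau> (ord_suc u) = ord_suc (\<tau> u)) \<and>
    (\<forall>u r. u1 \<le> u \<longrightarrow> u \<le> u0 \<longrightarrow> s0 \<le> r \<longrightarrow> r < \<tau> u \<longrightarrow>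
       (\<exists>v. u1 \<le> v \<and> v < u \<and> \<tau> v \<le> r \<and> r < \<tau> (ord_suc v)))"
  proof (rule simulation[where Q = "\<lambda>u s s'. s' = ord_suc s"])
    show "u1 \<le> u0" by (rule u)
    show "D s0 = Some (c u1)" using start Cc[OF u] by simp
  next
    fix u s assume us: "u1 \<le> u" "u < u0" "D s = Some (c u)"
    have "ord_suc u \<le> u0" using us by (simp add: stage_suc_le_iff)
    then have "D (ord_suc s) = Some (c (ord_suc u))"
      using traj_suc[OF D, of s] traj_suc[OF C, of u] us Cc[of u] Cc[of "ord_suc u"] by simp
    then show "\<exists>s'>s. D s' = Some (c (ord_suc u)) \<and> s' = ord_suc s" by simp
  next
    fix l t \<tau> assume l: "is_limit l" "u1 < l" "l \<le> u0" and t: "is_limit t" "s0 < t" "\<tau> u1 = s0"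
      and \<tau>: "\<And>v. u1 \<le> v \<Longrightarrow> v < l \<Longrightarrow> \<tau> v < t \<and> D (\<tau> v) = Some (c v) \<and> \<tau> (ord_suc v) = ord_suc (\<tau> v)"
      and mono: "\<And>v w. u1 \<le> v \<Longrightarrow> v < w \<Longrightarrow> w < l \<Longrightarrow> \<tau> v < \<tau> w"
      and cover: "\<And>r. s0 \<le> r \<Longrightarrow> r < t \<Longrightarrow> \<exists>v. u1 \<le> v \<and> v < l \<and> \<tau> v \<le> r \<and> r < \<tau> (ord_suc v)"
    have one: "r = \<tau> v" if "u1 \<le> v" "v < l" "\<tau> v \<le> r" "r < \<tau> (ord_suc v)" for v r
      using \<tau>[of v] that by (simp add: stage_less_suc_iff)
    have line': "fst (the (C v)) \<le> n" if "u1 \<le> v" "v < l" for v using line[of v] that l by simp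
    have tr: "is_lim s0 t (\<lambda>r. {g (the (D r))}) y" if "is_lim u1 l (\<lambda>u. {g (the (C u))}) y" for g y
    proof (rule is_lim_transfer[OF that l(1,2) _ t(3) mono cover])
      show "g (the (D r)) \<in> {g (the (C v))}" if "u1 \<le> v" "v < l" "\<tau> v \<le> r" "r < \<tau> (ord_suc v)" for v r
        using one[OF that] \<tau>[of v] Cc[of v] l that by simp
      show "\<exists>r. \<tau> v \<le> r \<and> r < \<tau> (ord_suc v) \<and> g (the (D r)) = y" if "u1 \<le> v" "v < l" "y \<in> {g (the (C v))}" for v y
        using \<tau>[of v] Cc[of v] l that by (intro exI[of _ "\<tau> v"]) auto
    qed (use \<tau> in auto)
    note CD = traj_limitD[OF C l(1,2) Cc[OF l(3)] line']
    have "D t = Some (fst (c l), snd (c l))"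
    proof (rule traj_limitI[OF D t(1,2)])
      show "D r \<noteq> None" if "s0 \<le> r" "r < t" for r
        using cover[OF that] one \<tau> by (metis option.distinct(1))
      show "is_lim s0 t (\<lambda>u. {fst (the (D u))}) (fst (c l))" by (rule tr[OF CD(1)])
      show "is_lim s0 t (\<lambda>u. {snd (the (D u)) i}) (snd (c l) i)" for i
        using tr[of "\<lambda>c. snd c i", OF CD(2)] .
    qed
    then show "D t = Some (c l)" by simp
  qed
  then obtain \<tau> where \<tau>: "\<tau> u1 = s0" "\<And>u. u1 \<le> u \<Longrightarrow> u \<le> u0 \<Longrightarrow> D (\<tau> u) = Some (c u)"
    "\<And>u v. u1 \<le> u \<Longrightarrow> u < v \<Longrightarrow> v \<le> u0 \<Longrightarrow> \<tau> u < \<tau> v"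
    "\<And>u. u1 \<le> u \<Longrightarrow> u < u0 \<Longrightarrow> \<tau> (ord_suc u) = ord_suc (\<tau> u)"
    "\<And>u r. u1 \<le> u \<Longrightarrow> u \<le> u0 \<Longrightarrow> s0 \<le> r \<Longrightarrow> r < \<tau> u \<Longrightarrow> \<exists>v. u1 \<le> v \<and> v < u \<and> \<tau> v \<le> r \<and> r < \<tau> (ord_suc v)"
    by blast
  show ?thesis
  proof (intro exI[of _ \<tau>] conjI allI impI)
    show "D (\<tau> u) = C u" if "u1 \<le> u" "u \<le> u0" for u using \<tau>(2) Cc that by simp
    show "\<exists>v\<ge>u1. v < u \<and> r = \<tau> v" if ur: "u1 \<le> u" "u \<le> u0" "s0 \<le> r" "r < \<tau> u" for u r
    proof -
      obtain v where v: "u1 \<le> v" "v < u" "\<tau> v \<le> r" "r < \<tau> (ord_suc v)" using \<tau>(5)[OF ur] by blast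
      then have "r = \<tau> v" using \<tau>(4)[of v] ur by (simp add: stage_less_suc_iff)
      then show ?thesis using v by blast
    qed
  qed (use \<tau> in auto)
qed

end

section \<open>Structured programs\<close>

datatype com =
    SKIP
  | INC nat
  | COPY nat nat
  | QUERY nat
  | Seq com com  (infixr ";;" 60)
  | Cond nat nat com com   \<comment> \<open>branches on equality of two registers\<close>
  | Loop nat nat com       \<comment> \<open>iterates while two registers differ\<close>

fun clen :: "com \<Rightarrow> nat" where
  "clen SKIP = 0"
| "clen (INC i) = 1"
| "clen (COPY i j) = 1"
| "clen (QUERY i) = 1"
| "clen (c1 ;; c2) = clen c1 + clen c2"
| "clen (Cond i j c1 c2) = clen c1 + clen c2 + 2"
| "clen (Loop i j c) = clen c + 2"

text \<open>The head of a loop has the least line index of its code. After limitly many rounds the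
  inferior limit of the active line is therefore this head, so a loop survives limit times.
  \<open>Jump 0 0\<close> always jumps.\<close>

fun code :: "nat \<Rightarrow> com \<Rightarrow> instr list" where
  "code a SKIP = []"
| "code a (INC i) = [Inc i]"
| "code a (COPY i j) = [Copy i j]"
| "code a (QUERY i) = [Query i]"
| "code a (c1 ;; c2) = code a c1 @ code (a + clen c1) c2"
| "code a (Cond i j c1 c2) = Jump i j (a + clen c2 + 2) # code (a + 1) c2 @
     Jump 0 0 (a + clen c1 + clen c2 + 2) # code (a + clen c2 + 2) c1"
| "code a (Loop i j c) = Jump i j (a + clen c + 2) # code (a + 1) c @ [Jump 0 0 a]"

lemma length_code [simp]: "length (code a c) = clen c"
  by (induction c arbitrary: a) auto

text \<open>\<open>wc c i\<close> bounds how often \<open>c\<close> writes to register \<open>i\<close>, where 2 stands for any larger number.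
  A register written at most once per iteration of a loop takes no values besides those at the
  loop head, so these determine its inferior limit.\<close>
fun wc :: "com \<Rightarrow> nat \<Rightarrow> nat" where
  "wc SKIP i = 0"
| "wc (INC j) i = (if i = j then 1 else 0)"
| "wc (COPY k j) i = (if i = j then 1 else 0)"
| "wc (QUERY j) i = (if i = j then 1 else 0)"
| "wc (c1 ;; c2) i = wc c1 i + wc c2 i"
| "wc (Cond j k c1 c2) i = max (wc c1 i) (wc c2 i)"
| "wc (Loop j k c) i = 2 * wc c i"

definition wframe :: "com \<Rightarrow> (nat \<Rightarrow> 'a) \<Rightarrow> (nat \<Rightarrow> 'a) set \<Rightarrow> (nat \<Rightarrow> 'a) \<Rightarrow> bool" where
  "wframe c R T R' \<longleftrightarrow> (\<forall>i. wc c i = 0 \<longrightarrow> R' i = R i \<and> (\<forall>S\<in>T. S i = R i)) \<and>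
     (\<forall>i. wc c i \<le> 1 \<longrightarrow> (\<forall>S\<in>T. S i = R i \<or> S i = R' i))"

context exp_closed begin

text \<open>The trace \<open>T\<close> is exact: it contains all contents seen from \<open>s\<close>
  up to but excluding \<open>s'\<close>, and no others. For inferior limits of an enclosing loop
  both inclusions matter, as a transient value can lower a limit and a missing one can fail
  to.\<close>

definition path :: "('a stage \<Rightarrow> 'a config option) \<Rightarrow> nat \<Rightarrow> nat \<Rightarrow> 'a stage \<Rightarrow> 'a stage \<Rightarrow>
    (nat \<Rightarrow> 'a) set \<Rightarrow> bool" where
  "path D a b s s' T \<longleftrightarrow> s \<le> s' \<and>
     (\<forall>r. s \<le> r \<longrightarrow> r < s' \<longrightarrow> (\<exists>l S. D r = Some (l, S) \<and> a \<le> l \<and> l < b \<and> S \<in> T)) \<and>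
     (\<forall>S\<in>T. \<exists>r l. s \<le> r \<and> r < s' \<and> D r = Some (l, S))"

lemma path_refl [simp]: "path D a b s s {}"
  unfolding path_def by auto

lemma path_trans:
  assumes "path D a b s s' T" "path D a b s' s'' T'"
  shows "path D a b s s'' (T \<union> T')"
proof -
  have *: "s \<le> s'" "s' \<le> s''" using assms unfolding path_def by auto
  have "\<exists>l S. D r = Some (l, S) \<and> a \<le> l \<and> l < b \<and> S \<in> T \<union> T'" if "s \<le> r" "r < s''" for r
  proof (cases "r < s'")
    case True then show ?thesis using assms(1) that unfolding path_def by blast
  next
    case False then show ?thesis using assms(2) that unfolding path_def by (meson UnI2 not_less)
  qed
  moreover have "\<exists>r l. s \<le> r \<and> r < s'' \<and> D r = Some (l, S)" if S: "S \<in> T \<union> T'" for S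
  proof (cases "S \<in> T")
    case True
    then obtain r l where "s \<le> r" "r < s'" "D r = Some (l, S)" using assms(1) unfolding path_def by blast
    then show ?thesis using * by (meson less_le_trans)
  next
    case False
    then obtain r l where "s' \<le> r" "r < s''" "D r = Some (l, S)" using S assms(2) unfolding path_def by blast
    then show ?thesis using * by (meson order_trans)
  qed
  ultimately show ?thesis unfolding path_def using * by auto
qed

lemma path_mono: "path D a b s s' T \<Longrightarrow> a' \<le> a \<Longrightarrow> b \<le> b' \<Longrightarrow> path D a' b' s s' T"
  unfolding path_def by (meson less_le_trans order_trans)

lemma path_step: "D s = Some (l, R) \<Longrightarrow> a \<le> l \<Longrightarrow> l < b \<Longrightarrow> path D a b s (ord_suc s) {R}"
  unfolding path_def by (auto simp: stage_less_suc_iff stage_le_suc intro!: exI[of _ s])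

text \<open>Quantifying over the surrounding program, the trajectory and the entry stage makes the
  statement compositional. The fragment may run for transfinitely many steps.\<close>

definition Exec :: "com \<Rightarrow> 'a set \<Rightarrow> (nat \<Rightarrow> 'a) \<Rightarrow> (nat \<Rightarrow> 'a) set \<Rightarrow> (nat \<Rightarrow> 'a) \<Rightarrow> bool" where
  "Exec c x R T R' \<longleftrightarrow> wframe c R T R' \<and>
     (\<forall>pre post D s. traj (pre @ code (length pre) c @ post) x D \<longrightarrow> D s = Some (length pre, R) \<longrightarrow>
       (\<exists>s'. D s' = Some (length pre + clen c, R') \<and> path D (length pre) (length pre + clen c) s s' T))"

lemma Exec_code:
  assumes "Exec c x R T R'" "traj P x D" "P = pre @ code a c @ post" "a = length pre" "D s = Some (a, R)"
  shows "\<exists>s'. D s' = Some (a + clen c, R') \<and> path D a (a + clen c) s s' T"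
  using assms unfolding Exec_def by blast

lemma Exec_frame: "Exec c x R T R' \<Longrightarrow> wc c i = 0 \<Longrightarrow> R' i = R i"
  and Exec_frame_trace: "Exec c x R T R' \<Longrightarrow> wc c i = 0 \<Longrightarrow> S \<in> T \<Longrightarrow> S i = R i"
  and Exec_once: "Exec c x R T R' \<Longrightarrow> wc c i \<le> 1 \<Longrightarrow> S \<in> T \<Longrightarrow> S i = R i \<or> S i = R' i"
  unfolding Exec_def wframe_def by blast+

lemma Exec_SKIP: "Exec SKIP x R {} R"
  unfolding Exec_def wframe_def by (auto intro: path_refl)

lemma traj_exec:
  fixes D :: "'a stage \<Rightarrow> 'a config option"
  assumes "traj P x D" "D s = Some (l, R)" "l < length P"
  shows "D (ord_suc s) = Some (exec (P ! l) x (l, R))"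
  using traj_suc[OF assms(1), of s] assms by (simp add: step_config)

lemma Exec_single:
  assumes c: "clen c = 1" "\<And>a. code a c = [I]" and I: "\<And>l. exec I x (l, R) = (Suc l, R')"
    and w: "\<And>i. wc c i = 0 \<Longrightarrow> R' i = R i"
  shows "Exec c x R {R} R'"
  unfolding Exec_def
proof (intro conjI allI impI)
  show "wframe c R {R} R'" using w unfolding wframe_def by auto
  fix pre post :: program and D :: "'a stage \<Rightarrow> 'a config option" and s
  assume D: "traj (pre @ code (length pre) c @ post) x D" "D s = Some (length pre, R)"
  have "D (ord_suc s) = Some (Suc (length pre), R')"
    using traj_exec[OF D] by (simp add: c I nth_append)
  then show "\<exists>s'. D s' = Some (length pre + clen c, R') \<and> path D (length pre) (length pre + clen c) s s' {R}"
    using path_step[of D s "length pre" R "length pre" "length pre + clen c"] D(2) c(1) by auto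
qed

lemma Exec_INC: "Exec (INC i) x R {R} (R(i := ord_suc (R i)))"
  by (rule Exec_single[where I="Inc i"]) (auto split: if_splits)

lemma Exec_COPY: "Exec (COPY i j) x R {R} (R(j := R i))"
  by (rule Exec_single[where I="Copy i j"]) (auto split: if_splits)

lemma Exec_QUERY: "Exec (QUERY j) x R {R} (R(j := if R j \<in> x then ord_one else ord_zero))"
  by (rule Exec_single[where I="Query j"]) (auto split: if_splits)

lemma Exec_Seq:
  assumes 1: "Exec c1 x R T1 R1" and 2: "Exec c2 x R1 T2 R2"
  shows "Exec (c1 ;; c2) x R (T1 \<union> T2) R2"
  unfolding Exec_def
proof (intro conjI allI impI)
  have w: "wframe c1 R T1 R1" "wframe c2 R1 T2 R2" using assms unfolding Exec_def by auto
  have z: "wc c1 i = 0 \<or> wc c2 i = 0" if "wc c1 i + wc c2 i \<le> 1" for i using that by linarith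
  show "wframe (c1 ;; c2) R (T1 \<union> T2) R2"
    using w z unfolding wframe_def wc.simps by (simp only: Un_iff add_is_0 ball_Un) (smt (verit) le_add1 le_add2 order_trans)
  fix pre post :: program and D :: "'a stage \<Rightarrow> 'a config option" and s
  let ?a = "length pre" let ?b = "?a + clen c1" let ?c = "?b + clen c2"
  assume D: "traj (pre @ code ?a (c1 ;; c2) @ post) x D" "D s = Some (?a, R)"
  have "\<exists>s'. D s' = Some (?b, R1) \<and> path D ?a ?b s s' T1"
    by (rule Exec_code[OF 1 D(1)]) (use D(2) in auto)
  then obtain s1 where s1: "D s1 = Some (?b, R1)" "path D ?a ?b s s1 T1" by blast
  have "\<exists>s'. D s' = Some (?c, R2) \<and> path D ?b ?c s1 s' T2"
    by (rule Exec_code[OF 2 D(1), where pre = "pre @ code ?a c1"]) (use s1 in auto)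
  then obtain s2 where s2: "D s2 = Some (?c, R2)" "path D ?b ?c s1 s2 T2" by blast
  show "\<exists>s'. D s' = Some (?a + clen (c1 ;; c2), R2) \<and> path D ?a (?a + clen (c1 ;; c2)) s s' (T1 \<union> T2)"
    using s2(1) path_trans[OF path_mono[OF s1(2)] path_mono[OF s2(2)], of ?a ?c] by (auto simp: add.assoc)
qed

lemma Exec_Cond_True:
  assumes 1: "Exec c1 x R T R'" and eq: "R i = R j"
  shows "Exec (Cond i j c1 c2) x R (insert R T) R'"
  unfolding Exec_def
proof (intro conjI allI impI)
  have w: "wframe c1 R T R'" using 1 unfolding Exec_def by auto
  then show "wframe (Cond i j c1 c2) R (insert R T) R'" unfolding wframe_def by auto
  fix pre post :: program and D :: "'a stage \<Rightarrow> 'a config option" and s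
  let ?a = "length pre" let ?b = "?a + clen c2 + 2" let ?c = "?b + clen c1"
  assume D: "traj (pre @ code ?a (Cond i j c1 c2) @ post) x D" "D s = Some (?a, R)"
  have s1: "D (ord_suc s) = Some (?b, R)"
    using traj_exec[OF D] by (simp add: eq nth_append)
  have "\<exists>s'. D s' = Some (?c, R') \<and> path D ?b ?c (ord_suc s) s' T"
    by (rule Exec_code[OF 1 D(1), where pre = "pre @ Jump i j ?b # code (?a + 1) c2 @
       [Jump 0 0 (?a + clen c1 + clen c2 + 2)]"]) (use s1 in auto)
  then obtain s2 where s2: "D s2 = Some (?c, R')" "path D ?b ?c (ord_suc s) s2 T" by blast
  have "path D ?a ?c s (ord_suc s) {R}" by (rule path_step[of D s ?a]) (use D in auto)
  from path_trans[OF this path_mono[OF s2(2)]] s2(1)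
  show "\<exists>s'. D s' = Some (?a + clen (Cond i j c1 c2), R') \<and>
      path D ?a (?a + clen (Cond i j c1 c2)) s s' (insert R T)"
    by (auto simp: add_ac)
qed

text \<open>The code of this branch comes first and ends with a jump over the other branch. That
  jump is executed with contents \<open>R'\<close>, which is why \<open>R'\<close> joins the trace
  here and not in the case of equality.\<close>

lemma Exec_Cond_False:
  assumes 2: "Exec c2 x R T R'" and neq: "R i \<noteq> R j"
  shows "Exec (Cond i j c1 c2) x R (insert R (insert R' T)) R'"
  unfolding Exec_def
proof (intro conjI allI impI)
  have w: "wframe c2 R T R'" using 2 unfolding Exec_def by auto
  then show "wframe (Cond i j c1 c2) R (insert R (insert R' T)) R'" unfolding wframe_def by auto
  fix pre post :: program and D :: "'a stage \<Rightarrow> 'a config option" and s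
  let ?a = "length pre" let ?b = "?a + 1" let ?c = "?b + clen c2"
  let ?e = "?a + clen (Cond i j c1 c2)"
  assume D: "traj (pre @ code ?a (Cond i j c1 c2) @ post) x D" "D s = Some (?a, R)"
  have s1: "D (ord_suc s) = Some (?b, R)"
    using traj_exec[OF D] by (simp add: neq nth_append)
  have "\<exists>s'. D s' = Some (?c, R') \<and> path D ?b ?c (ord_suc s) s' T"
    by (rule Exec_code[OF 2 D(1), where pre = "pre @ [Jump i j (?a + clen c2 + 2)]"]) (use s1 in auto)
  then obtain s2 where s2: "D s2 = Some (?c, R')" "path D ?b ?c (ord_suc s) s2 T" by blast
  have s3: "D (ord_suc s2) = Some (?e, R')"
    using traj_exec[OF D(1) s2(1)] by (simp add: nth_append add_ac)
  have p1: "path D ?a ?e s (ord_suc s) {R}" by (rule path_step[of D s ?a]) (use D in auto)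
  have p3: "path D ?a ?e s2 (ord_suc s2) {R'}" by (rule path_step[of D s2 ?c]) (use s2 in auto)
  have p2: "path D ?a ?e (ord_suc s) s2 T" by (rule path_mono[OF s2(2)]) auto
  have "{R} \<union> T \<union> {R'} = insert R (insert R' T)" by auto
  then show "\<exists>s'. D s' = Some (?e, R') \<and> path D ?a ?e s s' (insert R (insert R' T))"
    using s3 path_trans[OF path_trans[OF p1 p2] p3] by auto
qed

text \<open>A run from loop head to loop head that has not left the loop yet. Such runs can be
  prolonged by further rounds and through limits; \<open>Exec_Loop\<close> closes them.\<close>

definition Iter :: "nat \<Rightarrow> nat \<Rightarrow> com \<Rightarrow> 'a set \<Rightarrow> (nat \<Rightarrow> 'a) \<Rightarrow> (nat \<Rightarrow> 'a) set \<Rightarrow> (nat \<Rightarrow> 'a) \<Rightarrow> bool" where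
  "Iter i j c x R K R' \<longleftrightarrow> (\<forall>k. wc c k = 0 \<longrightarrow> R' k = R k \<and> (\<forall>S\<in>K. S k = R k)) \<and>
     (\<forall>pre post D s. traj (pre @ code (length pre) (Loop i j c) @ post) x D \<longrightarrow> D s = Some (length pre, R) \<longrightarrow>
       (\<exists>s'. D s' = Some (length pre, R') \<and> path D (length pre) (length pre + clen c + 2) s s' K))"

lemma Iter_step:
  assumes 1: "Iter i j c x R0 K R" and c: "Exec c x R T R'" and neq: "R i \<noteq> R j"
  shows "Iter i j c x R0 (K \<union> insert R (insert R' T)) R'"
  unfolding Iter_def
proof (intro conjI allI impI)
  fix k assume "wc c k = 0"
  then show "R' k = R0 k" "\<forall>S\<in>K \<union> insert R (insert R' T). S k = R0 k"
    using 1 Exec_frame[OF c] Exec_frame_trace[OF c] unfolding Iter_def by auto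
next
  fix pre post :: program and D :: "'a stage \<Rightarrow> 'a config option" and s
  let ?a = "length pre" let ?b = "?a + 1" let ?c = "?b + clen c" let ?e = "?a + clen c + 2"
  assume D: "traj (pre @ code ?a (Loop i j c) @ post) x D" "D s = Some (?a, R0)"
  then obtain s0 where s0: "D s0 = Some (?a, R)" "path D ?a ?e s s0 K"
    using 1 unfolding Iter_def by blast
  have s1: "D (ord_suc s0) = Some (?b, R)"
    using traj_exec[OF D(1) s0(1)] by (simp add: neq nth_append)
  have "\<exists>s'. D s' = Some (?c, R') \<and> path D ?b ?c (ord_suc s0) s' T"
    by (rule Exec_code[OF c D(1), where pre = "pre @ [Jump i j (?a + clen c + 2)]"]) (use s1 in auto)
  then obtain s2 where s2: "D s2 = Some (?c, R')" "path D ?b ?c (ord_suc s0) s2 T" by blast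
  have s3: "D (ord_suc s2) = Some (?a, R')"
    using traj_exec[OF D(1) s2(1)] by (simp add: nth_append)
  have p1: "path D ?a ?e s0 (ord_suc s0) {R}" by (rule path_step[of D s0 ?a]) (use s0 in auto)
  have p3: "path D ?a ?e s2 (ord_suc s2) {R'}" by (rule path_step[of D s2 ?c]) (use s2 in auto)
  have p2: "path D ?a ?e (ord_suc s0) s2 T" by (rule path_mono[OF s2(2)]) auto
  have "K \<union> {R} \<union> T \<union> {R'} = K \<union> insert R (insert R' T)" by auto
  then show "\<exists>s'. D s' = Some (?a, R') \<and> path D ?a ?e s s' (K \<union> insert R (insert R' T))"
    using s3 path_trans[OF path_trans[OF path_trans[OF s0(2) p1] p2] p3] by auto
qed

lemma Iter_refl: "Iter i j c x R {} R"
  unfolding Iter_def by (auto intro: path_refl)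

lemma Exec_Loop:
  assumes 1: "Iter i j c x R K R'" and eq: "R' i = R' j"
  shows "Exec (Loop i j c) x R (insert R' K) R'"
  unfolding Exec_def
proof (intro conjI allI impI)
  show "wframe (Loop i j c) R (insert R' K) R'" using 1 unfolding wframe_def Iter_def by auto
  fix pre post :: program and D :: "'a stage \<Rightarrow> 'a config option" and s
  let ?a = "length pre" let ?e = "?a + clen c + 2"
  assume D: "traj (pre @ code ?a (Loop i j c) @ post) x D" "D s = Some (?a, R)"
  then obtain s0 where s0: "D s0 = Some (?a, R')" "path D ?a ?e s s0 K"
    using 1 unfolding Iter_def by blast
  have s1: "D (ord_suc s0) = Some (?e, R')"
    using traj_exec[OF D(1) s0(1)] by (simp add: eq nth_append)
  have p1: "path D ?a ?e s0 (ord_suc s0) {R'}" by (rule path_step[of D s0 ?a]) (use s0 in auto)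
  have e: "?a + clen (Loop i j c) = ?e" by simp
  show "\<exists>s'. D s' = Some (?a + clen (Loop i j c), R') \<and> path D ?a (?a + clen (Loop i j c)) s s' (insert R' K)"
    unfolding e using s1 path_trans[OF s0(2) p1] by auto
qed

text \<open>\<open>R u\<close> are the contents at the head before round \<open>u\<close>. Since the
  head is the least line of the loop, what remains to be known at a limit is that each register has
  the inferior limit of its traces, which the premise \<open>lim\<close> supplies.\<close>

lemma Iter_limit:
  fixes R :: "'a stage \<Rightarrow> nat \<Rightarrow> 'a" and T :: "'a stage \<Rightarrow> (nat \<Rightarrow> 'a) set"
  assumes u: "u1 \<le> u0"
    and body: "\<And>u. u1 \<le> u \<Longrightarrow> u < u0 \<Longrightarrow> R u i \<noteq> R u j \<and> Exec c x (R u) (T u) (R (ord_suc u))"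
    and lim: "\<And>l k. is_limit l \<Longrightarrow> u1 < l \<Longrightarrow> l \<le> u0 \<Longrightarrow>
      is_lim u1 l (\<lambda>u. (\<lambda>S. S k) ` insert (R u) (insert (R (ord_suc u)) (T u))) (R l k)"
  shows "Iter i j c x (R u1) (\<Union>u\<in>{u1..<u0}. insert (R u) (insert (R (ord_suc u)) (T u))) (R u0)"
  unfolding Iter_def
proof (intro conjI allI impI)
  let ?T = "\<lambda>u. insert (R u) (insert (R (ord_suc u)) (T u))"
  fix k assume k: "wc c k = 0"
  have const: "u \<le> u0 \<longrightarrow> R u k = R u1 k" if "u1 \<le> u" for u
    using that
  proof (induction u rule: stage_interval_induct)
    case (suc u)
    show ?case
    proof
      assume "ord_suc u \<le> u0"
      then have "u < u0" by (simp add: stage_suc_le_iff)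
      then have "Exec c x (R u) (T u) (R (ord_suc u))" "R u k = R u1 k"
        using body[OF suc.hyps] suc.IH by auto
      then show "R (ord_suc u) k = R u1 k" using Exec_frame[OF _ k] by metis
    qed
  next
    case (limit l)
    show ?case
    proof
      assume l: "l \<le> u0"
      have "is_lim u1 l (\<lambda>u. (\<lambda>S. S k) ` ?T u) (R u1 k)"
      proof (rule is_lim_const[OF limit(2)])
        fix u assume u: "u1 \<le> u" "u < l"
        then have "R u k = R u1 k" using limit(3)[OF u] l by simp
        moreover have "R (ord_suc u) k = R u k" "\<forall>S\<in>T u. S k = R u k"
          using body[of u] u l Exec_frame[OF _ k] Exec_frame_trace[OF _ k] by (meson less_le_trans)+
        ultimately show "(\<lambda>S. S k) ` ?T u = {R u1 k}" by auto
      qed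
      then show "R l k = R u1 k" using is_lim_unique lim[OF limit(1,2) l] by blast
    qed
  qed simp
  have "R u0 k = R u1 k" using const[OF u] by blast
  moreover have "S k = R u1 k" if S: "S \<in> ?T u" and uu: "u1 \<le> u" "u < u0" for S u
  proof -
    have "R u k = R u1 k" using const[OF uu(1)] uu(2) by auto
    moreover have "R (ord_suc u) k = R u k" "\<forall>S\<in>T u. S k = R u k"
      using body[OF uu] Exec_frame[OF _ k] Exec_frame_trace[OF _ k] by blast+
    ultimately show ?thesis using S by auto
  qed
  ultimately show "R u0 k = R u1 k" "\<forall>S\<in>(\<Union>u\<in>{u1..<u0}. ?T u). S k = R u1 k" by auto
next
  let ?T = "\<lambda>u. insert (R u) (insert (R (ord_suc u)) (T u))"
  fix pre post :: program and D :: "'a stage \<Rightarrow> 'a config option" and s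
  let ?a = "length pre" let ?e = "?a + clen c + 2"
  assume D: "traj (pre @ code ?a (Loop i j c) @ post) x D" "D s = Some (?a, R u1)"
  have one: "\<exists>s'>s. D s' = Some (?a, R (ord_suc u)) \<and> path D ?a ?e s s' (?T u)"
    if uu: "u1 \<le> u" "u < u0" and Ds: "D s = Some (?a, R u)" for u s
  proof -
    have "Iter i j c x (R u) ({} \<union> ?T u) (R (ord_suc u))"
      by (rule Iter_step[OF Iter_refl]) (use body[OF uu] in auto)
    then have "Iter i j c x (R u) (?T u) (R (ord_suc u))" by simp
    with D(1) Ds obtain s' where s': "D s' = Some (?a, R (ord_suc u))" "path D ?a ?e s s' (?T u)"
      unfolding Iter_def by blast
    moreover have "s < s'" using s'(2) unfolding path_def by force
    ultimately show ?thesis by blast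
  qed
  have "\<exists>\<tau>. \<tau> u1 = s \<and> (\<forall>u. u1 \<le> u \<longrightarrow> u \<le> u0 \<longrightarrow> D (\<tau> u) = Some (?a, R u)) \<and>
    (\<forall>u v. u1 \<le> u \<longrightarrow> u < v \<longrightarrow> v \<le> u0 \<longrightarrow> \<tau> u < \<tau> v) \<and>
    (\<forall>u. u1 \<le> u \<longrightarrow> u < u0 \<longrightarrow> path D ?a ?e (\<tau> u) (\<tau> (ord_suc u)) (?T u)) \<and>
    (\<forall>u r. u1 \<le> u \<longrightarrow> u \<le> u0 \<longrightarrow> s \<le> r \<longrightarrow> r < \<tau> u \<longrightarrow>
       (\<exists>v. u1 \<le> v \<and> v < u \<and> \<tau> v \<le> r \<and> r < \<tau> (ord_suc v)))"
  proof (rule simulation[where Q = "\<lambda>u s s'. path D ?a ?e s s' (?T u)"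
        and c = "\<lambda>u. (?a, R u)" and D = D and ?s0.0 = s
        and ?u1.0 = u1, OF u D(2)])
    fix l t \<tau> assume l: "is_limit l" "u1 < l" "l \<le> u0" and t: "is_limit t" "s < t" "\<tau> u1 = s"
      and \<tau>: "\<And>v. u1 \<le> v \<Longrightarrow> v < l \<Longrightarrow> \<tau> v < t \<and> D (\<tau> v) = Some (?a, R v) \<and>
          path D ?a ?e (\<tau> v) (\<tau> (ord_suc v)) (?T v)"
      and mono: "\<And>v w. u1 \<le> v \<Longrightarrow> v < w \<Longrightarrow> w < l \<Longrightarrow> \<tau> v < \<tau> w"
      and cover: "\<And>r. s \<le> r \<Longrightarrow> r < t \<Longrightarrow> \<exists>v. u1 \<le> v \<and> v < l \<and> \<tau> v \<le> r \<and> r < \<tau> (ord_suc v)"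
    have vis: "\<exists>k S. D r = Some (k, S) \<and> ?a \<le> k \<and> k < ?e \<and> S \<in> ?T v"
      if "u1 \<le> v" "v < l" "\<tau> v \<le> r" "r < \<tau> (ord_suc v)" for v r
      using \<tau>[OF that(1,2)] that(3,4) unfolding path_def by blast
    show "D t = Some (?a, R l)"
    proof (rule traj_limitI[OF D(1) t(1,2)])
      show "D r \<noteq> None" if "s \<le> r" "r < t" for r
        using cover[OF that] vis by (metis option.distinct(1))
      \<comment> \<open>No line below the head is visited, and the head is visited once in every
        round.\<close>
      show "is_lim s t (\<lambda>u. {fst (the (D u))}) ?a"
      proof (rule is_limI)
        fix w assume "w < ?a"
        have "w < fst (the (D r))" if r: "s \<le> r" "r < t" for r
        proof -
          obtain v where "u1 \<le> v" "v < l" "\<tau> v \<le> r" "r < \<tau> (ord_suc v)" using cover[OF r] by blast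
          from vis[OF this] \<open>w < ?a\<close> show ?thesis by auto
        qed
        then show "\<exists>u\<ge>s. u < t \<and> (\<forall>r. u \<le> r \<and> r < t \<longrightarrow> (\<forall>y\<in>{fst (the (D r))}. w < y))"
          using t(2) by (intro exI[of _ s]) simp
      next
        fix r assume "s \<le> r" "r < t"
        then obtain v where v: "u1 \<le> v" "v < l" "r < \<tau> (ord_suc v)" using cover by blast
        have "u1 \<le> ord_suc v" "ord_suc v < l"
          using v is_limit_suc[OF l(1)] by (auto intro: stage_le_suc)
        with \<tau>[of "ord_suc v"] v
        show "\<exists>q y. r \<le> q \<and> q < t \<and> y \<in> {fst (the (D q))} \<and> y \<le> ?a"
          by (intro exI[of _ "\<tau> (ord_suc v)"]) auto
      qed
      show "is_lim s t (\<lambda>u. {snd (the (D u)) k}) (R l k)" for k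
      proof (rule is_lim_transfer[OF lim[OF l] l(1,2) _ t(3) mono cover])
        show "snd (the (D r)) k \<in> (\<lambda>S. S k) ` ?T v" if "u1 \<le> v" "v < l" "\<tau> v \<le> r" "r < \<tau> (ord_suc v)" for v r
          using vis[OF that] by auto
        show "\<exists>r. \<tau> v \<le> r \<and> r < \<tau> (ord_suc v) \<and> snd (the (D r)) k = y"
          if vy: "u1 \<le> v" "v < l" "y \<in> (\<lambda>S. S k) ` ?T v" for v y
        proof -
          obtain S where S: "S \<in> ?T v" "y = S k" using vy(3) by blast
          then obtain r q where "\<tau> v \<le> r" "r < \<tau> (ord_suc v)" "D r = Some (q, S)"
            using \<tau>[OF vy(1,2)] unfolding path_def by blast
          with S show ?thesis by (intro exI[of _ r]) simp
        qed
      qed (use \<tau> in auto)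
    qed
  qed (rule one)
  then obtain \<tau> where \<tau>: "\<tau> u1 = s" "\<And>u. u1 \<le> u \<Longrightarrow> u \<le> u0 \<Longrightarrow> D (\<tau> u) = Some (?a, R u)"
    "\<And>u v. u1 \<le> u \<Longrightarrow> u < v \<Longrightarrow> v \<le> u0 \<Longrightarrow> \<tau> u < \<tau> v"
    "\<And>u. u1 \<le> u \<Longrightarrow> u < u0 \<Longrightarrow> path D ?a ?e (\<tau> u) (\<tau> (ord_suc u)) (?T u)"
    "\<And>u r. u1 \<le> u \<Longrightarrow> u \<le> u0 \<Longrightarrow> s \<le> r \<Longrightarrow> r < \<tau> u \<Longrightarrow> \<exists>v. u1 \<le> v \<and> v < u \<and> \<tau> v \<le> r \<and> r < \<tau> (ord_suc v)"
    by blast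
  have le: "\<tau> v \<le> \<tau> w" if "u1 \<le> v" "v \<le> w" "w \<le> u0" for v w
    using \<tau>(3)[OF that(1) _ that(3)] that(2) by (auto simp: order_le_less)
  have "path D ?a ?e s (\<tau> u0) (\<Union>u\<in>{u1..<u0}. ?T u)"
    unfolding path_def
  proof (intro conjI allI impI ballI)
    show "s \<le> \<tau> u0" using le[of u1 u0] \<tau>(1) u by simp
    fix r assume r: "s \<le> r" "r < \<tau> u0"
    then obtain v where v: "u1 \<le> v" "v < u0" "\<tau> v \<le> r" "r < \<tau> (ord_suc v)" using \<tau>(5)[OF u] by blast
    then obtain l S where "D r = Some (l, S) \<and> ?a \<le> l \<and> l < ?e \<and> S \<in> ?T v"
      using \<tau>(4)[of v] unfolding path_def by blast
    with v show "\<exists>l S. D r = Some (l, S) \<and> ?a \<le> l \<and> l < ?e \<and> S \<in> (\<Union>u\<in>{u1..<u0}. ?T u)" by auto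
  next
    fix S assume "S \<in> (\<Union>u\<in>{u1..<u0}. ?T u)"
    then obtain v where v: "u1 \<le> v" "v < u0" "S \<in> ?T v" by auto
    then obtain r l where r: "\<tau> v \<le> r" "r < \<tau> (ord_suc v)" "D r = Some (l, S)"
      using \<tau>(4)[of v] unfolding path_def by blast
    moreover have "s \<le> \<tau> v" using le[of u1 v] \<tau>(1) v by simp
    moreover have "\<tau> (ord_suc v) \<le> \<tau> u0"
      by (rule le) (use v in \<open>auto simp: stage_suc_le_iff intro: stage_le_suc\<close>)
    ultimately show "\<exists>r l. s \<le> r \<and> r < \<tau> u0 \<and> D r = Some (l, S)"
      by (intro exI[of _ r] exI[of _ l]) auto
  qed
  then show "\<exists>s'. D s' = Some (?a, R u0) \<and> path D ?a ?e s s' (\<Union>u\<in>{u1..<u0}. ?T u)"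
    using \<tau>(2)[OF u] by blast
qed

text \<open>All values of register \<open>k\<close> during round \<open>u\<close>. The contents
  \<open>R u\<close> and \<open>R (ord_suc u)\<close> are seen at the two jumps that frame the
  body.\<close>

definition trc :: "('a stage \<Rightarrow> nat \<Rightarrow> 'a) \<Rightarrow> ('a stage \<Rightarrow> (nat \<Rightarrow> 'a) set) \<Rightarrow> nat \<Rightarrow> 'a stage \<Rightarrow> 'a set" where
  "trc R T k u = (\<lambda>S. S k) ` insert (R u) (insert (R (ord_suc u)) (T u))"

lemma trc_two_valued:
  assumes l: "is_limit l" and "\<And>u. u1 \<le> u \<Longrightarrow> u < l \<Longrightarrow> Exec c x (R u) (T u) (R (ord_suc u))" "wc c k \<le> 1"
  shows "is_lim u1 l (trc R T k) v \<longleftrightarrow> is_lim u1 l (\<lambda>u. {R u k}) v"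
proof (rule is_lim_two_valued[OF l])
  show "R u k \<in> trc R T k u" for u unfolding trc_def by simp
  show "y = R u k \<or> y = R (ord_suc u) k" if u: "u1 \<le> u" "u < l" "y \<in> trc R T k u" for u y
  proof -
    obtain S where "S \<in> insert (R u) (insert (R (ord_suc u)) (T u))" "y = S k"
      using u(3) unfolding trc_def by blast
    then show ?thesis using Exec_once[OF assms(2)[OF u(1,2)] assms(3)] by blast
  qed
qed

lemma trc_const:
  assumes "u1 < l" and "\<And>u. u1 \<le> u \<Longrightarrow> u < l \<Longrightarrow> Exec c x (R u) (T u) (R (ord_suc u)) \<and> R u k = v" "wc c k = 0"
  shows "is_lim u1 l (trc R T k) v"
proof (rule is_lim_const[OF assms(1)])
  fix u assume u: "u1 \<le> u" "u < l"
  then have E: "Exec c x (R u) (T u) (R (ord_suc u))" "R u k = v" using assms(2) by auto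
  show "trc R T k u = {v}" unfolding trc_def
    using Exec_frame[OF E(1) assms(3)] Exec_frame_trace[OF E(1) assms(3)] E(2) by auto
qed

lemma trc_zero:
  assumes "\<And>u. u1 \<le> u \<Longrightarrow> u < l \<Longrightarrow> R u k = ord_zero"
  shows "is_lim u1 l (trc R T k) ord_zero"
proof (rule is_lim_zero)
  fix u assume "u1 \<le> u" "u < l"
  with assms show "\<exists>r. u \<le> r \<and> r < l \<and> ord_zero \<in> trc R T k r"
    unfolding trc_def by (intro exI[of _ u]) (auto intro: image_eqI[of _ _ "R u"])
qed

text \<open>Usually only the existence of suitable contents after a round is known, so the sequence
  of head contents is chosen by recursion along with the invariant \<open>Inv\<close>. At a limit
  nothing is free: the task left to the premise \<open>lim\<close> is to show that the inferior
  limits exist, that is, that no register overflows, and that they satisfy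
  \<open>Inv\<close>.\<close>

lemma Iter_inv:
  assumes u: "u1 \<le> u0" and start: "Inv u1 R0"
    and step: "\<And>u R. u1 \<le> u \<Longrightarrow> u < u0 \<Longrightarrow> Inv u R \<Longrightarrow> R i \<noteq> R j \<and>
      (\<exists>T R'. Exec c x R T R' \<and> Q u R T R' \<and> Inv (ord_suc u) R')"
    and lim: "\<And>l R T. is_limit l \<Longrightarrow> u1 < l \<Longrightarrow> l \<le> u0 \<Longrightarrow> R u1 = R0 \<Longrightarrow>
      (\<And>u. u1 \<le> u \<Longrightarrow> u < l \<Longrightarrow> Inv u (R u) \<and> Exec c x (R u) (T u) (R (ord_suc u)) \<and> Q u (R u) (T u) (R (ord_suc u))) \<Longrightarrow>
      (\<And>l' k. is_limit l' \<Longrightarrow> u1 < l' \<Longrightarrow> l' < l \<Longrightarrow> is_lim u1 l' (trc R T k) (R l' k)) \<Longrightarrow>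
      \<exists>R'. Inv l R' \<and> (\<forall>k. is_lim u1 l (trc R T k) (R' k))"
  shows "\<exists>R T. R u1 = R0 \<and> (\<forall>u. u1 \<le> u \<longrightarrow> u \<le> u0 \<longrightarrow> Inv u (R u)) \<and>
    (\<forall>u. u1 \<le> u \<longrightarrow> u < u0 \<longrightarrow> Exec c x (R u) (T u) (R (ord_suc u)) \<and> Q u (R u) (T u) (R (ord_suc u))) \<and>
    (\<forall>l k. is_limit l \<longrightarrow> u1 < l \<longrightarrow> l \<le> u0 \<longrightarrow> is_lim u1 l (trc R T k) (R l k)) \<and>
    Iter i j c x R0 (\<Union>u\<in>{u1..<u0}. insert (R u) (insert (R (ord_suc u)) (T u))) (R u0)"
proof -
  define nx where "nx u R = (SOME p. Exec c x R (fst p) (snd p) \<and> Q u R (fst p) (snd p) \<and> Inv (ord_suc u) (snd p))" for u R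
  have nx: "Exec c x R (fst (nx u R)) (snd (nx u R)) \<and> Q u R (fst (nx u R)) (snd (nx u R)) \<and> Inv (ord_suc u) (snd (nx u R))"
    if "u1 \<le> u" "u < u0" "Inv u R" for u R
  proof -
    from step[OF that] obtain T R' where "Exec c x R T R' \<and> Q u R T R' \<and> Inv (ord_suc u) R'" by blast
    then have "\<exists>p. Exec c x R (fst p) (snd p) \<and> Q u R (fst p) (snd p) \<and> Inv (ord_suc u) (snd p)"
      by (intro exI[of _ "(T, R')"]) simp
    then show ?thesis unfolding nx_def by (rule someI_ex)
  qed
  define W where "W f k v = (\<lambda>S. S k) ` insert (f v) (insert (snd (nx v (f v))) (fst (nx v (f v))))" for f k v
  \<comment> \<open>The limit clause looks at the traces of earlier rounds, recomputed by
    \<open>W\<close> from the head contents alone, so it is a legitimate recursion on smaller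
    stages.\<close>
  define F where "F = (\<lambda>f u. if u \<le> u1 then R0 else if is_limit u
     then SOME R'. Inv u R' \<and> (\<forall>k. is_lim u1 u (W f k) (R' k))
     else snd (nx (THE v. u = ord_suc v) (f (THE v. u = ord_suc v))))"
  define R where "R = wfrec {(v, w). v < w} F"
  define T where "T u = fst (nx u (R u))" for u
  have rec: "R u = F R u" for u
  proof -
    have "wf {(v :: 'a stage, w). v < w}" by (rule wf)
    from wfrec[OF this, of F u] have "R u = F (cut R {(v, w). v < w} u) u" unfolding R_def .
    also have "\<dots> = F R u"
    proof -
      have W: "is_lim u1 u (W (cut R {(v, w). v < w} u) k) = is_lim u1 u (W R k)" for k
        by (intro ext is_lim_cong) (simp add: W_def cut_def)
      have "(THE v. u = ord_suc v) < u" if "u1 < u" "\<not> is_limit u"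
        using that(1)
      proof (cases rule: stage_cases)
        case (1 v)
        then have "(THE v. u = ord_suc v) = v" by (intro the_equality) auto
        then show ?thesis using 1 by simp
      qed (use that in auto)
      then have "cut R {(v, w). v < w} u (THE v. u = ord_suc v) = R (THE v. u = ord_suc v)"
        if "\<not> u \<le> u1" "\<not> is_limit u" using that by (simp add: cut_def)
      then show ?thesis unfolding F_def W by simp
    qed
    finally show ?thesis .
  qed
  have R1: "R u1 = R0" unfolding rec[of u1] F_def by simp
  have Rsuc: "R (ord_suc u) = snd (nx u (R u))" if "u1 \<le> u" for u
  proof -
    have "\<not> ord_suc u \<le> u1" using that by (simp add: stage_suc_le_iff)
    moreover have "(THE v. ord_suc u = ord_suc v) = u" by (intro the_equality) auto
    ultimately show ?thesis unfolding rec[of "ord_suc u"] F_def by simp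
  qed
  have Wtrc: "W R k u = trc R T k u" if "u1 \<le> u" for u k
    unfolding W_def trc_def T_def Rsuc[OF that] ..
  have body: "Exec c x (R u) (T u) (R (ord_suc u)) \<and> Q u (R u) (T u) (R (ord_suc u)) \<and> Inv (ord_suc u) (R (ord_suc u))"
    if "u1 \<le> u" "u < u0" "Inv u (R u)" for u
    using nx[OF that] unfolding Rsuc[OF that(1)] T_def .
  have main: "u \<le> u0 \<longrightarrow> Inv u (R u) \<and> (is_limit u \<longrightarrow> u1 < u \<longrightarrow> (\<forall>k. is_lim u1 u (trc R T k) (R u k)))"
    if "u1 \<le> u" for u
    using that
  proof (induction u rule: stage_interval_induct)
    case start
    then show ?case using assms(2) R1 by simp
  next
    case (suc u)
    show ?case
    proof
      assume "ord_suc u \<le> u0"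
      then have "u < u0" by (simp add: stage_suc_le_iff)
      moreover from this have "Inv u (R u)" using suc.IH by simp
      ultimately show "Inv (ord_suc u) (R (ord_suc u)) \<and> (is_limit (ord_suc u) \<longrightarrow> u1 < ord_suc u \<longrightarrow>
         (\<forall>k. is_lim u1 (ord_suc u) (trc R T k) (R (ord_suc u) k)))"
        using body[OF suc.hyps] by simp
    qed
  next
    case (limit l)
    show ?case
    proof
      assume l: "l \<le> u0"
      have "\<exists>R'. Inv l R' \<and> (\<forall>k. is_lim u1 l (trc R T k) (R' k))"
      proof (rule lim[where R = R and T = T, OF limit(1,2) l R1])
        show "Inv u (R u) \<and> Exec c x (R u) (T u) (R (ord_suc u)) \<and> Q u (R u) (T u) (R (ord_suc u))"
          if "u1 \<le> u" "u < l" for u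
          using limit(3)[OF that] that l body[of u] by simp
        show "is_lim u1 l' (trc R T k) (R l' k)" if "is_limit l'" "u1 < l'" "l' < l" for l' k
          using limit(3)[of l'] that l by simp
      qed
      moreover have "is_lim u1 l (W R k) y \<longleftrightarrow> is_lim u1 l (trc R T k) y" for k y
        by (rule is_lim_cong) (rule Wtrc)
      ultimately have exl: "\<exists>R'. Inv l R' \<and> (\<forall>k. is_lim u1 l (W R k) (R' k))" by simp
      have Rl: "R l = (SOME R'. Inv l R' \<and> (\<forall>k. is_lim u1 l (W R k) (R' k)))"
        unfolding rec[of l] F_def using limit(1) limit(2)[unfolded not_le[symmetric]] by auto
      from someI_ex[OF exl] have "Inv l (R l) \<and> (\<forall>k. is_lim u1 l (W R k) (R l k))" unfolding Rl .
      with \<open>\<And>k y. is_lim u1 l (W R k) y \<longleftrightarrow> is_lim u1 l (trc R T k) y\<close>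
      show "Inv l (R l) \<and> (is_limit l \<longrightarrow> u1 < l \<longrightarrow> (\<forall>k. is_lim u1 l (trc R T k) (R l k)))" by simp
    qed
  qed
  have "Iter i j c x (R u1) (\<Union>u\<in>{u1..<u0}. insert (R u) (insert (R (ord_suc u)) (T u))) (R u0)"
  proof (rule Iter_limit[OF u])
    show "R u i \<noteq> R u j \<and> Exec c x (R u) (T u) (R (ord_suc u))" if "u1 \<le> u" "u < u0" for u
      using step[OF that] body[OF that] main[OF that(1)] that(2) by simp
    show "is_lim u1 l (\<lambda>u. (\<lambda>S. S k) ` insert (R u) (insert (R (ord_suc u)) (T u))) (R l k)"
      if "is_limit l" "u1 < l" "l \<le> u0" for l k
      using main[of l] that unfolding trc_def[abs_def] by simp
  qed
  then show ?thesis using R1 main body by (intro exI[of _ R] exI[of _ T]) auto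
qed

end

section \<open>Simulating a program\<close>

fun iregs :: "instr \<Rightarrow> nat set" where
  "iregs (Inc i) = {i}"
| "iregs (Copy i j) = {i, j}"
| "iregs (Jump i j l) = {i, j}"
| "iregs (Query j) = {j}"

definition regs_below :: "nat \<Rightarrow> program \<Rightarrow> bool" where
  "regs_below k P \<longleftrightarrow> (\<forall>I\<in>set P. \<forall>i\<in>iregs I. i < k)"

lemma regs_below_ex: "\<exists>k. regs_below k P \<and> m \<le> k"
proof -
  have "finite (iregs I)" for I by (cases I) auto
  then have "finite (\<Union>I\<in>set P. iregs I)" by auto
  then obtain k where "\<forall>i\<in>(\<Union>I\<in>set P. iregs I). i < k" using finite_nat_set_iff_bounded by auto
  then show ?thesis unfolding regs_below_def by (intro exI[of _ "max k m"]) fastforce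
qed

text \<open>Register \<open>i\<close> of the simulated program is kept in register \<open>off + i\<close>, its active line in
  register \<open>pc\<close>; the register \<open>kb + l\<close> contains the number \<open>l\<close>.\<close>
fun icom :: "nat \<Rightarrow> nat \<Rightarrow> nat \<Rightarrow> (nat \<Rightarrow> com) \<Rightarrow> nat \<Rightarrow> nat \<Rightarrow> instr \<Rightarrow> com" where
  "icom off pc kb qc n l (Inc i) = INC (off + i) ;; COPY (kb + Suc l) pc"
| "icom off pc kb qc n l (Copy i j) = COPY (off + i) (off + j) ;; COPY (kb + Suc l) pc"
| "icom off pc kb qc n l (Jump i j m) =
     Cond (off + i) (off + j) (COPY (kb + min m n) pc) (COPY (kb + Suc l) pc)"
| "icom off pc kb qc n l (Query j) = qc (off + j) ;; COPY (kb + Suc l) pc"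

fun disp :: "nat \<Rightarrow> nat \<Rightarrow> nat \<Rightarrow> (nat \<Rightarrow> com) \<Rightarrow> nat \<Rightarrow> nat \<Rightarrow> instr list \<Rightarrow> com" where
  "disp off pc kb qc n l [] = SKIP"
| "disp off pc kb qc n l (I # Is) = Cond pc (kb + l) (icom off pc kb qc n l I) (disp off pc kb qc n (Suc l) Is)"

text \<open>The hook \<open>H\<close> can end the simulation by writing 1 to register \<open>st\<close>.\<close>
definition simbody :: "nat \<Rightarrow> nat \<Rightarrow> nat \<Rightarrow> nat \<Rightarrow> (nat \<Rightarrow> com) \<Rightarrow> com \<Rightarrow> program \<Rightarrow> com" where
  "simbody off pc kb st qc H P =
     H ;; Cond st (kb + 1) (COPY (kb + length P) pc) (disp off pc kb qc (length P) 0 P)"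

definition simcom :: "nat \<Rightarrow> nat \<Rightarrow> nat \<Rightarrow> nat \<Rightarrow> (nat \<Rightarrow> com) \<Rightarrow> com \<Rightarrow> program \<Rightarrow> com" where
  "simcom off pc kb st qc H P = Loop pc (kb + length P) (simbody off pc kb st qc H P)"

context exp_closed begin

definition kconsts :: "nat \<Rightarrow> nat \<Rightarrow> (nat \<Rightarrow> 'a) \<Rightarrow> bool" where
  "kconsts kb N R \<longleftrightarrow> (\<forall>l\<le>N. R (kb + l) = num l)"

text \<open>Jumps may lead to any line beyond the program. All these halting lines are represented
  by \<open>n\<close>, since only finitely many constants are stored and the exit test compares with
  one of them.\<close>

definition rep :: "nat \<Rightarrow> nat \<Rightarrow> nat \<Rightarrow> nat \<Rightarrow> 'a config \<Rightarrow> (nat \<Rightarrow> 'a) \<Rightarrow> bool" where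
  "rep off pc k n c R \<longleftrightarrow> R pc = num (min (fst c) n) \<and> (\<forall>i<k. R (off + i) = snd c i)"

end

text \<open>Each simulated instruction writes its target register and \<open>pc\<close> at most
  once. By \<open>trc_two_valued\<close> the simulation then computes the same inferior limits as
  the simulated program.\<close>

lemma icom_wc:
  assumes wcq: "\<And>j. j < k \<Longrightarrow> wc (qc (off + j)) i \<le> (if i = off + j then 1 else 0)"
    and I: "\<And>i. i \<in> iregs I \<Longrightarrow> i < k" and pc: "pc \<notin> {off..<off+k}"
  shows "wc (icom off pc kb qc n l I) i \<le> 1"
    and "i \<notin> insert pc {off..<off+k} \<Longrightarrow> wc (icom off pc kb qc n l I) i = 0"
proof -
  have pcn: "off + j \<noteq> pc" if "j < k" for j using pc that by auto
  have "wc (icom off pc kb qc n l I) i \<le> 1 \<and>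
    (i \<notin> insert pc {off..<off+k} \<longrightarrow> wc (icom off pc kb qc n l I) i = 0)"
  proof (cases I)
    case (Inc m)
    then show ?thesis using I pcn by auto
  next
    case (Copy m j)
    then show ?thesis using I pcn by auto
  next
    case (Jump m j q)
    then show ?thesis by auto
  next
    case (Query j)
    then have j: "j < k" using I by simp
    show ?thesis using wcq[OF j] pcn[OF j] j unfolding Query by (auto split: if_splits)
  qed
  then show "wc (icom off pc kb qc n l I) i \<le> 1"
    "i \<notin> insert pc {off..<off+k} \<Longrightarrow> wc (icom off pc kb qc n l I) i = 0" by blast+
qed

lemma disp_wc:
  assumes wcq: "\<And>j. j < k \<Longrightarrow> wc (qc (off + j)) i \<le> (if i = off + j then 1 else 0)"
    and pc: "pc \<notin> {off..<off+k}" and P: "regs_below k P"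
  shows "wc (disp off pc kb qc n l P) i \<le> 1"
    and "i \<notin> insert pc {off..<off+k} \<Longrightarrow> wc (disp off pc kb qc n l P) i = 0"
proof -
  have "wc (disp off pc kb qc n l P) i \<le> 1 \<and>
    (i \<notin> insert pc {off..<off+k} \<longrightarrow> wc (disp off pc kb qc n l P) i = 0)"
    using P
  proof (induction P arbitrary: l)
    case (Cons I P)
    have I: "\<And>i. i \<in> iregs I \<Longrightarrow> i < k" "regs_below k P" using Cons.prems unfolding regs_below_def by auto
    show ?case using icom_wc[where l = l and kb = kb and n = n, OF wcq I(1) pc] Cons.IH[OF I(2), of "Suc l"] by simp
  qed simp
  then show "wc (disp off pc kb qc n l P) i \<le> 1"
    "i \<notin> insert pc {off..<off+k} \<Longrightarrow> wc (disp off pc kb qc n l P) i = 0" by blast+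
qed

context exp_closed begin

text \<open>The simulated oracle \<open>z\<close> is separate from the oracle \<open>x\<close> of
  the simulating program: the code \<open>qc\<close> answers a query to \<open>z\<close> in its own
  way. \<open>W\<close> remembers a property of the trace of that code, for use after the
  simulation.\<close>

lemma icom_exec:
  assumes rep: "rep off pc k n c R" and n: "fst c < n" "length P = n" "regs_below k P"
    and pc: "pc \<notin> {off..<off+k}" and kb: "{kb..kb+n} \<inter> insert pc {off..<off+k} = {}"
    and kconsts: "kconsts kb n R"
    and qc: "\<And>j. j < k \<Longrightarrow> \<exists>T. Exec (qc (off + j)) x R T
       (R(off + j := if R (off + j) \<in> z then ord_one else ord_zero)) \<and> W j R T"
  shows "\<exists>T R'. Exec (icom off pc kb qc n (fst c) (P ! fst c)) x R T R' \<and> rep off pc k n (step P z c) R' \<and>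
    (\<forall>j. j \<notin> insert pc {off..<off+k} \<longrightarrow> R' j = R j) \<and>
    (\<forall>j. P ! fst c = Query j \<longrightarrow> (\<exists>Tq\<subseteq>T. W j R Tq))"
proof -
  obtain l S where c: "c = (l, S)" by (cases c)
  have I: "\<And>i. i \<in> iregs (P ! l) \<Longrightarrow> i < k" using n c unfolding regs_below_def by auto
  have st: "step P z c = exec (P ! l) z (l, S)" using n c by (simp add: step_config)
  have RS: "\<And>i. i < k \<Longrightarrow> R (off + i) = S i" using rep c unfolding rep_def by simp
  have kbv: "R (kb + m) = num m" if "m \<le> n" for m using kconsts that unfolding kconsts_def by simp
  have kbn: "kb + m \<noteq> off + i" if "m \<le> n" "i < k" for m i
    using kb that by (metis (no_types, lifting) IntI add_le_cancel_left add_less_cancel_left atLeastAtMost_iff atLeastLessThan_iff empty_iff insertCI le_add1)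
  have l: "Suc l \<le> n" using n c by simp
  have pcn: "off + i \<noteq> pc" if "i < k" for i using pc that by auto
  show ?thesis
  proof (cases "P ! l")
    case (Inc i)
    then have i: "i < k" using I by simp
    let ?R1 = "R(off + i := ord_suc (R (off + i)))"
    have "Exec (icom off pc kb qc n l (P ! l)) x R ({R} \<union> {?R1}) (?R1(pc := ?R1 (kb + Suc l)))"
      unfolding Inc icom.simps by (rule Exec_Seq[OF Exec_INC Exec_COPY])
    moreover have "rep off pc k n (step P z c) (?R1(pc := ?R1 (kb + Suc l)))"
      using i l RS kbv[OF l] kbn[OF l i] pcn unfolding rep_def st Inc by (auto simp: min_def)
    ultimately show ?thesis unfolding c using i Inc by (intro exI conjI) auto
  next
    case (Copy i j)
    then have i: "i < k" "j < k" using I by auto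
    let ?R1 = "R(off + j := R (off + i))"
    have "Exec (icom off pc kb qc n l (P ! l)) x R ({R} \<union> {?R1}) (?R1(pc := ?R1 (kb + Suc l)))"
      unfolding Copy icom.simps by (rule Exec_Seq[OF Exec_COPY Exec_COPY])
    moreover have "rep off pc k n (step P z c) (?R1(pc := ?R1 (kb + Suc l)))"
      using i l RS kbv[OF l] kbn[OF l i(2)] pcn unfolding rep_def st Copy by (auto simp: min_def)
    ultimately show ?thesis unfolding c using i Copy by (intro exI conjI) auto
  next
    case (Jump i j m)
    then have i: "i < k" "j < k" using I by auto
    show ?thesis
    proof (cases "S i = S j")
      case True
      have "Exec (icom off pc kb qc n l (P ! l)) x R (insert R {R}) (R(pc := R (kb + min m n)))"
        unfolding Jump icom.simps by (rule Exec_Cond_True[OF Exec_COPY]) (simp add: RS i True)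
      moreover have "rep off pc k n (step P z c) (R(pc := R (kb + min m n)))"
        using i RS kbv[of "min m n"] pcn True unfolding rep_def st Jump by auto
      ultimately show ?thesis unfolding c using Jump by (intro exI conjI) auto
    next
      case False
      have "Exec (icom off pc kb qc n l (P ! l)) x R (insert R (insert (R(pc := R (kb + Suc l))) {R})) (R(pc := R (kb + Suc l)))"
        unfolding Jump icom.simps by (rule Exec_Cond_False[OF Exec_COPY]) (simp add: RS i False)
      moreover have "rep off pc k n (step P z c) (R(pc := R (kb + Suc l)))"
        using i l RS kbv[OF l] pcn False unfolding rep_def st Jump by (auto simp: min_def)
      ultimately show ?thesis unfolding c using Jump by (intro exI conjI) auto
    qed
  next
    case (Query j)
    then have j: "j < k" using I by simp
    let ?R1 = "R(off + j := if R (off + j) \<in> z then ord_one else ord_zero)"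
    from qc[OF j] obtain T where T: "Exec (qc (off + j)) x R T ?R1" "W j R T" by blast
    have "Exec (icom off pc kb qc n l (P ! l)) x R (T \<union> {?R1}) (?R1(pc := ?R1 (kb + Suc l)))"
      unfolding Query icom.simps by (rule Exec_Seq[OF T(1) Exec_COPY])
    moreover have "rep off pc k n (step P z c) (?R1(pc := ?R1 (kb + Suc l)))"
      using j l RS kbv[OF l] kbn[OF l j] pcn unfolding rep_def st Query by (auto simp: min_def)
    ultimately show ?thesis unfolding c using j Query T(2) by (intro exI conjI) auto
  qed
qed

lemma disp_select:
  assumes E: "Exec (icom off pc kb qc n (l + i) (P ! i)) x R T R'" and i: "i < length P"
    and pc: "R pc = num (l + i)" and kconsts: "\<And>j. j < length P \<Longrightarrow> R (kb + (l + j)) = num (l + j)"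
  shows "\<exists>T'. T \<subseteq> T' \<and> Exec (disp off pc kb qc n l P) x R T' R'"
  using assms
proof (induction P arbitrary: l i)
  case (Cons I P)
  show ?case
  proof (cases i)
    case 0
    then have "Exec (disp off pc kb qc n l (I # P)) x R (insert R T) R'"
      using Cons.prems(1,3) Cons.prems(4)[of 0] by (auto intro!: Exec_Cond_True)
    then show ?thesis by blast
  next
    case (Suc m)
    have "\<exists>T'. T \<subseteq> T' \<and> Exec (disp off pc kb qc n (Suc l) P) x R T' R'"
    proof (rule Cons.IH[of "Suc l" m])
      show "R (kb + (Suc l + j)) = num (Suc l + j)" if "j < length P" for j
        using Cons.prems(4)[of "Suc j"] that by simp
    qed (use Cons.prems Suc in auto)
    then obtain T' where T': "T \<subseteq> T'" "Exec (disp off pc kb qc n (Suc l) P) x R T' R'" by blast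
    have "R (kb + l) = num l" using Cons.prems(4)[of 0] by simp
    then have "R pc \<noteq> R (kb + l)" using Cons.prems(3) Suc by simp
    then have "Exec (disp off pc kb qc n l (I # P)) x R (insert R (insert R' T')) R'"
      unfolding disp.simps by (rule Exec_Cond_False[OF T'(2)])
    moreover have "T \<subseteq> insert R (insert R' T')" using T'(1) by auto
    ultimately show ?thesis by (intro exI conjI)
  qed
qed simp

lemma disp_exec:
  assumes rep: "rep off pc k n c R" and n: "fst c < n" "length P = n" "regs_below k P"
    and pc: "pc \<notin> {off..<off+k}" and kb: "{kb..kb+n} \<inter> insert pc {off..<off+k} = {}"
    and kconsts: "kconsts kb n R"
    and qc: "\<And>j. j < k \<Longrightarrow> \<exists>T. Exec (qc (off + j)) x R T
       (R(off + j := if R (off + j) \<in> z then ord_one else ord_zero)) \<and> W j R T"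
  shows "\<exists>T R'. Exec (disp off pc kb qc n 0 P) x R T R' \<and> rep off pc k n (step P z c) R' \<and>
    (\<forall>j. j \<notin> insert pc {off..<off+k} \<longrightarrow> R' j = R j) \<and>
    (\<forall>j. P ! fst c = Query j \<longrightarrow> (\<exists>Tq\<subseteq>T. W j R Tq))"
proof -
  from icom_exec[where W = W, OF assms(1-7) qc] obtain T R' where T: "Exec (icom off pc kb qc n (0 + fst c) (P ! fst c)) x R T R'"
    "rep off pc k n (step P z c) R'" "\<forall>j. j \<notin> insert pc {off..<off+k} \<longrightarrow> R' j = R j"
    "\<forall>j. P ! fst c = Query j \<longrightarrow> (\<exists>Tq\<subseteq>T. W j R Tq)" by auto
  have "\<exists>T'. T \<subseteq> T' \<and> Exec (disp off pc kb qc n 0 P) x R T' R'"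
    by (rule disp_select[OF T(1)]) (use rep n kconsts in \<open>auto simp: rep_def kconsts_def\<close>)
  with T(2-4) show ?thesis by (meson order_trans)
qed

lemma simbody_wc:
  assumes "\<And>j. j < k \<Longrightarrow> wc (qc (off + j)) i \<le> (if i = off + j then 1 else 0)"
    and "pc \<notin> {off..<off+k}" "regs_below k P"
  shows "wc H i = 0 \<Longrightarrow> wc (simbody off pc kb st qc H P) i \<le> 1"
    and "i \<notin> insert pc {off..<off+k} \<Longrightarrow> wc (simbody off pc kb st qc H P) i = wc H i"
  using disp_wc[OF assms] assms(2) unfolding simbody_def by auto

lemma rep_halted: "rep off pc k n c R \<Longrightarrow> R pc = num n \<longleftrightarrow> n \<le> fst c"
  unfolding rep_def by auto

text \<open>Every ordinal below a finite one is finite, so inferior limits of line indices, taken in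
  the natural numbers, agree with those of the register \<open>pc\<close>.\<close>

lemma is_lim_num:
  assumes "is_lim s t (\<lambda>u. {f u}) m"
  shows "is_lim s t (\<lambda>u. {num (f u)}) (num m)"
proof (rule is_limI)
  fix w assume "w < num m"
  then obtain w' where w: "w' < m" "w = num w'" using less_num_ex by blast
  from is_limD1[OF assms w(1)] obtain u where "s \<le> u" "u < t" "\<forall>r y. u \<le> r \<longrightarrow> r < t \<longrightarrow> y \<in> {f r} \<longrightarrow> w' < y"
    by blast
  then show "\<exists>u\<ge>s. u < t \<and> (\<forall>r. u \<le> r \<and> r < t \<longrightarrow> (\<forall>y\<in>{num (f r)}. w < y))"
    using w(2) by (intro exI[of _ u]) simp
next
  fix u assume "s \<le> u" "u < t"
  with assms obtain r y where "u \<le> r" "r < t" "y \<in> {f r}" "y \<le> m" by (rule is_limD2)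
  then show "\<exists>r y. u \<le> r \<and> r < t \<and> y \<in> {num (f r)} \<and> y \<le> num m" by auto
qed

end

text \<open>A simulation with a hook \<open>H\<close> before each step. Registers fall into three
  groups: those representing the configuration (\<open>pc\<close> and the block at
  \<open>off\<close>), the set \<open>X\<close> with the state of the hook, and all others, which
  are back at \<open>R0\<close> at every loop head. By \<open>rest\<close>, those of the third group
  with non-zero \<open>R0\<close> are never written; the others are 0 at cofinally many times and so
  have inferior limit 0. Only \<open>X\<close> needs a limit argument of its own,
  \<open>limX\<close>. \<open>E\<close> is an invariant of the hook state; \<open>G\<close> and
  \<open>W\<close> log what the hook and the queries did.\<close>

locale simulation_layout = exp_closed ty for ty :: "'a::wellorder itself" +
  fixes off pc kb st n k :: nat and P :: program and qc :: "nat \<Rightarrow> com" and H :: com and x z :: "'a set"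
    and X :: "nat set" and R0 :: "nat \<Rightarrow> 'a" and C :: "'a stage \<Rightarrow> 'a config option"
    and u1 u0 :: "'a stage" and E :: "'a stage \<Rightarrow> (nat \<Rightarrow> 'a) \<Rightarrow> bool"
    and G :: "'a stage \<Rightarrow> (nat \<Rightarrow> 'a) \<Rightarrow> (nat \<Rightarrow> 'a) set \<Rightarrow> (nat \<Rightarrow> 'a) \<Rightarrow> bool"
    and W :: "nat \<Rightarrow> (nat \<Rightarrow> 'a) \<Rightarrow> (nat \<Rightarrow> 'a) set \<Rightarrow> bool"
  assumes C: "traj P z C" and u10: "u1 \<le> u0" and Cdef: "C u0 \<noteq> None"
    and line: "\<And>u. u1 \<le> u \<Longrightarrow> u < u0 \<Longrightarrow> fst (the (C u)) < n"
    and P: "length P = n" "regs_below k P"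
    and pc: "pc \<notin> {off..<off+k}" and kbd: "{kb..kb+n} \<inter> insert pc {off..<off+k} = {}"
      "kb + 1 \<notin> insert pc {off..<off+k}"
    and Xd: "X \<inter> insert pc {off..<off+k} = {}" "X \<inter> {kb..kb+n} = {}" "kb + 1 \<notin> X"
    and st: "st \<notin> insert pc {off..<off+k}" "st \<notin> X"
    and kconsts: "kconsts kb n R0" "R0 (kb + 1) = ord_one" and R0st: "R0 st = ord_zero"
    and rep1: "rep off pc k n (the (C u1)) R0" and E1: "E u1 R0"
    and hook: "\<And>u R. u1 \<le> u \<Longrightarrow> u < u0 \<Longrightarrow> rep off pc k n (the (C u)) R \<Longrightarrow>
       (\<And>j. j \<notin> insert pc {off..<off+k} \<Longrightarrow> j \<notin> X \<Longrightarrow> R j = R0 j) \<Longrightarrow> E u R \<Longrightarrow>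
       \<exists>T R1. Exec H x R T R1 \<and> (\<forall>j. j \<notin> X \<longrightarrow> R1 j = R j) \<and> G u R T R1 \<and> E (ord_suc u) R1"
    and wcH: "\<And>i. i \<in> insert pc {off..<off+k} \<Longrightarrow> wc H i = 0"
    and qc: "\<And>R j. j < k \<Longrightarrow> (\<And>i. i \<notin> insert pc {off..<off+k} \<Longrightarrow> i \<notin> X \<Longrightarrow> R i = R0 i) \<Longrightarrow>
       \<exists>T. Exec (qc (off + j)) x R T (R(off + j := if R (off + j) \<in> z then ord_one else ord_zero)) \<and> W j R T"
    and wcq: "\<And>j i. j < k \<Longrightarrow> i \<in> insert pc {off..<off+k} \<union> X \<Longrightarrow>
       wc (qc (off + j)) i \<le> (if i = off + j then 1 else 0)"
    and rest: "\<And>i. i \<notin> insert pc {off..<off+k} \<Longrightarrow> i \<notin> X \<Longrightarrow> R0 i \<noteq> ord_zero \<Longrightarrow>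
       wc H i = 0 \<and> (\<forall>j<k. wc (qc (off + j)) i = 0)"
    and Econg: "\<And>u R R'. E u R \<Longrightarrow> (\<And>j. j \<in> X \<Longrightarrow> R j = R' j) \<Longrightarrow> E u R'"
    and Gcl: "\<And>u R T T' R1 R'. G u R T R1 \<Longrightarrow> T \<subseteq> T' \<Longrightarrow> (\<And>j. j \<in> X \<Longrightarrow> R' j = R1 j) \<Longrightarrow>
       (\<And>S. S \<in> T' \<Longrightarrow> (\<exists>S'\<in>insert R1 T. \<forall>j\<in>X. S j = S' j)) \<Longrightarrow> G u R T' R'"
    and limX: "\<And>l R T. is_limit l \<Longrightarrow> u1 < l \<Longrightarrow> l \<le> u0 \<Longrightarrow> R u1 = R0 \<Longrightarrow>
       (\<And>u. u1 \<le> u \<Longrightarrow> u < l \<Longrightarrow> rep off pc k n (the (C u)) (R u) \<and> E u (R u) \<and>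
          Exec (simbody off pc kb st qc H P) x (R u) (T u) (R (ord_suc u)) \<and> G u (R u) (T u) (R (ord_suc u))) \<Longrightarrow>
       (\<And>l' j. is_limit l' \<Longrightarrow> u1 < l' \<Longrightarrow> l' < l \<Longrightarrow> is_lim u1 l' (trc R T j) (R l' j)) \<Longrightarrow>
       \<exists>g. (\<forall>j\<in>X. is_lim u1 l (trc R T j) (g j)) \<and> (\<forall>R'. (\<forall>j\<in>X. R' j = g j) \<longrightarrow> E l R')"
begin

abbreviation "PP \<equiv> insert pc {off..<off+k}"
abbreviation "body \<equiv> simbody off pc kb st qc H P"

definition Inv :: "'a stage \<Rightarrow> (nat \<Rightarrow> 'a) \<Rightarrow> bool" where
  "Inv u R \<longleftrightarrow> rep off pc k n (the (C u)) R \<and> (\<forall>j. j \<notin> PP \<longrightarrow> j \<notin> X \<longrightarrow> R j = R0 j) \<and> E u R"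

text \<open>A query is answered after the hook has run, hence the intermediate contents
  \<open>R1\<close>.\<close>

definition Qs :: "'a stage \<Rightarrow> (nat \<Rightarrow> 'a) \<Rightarrow> (nat \<Rightarrow> 'a) set \<Rightarrow> (nat \<Rightarrow> 'a) \<Rightarrow> bool" where
  "Qs u R T R' \<longleftrightarrow> G u R T R' \<and> (\<forall>j. P ! fst (the (C u)) = Query j \<longrightarrow>
     (\<exists>Tq R1. Tq \<subseteq> T \<and> R1 (off + j) = snd (the (C u)) j \<and> (\<forall>i. i \<notin> PP \<longrightarrow> i \<notin> X \<longrightarrow> R1 i = R0 i) \<and> W j R1 Tq))"

lemma kb_in: "kb + 1 \<notin> PP \<union> X" "st \<notin> PP \<union> X" "i \<le> n \<Longrightarrow> kb + i \<notin> PP \<union> X"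
proof -
  show "kb + i \<notin> PP \<union> X" if "i \<le> n"
  proof -
    have "kb + i \<in> {kb..kb+n}" using that by simp
    then show ?thesis using kbd(1) Xd(2) by blast
  qed
qed (use kbd Xd st in blast)+

lemma body_wc:
  shows "i \<in> PP \<Longrightarrow> wc body i \<le> 1" "i \<in> X \<Longrightarrow> wc body i = wc H i"
proof -
  show "wc body i \<le> 1" if "i \<in> PP"
    by (rule simbody_wc(1)[where k = k, OF wcq pc P(2) wcH[OF that]]) (use that in auto)
  show "wc body i = wc H i" if "i \<in> X"
    by (rule simbody_wc(2)[where k = k, OF wcq pc P(2)]) (use that Xd(1) in auto)
qed

lemma sim_step:
  assumes u: "u1 \<le> u" "u < u0" and I: "Inv u R"
  shows "R pc \<noteq> R (kb + n) \<and> (\<exists>T R'. Exec body x R T R' \<and> Qs u R T R' \<and> Inv (ord_suc u) R')"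
proof
  have I': "rep off pc k n (the (C u)) R" "\<And>j. j \<notin> PP \<Longrightarrow> j \<notin> X \<Longrightarrow> R j = R0 j" "E u R"
    using I unfolding Inv_def by auto
  have lu: "fst (the (C u)) < n" by (rule line[OF u])
  have Rkb: "R (kb + l) = num l" if "l \<le> n" for l
    using I'(2)[of "kb + l"] kb_in(3)[OF that] kconsts(1) that unfolding kconsts_def by auto
  show "R pc \<noteq> R (kb + n)"
    using rep_halted[OF I'(1)] lu Rkb[of n] by simp
  obtain T R1 where T: "Exec H x R T R1" "\<And>j. j \<notin> X \<Longrightarrow> R1 j = R j" "G u R T R1" "E (ord_suc u) R1"
    using hook[OF u I'] by blast
  have rep': "rep off pc k n (the (C u)) R1"
    using I'(1) T(2) Xd unfolding rep_def by (metis (no_types, lifting) Int_iff atLeastLessThan_iff empty_iff insert_iff le_add1 nat_add_left_cancel_less)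
  have R1: "R1 j = R0 j" if "j \<notin> PP" "j \<notin> X" for j using T(2) I'(2) that by simp
  have kc: "kconsts kb n R1" "R1 (kb + 1) = ord_one" "R1 st = ord_zero"
    using R1 kb_in kconsts R0st unfolding kconsts_def by auto
  obtain T2 R' where R': "Exec (disp off pc kb qc n 0 P) x R1 T2 R'" "rep off pc k n (step P z (the (C u))) R'"
    "\<And>j. j \<notin> PP \<Longrightarrow> R' j = R1 j"
    "\<And>j. P ! fst (the (C u)) = Query j \<Longrightarrow> \<exists>Tq\<subseteq>T2. W j R1 Tq"
  proof -
    have "\<exists>T2 R'. Exec (disp off pc kb qc n 0 P) x R1 T2 R' \<and> rep off pc k n (step P z (the (C u))) R' \<and>
      (\<forall>j. j \<notin> PP \<longrightarrow> R' j = R1 j) \<and>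
      (\<forall>j. P ! fst (the (C u)) = Query j \<longrightarrow> (\<exists>Tq\<subseteq>T2. W j R1 Tq))"
      by (rule disp_exec[OF rep' lu P pc kbd(1) kc(1)]) (rule qc[OF _ R1])
    then show ?thesis using that by blast
  qed
  have "Exec (Cond st (kb + 1) (COPY (kb + n) pc) (disp off pc kb qc n 0 P)) x R1 (insert R1 (insert R' T2)) R'"
    by (rule Exec_Cond_False[OF R'(1)]) (use kc(2,3) one_neq_zero in auto)
  from Exec_Seq[OF T(1) this] have ex: "Exec body x R (T \<union> insert R1 (insert R' T2)) R'"
    unfolding simbody_def P(1) .
  have dX: "S j = R1 j" if "S \<in> T2" "j \<in> X" for S j
  proof -
    have "wc (disp off pc kb qc n 0 P) j = 0"
      by (rule disp_wc(2)[where k = k, OF wcq pc P(2)]) (use that(2) Xd in auto)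
    then show ?thesis using Exec_frame_trace[OF R'(1) _ that(1)] by blast
  qed
  have R'X: "R' j = R1 j" if "j \<in> X" for j
  proof -
    have "j \<notin> PP" using Xd(1) that by blast
    then show ?thesis by (rule R'(3))
  qed
  have "G u R (T \<union> insert R1 (insert R' T2)) R'"
  proof (rule Gcl[OF T(3)])
    fix S assume "S \<in> T \<union> insert R1 (insert R' T2)"
    then show "\<exists>S'\<in>insert R1 T. \<forall>j\<in>X. S j = S' j"
      using dX R'X by auto
  qed (use R'X in auto)
  moreover have "\<exists>Tq R1. Tq \<subseteq> T \<union> insert R1' (insert R' T2) \<and> R1 (off + j) = snd (the (C u)) j \<and>
      (\<forall>i. i \<notin> PP \<longrightarrow> i \<notin> X \<longrightarrow> R1 i = R0 i) \<and> W j R1 Tq" if q: "P ! fst (the (C u)) = Query j" for j R1'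
  proof -
    obtain Tq where "Tq \<subseteq> T2" "W j R1 Tq" using R'(4)[OF q] by blast
    moreover have "j < k" using P q lu unfolding regs_below_def by (metis insertI1 iregs.simps(4) nth_mem)
    then have "R1 (off + j) = snd (the (C u)) j" using rep' unfolding rep_def by simp
    ultimately show ?thesis using R1 by blast
  qed
  ultimately have Q: "Qs u R (T \<union> insert R1 (insert R' T2)) R'" unfolding Qs_def by blast
  have Cu: "C u \<noteq> None" using traj_defined[OF C Cdef u(2)] .
  then have "the (C (ord_suc u)) = step P z (the (C u))" using traj_suc[OF C, of u] by auto
  then have "Inv (ord_suc u) R'" unfolding Inv_def using R'(2,3) R1 R'X Econg[OF T(4), of R'] by auto
  with ex Q show "\<exists>T R'. Exec body x R T R' \<and> Qs u R T R' \<and> Inv (ord_suc u) R'" by blast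
qed

text \<open>Four cases: \<open>pc\<close> and the simulated registers are written at most once per
  round and follow the trajectory \<open>C\<close>; the registers in \<open>X\<close> are covered by
  \<open>limX\<close>; of the rest, those that are 0 at the heads have limit 0 whatever happens in
  between, and the others are constant.\<close>

lemma sim_limit:
  assumes l: "is_limit l" "u1 < l" "l \<le> u0" and Ru1: "R u1 = R0"
    and fam: "\<And>u. u1 \<le> u \<Longrightarrow> u < l \<Longrightarrow> Inv u (R u) \<and> Exec body x (R u) (T u) (R (ord_suc u)) \<and> Qs u (R u) (T u) (R (ord_suc u))"
    and lims: "\<And>l' j. is_limit l' \<Longrightarrow> u1 < l' \<Longrightarrow> l' < l \<Longrightarrow> is_lim u1 l' (trc R T j) (R l' j)"
  shows "\<exists>R'. Inv l R' \<and> (\<forall>j. is_lim u1 l (trc R T j) (R' j))"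
proof -
  have fam': "rep off pc k n (the (C u)) (R u)" "\<And>j. j \<notin> PP \<Longrightarrow> j \<notin> X \<Longrightarrow> R u j = R0 j"
    "E u (R u)" "Exec body x (R u) (T u) (R (ord_suc u))" "G u (R u) (T u) (R (ord_suc u))"
    if "u1 \<le> u" "u < l" for u
    using fam[OF that] unfolding Inv_def Qs_def by auto
  have "\<exists>g. (\<forall>j\<in>X. is_lim u1 l (trc R T j) (g j)) \<and> (\<forall>R'. (\<forall>j\<in>X. R' j = g j) \<longrightarrow> E l R')"
    by (rule limX[where R = R and T = T, OF l Ru1 _ lims]) (use fam' in auto)
  then obtain g where g: "\<And>j. j \<in> X \<Longrightarrow> is_lim u1 l (trc R T j) (g j)"
    "\<And>R'. (\<And>j. j \<in> X \<Longrightarrow> R' j = g j) \<Longrightarrow> E l R'" by blast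
  have "C l \<noteq> None" using traj_defined[OF C Cdef, of l] Cdef l(3) by (auto simp: order_le_less)
  then obtain c where c: "C l = Some c" by blast
  have ln: "fst (the (C u)) \<le> n - 1" "fst (the (C u)) < n" if "u1 \<le> u" "u < l" for u
  proof -
    have "u < u0" using that l(3) by simp
    then show "fst (the (C u)) < n" using line[OF that(1)] by simp
    then show "fst (the (C u)) \<le> n - 1" by simp
  qed
  note CD = traj_limitD[OF C l(1,2) c ln(1)]
  have fc: "fst c < n"
  proof -
    have "fst c \<le> n - 1" by (rule is_lim_le[OF CD(1)]) (use ln(1) in auto)
    then show ?thesis using ln(2)[of u1] l by auto
  qed
  define R' where "R' j = (if j = pc then num (fst c) else if j \<in> {off..<off+k} then snd c (j - off)
    else if j \<in> X then g j else R0 j)" for j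
  have lim: "is_lim u1 l (trc R T j) (R' j)" for j
  proof -
    consider "j = pc" | "j \<noteq> pc" "j \<in> {off..<off+k}" | "j \<notin> PP" "j \<in> X" | "j \<notin> PP" "j \<notin> X" by auto
    then show ?thesis
    proof cases
      case 1
      have w: "wc body j \<le> 1" using body_wc(1)[of j] 1 by simp
      have "is_lim u1 l (\<lambda>u. {R u j}) (num (fst c)) \<longleftrightarrow> is_lim u1 l (\<lambda>u. {num (fst (the (C u)))}) (num (fst c))"
        by (rule is_lim_cong) (use fam'(1) less_imp_le[OF ln(2)] 1 in \<open>simp add: rep_def min_absorb1\<close>)
      then show ?thesis using trc_two_valued[where R = R and T = T and ?u1.0 = u1 and c = body and x = x, OF l(1) fam'(4) w] is_lim_num[OF CD(1)] 1 by (simp add: R'_def)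
    next
      case 2
      have w: "wc body j \<le> 1" using body_wc(1)[of j] 2 by simp
      have "R u j = snd (the (C u)) (j - off)" if "u1 \<le> u" "u < l" for u
        using fam'(1)[OF that] 2 unfolding rep_def by (metis add_diff_inverse_nat atLeastLessThan_iff nat_add_left_cancel_less not_le)
      then have "is_lim u1 l (\<lambda>u. {R u j}) (snd c (j - off)) \<longleftrightarrow> is_lim u1 l (\<lambda>u. {snd (the (C u)) (j - off)}) (snd c (j - off))"
        by (intro is_lim_cong) auto
      then show ?thesis using trc_two_valued[where R = R and T = T and ?u1.0 = u1 and c = body and x = x, OF l(1) fam'(4) w] CD(2)[of "j - off"] 2 by (simp add: R'_def)
    next
      case 3
      then have "R' j = g j" by (auto simp: R'_def)
      then show ?thesis using g(1) 3 by simp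
    next
      case 4
      have Rj: "R u j = R0 j" if "u1 \<le> u" "u < l" for u using fam'(2)[OF that 4] .
      have "is_lim u1 l (trc R T j) (R0 j)"
      proof (cases "R0 j = ord_zero")
        case True
        then show ?thesis using trc_zero[of u1 l R j T] Rj by simp
      next
        case False
        then have r: "wc H j = 0" "\<And>i. i < k \<Longrightarrow> wc (qc (off + i)) j = 0" using rest[OF 4 False] by auto
        have "wc body j = 0"
          using simbody_wc(2)[where k = k and qc = qc and off = off and i = j and pc = pc and P = P and H = H and kb = kb and st = st,
            OF _ pc P(2) 4(1)] r by auto
        then show ?thesis using trc_const[OF l(2), of body x R T j] fam'(4) Rj by simp
      qed
      moreover have "R' j = R0 j" using 4 by (auto simp: R'_def)
      ultimately show ?thesis by simp
    qed
  qed
  have "E l R'" by (rule g(2)) (use Xd in \<open>auto simp: R'_def\<close>)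
  moreover have "rep off pc k n (the (C l)) R'"
    unfolding rep_def c using fc pc by (auto simp: R'_def min_def)
  ultimately have "Inv l R'" unfolding Inv_def by (auto simp: R'_def)
  with lim show ?thesis by blast
qed

theorem sim_iter:
  "\<exists>R T. R u1 = R0 \<and> (\<forall>u. u1 \<le> u \<longrightarrow> u \<le> u0 \<longrightarrow> Inv u (R u)) \<and>
    (\<forall>u. u1 \<le> u \<longrightarrow> u < u0 \<longrightarrow> Exec body x (R u) (T u) (R (ord_suc u)) \<and> Qs u (R u) (T u) (R (ord_suc u))) \<and>
    (\<forall>l j. is_limit l \<longrightarrow> u1 < l \<longrightarrow> l \<le> u0 \<longrightarrow> is_lim u1 l (trc R T j) (R l j)) \<and>
    Iter pc (kb + n) body x R0 (\<Union>u\<in>{u1..<u0}. insert (R u) (insert (R (ord_suc u)) (T u))) (R u0)"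
proof (rule Iter_inv[OF u10])
  show "Inv u1 R0" unfolding Inv_def using rep1 E1 by simp
qed (use sim_step sim_limit in blast)+

end

section \<open>Leaving the simulation loop\<close>

context exp_closed begin

lemma sim_halt:
  assumes "Iter pc (kb + n) (simbody off pc kb st qc H P) x R0 K R" "length P = n" "R pc = R (kb + n)"
  shows "Exec (simcom off pc kb st qc H P) x R0 (insert R K) R"
  using Exec_Loop[OF assms(1,3)] assms(2) unfolding simcom_def by simp

text \<open>When the hook raises the flag in \<open>st\<close>, the round writes the exit line to
  \<open>pc\<close> instead of executing an instruction, so the simulated configuration at which the
  hook struck is not left any more.\<close>

lemma sim_stop:
  assumes I: "Iter pc (kb + n) (simbody off pc kb st qc H P) x R0 K R" and n: "length P = n"
    and neq: "R pc \<noteq> R (kb + n)" and H: "Exec H x R T R1" and s: "R1 st = R1 (kb + 1)"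
    and d: "kb + n \<noteq> pc"
  shows "\<exists>K'. K \<subseteq> K' \<and> Exec (simcom off pc kb st qc H P) x R0 K' (R1(pc := R1 (kb + n)))"
proof -
  let ?R = "R1(pc := R1 (kb + n))"
  have "Exec (Cond st (kb + 1) (COPY (kb + n) pc) (disp off pc kb qc n 0 P)) x R1 (insert R1 {R1}) ?R"
    by (rule Exec_Cond_True[OF Exec_COPY s])
  from Exec_Seq[OF H this] have "Exec (simbody off pc kb st qc H P) x R (T \<union> insert R1 {R1}) ?R"
    unfolding simbody_def n .
  note L = Exec_Loop[OF Iter_step[OF I this neq]]
  have "?R pc = ?R (kb + n)" using d by simp
  from L[OF this] show ?thesis unfolding simcom_def n
    by (intro exI[of _ "insert ?R (K \<union> insert R (insert ?R (T \<union> insert R1 {R1})))"] conjI) auto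
qed

end

section \<open>Program fragments\<close>

fun mkconsts :: "nat \<Rightarrow> nat \<Rightarrow> com" where
  "mkconsts kb 0 = SKIP"
| "mkconsts kb (Suc N) = mkconsts kb N ;; COPY (kb + N) (kb + Suc N) ;; INC (kb + Suc N)"

fun copy_block :: "nat \<Rightarrow> nat \<Rightarrow> nat \<Rightarrow> com" where
  "copy_block a b 0 = SKIP"
| "copy_block a b (Suc m) = copy_block a b m ;; COPY (a + m) (b + m)"

fun fill_block :: "nat \<Rightarrow> nat \<Rightarrow> nat \<Rightarrow> com" where
  "fill_block z b 0 = SKIP"
| "fill_block z b (Suc m) = fill_block z b m ;; COPY z (b + m)"

lemma copy_block_wc: "wc (copy_block a b m) j = (if j \<in> {b..<b+m} then 1 else 0)"
  by (induction m) auto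

lemma fill_block_wc: "wc (fill_block z b m) j = (if j \<in> {b..<b+m} then 1 else 0)"
  by (induction m) auto

context exp_closed begin

lemma Exec_ex: "Exec c x R T R1 \<Longrightarrow> R1 = R' \<Longrightarrow> \<exists>T. Exec c x R T R'"
  by blast

lemma Exec_mkconsts:
  assumes "R kb = ord_zero"
  shows "\<exists>T. Exec (mkconsts kb N) x R T (\<lambda>j. if j \<in> {kb..kb+N} then num (j - kb) else R j)"
proof (induction N)
  case 0
  have "(\<lambda>j. if j \<in> {kb..kb+0} then num (j - kb) else R j) = R" using assms by (auto simp: num_0)
  then show ?case using Exec_SKIP by auto
next
  case (Suc N)
  let ?R = "\<lambda>N j. if j \<in> {kb..kb+N} then num (j - kb) else R j"
  from Suc obtain T where T: "Exec (mkconsts kb N) x R T (?R N)" by blast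
  show ?case unfolding mkconsts.simps
    by (rule Exec_ex[OF Exec_Seq[OF T Exec_Seq[OF Exec_COPY Exec_INC]]])
      (auto simp: fun_eq_iff num_Suc[symmetric] Suc_diff_le)
qed

lemma Exec_copy_block:
  assumes "{a..<a+m} \<inter> {b..<b+m} = {}"
  shows "\<exists>T. Exec (copy_block a b m) x R T (\<lambda>j. if j \<in> {b..<b+m} then R (a + (j - b)) else R j)"
  using assms
proof (induction m)
  case 0
  then show ?case using Exec_SKIP by auto
next
  case (Suc m)
  let ?R = "\<lambda>m j. if j \<in> {b..<b+m} then R (a + (j - b)) else R j"
  have "{a..<a+m} \<inter> {b..<b+m} = {}" using Suc.prems by auto
  with Suc.IH obtain T where T: "Exec (copy_block a b m) x R T (?R m)" by blast
  have "a + m \<in> {a..<a+Suc m}" by simp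
  then have "a + m \<notin> {b..<b+m}" using Suc.prems by auto
  then show ?case unfolding copy_block.simps
    by (intro Exec_ex[OF Exec_Seq[OF T Exec_COPY]]) (auto simp: fun_eq_iff)
qed

lemma Exec_fill_block:
  assumes "z \<notin> {b..<b+m}"
  shows "\<exists>T. Exec (fill_block z b m) x R T (\<lambda>j. if j \<in> {b..<b+m} then R z else R j)"
  using assms
proof (induction m)
  case 0
  then show ?case using Exec_SKIP by auto
next
  case (Suc m)
  let ?R = "\<lambda>m j. if j \<in> {b..<b+m} then R z else R j"
  from Suc obtain T where T: "Exec (fill_block z b m) x R T (?R m)" by auto
  show ?case unfolding fill_block.simps
    by (rule Exec_ex[OF Exec_Seq[OF T Exec_COPY]]) (use Suc.prems in \<open>auto simp: fun_eq_iff\<close>)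
qed

section \<open>Whole programs\<close>

lemma run_zero: "run P x xs (ord_zero :: 'a stage) = Some (init_config xs)"
  by (rule run_start) simp

lemma run_code:
  assumes "Exec c x (snd (init_config xs)) T R"
  shows "halts_with (code 0 c) x xs (R 0)"
    and "S \<in> T \<Longrightarrow> \<exists>(t :: 'a stage) l. run (code 0 c) x xs t = Some (l, S) \<and> l < length (code 0 c)"
proof -
  let ?P = "code 0 c" let ?D = "run ?P x xs :: 'a stage \<Rightarrow> _"
  have D0: "?D ord_zero = Some (0, snd (init_config xs))"
    unfolding run_zero init_config_def by simp
  have "\<exists>s'. ?D s' = Some (0 + clen c, R) \<and> path ?D 0 (0 + clen c) ord_zero s' T"
    by (rule Exec_code[where pre = "[]" and post = "[]", OF assms traj_run]) (use D0 in auto)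
  then obtain s' where s': "?D s' = Some (clen c, R)" "path ?D 0 (clen c) ord_zero s' T" by auto
  show "halts_with ?P x xs (R 0)"
    unfolding halts_with_def using s'(1) by (intro exI[of _ s'] exI[of _ "(clen c, R)"]) (simp add: halted_def)
  assume "S \<in> T"
  then obtain r l where r: "r < s'" "?D r = Some (l, S)" using s'(2) unfolding path_def by blast
  then obtain l' S' where "?D r = Some (l', S')" "l' < clen c" using s'(2) unfolding path_def by force
  with r show "\<exists>(t :: 'a stage) l. run ?P x xs t = Some (l, S) \<and> l < length ?P" by auto
qed

lemma halts_with_first:
  fixes x :: "'a set"
  assumes "halts_with P x xs v"
  obtains u :: "'a stage" and c where "run P x xs u = Some c" "halted P c" "snd c 0 = v"
    "\<And>s. s < u \<Longrightarrow> fst (the (run P x xs s)) < length P"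
proof -
  from assms obtain t :: "'a stage" and c where t: "run P x xs t = Some c" "halted P c" "snd c 0 = v"
    unfolding halts_with_def by blast
  define u where "u = (LEAST u :: 'a stage. \<exists>c. run P x xs u = Some c \<and> halted P c)"
  have "\<exists>c. run P x xs u = Some c \<and> halted P c"
    unfolding u_def by (rule LeastI[of _ t]) (use t in blast)
  then obtain c' where c': "run P x xs u = Some c'" "halted P c'" by blast
  have "u \<le> t" unfolding u_def by (rule Least_le) (use t in blast)
  then have "c' = c" using traj_halted[OF traj_run c'] t(1) by simp
  moreover have "fst (the (run P x xs s)) < length P" if "s < u" for s
  proof -
    have "run P x xs s \<noteq> None" by (rule traj_defined[OF traj_run _ that]) (use c' in simp)
    then obtain d where d: "run P x xs s = Some d" by blast
    moreover have "\<not> halted P d" using not_less_Least[OF that[unfolded u_def]] d by blast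
    ultimately show ?thesis by (simp add: halted_def)
  qed
  ultimately show ?thesis using that[of u c] c' t by blast
qed

lemma halts_with_unique: "halts_with P (x :: 'a set) xs v \<Longrightarrow> halts_with P x xs w \<Longrightarrow> v = w"
proof -
  assume "halts_with P x xs v" "halts_with P x xs w"
  then obtain s t :: "'a stage" and c d where st: "run P x xs s = Some c" "halted P c" "snd c 0 = v"
    "run P x xs t = Some d" "halted P d" "snd d 0 = w" unfolding halts_with_def by blast
  then have "c = d" using traj_halted[OF traj_run st(1,2), of t] traj_halted[OF traj_run st(4,5), of s]
    by (cases "s \<le> t") auto
  with st show "v = w" by simp
qed

section \<open>Coding several parameters into one\<close>

lemma wo_rec_ex:
  fixes F :: "('t::wellorder \<Rightarrow> 'b) \<Rightarrow> 't \<Rightarrow> 'b"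
  assumes "\<And>f g u. (\<And>v. v < u \<Longrightarrow> f v = g v) \<Longrightarrow> F f u = F g u"
  shows "\<exists>f. \<forall>u. f u = F f u"
proof -
  have w: "wf {(v :: 't, w). v < w}" by (rule wf)
  define f where "f = wfrec {(v, w). v < w} F"
  have "f u = F f u" for u
  proof -
    have "f u = F (cut f {(v, w). v < w} u) u" unfolding f_def by (rule wfrec[OF w])
    also have "\<dots> = F f u" by (rule assms) (simp add: cut_def)
    finally show ?thesis .
  qed
  then show ?thesis by blast
qed

text \<open>\<open>w\<close> never decreases, so at a limit \<open>l\<close> either
  \<open>w l\<close> has grown beyond \<open>w u\<close>, or \<open>w\<close> is constant from
  \<open>u\<close> to \<open>l\<close>. In the second case \<open>c\<close> increases throughout and
  its inferior limit exceeds \<open>c u\<close>.\<close>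

lemma lex_increasing:
  fixes w c :: "'a stage \<Rightarrow> 'a"
  assumes step: "\<And>u. s \<le> u \<Longrightarrow> ord_suc u < t \<Longrightarrow> w (ord_suc u) = w u \<and> c (ord_suc u) = ord_suc (c u) \<or> w u < w (ord_suc u)"
    and lim: "\<And>l. is_limit l \<Longrightarrow> s < l \<Longrightarrow> l < t \<Longrightarrow> is_lim s l (\<lambda>u. {w u}) (w l) \<and> is_lim s l (\<lambda>u. {c u}) (c l)"
    and u: "s \<le> u" "u < u'" "u' < t"
  shows "lexl (w u, c u) (w u', c u')"
proof -
  have trans: "lexl p q \<Longrightarrow> lexl q r \<Longrightarrow> lexl p r" for p q r :: "'a \<times> 'a"
    unfolding lexl_def by auto
  have "u' < t \<longrightarrow> (\<forall>u. s \<le> u \<longrightarrow> u < u' \<longrightarrow> lexl (w u, c u) (w u', c u'))" if "s \<le> u'" for u'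
    using that
  proof (induction u' rule: stage_interval_induct)
    case (suc v)
    show ?case
    proof (intro impI allI)
      fix u assume a: "ord_suc v < t" "s \<le> u" "u < ord_suc v"
      have one: "lexl (w v, c v) (w (ord_suc v), c (ord_suc v))"
        using step[OF suc.hyps a(1)] unfolding lexl_def by auto
      have "v < t" using a(1) by (rule less_trans[OF stage_suc_gt])
      then show "lexl (w u, c u) (w (ord_suc v), c (ord_suc v))"
        using suc.IH a one trans[OF _ one] by (auto simp: stage_less_suc_iff order_le_less)
    qed
  next
    case (limit l)
    show ?case
    proof (intro impI allI)
      fix u assume a: "l < t" "s \<le> u" "u < l"
      have IH: "lexl (w v, c v) (w v', c v')" if "s \<le> v" "v < v'" "v' < l" for v v'
        using limit(3)[of v'] that a(1) by auto
      have L: "is_lim s l (\<lambda>u. {w u}) (w l)" "is_lim s l (\<lambda>u. {c u}) (c l)"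
        using lim[OF limit(1,2) a(1)] by auto
      have mono: "w v \<le> w v'" if "s \<le> v" "v \<le> v'" "v' < l" for v v'
        using IH[OF that(1) _ that(3)] that(2) unfolding lexl_def by (auto simp: order_le_less)
      have ge: "w v \<le> w l" if v: "s \<le> v" "v < l" for v
        by (rule is_lim_ge[OF L(1) v]) (use mono v in auto)
      have su: "s \<le> ord_suc u" "ord_suc u < l" using a is_limit_suc[OF limit(1)] by (auto intro: stage_le_suc)
      show "lexl (w u, c u) (w l, c l)"
      proof (cases "w u = w l")
        case True
        have eq: "w v = w u" if "u \<le> v" "v < l" for v
          using mono[OF a(2) that] ge[of v] a that True by (auto intro: antisym)
        have cm: "c (ord_suc u) \<le> c v" if "ord_suc u \<le> v" "v < l" for v
        proof (cases "v = ord_suc u")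
          case False
          then have "ord_suc u < v" using that by simp
          moreover have "u \<le> v" using that by (meson less_imp_le order_trans stage_suc_gt)
          ultimately show ?thesis using IH[OF su(1) _ that(2)] eq[of v] eq[of "ord_suc u"] su that
            unfolding lexl_def by (auto simp: stage_le_suc)
        qed simp
        have "c u < c (ord_suc u)" using IH[OF a(2) stage_suc_gt su(2)] eq[of "ord_suc u"] su
          unfolding lexl_def by (auto simp: stage_le_suc)
        also have "c (ord_suc u) \<le> c l" by (rule is_lim_ge[OF L(2) su]) (use cm in auto)
        finally show ?thesis using True by (simp add: lexl_def)
      next
        case False
        then show ?thesis using ge[OF a(2,3)] by (simp add: lexl_def)
      qed
    qed
  qed (meson leD)
  with u show ?thesis by simp
qed

text \<open>Keeping the second component at most the first makes every row finish, by an equality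
  test that a program can carry out.\<close>

definition next_pair :: "'a \<times> 'a \<Rightarrow> 'a \<times> 'a" where
  "next_pair p = (if snd p = fst p then (ord_suc (fst p), ord_zero) else (fst p, ord_suc (snd p)))"

text \<open>By \<open>no_lex\<close>, the lexicographic enumeration of the pairs \<open>(a, b)\<close> with \<open>b \<le> a\<close> reaches each of
  them before \<open>\<alpha>\<close>.\<close>
lemma pair_enumeration:
  obtains g :: "'a stage \<Rightarrow> 'a \<times> 'a" where
    "g ord_zero = (ord_zero, ord_zero)" "\<And>u. g (ord_suc u) = next_pair (g u)"
    "\<And>l. is_limit l \<Longrightarrow> l < top_stage \<Longrightarrow>
       is_lim ord_zero l (\<lambda>u. {fst (g u)}) (fst (g l)) \<and> is_lim ord_zero l (\<lambda>u. {snd (g u)}) (snd (g l))"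
    "\<And>a b. b \<le> a \<Longrightarrow> \<exists>v. g (stg v) = (a, b)"
proof -
  define F where "F = (\<lambda>(f :: 'a stage \<Rightarrow> 'a \<times> 'a) u. if is_limit u
     then (SOME v. is_lim ord_zero u (\<lambda>u. {fst (f u)}) v, SOME v. is_lim ord_zero u (\<lambda>u. {snd (f u)}) v)
     else if \<exists>v. u = ord_suc v then next_pair (f (THE v. u = ord_suc v)) else (ord_zero, ord_zero))"
  have "\<exists>g. \<forall>u. g u = F g u"
  proof (rule wo_rec_ex)
    fix f g :: "'a stage \<Rightarrow> 'a \<times> 'a" and u assume fg: "\<And>v. v < u \<Longrightarrow> f v = g v"
    have "is_lim ord_zero u (\<lambda>u. {h (f u)}) = is_lim ord_zero u (\<lambda>u. {h (g u)})" for h :: "'a \<times> 'a \<Rightarrow> 'a"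
      by (intro ext is_lim_cong) (use fg in simp)
    moreover have "f (THE v. u = ord_suc v) = g (THE v. u = ord_suc v)" if "\<exists>v. u = ord_suc v"
    proof -
      from that obtain v where v: "u = ord_suc v" by blast
      then have "(THE v. u = ord_suc v) = v" by (intro the_equality) auto
      then show ?thesis using fg v by simp
    qed
    ultimately show "F f u = F g u" unfolding F_def by auto
  qed
  then obtain g where g: "\<And>u. g u = F g u" by blast
  have z: "g ord_zero = (ord_zero, ord_zero)"
  proof -
    have "\<not> is_limit (ord_zero :: 'a stage)" unfolding is_limit_def by simp
    moreover have "\<nexists>v. (ord_zero :: 'a stage) = ord_suc v" by (metis not_less_ord_zero stage_suc_gt)
    ultimately show ?thesis unfolding g[of ord_zero] F_def by simp
  qed
  have s: "g (ord_suc u) = next_pair (g u)" for u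
  proof -
    have "(THE v. ord_suc u = ord_suc v) = u" by (intro the_equality) auto
    then show ?thesis unfolding g[of "ord_suc u"] F_def by auto
  qed
  have lz: "(ord_zero :: 'a stage) < l" if "is_limit l" for l
    using that unfolding is_limit_def by (metis neq_ord_zero_iff not_less_ord_zero)
  \<comment> \<open>Both components are bounded by the time index, so they cannot overflow before
    \<alpha> and the limits picked by \<open>SOME\<close> exist.\<close>
  have bd: "u < top_stage \<longrightarrow> stg (fst (g u)) \<le> u \<and> stg (snd (g u)) \<le> u \<and>
     (is_limit u \<longrightarrow> is_lim ord_zero u (\<lambda>u. {fst (g u)}) (fst (g u)) \<and> is_lim ord_zero u (\<lambda>u. {snd (g u)}) (snd (g u)))"
    for u
  proof -
    have "ord_zero \<le> u" by simp
    then show ?thesis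
    proof (induction u rule: stage_interval_induct)
      case start
      show ?case using z stg_zero by (simp add: is_limit_def)
    next
      case (suc u)
      show ?case
      proof
        assume "ord_suc u < top_stage"
        then have "u < top_stage" by (rule less_trans[OF stage_suc_gt])
        with suc.IH have IH: "stg (fst (g u)) \<le> u" "stg (snd (g u)) \<le> u" by auto
        have "ord_suc a \<le> ord_suc u" if "a \<le> u" for a using that by (simp add: stage_suc_le_iff stage_less_suc_iff)
        with IH show "stg (fst (g (ord_suc u))) \<le> ord_suc u \<and> stg (snd (g (ord_suc u))) \<le> ord_suc u \<and>
          (is_limit (ord_suc u) \<longrightarrow> is_lim ord_zero (ord_suc u) (\<lambda>u. {fst (g u)}) (fst (g (ord_suc u))) \<and>
           is_lim ord_zero (ord_suc u) (\<lambda>u. {snd (g u)}) (snd (g (ord_suc u))))"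
          unfolding s next_pair_def by (auto simp: stg_suc stg_zero stage_le_suc)
      qed
    next
      case (limit l)
      show ?case
      proof
        assume l: "l < top_stage"
        then obtain b where b: "l = stg b" using less_top_ex by blast
        have ex: "\<exists>v\<le>b. is_lim ord_zero l (\<lambda>u. {h (g u)}) v" if h: "h = fst \<or> h = snd" for h :: "'a \<times> 'a \<Rightarrow> 'a"
        proof (rule is_lim_ex)
          fix u assume u: "ord_zero \<le> u" "u < l"
          then have "stg (h (g u)) \<le> u" using limit(3)[of u] l h by auto
          then have "h (g u) \<le> b" using u(2) b by (metis less_imp_le order_trans stg_le_iff)
          then show "\<exists>r y. u \<le> r \<and> r < l \<and> y \<in> {h (g r)} \<and> y \<le> b" using u(2) by blast
        qed
        obtain v1 where v1: "v1 \<le> b" "is_lim ord_zero l (\<lambda>u. {fst (g u)}) v1" using ex[of fst] by blast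
        obtain v2 where v2: "v2 \<le> b" "is_lim ord_zero l (\<lambda>u. {snd (g u)}) v2" using ex[of snd] by blast
        have "(SOME v. is_lim ord_zero l (\<lambda>u. {fst (g u)}) v) = v1"
          using v1(2) is_lim_unique by (intro some_equality) blast+
        moreover have "(SOME v. is_lim ord_zero l (\<lambda>u. {snd (g u)}) v) = v2"
          using v2(2) is_lim_unique by (intro some_equality) blast+
        ultimately have "g l = (v1, v2)" unfolding g[of l] F_def using limit(1) by simp
        then show "stg (fst (g l)) \<le> l \<and> stg (snd (g l)) \<le> l \<and>
          (is_limit l \<longrightarrow> is_lim ord_zero l (\<lambda>u. {fst (g u)}) (fst (g l)) \<and> is_lim ord_zero l (\<lambda>u. {snd (g u)}) (snd (g l)))"
          using v1 v2 b by simp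
      qed
    qed
  qed
  have lim: "is_lim ord_zero l (\<lambda>u. {fst (g u)}) (fst (g l)) \<and> is_lim ord_zero l (\<lambda>u. {snd (g u)}) (snd (g l))"
    if "is_limit l" "l < top_stage" for l using bd[of l] that by blast
  have lex: "lexl (g u) (g u')" if "u < u'" "u' < top_stage" for u u'
  proof -
    have "lexl (fst (g u), snd (g u)) (fst (g u'), snd (g u'))"
      by (rule lex_increasing[where s = ord_zero, OF _ lim _ that]) (auto simp: s next_pair_def)
    then show ?thesis by simp
  qed
  have "\<exists>v. g (stg v) = (a, b)" if ab: "b \<le> a" for a b
  proof (rule ccontr)
    assume n: "\<nexists>v. g (stg v) = (a, b)"
    have nt: "g u \<noteq> (a, b)" if "u < top_stage" for u using n less_top_ex[OF that] by blast
    \<comment> \<open>A missed pair would never be overtaken: the enumeration moves to the immediate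
      successor, and its limits do not jump. It would then stay in a bounded square for \<alpha>
      many steps, against \<open>no_lex\<close>.\<close>
    have below: "u < top_stage \<longrightarrow> lexl (g u) (a, b)" for u
    proof -
      have "ord_zero \<le> u" by simp
      then show ?thesis
      proof (induction u rule: stage_interval_induct)
        case start
        show ?case using nt[of ord_zero] z by (auto simp: lexl_def neq_ord_zero_iff[symmetric])
      next
        case (suc u)
        show ?case
        proof
          assume lt: "ord_suc u < top_stage"
          then have "u < top_stage" by (rule less_trans[OF stage_suc_gt])
          with suc.IH have IH: "lexl (g u) (a, b)" by simp
          have "g (ord_suc u) \<noteq> (a, b)" by (rule nt[OF lt])
          obtain p q where pq: "g u = (p, q)" by (cases "g u")
          show "lexl (g (ord_suc u)) (a, b)"
          proof (cases "p < a")
            case True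
            then have "ord_suc p \<le> a" by (simp add: ord_suc_le_iff)
            then show ?thesis using \<open>g (ord_suc u) \<noteq> (a, b)\<close> True unfolding s pq next_pair_def lexl_def
              by (auto simp: order_le_less neq_ord_zero_iff[symmetric])
          next
            case False
            then have "p = a" "q < b" using IH unfolding pq lexl_def by auto
            moreover from this have "ord_suc q \<le> b" by (simp add: ord_suc_le_iff)
            ultimately show ?thesis using \<open>g (ord_suc u) \<noteq> (a, b)\<close> ab unfolding s pq next_pair_def lexl_def
              by (auto simp: order_le_less)
          qed
        qed
      next
        case (limit l)
        show ?case
        proof
          assume l: "l < top_stage"
          have IH: "lexl (g u) (a, b)" if "u < l" for u using limit(3)[of u] that l by simp
          have L: "is_lim ord_zero l (\<lambda>u. {fst (g u)}) (fst (g l))" "is_lim ord_zero l (\<lambda>u. {snd (g u)}) (snd (g l))"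
            using lim[OF limit(1) l] by auto
          have fa: "fst (g l) \<le> a"
            by (rule is_lim_le[OF L(1)]) (use IH in \<open>auto simp: lexl_def intro: less_imp_le\<close>)
          have "snd (g l) \<le> b" if eq: "fst (g l) = a"
          proof (cases "\<exists>u<l. fst (g u) = a")
            case True
            then obtain u where u: "u < l" "fst (g u) = a" by blast
            have "snd (g v) \<le> b" if v: "u \<le> v" "v < l" for v
            proof -
              have "fst (g u) \<le> fst (g v)" using lex[of u v] v l unfolding lexl_def by (auto simp: order_le_less)
              then show ?thesis using IH[OF v(2)] u by (auto simp: lexl_def intro: less_imp_le)
            qed
            then show ?thesis
              by (intro is_lim_le[OF is_lim_tail[OF L(2) limit(2) u(1)]]) auto
          next
            case False
            \<comment> \<open>If row \<open>a\<close> is only reached at \<open>l\<close> itself,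
              rows change cofinally often below \<open>l\<close>, and each new row starts with
              second component 0.\<close>
            have cof: "\<exists>v. u \<le> v \<and> v < l \<and> snd (g v) = ord_zero" if u: "u < l" for u
            proof (rule ccontr)
              assume no: "\<nexists>v. u \<le> v \<and> v < l \<and> snd (g v) = ord_zero"
              have const: "v < l \<longrightarrow> fst (g v) = fst (g u)" if "u \<le> v" for v
                using that
              proof (induction v rule: stage_interval_induct)
                case (suc v)
                have sv: "u \<le> ord_suc v" using suc.hyps by (rule stage_le_suc)
                have "v < l" if "ord_suc v < l" by (rule less_trans[OF stage_suc_gt that])
                moreover have "snd (g (ord_suc v)) \<noteq> ord_zero" if "ord_suc v < l" using no sv that by blast
                ultimately show ?case using suc.IH unfolding s next_pair_def by (auto split: if_splits)
              next
                case (limit m)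
                show ?case
                proof
                  assume m: "m < l"
                  have "is_lim ord_zero m (\<lambda>u. {fst (g u)}) (fst (g m))" using lim[OF limit(1)] m l by simp
                  then have "is_lim u m (\<lambda>u. {fst (g u)}) (fst (g m))"
                    by (rule is_lim_tail[OF _ lz[OF limit(1)] limit(2)])
                  moreover have "is_lim u m (\<lambda>u. {fst (g u)}) (fst (g u))"
                    
                  proof (rule is_lim_const[OF limit(2)])
                    fix r assume r: "u \<le> r" "r < m"
                    have "r < l" using r(2) m by (rule less_trans)
                    then show "{fst (g r)} = {fst (g u)}" using limit(3)[OF r] by blast
                  qed
                  ultimately show "fst (g m) = fst (g u)" by (rule is_lim_unique)
                qed
              qed simp
              have "is_lim u l (\<lambda>u. {fst (g u)}) (fst (g u))" 
              proof (rule is_lim_const[OF u])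
                fix r assume r: "u \<le> r" "r < l"
                then show "{fst (g r)} = {fst (g u)}" using const[OF r(1)] by blast
              qed
              then have "fst (g u) = fst (g l)"
                using is_lim_tail[OF L(1) limit(2) u] by (rule is_lim_unique)
              then show False using False u eq by auto
            qed
            have "is_lim ord_zero l (\<lambda>u. {snd (g u)}) ord_zero" by (rule is_lim_zero) (use cof in \<open>metis insertI1\<close>)
            then show ?thesis using is_lim_unique[OF L(2)] by simp
          qed
          then show "lexl (g l) (a, b)" using fa nt[OF l] unfolding lexl_def
            by (metis fst_conv order_le_less prod.collapse snd_conv)
        qed
      qed
    qed
    obtain B where B: "a < B" "ord_suc a < B" using no_max[of "ord_suc a"] by (meson less_trans ord_suc_gt)
    have le: "fst (g u) < B \<and> snd (g u) < B" if "u < top_stage" for u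
    proof -
      have f: "fst (g u) \<le> a" using below[of u] that by (auto simp: lexl_def intro: less_imp_le)
      have "u < top_stage \<longrightarrow> snd (g u) \<le> fst (g u)" for u
      proof -
        have "ord_zero \<le> u" by simp
        then show ?thesis
        proof (induction u rule: stage_interval_induct)
          case (suc u)
          have "u < top_stage" if "ord_suc u < top_stage" by (rule less_trans[OF stage_suc_gt that])
          then show ?case using suc.IH unfolding s next_pair_def by (auto simp: ord_suc_le_iff)
        next
          case (limit l)
          show ?case
          proof
            assume l: "l < top_stage"
            note L = lim[OF limit(1) l]
            show "snd (g l) \<le> fst (g l)"
            proof (rule is_lim_le[OF conjunct2[OF L]])
              fix u y assume u: "ord_zero \<le> u" "u < l" "y \<in> {snd (g u)}"
              have "fst (g u) \<le> fst (g l)"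
                using lex[OF u(2) l] by (auto simp: lexl_def intro: less_imp_le)
              then show "y \<le> fst (g l)" using limit(3)[OF u(1,2)] u l by auto
            qed auto
          qed
        qed (simp add: z)
      qed
      with that f B show ?thesis by (meson le_less_trans order_trans)
    qed
    show False
      by (rule no_lex[of "\<lambda>v. fst (g (stg v))" B "\<lambda>v. snd (g (stg v))"]) (use le lex in auto)
  qed
  then show ?thesis using that z s lim by blast
qed

lemma is_lim_index:
  assumes l: "is_limit l" "s < l" and f: "\<And>u. s \<le> u \<Longrightarrow> u < l \<Longrightarrow> stg (f u) = u" and v: "stg v = l"
  shows "is_lim s l (\<lambda>u. {f u}) v"
proof (rule is_limI)
  fix w assume "w < v"
  then have "stg (ord_suc w) < l" using is_limit_suc[OF l(1)] v stg_suc by auto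
  moreover have "w < f r" if "max s (stg (ord_suc w)) \<le> r" "r < l" for r
  proof -
    have "stg (ord_suc w) \<le> stg (f r)" using f[of r] that by simp
    then show ?thesis by (simp add: ord_suc_le_iff)
  qed
  ultimately show "\<exists>u\<ge>s. u < l \<and> (\<forall>r. u \<le> r \<and> r < l \<longrightarrow> (\<forall>y\<in>{f r}. w < y))"
    using l(2) by (intro exI[of _ "max s (stg (ord_suc w))"]) auto
next
  fix u assume u: "s \<le> u" "u < l"
  then have "stg (f u) \<le> stg v" using f v by simp
  then show "\<exists>r y. u \<le> r \<and> r < l \<and> y \<in> {f r} \<and> y \<le> v" using u by (intro exI[of _ u]) simp
qed

text \<open>Register 0 holds the index of the wanted pair, 3 counts up to it, 1 and 2 hold the
  current pair, and 4 stays 0 to reset 2. Each of 1, 2 and 3 is written at most once per round, so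
  all three have the expected limits.\<close>

definition unpair_loop :: com where
  "unpair_loop = Loop 3 0 (Cond 2 1 (COPY 4 2 ;; INC 1) (INC 2) ;; INC 3)"

lemma Exec_unpair:
  assumes "b \<le> a"
  shows "\<exists>p. \<forall>x R. R 0 = p \<longrightarrow> (\<forall>j\<in>{1,2,3,4}. R j = ord_zero) \<longrightarrow>
    (\<exists>T R'. Exec unpair_loop x R T R' \<and> R' 1 = a \<and> R' 2 = b \<and> (\<forall>j. j \<notin> {1,2,3} \<longrightarrow> R' j = R j))"
proof -
  obtain g :: "'a stage \<Rightarrow> 'a \<times> 'a" where g: "g ord_zero = (ord_zero, ord_zero)"
    "\<And>u. g (ord_suc u) = next_pair (g u)"
    "\<And>l. is_limit l \<Longrightarrow> l < top_stage \<Longrightarrow>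
       is_lim ord_zero l (\<lambda>u. {fst (g u)}) (fst (g l)) \<and> is_lim ord_zero l (\<lambda>u. {snd (g u)}) (snd (g l))"
    "\<And>a b. b \<le> a \<Longrightarrow> \<exists>v. g (stg v) = (a, b)"
    using pair_enumeration by blast
  obtain p where p: "g (stg p) = (a, b)" using g(4)[OF assms] by blast
  show ?thesis
  proof (rule exI[of _ p], intro allI impI)
    fix x and R0 :: "nat \<Rightarrow> 'a" assume R0: "R0 0 = p" "\<forall>j\<in>{1,2,3,4}. R0 j = ord_zero"
    let ?b = "Cond 2 1 (COPY 4 2 ;; INC 1) (INC 2) ;; INC 3"
    define Inv where "Inv u R \<longleftrightarrow> (\<forall>j. j \<notin> {1,2,3} \<longrightarrow> R j = R0 j) \<and> (R 1, R 2) = g u \<and> stg (R 3) = u" for u R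
    have "\<exists>R T. R ord_zero = R0 \<and> (\<forall>u. ord_zero \<le> u \<longrightarrow> u \<le> stg p \<longrightarrow> Inv u (R u)) \<and>
      (\<forall>u. ord_zero \<le> u \<longrightarrow> u < stg p \<longrightarrow> Exec ?b x (R u) (T u) (R (ord_suc u)) \<and> True) \<and>
      (\<forall>l k. is_limit l \<longrightarrow> ord_zero < l \<longrightarrow> l \<le> stg p \<longrightarrow> is_lim ord_zero l (trc R T k) (R l k)) \<and>
      Iter 3 0 ?b x R0 (\<Union>u\<in>{ord_zero..<stg p}. insert (R u) (insert (R (ord_suc u)) (T u))) (R (stg p))"
    proof (rule Iter_inv[where Q = "\<lambda>_ _ _ _. True"])
      show "Inv ord_zero R0" unfolding Inv_def using R0 g(1) stg_zero by simp
    next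
      fix u R assume u: "u < stg p" and I: "Inv u R"
      have I': "\<And>j. j \<notin> {1,2,3} \<Longrightarrow> R j = R0 j" "(R 1, R 2) = g u" "stg (R 3) = u"
        using I unfolding Inv_def by auto
      have "R 3 \<noteq> R 0" using u I'(1)[of 0] I'(3) R0 by auto
      moreover have "\<exists>T R'. Exec ?b x R T R' \<and> True \<and> Inv (ord_suc u) R'"
      proof (cases "R 2 = R 1")
        case True
        let ?R1 = "R(2 := R 4)" let ?R2 = "?R1(1 := ord_suc (?R1 1))" let ?R3 = "?R2(3 := ord_suc (?R2 3))"
        have "Exec ?b x R (insert R ({R} \<union> {?R1}) \<union> {?R2}) ?R3"
          by (rule Exec_Seq[OF Exec_Cond_True[OF Exec_Seq[OF Exec_COPY Exec_INC] True] Exec_INC])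
        moreover have "g u = (R 1, R 2)" using I'(2) by simp
        then have "(?R3 1, ?R3 2) = g (ord_suc u)" unfolding g(2) next_pair_def using True I'(1)[of 4] R0 by simp
        moreover have "stg (?R3 3) = ord_suc u" using I'(3) by (simp add: stg_suc)
        ultimately show ?thesis unfolding Inv_def using I'(1)
          by (intro exI[of _ "insert R ({R} \<union> {?R1}) \<union> {?R2}"] exI[of _ ?R3]) simp
      next
        case False
        let ?R2 = "R(2 := ord_suc (R 2))" let ?R3 = "?R2(3 := ord_suc (?R2 3))"
        have "Exec ?b x R (insert R (insert ?R2 {R}) \<union> {?R2}) ?R3"
          by (rule Exec_Seq[OF Exec_Cond_False[OF Exec_INC False] Exec_INC])
        moreover have "g u = (R 1, R 2)" using I'(2) by simp
        then have "(?R3 1, ?R3 2) = g (ord_suc u)" unfolding g(2) next_pair_def using False by simp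
        moreover have "stg (?R3 3) = ord_suc u" using I'(3) by (simp add: stg_suc)
        ultimately show ?thesis unfolding Inv_def using I'(1)
          by (intro exI[of _ "insert R (insert ?R2 {R}) \<union> {?R2}"] exI[of _ ?R3]) simp
      qed
      ultimately show "R 3 \<noteq> R 0 \<and> (\<exists>T R'. Exec ?b x R T R' \<and> True \<and> Inv (ord_suc u) R')" by blast
    next
      fix l R T assume l: "is_limit l" "ord_zero < l" "l \<le> stg p"
        and fam: "\<And>u. ord_zero \<le> u \<Longrightarrow> u < l \<Longrightarrow> Inv u (R u) \<and> Exec ?b x (R u) (T u) (R (ord_suc u)) \<and> True"
      have lt: "l < top_stage" using l(3) stg_less_top by (rule le_less_trans)
      obtain v where v: "l = stg v" using less_top_ex[OF lt] by blast
      have I': "\<And>j. j \<notin> {1,2,3} \<Longrightarrow> R u j = R0 j" "R u 1 = fst (g u)" "R u 2 = snd (g u)" "stg (R u 3) = u"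
        if "u < l" for u
        using fam[of u] that unfolding Inv_def by (auto simp: prod_eq_iff)
      have ex: "Exec ?b x (R u) (T u) (R (ord_suc u))" if "ord_zero \<le> u" "u < l" for u using fam that by blast
      let ?R = "R0(1 := fst (g l), 2 := snd (g l), 3 := v)"
      have "is_lim ord_zero l (trc R T k) (?R k)" for k
      proof -
        have two: "is_lim ord_zero l (trc R T k) y \<longleftrightarrow> is_lim ord_zero l (\<lambda>u. {R u k}) y" if "k \<in> {1,2,3}" for y
          by (rule trc_two_valued[where c = ?b and x = x, OF l(1)]) (use ex that in auto)
        consider "k = 1" | "k = 2" | "k = 3" | "k \<notin> {1,2,3}" by blast
        then show ?thesis
        proof cases
          case 1
          have "is_lim ord_zero l (\<lambda>u. {R u k}) (?R k) \<longleftrightarrow> is_lim ord_zero l (\<lambda>u. {fst (g u)}) (?R k)"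
            by (rule is_lim_cong) (use I'(2) 1 in simp)
          then show ?thesis using two g(3)[OF l(1) lt] 1 by simp
        next
          case 2
          have "is_lim ord_zero l (\<lambda>u. {R u k}) (?R k) \<longleftrightarrow> is_lim ord_zero l (\<lambda>u. {snd (g u)}) (?R k)"
            by (rule is_lim_cong) (use I'(3) 2 in simp)
          then show ?thesis using two g(3)[OF l(1) lt] 2 by simp
        next
          case 3
          have "is_lim ord_zero l (\<lambda>u. {R u 3}) v" by (rule is_lim_index[OF l(1,2)]) (use I'(4) v in auto)
          then show ?thesis using two 3 by simp
        next
          case 4
          have "is_lim ord_zero l (trc R T k) (R0 k)"
            by (rule trc_const[OF l(2)]) (use ex I'(1) 4 in auto)
          then show ?thesis using 4 by simp
        qed
      qed
      moreover have "Inv l ?R" unfolding Inv_def using v by simp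
      ultimately show "\<exists>R'. Inv l R' \<and> (\<forall>k. is_lim ord_zero l (trc R T k) (R' k))" by blast
    qed simp
    then obtain Rs T where Rs: "\<forall>u. ord_zero \<le> u \<longrightarrow> u \<le> stg p \<longrightarrow> Inv u (Rs u)"
      "Iter 3 0 ?b x R0 (\<Union>u\<in>{ord_zero..<stg p}. insert (Rs u) (insert (Rs (ord_suc u)) (T u))) (Rs (stg p))"
      by (elim exE conjE)
    then have "Inv (stg p) (Rs (stg p))" by simp
    with Rs(2) obtain R K where R: "Inv (stg p) R" "Iter 3 0 ?b x R0 K R" by blast
    have "R 3 = R 0" using R(1) R0 unfolding Inv_def by simp
    from Exec_Loop[OF R(2) this] R(1) p
    show "\<exists>T R'. Exec unpair_loop x R0 T R' \<and> R' 1 = a \<and> R' 2 = b \<and> (\<forall>j. j \<notin> {1,2,3} \<longrightarrow> R' j = R0 j)"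
      unfolding unpair_loop_def Inv_def by auto
  qed
qed

text \<open>Nesting: the head of the list is paired with the code of its tail. Only pairs whose
  second component is at most the first are enumerated, so the larger of the two ends up in register
  1; which one that is gets fixed in the program text, as program and code may both depend on the
  list. Registers 1 to 4 are cleared for the next level.\<close>

lemma decode:
  "5 \<le> base \<Longrightarrow> \<exists>p c. \<forall>x R. R 0 = p \<longrightarrow> (\<forall>j\<in>{1,2,3,4}. R j = ord_zero) \<longrightarrow>
    (\<exists>T. Exec c x R T (\<lambda>j. if j \<in> {base..<base + length vs} then vs ! (j - base)
       else if j = 0 then ord_zero else R j))"
proof (induction vs arbitrary: base)
  case Nil
  show ?case
    by (rule exI[of _ ord_zero], rule exI[of _ SKIP]) (auto intro!: Exec_ex[OF Exec_SKIP] simp: fun_eq_iff)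
next
  case (Cons v vs)
  from Cons.prems have "5 \<le> Suc base" by simp
  from Cons.IH[OF this] obtain p c where c: "\<And>x R. R 0 = p \<Longrightarrow> (\<forall>j\<in>{1,2,3,4}. R j = ord_zero) \<Longrightarrow>
    (\<exists>T. Exec c x R T (\<lambda>j. if j \<in> {Suc base..<Suc base + length vs} then vs ! (j - Suc base)
       else if j = 0 then ord_zero else R j))" by blast
  obtain q i j where q: "\<And>x R. R 0 = q \<Longrightarrow> (\<forall>j\<in>{1,2,3,4}. R j = ord_zero) \<Longrightarrow>
    (\<exists>T R'. Exec unpair_loop x R T R' \<and> R' i = v \<and> R' j = p \<and> (\<forall>j. j \<notin> {1,2,3} \<longrightarrow> R' j = R j))"
    "i \<in> {1,2}" "j \<in> {1,2}"
  proof (cases "p \<le> v")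
    case True
    from Exec_unpair[OF True] show ?thesis using that[of _ 1 2] by blast
  next
    case False
    then have "v \<le> p" by simp
    from Exec_unpair[OF this] show ?thesis using that[of _ 2 1] by blast
  qed
  let ?c = "unpair_loop ;; COPY i base ;; COPY j 0 ;; COPY 4 1 ;; COPY 4 2 ;; COPY 4 3 ;; c"
  have "\<exists>T. Exec ?c x R T (\<lambda>j. if j \<in> {base..<base + length (v # vs)} then (v # vs) ! (j - base)
       else if j = 0 then ord_zero else R j)" if R: "R 0 = q" "\<forall>j\<in>{1,2,3,4}. R j = ord_zero" for x R
  proof -
    from q(1)[OF R] obtain T R1 where R1: "Exec unpair_loop x R T R1" "R1 i = v" "R1 j = p"
      "\<And>j. j \<notin> {1,2,3} \<Longrightarrow> R1 j = R j" by blast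
    define R2 where "R2 = R1(base := R1 i)"
    define R3 where "R3 = R2(0 := R2 j)"
    define R4 where "R4 = R3(1 := R3 4)"
    define R5 where "R5 = R4(2 := R4 4)"
    define R6 where "R6 = R5(3 := R5 4)"
    have v6: "R6 0 = p" "\<forall>j\<in>{1,2,3,4}. R6 j = ord_zero" "R6 base = v"
      "\<And>j. j \<notin> {0, base} \<Longrightarrow> R6 j = R j"
      using R1 R q(2,3) Cons.prems unfolding R6_def R5_def R4_def R3_def R2_def by auto
    from c[OF v6(1,2)] obtain T' where T': "Exec c x R6 T' (\<lambda>j. if j \<in> {Suc base..<Suc base + length vs}
       then vs ! (j - Suc base) else if j = 0 then ord_zero else R6 j)" by blast
    have e: "Exec (COPY i base) x R1 {R1} R2" "Exec (COPY j 0) x R2 {R2} R3" "Exec (COPY 4 1) x R3 {R3} R4"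
      "Exec (COPY 4 2) x R4 {R4} R5" "Exec (COPY 4 3) x R5 {R5} R6"
      unfolding R2_def R3_def R4_def R5_def R6_def by (rule Exec_COPY)+
    show ?thesis
      by (rule Exec_ex[OF Exec_Seq[OF R1(1) Exec_Seq[OF e(1) Exec_Seq[OF e(2) Exec_Seq[OF e(3)
        Exec_Seq[OF e(4) Exec_Seq[OF e(5) T']]]]]]])
       (use v6(3,4) Cons.prems in \<open>auto simp: fun_eq_iff nth_Cons'\<close>)
  qed
  then show ?case by (intro exI[of _ q] exI[of _ ?c]) blast
qed

text \<open>The case that \<open>X\<close> is empty: the hook restores everything, so no limit
  argument is left. The last clause keeps, for every simulated query, the part of the trace in which
  it was answered.\<close>

lemma sim_simple:
  fixes C :: "'a stage \<Rightarrow> 'a config option"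
  assumes C: "traj P z C" "u1 \<le> u0" "C u0 \<noteq> None"
    and line: "\<And>u. u1 \<le> u \<Longrightarrow> u < u0 \<Longrightarrow> fst (the (C u)) < n"
    and P: "length P = n" "regs_below k P"
    and pc: "pc \<notin> {off..<off+k}" and kbd: "{kb..kb+n} \<inter> insert pc {off..<off+k} = {}"
      "kb + 1 \<notin> insert pc {off..<off+k}"
    and st: "st \<notin> insert pc {off..<off+k}"
    and kc: "kconsts kb n R0" "R0 (kb + 1) = ord_one" "R0 st = ord_zero"
    and rep1: "rep off pc k n (the (C u1)) R0"
    and hook: "\<And>u R. u1 \<le> u \<Longrightarrow> u < u0 \<Longrightarrow> rep off pc k n (the (C u)) R \<Longrightarrow>
       (\<And>j. j \<notin> insert pc {off..<off+k} \<Longrightarrow> R j = R0 j) \<Longrightarrow> \<exists>T. Exec H x R T R"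
    and wcH: "\<And>i. i \<in> insert pc {off..<off+k} \<Longrightarrow> wc H i = 0"
    and qc: "\<And>R j. j < k \<Longrightarrow> (\<And>i. i \<notin> insert pc {off..<off+k} \<Longrightarrow> R i = R0 i) \<Longrightarrow>
       \<exists>T. Exec (qc (off + j)) x R T (R(off + j := if R (off + j) \<in> z then ord_one else ord_zero)) \<and> W j R T"
    and wcq: "\<And>j i. j < k \<Longrightarrow> i \<in> insert pc {off..<off+k} \<Longrightarrow> wc (qc (off + j)) i \<le> (if i = off + j then 1 else 0)"
    and rest: "\<And>i. i \<notin> insert pc {off..<off+k} \<Longrightarrow> R0 i \<noteq> ord_zero \<Longrightarrow>
       wc H i = 0 \<and> (\<forall>j<k. wc (qc (off + j)) i = 0)"
  shows "\<exists>K R. Iter pc (kb + n) (simbody off pc kb st qc H P) x R0 K R \<and> rep off pc k n (the (C u0)) R \<and>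
    (\<forall>j. j \<notin> insert pc {off..<off+k} \<longrightarrow> R j = R0 j) \<and>
    (\<forall>u j. u1 \<le> u \<longrightarrow> u < u0 \<longrightarrow> P ! fst (the (C u)) = Query j \<longrightarrow>
       (\<exists>Tq R1. Tq \<subseteq> K \<and> R1 (off + j) = snd (the (C u)) j \<and> W j R1 Tq))"
proof -
  interpret S: simulation_layout "TYPE('a)" off pc kb st n k P qc H x z "{}" R0 C u1 u0
      "\<lambda>_ _. True" "\<lambda>_ _ _ _. True" W
  proof
    fix u R assume "u1 \<le> u" "u < u0" "rep off pc k n (the (C u)) R"
      "\<And>j. j \<notin> insert pc {off..<off+k} \<Longrightarrow> j \<notin> {} \<Longrightarrow> R j = R0 j"
    then show "\<exists>T R1. Exec H x R T R1 \<and> (\<forall>j. j \<notin> {} \<longrightarrow> R1 j = R j) \<and> True \<and> True"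
      using hook[of u R] by blast
  qed (use assms in auto)
  from S.sim_iter obtain Rs T where Rs: "\<forall>u. u1 \<le> u \<longrightarrow> u \<le> u0 \<longrightarrow> S.Inv u (Rs u)"
    "\<forall>u. u1 \<le> u \<longrightarrow> u < u0 \<longrightarrow> Exec (simbody off pc kb st qc H P) x (Rs u) (T u) (Rs (ord_suc u)) \<and> S.Qs u (Rs u) (T u) (Rs (ord_suc u))"
    "Iter pc (kb + n) (simbody off pc kb st qc H P) x R0 (\<Union>u\<in>{u1..<u0}. insert (Rs u) (insert (Rs (ord_suc u)) (T u))) (Rs u0)"
    by (elim exE conjE)
  let ?K = "\<Union>u\<in>{u1..<u0}. insert (Rs u) (insert (Rs (ord_suc u)) (T u))"
  have "\<exists>Tq R1. Tq \<subseteq> ?K \<and> R1 (off + j) = snd (the (C u)) j \<and> W j R1 Tq"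
    if u: "u1 \<le> u" "u < u0" and q: "P ! fst (the (C u)) = Query j" for u j
  proof -
    have "S.Qs u (Rs u) (T u) (Rs (ord_suc u))" using Rs(2) u by blast
    then obtain Tq R1 where "Tq \<subseteq> T u" "R1 (off + j) = snd (the (C u)) j" "W j R1 Tq"
      unfolding S.Qs_def using q by blast
    moreover have "T u \<subseteq> ?K" using u by auto
    ultimately show ?thesis by blast
  qed
  moreover have "S.Inv u0 (Rs u0)" using Rs(1) C(2) by blast
  ultimately show ?thesis using Rs(3) unfolding S.Inv_def by blast
qed

definition call :: "nat \<Rightarrow> nat \<Rightarrow> nat \<Rightarrow> nat \<Rightarrow> nat \<Rightarrow> nat \<Rightarrow> nat \<Rightarrow> nat \<Rightarrow> program \<Rightarrow> com" where
  "call src par dst off pc kb st k P = COPY src off ;; COPY par (off + 1) ;;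
     simcom off pc kb st (COPY kb) SKIP P ;; COPY off dst ;; fill_block kb off k ;; COPY kb pc"

lemma simcom_wc:
  assumes "pc \<notin> {off..<off+k}" "regs_below k P" "i \<notin> insert pc {off..<off+k}"
  shows "wc (simcom off pc kb st (COPY kb) H P) i = 2 * wc H i"
  using simbody_wc(2)[where k = k and qc = "COPY kb" and off = off, OF _ assms(1,2) assms(3)]
  unfolding simcom_def by simp

lemma call_wc:
  assumes "pc \<notin> {off..<off+k}" "regs_below k P" "i \<notin> insert pc {off..<off+k}" "2 \<le> k"
  shows "wc (call src par dst off pc kb st k P) i = (if i = dst then 1 else 0)"
  using simcom_wc[OF assms(1-3)] assms(3,4) unfolding call_def by (auto simp: fill_block_wc)

lemma rep_init:
  assumes "\<And>i. i < k \<Longrightarrow> R (off + i) = (if i < length xs then xs ! i else ord_zero)" "R pc = ord_zero"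
  shows "rep off pc k n (init_config xs) R"
  using assms unfolding rep_def init_config_def by (simp add: num_0)

lemma Exec_call:
  assumes h: "halts_with P {} [R src, R par] v" and P: "regs_below k P" "2 \<le> k"
    and kc: "kconsts kb N R" "length P \<le> N" "1 \<le> N"
    and z: "\<And>j. j \<in> insert pc {off..<off+k} \<Longrightarrow> R j = ord_zero" "R st = ord_zero"
    and d: "pc \<notin> {off..<off+k}" "{kb..kb+N} \<inter> insert pc {off..<off+k} = {}" "st \<notin> insert pc {off..<off+k}"
      "src \<notin> insert pc {off..<off+k}" "par \<notin> insert pc {off..<off+k}" "dst \<notin> insert pc {off..<off+k}"
      "dst \<notin> {kb..kb+N}"
  shows "\<exists>T. R \<in> T \<and> Exec (call src par dst off pc kb st k P) x R T (R(dst := v))"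
proof -
  let ?PP = "insert pc {off..<off+k}"
  obtain u0 :: "'a stage" and c where c: "run P {} [R src, R par] u0 = Some c" "halted P c" "snd c 0 = v"
    and line: "\<And>u. u < u0 \<Longrightarrow> fst (the (run P {} [R src, R par] u)) < length P"
    using halts_with_first[OF h] by blast
  define R1 where "R1 = R(off := R src)"
  define R2 where "R2 = R1(off + 1 := R1 par)"
  have offs: "off \<in> {off..<off+k}" "off + 1 \<in> {off..<off+k}" using P(2) by auto
  have parn: "par \<noteq> off" "off + 1 \<noteq> pc" "off \<noteq> pc" using d(1,5) offs by blast+
  have R2: "R2 off = R src" "R2 (off + 1) = R par" "\<And>j. j \<noteq> off \<Longrightarrow> j \<noteq> off + 1 \<Longrightarrow> R2 j = R j"
    unfolding R2_def R1_def using parn by auto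
  have R2': "R2 j = R j" if "j \<notin> ?PP" for j using R2(3)[of j] that P(2) by auto
  have kbn: "kb + l \<notin> ?PP" if "l \<le> N" for l
  proof -
    have "kb + l \<in> {kb..kb+N}" using that by simp
    then show ?thesis using d(2) by blast
  qed
  have R2k: "R2 (kb + l) = num l" if "l \<le> N" for l
    using R2'[OF kbn[OF that]] kc(1) that unfolding kconsts_def by simp
  have "\<exists>K R'. Iter pc (kb + length P) (simbody off pc kb st (COPY kb) SKIP P) x R2 K R' \<and>
    rep off pc k (length P) (the (run P {} [R src, R par] u0)) R' \<and>
    (\<forall>j. j \<notin> ?PP \<longrightarrow> R' j = R2 j) \<and>
    (\<forall>u j. ord_zero \<le> u \<longrightarrow> u < u0 \<longrightarrow> P ! fst (the (run P {} [R src, R par] u)) = Query j \<longrightarrow>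
       (\<exists>Tq R1. Tq \<subseteq> K \<and> R1 (off + j) = snd (the (run P {} [R src, R par] u)) j \<and> True))"
  proof (rule sim_simple[where W = "\<lambda>_ _ _. True", OF traj_run])
    show "run P {} [R src, R par] u0 \<noteq> None" using c by simp
    have "{kb..kb + length P} \<subseteq> {kb..kb + N}" using kc(2) by auto
    with d(2) show "{kb..kb + length P} \<inter> ?PP = {}" by blast
    show "kb + 1 \<notin> ?PP" by (rule kbn[OF kc(3)])
    show "kconsts kb (length P) R2" unfolding kconsts_def using R2k kc(2) by simp
    show "R2 (kb + 1) = ord_one" using R2k[of 1] kc(3) by (simp add: num_1)
    show "R2 st = ord_zero" using R2' d(3) z(2) by simp
    show "rep off pc k (length P) (the (run P {} [R src, R par] (ord_zero :: 'a stage))) R2"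
      unfolding run_zero option.sel
    proof (rule rep_init)
      show "R2 pc = ord_zero" using R2(3) parn z(1) by auto
      show "R2 (off + i) = (if i < length [R src, R par] then [R src, R par] ! i else ord_zero)" if "i < k" for i
      proof -
        consider "i = 0" | "i = 1" | "i \<ge> 2" by linarith
        then show ?thesis using R2 z(1)[of "off + i"] that by cases (auto)
      qed
    qed
    show "\<exists>T. Exec SKIP x R' T R'" for R' using Exec_SKIP by blast
    show "\<exists>T. Exec (COPY kb (off + j)) x R' T (R'(off + j := if R' (off + j) \<in> {} then ord_one else ord_zero)) \<and> True"
      if "j < k" "\<And>i. i \<notin> ?PP \<Longrightarrow> R' i = R2 i" for R' j
    proof -
      have "R' kb = ord_zero" using that(2)[of kb] kbn[of 0] R2k[of 0] by (simp add: num_0)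
      then show ?thesis using Exec_COPY[of kb "off + j" x R'] by auto
    qed
    show "wc SKIP i = 0 \<and> (\<forall>j<k. wc (COPY kb (off + j)) i = 0)" if "i \<notin> ?PP" for i
      using that by auto
  qed (use line P(1) d(1,3) in simp_all)
  then obtain K R3 where R3: "Iter pc (kb + length P) (simbody off pc kb st (COPY kb) SKIP P) x R2 K R3"
    "rep off pc k (length P) (the (run P {} [R src, R par] u0)) R3" and R3': "\<forall>j. j \<notin> ?PP \<longrightarrow> R3 j = R2 j"
    by (elim exE conjE)
  have R3k: "R3 (kb + l) = num l" if "l \<le> N" for l using R3'[rule_format, OF kbn[OF that]] R2k[OF that] by simp
  have "R3 pc = num (length P)" using rep_halted[OF R3(2)] c by (simp add: halted_def)
  then have ex: "Exec (simcom off pc kb st (COPY kb) SKIP P) x R2 (insert R3 K) R3"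
    by (intro sim_halt[OF R3(1)]) (simp_all add: R3k kc(2))
  have "\<forall>i<k. R3 (off + i) = snd c i" using R3(2) c unfolding rep_def by simp
  from this[rule_format, of 0] have v: "R3 off = v" using c P(2) by simp
  define R4 where "R4 = R3(dst := R3 off)"
  have "kb \<notin> {off..<off+k}" using kbn[of 0] by simp
  from Exec_fill_block[OF this, of x R4] obtain T5 where
    T5: "Exec (fill_block kb off k) x R4 T5 (\<lambda>j. if j \<in> {off..<off+k} then R4 kb else R4 j)" by blast
  let ?R5 = "\<lambda>j. if j \<in> {off..<off+k} then R4 kb else R4 j"
  have e: "Exec (COPY src off) x R {R} R1" "Exec (COPY par (off + 1)) x R1 {R1} R2" "Exec (COPY off dst) x R3 {R3} R4"
    unfolding R1_def R2_def R4_def by (rule Exec_COPY)+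
  have R4kb: "R4 kb = ord_zero" unfolding R4_def using R3k[of 0] d(7) by (auto simp: num_0)
  have "?R5(pc := ?R5 kb) = R(dst := v)"
  proof
    fix j
    show "(?R5(pc := ?R5 kb)) j = (R(dst := v)) j"
    proof (cases "j \<in> ?PP")
      case True
      then show ?thesis using R4kb z(1)[OF True] d(6) kbn[of 0] by auto
    next
      case False
      then show ?thesis using R3'[rule_format, OF False] R2'[OF False] v unfolding R4_def by auto
    qed
  qed
  moreover have "Exec (call src par dst off pc kb st k P) x R
      ({R} \<union> ({R1} \<union> (insert R3 K \<union> ({R3} \<union> (T5 \<union> {?R5}))))) (?R5(pc := ?R5 kb))"
    unfolding call_def by (rule Exec_Seq[OF e(1) Exec_Seq[OF e(2) Exec_Seq[OF ex Exec_Seq[OF e(3)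
      Exec_Seq[OF T5 Exec_COPY]]]]])
  ultimately show ?thesis by (intro exI[of _ "{R} \<union> ({R1} \<union> (insert R3 K \<union> ({R3} \<union> (T5 \<union> {?R5}))))"]) simp
qed

text \<open>Common opening of the programs below: unpack the parameters into registers from 5 on and
  write finite constants from \<open>kb\<close> on. Code and parameter are independent of the
  oracle, since recognition needs one program for all oracles.\<close>

lemma prologue:
  "\<exists>p c. \<forall>x. \<exists>T. Exec (c ;; mkconsts kb N) x (snd (init_config [p])) T
     (\<lambda>j. if j \<in> {kb..kb+N} then num (j - kb) else if j \<in> {5..<5 + length vs} then vs ! (j - 5) else ord_zero)"
  if kb: "5 + length vs \<le> kb"
proof -
  obtain p c where c: "\<And>x R. R 0 = p \<Longrightarrow> (\<forall>j\<in>{1,2,3,4}. R j = ord_zero) \<Longrightarrow>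
    (\<exists>T. Exec c x R T (\<lambda>j. if j \<in> {5..<5 + length vs} then vs ! (j - 5) else if j = 0 then ord_zero else R j))"
    using decode[of 5 vs] by auto
  have "\<exists>T. Exec (c ;; mkconsts kb N) x (snd (init_config [p])) T
     (\<lambda>j. if j \<in> {kb..kb+N} then num (j - kb) else if j \<in> {5..<5 + length vs} then vs ! (j - 5) else ord_zero)" for x
  proof -
    let ?R0 = "snd (init_config [p]) :: nat \<Rightarrow> 'a"
    have R0: "?R0 j = (if j = 0 then p else ord_zero)" for j unfolding init_config_def by auto
    have "\<exists>T. Exec c x ?R0 T (\<lambda>j. if j \<in> {5..<5 + length vs} then vs ! (j - 5) else if j = 0 then ord_zero else ?R0 j)"
      by (rule c) (auto simp: R0)
    then obtain T where T: "Exec c x ?R0 T (\<lambda>j. if j \<in> {5..<5 + length vs} then vs ! (j - 5) else if j = 0 then ord_zero else ?R0 j)"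
      by blast
    let ?R1 = "\<lambda>j. if j \<in> {5..<5 + length vs} then vs ! (j - 5) else if j = 0 then ord_zero else ?R0 j"
    have "?R1 kb = ord_zero" using kb by (auto simp: R0)
    from Exec_mkconsts[where R = ?R1, OF this, of N x] obtain T' where
      T': "Exec (mkconsts kb N) x ?R1 T' (\<lambda>j. if j \<in> {kb..kb+N} then num (j - kb) else ?R1 j)" by blast
    show ?thesis by (rule Exec_ex[OF Exec_Seq[OF T T']]) (auto simp: fun_eq_iff R0)
  qed
  then show ?thesis by blast
qed

text \<open>The two inputs occupy registers 0 and 1, so register 2 still holds 0.\<close>

lemma empty_computable: "({} :: 'a set) \<in> COMP"
proof -
  have "halts_with (code 0 (COPY 2 0)) {} [\<iota>, ord_zero] (ord_zero :: 'a)" for \<iota>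
  proof -
    have "halts_with (code 0 (COPY 2 0)) {} [\<iota>, ord_zero] (((snd (init_config [\<iota>, ord_zero]))(0 := snd (init_config [\<iota>, ord_zero]) 2)) 0)"
      by (rule run_code(1)[OF Exec_COPY])
    then show ?thesis by (simp add: init_config_def)
  qed
  then show ?thesis unfolding COMP_def wITRM_computable_def by auto
qed

section \<open>Searchability, recognizability and weakness\<close>

text \<open>The use principle for transfinite runs: an oracle enters only through the queries, and
  limit configurations depend only on what came before.\<close>

lemma run_oracle_cong:
  fixes x y :: "'a set" and u0 :: "'a stage"
  assumes "\<And>u l R j. u < u0 \<Longrightarrow> run Q x xs u = Some (l, R) \<Longrightarrow> l < length Q \<Longrightarrow> Q ! l = Query j \<Longrightarrow> R j \<in> x \<longleftrightarrow> R j \<in> y"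
  shows "u \<le> u0 \<Longrightarrow> run Q y xs (u :: 'a stage) = run Q x xs u"
proof -
  have "u \<le> u0 \<longrightarrow> run Q y xs u = run Q x xs u" for u
  proof -
    have "ord_zero \<le> u" by simp
    then show ?thesis
    proof (induction u rule: stage_interval_induct)
      case start
      show ?case by (simp add: run_zero)
    next
      case (suc u)
      show ?case
      proof
        assume "ord_suc u \<le> u0"
        then have u: "u < u0" by (simp add: stage_suc_le_iff)
        have eq: "run Q y xs u = run Q x xs u" using suc.IH u by simp
        have "step Q y c = step Q x c" if c: "run Q x xs u = Some c" for c
        proof (cases "halted Q c")
          case False
          obtain l R where lR: "c = (l, R)" by (cases c)
          have l: "l < length Q" using False lR by (simp add: halted_def)
          show ?thesis using assms[OF u] c l unfolding lR step_config[OF l] by (cases "Q ! l") auto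
        qed (simp add: step_halted)
        then show "run Q y xs (ord_suc u) = run Q x xs (ord_suc u)"
          unfolding traj_suc[OF traj_run] eq by (cases "run Q x xs u") auto
      qed
    next
      case (limit l)
      show ?case
      proof
        assume "l \<le> u0"
        then have "limit_config l (run Q y xs) = limit_config l (run Q x xs)"
          using limit(3) by (intro limit_config_cong) simp
        then show "run Q y xs l = run Q x xs l" using run_limit[OF limit(1)] by metis
      qed
    qed
  qed
  then show "u \<le> u0 \<Longrightarrow> run Q y xs u = run Q x xs u" by blast
qed

text \<open>The register layout of the next two programs: 5 and 6 contain the parameters, 7 and 8
  control the outer simulation, 9 and 10 the inner one, 11 and 12 are scratch registers. The
  constants start at 14; they are followed by the registers of the two simulated programs.\<close>

lemma searchable_if_recognized:
  fixes x :: "'a set"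
  assumes x: "x \<in> COMP" "x \<in> RECOG"
  shows "wITRM_searchable TYPE('a)"
proof -
  obtain P \<rho> where P: "\<And>\<iota>. halts_with P {} [\<iota>, \<rho>] (if \<iota> \<in> x then ord_one else ord_zero)"
    using x(1) unfolding COMP_def wITRM_computable_def by blast
  obtain Q \<xi> where Q: "\<And>y. halts_with Q y [\<xi>] (if y = x then ord_one else ord_zero)"
    using x(2) unfolding RECOG_def wITRM_recognizable_def by blast
  obtain u0 :: "'a stage" and c where c: "run Q x [\<xi>] u0 = Some c" "halted Q c" "snd c 0 = ord_one"
    and line: "\<And>u. u < u0 \<Longrightarrow> fst (the (run Q x [\<xi>] u)) < length Q"
    using halts_with_first[OF Q[of x]] by auto
  have asked: "\<exists>u j. u < u0 \<and> Q ! fst (the (run Q x [\<xi>] u)) = Query j \<and> snd (the (run Q x [\<xi>] u)) j = \<iota>" for \<iota>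
  proof (rule ccontr)
    assume no: "\<not> ?thesis"
    define y where "y = (if \<iota> \<in> x then x - {\<iota>} else insert \<iota> x)"
    have yx: "y \<noteq> x" "\<And>v. v \<noteq> \<iota> \<Longrightarrow> v \<in> y \<longleftrightarrow> v \<in> x" unfolding y_def by auto
    have "run Q y [\<xi>] u0 = run Q x [\<xi>] u0"
    proof (rule run_oracle_cong)
      fix u l R j assume "u < u0" "run Q x [\<xi>] u = Some (l, R)" "l < length Q" "Q ! l = Query j"
      then have "R j \<noteq> \<iota>" using no by force
      then show "R j \<in> x \<longleftrightarrow> R j \<in> y" using yx(2) by blast
    qed simp
    then have "halts_with Q y [\<xi>] ord_one" unfolding halts_with_def using c by (intro exI[of _ u0] exI[of _ c]) simp
    moreover have "halts_with Q y [\<xi>] ord_zero" using Q[of y] yx(1) by simp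
    ultimately show False using halts_with_unique by (metis one_neq_zero(1))
  qed
  obtain k1 where k1: "regs_below k1 Q" "1 \<le> k1" using regs_below_ex by blast
  obtain k2 where k2: "regs_below k2 P" "2 \<le> k2" using regs_below_ex by blast
  define N where "N = length P + length Q + 1"
  define off1 where "off1 = 15 + N"
  define off2 where "off2 = off1 + k1"
  let ?PP1 = "insert 7 {off1..<off1+k1}" let ?PP2 = "insert 9 {off2..<off2+k2}"
  let ?call = "\<lambda>j. call j 6 j off2 9 14 10 k2 P"
  \<comment> \<open>The queried ordinal is shown in the search register 0 before the answer is
    computed; afterwards register 0 is cleared, so that it counts as scratch for the outer
    simulation.\<close>
  let ?qc = "\<lambda>j. COPY j 0 ;; ?call j ;; COPY 14 0"
  obtain p d where pd: "\<And>z. \<exists>T. Exec (d ;; mkconsts 14 N) z (snd (init_config [p])) T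
     (\<lambda>j. if j \<in> {14..14+N} then num (j - 14) else if j \<in> {5..<5 + length [\<xi>, \<rho>]} then [\<xi>, \<rho>] ! (j - 5) else ord_zero)"
    using prologue[of "[\<xi>, \<rho>]" 14 N] by auto
  define R0 where "R0 j = (if j \<in> {14..14+N} then num (j - 14) else if j \<in> {5..<5 + length [\<xi>, \<rho>]} then [\<xi>, \<rho>] ! (j - 5) else ord_zero)" for j
  define R1 where "R1 = R0(off1 := R0 5)"
  have R1: "R1 5 = \<xi>" "R1 6 = \<rho>" "R1 off1 = \<xi>" "\<And>l. l \<le> N \<Longrightarrow> R1 (14 + l) = num l"
    "\<And>j. j \<noteq> 5 \<Longrightarrow> j \<noteq> 6 \<Longrightarrow> j \<noteq> off1 \<Longrightarrow> j \<notin> {14..14+N} \<Longrightarrow> R1 j = ord_zero"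
    unfolding R1_def R0_def off1_def by auto
  have kc: "kconsts 14 N R1" unfolding kconsts_def using R1(4) by simp
  have "\<exists>K R. Iter 7 (14 + length Q) (simbody off1 7 14 8 ?qc SKIP Q) {} R1 K R \<and>
    rep off1 7 k1 (length Q) (the (run Q x [\<xi>] u0)) R \<and>
    (\<forall>j. j \<notin> ?PP1 \<longrightarrow> R j = R1 j) \<and>
    (\<forall>u j. ord_zero \<le> u \<longrightarrow> u < u0 \<longrightarrow> Q ! fst (the (run Q x [\<xi>] u)) = Query j \<longrightarrow>
       (\<exists>Tq Rq. Tq \<subseteq> K \<and> Rq (off1 + j) = snd (the (run Q x [\<xi>] u)) j \<and> (\<exists>S\<in>Tq. S 0 = Rq (off1 + j))))"
  proof (rule sim_simple[where W = "\<lambda>j R T. \<exists>S\<in>T. S 0 = R (off1 + j)", OF traj_run])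
    show "run Q x [\<xi>] u0 \<noteq> None" using c by simp
    show "kconsts 14 (length Q) R1" using kc unfolding kconsts_def N_def by simp
    show "R1 (14 + 1) = ord_one" using R1(4)[of 1] by (simp add: N_def num_1)
    show "R1 8 = ord_zero" using R1(5)[of 8] by (simp add: off1_def)
    show "rep off1 7 k1 (length Q) (the (run Q x [\<xi>] (ord_zero :: 'a stage))) R1"
      unfolding run_zero option.sel
    proof (rule rep_init)
      show "R1 7 = ord_zero" using R1(5)[of 7] by (simp add: off1_def)
      show "R1 (off1 + i) = (if i < length [\<xi>] then [\<xi>] ! i else ord_zero)" for i
        using R1(3) R1(5)[of "off1 + i"] by (cases i) (auto simp: off1_def)
    qed
    show "\<exists>T. Exec SKIP {} R' T R'" for R' using Exec_SKIP by blast
  next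
    fix R j assume j: "j < k1" and R: "\<And>i. i \<notin> ?PP1 \<Longrightarrow> R i = R1 i"
    define R2 where "R2 = R(0 := R (off1 + j))"
    have R2: "R2 (off1 + j) = R (off1 + j)" "R2 6 = \<rho>" unfolding R2_def using R[of 6] R1(2) by (auto simp: off1_def)
    let ?v = "if R (off1 + j) \<in> x then ord_one else ord_zero"
    have "\<exists>T. R2 \<in> T \<and> Exec (?call (off1 + j)) {} R2 T (R2(off1 + j := ?v))"
    proof (rule Exec_call[where N = N])
      show "halts_with P {} [R2 (off1 + j), R2 6] ?v" unfolding R2 by (rule P)
      have "R2 (14 + l) = num l" if "l \<le> N" for l using R[of "14 + l"] R1(4)[OF that] that unfolding R2_def off1_def by auto
      then show "kconsts 14 N R2" unfolding kconsts_def by simp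
      show "R2 i = ord_zero" if "i \<in> ?PP2" for i
        using that R[of i] R1(5)[of i] k1 j unfolding R2_def off2_def off1_def by auto
      show "R2 10 = ord_zero" using R[of 10] R1(5)[of 10] unfolding R2_def off1_def by auto
    qed (use k2 j in \<open>auto simp: N_def off2_def off1_def\<close>)
    then obtain T where T: "R2 \<in> T" "Exec (?call (off1 + j)) {} R2 T (R2(off1 + j := ?v))" by blast
    let ?R3 = "R2(off1 + j := ?v)"
    have "Exec (COPY (off1 + j) 0) {} R {R} R2" unfolding R2_def by (rule Exec_COPY)
    from Exec_Seq[OF this Exec_Seq[OF T(2) Exec_COPY]]
    have "Exec (?qc (off1 + j)) {} R ({R} \<union> (T \<union> {?R3})) (?R3(0 := ?R3 14))" .
    moreover have "?R3(0 := ?R3 14) = R(off1 + j := ?v)"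
      using R[of 0] R[of 14] R1(4)[of 0] R1(5)[of 0] unfolding R2_def off1_def by (auto simp: fun_eq_iff num_0)
    ultimately show "\<exists>T. Exec (?qc (off1 + j)) {} R T (R(off1 + j := ?v)) \<and> (\<exists>S\<in>T. S 0 = R (off1 + j))"
      using T(1) by (intro exI[of _ "{R} \<union> (T \<union> {?R3})"] conjI bexI[of _ R2]) (simp_all add: R2_def)
  next
    fix i j assume i: "j < k1" "i \<in> ?PP1"
    have "wc (?call (off1 + j)) i = (if i = off1 + j then 1 else 0)"
      by (rule call_wc) (use k2 i in \<open>auto simp: off2_def off1_def\<close>)
    then show "wc (?qc (off1 + j)) i \<le> (if i = off1 + j then 1 else 0)" using i by (auto simp: off1_def)
  next
    fix i assume i: "i \<notin> ?PP1" "R1 i \<noteq> ord_zero"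
    have "wc (?qc (off1 + j)) i = 0" if j: "j < k1" for j
    proof -
      have "R1 0 = ord_zero" by (rule R1(5)) (auto simp: off1_def)
      then have "i \<noteq> 0" using i(2) by metis
      have "i \<notin> ?PP2" using i R1(5)[of i] k1 unfolding off2_def off1_def by auto
      then have "wc (?call (off1 + j)) i = (if i = off1 + j then 1 else 0)"
        by (intro call_wc) (use k2 in \<open>auto simp: off2_def off1_def\<close>)
      then show ?thesis using i j \<open>i \<noteq> 0\<close> by auto
    qed
    then show "wc SKIP i = 0 \<and> (\<forall>j<k1. wc (?qc (off1 + j)) i = 0)" by simp
  qed (use k1 k2 line in \<open>auto simp: N_def off1_def\<close>)
  then obtain K R where KR: "Iter 7 (14 + length Q) (simbody off1 7 14 8 ?qc SKIP Q) {} R1 K R"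
    "rep off1 7 k1 (length Q) (the (run Q x [\<xi>] u0)) R" and KR3: "\<forall>j. j \<notin> ?PP1 \<longrightarrow> R j = R1 j"
    and KQ': "\<forall>u j. ord_zero \<le> u \<longrightarrow> u < u0 \<longrightarrow> Q ! fst (the (run Q x [\<xi>] u)) = Query j \<longrightarrow>
       (\<exists>Tq Rq. Tq \<subseteq> K \<and> Rq (off1 + j) = snd (the (run Q x [\<xi>] u)) j \<and> (\<exists>S\<in>Tq. S 0 = Rq (off1 + j)))"
    by (elim exE conjE)
  have KQ: "\<exists>Tq Rq. Tq \<subseteq> K \<and> Rq (off1 + j) = snd (the (run Q x [\<xi>] u)) j \<and> (\<exists>S\<in>Tq. S 0 = Rq (off1 + j))"
    if "u < u0" "Q ! fst (the (run Q x [\<xi>] u)) = Query j" for u j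
    using KQ' that by simp
  have "R 7 = num (length Q)" using rep_halted[OF KR(2)] c by (simp add: halted_def)
  moreover have "R (14 + length Q) = num (length Q)"
    using KR3[rule_format, of "14 + length Q"] R1(4)[of "length Q"] by (auto simp: off1_def N_def)
  ultimately have sim: "Exec (simcom off1 7 14 8 ?qc SKIP Q) {} R1 (insert R K) R"
    using sim_halt[OF KR(1)] by simp
  obtain T where T: "Exec (d ;; mkconsts 14 N) {} (snd (init_config [p])) T R0"
    using pd[of "{}"] unfolding R0_def[abs_def] by blast
  have "Exec (COPY 5 off1) {} R0 {R0} R1" unfolding R1_def by (rule Exec_COPY)
  from Exec_Seq[OF T Exec_Seq[OF this sim]]
  have main: "Exec ((d ;; mkconsts 14 N) ;; COPY 5 off1 ;; simcom off1 7 14 8 ?qc SKIP Q) {} (snd (init_config [p]))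
      (T \<union> ({R0} \<union> insert R K)) R" .
  let ?M = "code 0 ((d ;; mkconsts 14 N) ;; COPY 5 off1 ;; simcom off1 7 14 8 ?qc SKIP Q)"
  have "\<exists>(t :: 'a stage) c. run ?M {} [p] t = Some c \<and> \<not> halted ?M c \<and> snd c 0 = \<iota>" for \<iota>
  proof -
    obtain u j where u: "u < u0" "Q ! fst (the (run Q x [\<xi>] u)) = Query j" "snd (the (run Q x [\<xi>] u)) j = \<iota>"
      using asked by blast
    then obtain S where S: "S \<in> K" "S 0 = \<iota>" using KQ[OF u(1,2)] by fastforce
    then have "S \<in> T \<union> ({R0} \<union> insert R K)" by simp
    from run_code(2)[OF main this] obtain t :: "'a stage" and l where
      "run ?M {} [p] t = Some (l, S)" "l < length ?M" by blast
    then show ?thesis using S(2) by (intro exI[of _ t] exI[of _ "(l, S)"]) (simp add: halted_def)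
  qed
  moreover have "halts ?M {} [p]" using run_code(1)[OF main]
    unfolding halts_with_def halts_def halted_by_def by blast
  ultimately show ?thesis unfolding wITRM_searchable_def by blast
qed

lemma recognizable_if_searchable:
  fixes x :: "'a set"
  assumes s: "wITRM_searchable TYPE('a)" and x: "x \<in> COMP"
  shows "x \<in> RECOG"
proof -
  obtain P \<rho> where P: "\<And>\<iota>. halts_with P {} [\<iota>, \<rho>] (if \<iota> \<in> x then ord_one else ord_zero)"
    using x unfolding COMP_def wITRM_computable_def by blast
  obtain Q \<xi> where Q: "halts Q {} [\<xi> :: 'a]"
    "\<And>\<iota> :: 'a. \<exists>(t :: 'a stage) c. run Q {} [\<xi>] t = Some c \<and> \<not> halted Q c \<and> snd c 0 = \<iota>"
    using s unfolding wITRM_searchable_def by blast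
  let ?C = "run Q {} [\<xi>] :: 'a stage \<Rightarrow> 'a config option"
  have hQ: "\<exists>v. halts_with Q {} [\<xi>] v" using Q(1) unfolding halts_def halted_by_def halts_with_def by blast
  then obtain h :: "'a stage" and c where c: "?C h = Some c" "halted Q c"
    and line: "\<And>u. u < h \<Longrightarrow> fst (the (?C u)) < length Q"
    using halts_with_first by blast
  obtain k1 where k1: "regs_below k1 Q" "1 \<le> k1" using regs_below_ex by blast
  obtain k2 where k2: "regs_below k2 P" "2 \<le> k2" using regs_below_ex by blast
  define N where "N = length P + length Q + 1"
  define off1 where "off1 = 15 + N"
  define off2 where "off2 = off1 + k1"
  let ?PP1 = "insert 7 {off1..<off1+k1}" let ?PP2 = "insert 9 {off2..<off2+k2}"
  let ?call = "call off1 6 11 off2 9 14 10 k2 P"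
  \<comment> \<open>Register 11 receives the computed bit of \<open>x\<close> at the current search
    value, register 12 the bit of the oracle. A mismatch raises the stop flag 8; 11 and 12 are
    cleared because they are scratch.\<close>
  let ?H = "?call ;; COPY off1 12 ;; QUERY 12 ;; Cond 11 12 SKIP (COPY 15 8) ;; COPY 14 11 ;; COPY 14 12"
  let ?M = "simcom off1 7 14 8 (COPY 14) ?H Q"
  obtain p d where pd: "\<And>z. \<exists>T. Exec (d ;; mkconsts 14 N) z (snd (init_config [p])) T
     (\<lambda>j. if j \<in> {14..14+N} then num (j - 14) else if j \<in> {5..<5 + length [\<xi>, \<rho>]} then [\<xi>, \<rho>] ! (j - 5) else ord_zero)"
    using prologue[of "[\<xi>, \<rho>]" 14 N] by auto
  define R0 where "R0 j = (if j \<in> {14..14+N} then num (j - 14) else if j \<in> {5..<5 + length [\<xi>, \<rho>]} then [\<xi>, \<rho>] ! (j - 5) else ord_zero)" for j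
  define R1 where "R1 = R0(off1 := R0 5)"
  have R1: "R1 5 = \<xi>" "R1 6 = \<rho>" "R1 off1 = \<xi>" "\<And>l. l \<le> N \<Longrightarrow> R1 (14 + l) = num l"
    "\<And>j. j \<noteq> 5 \<Longrightarrow> j \<noteq> 6 \<Longrightarrow> j \<noteq> off1 \<Longrightarrow> j \<notin> {14..14+N} \<Longrightarrow> R1 j = ord_zero"
    unfolding R1_def R0_def off1_def by auto
  have kc: "kconsts 14 N R1" unfolding kconsts_def using R1(4) by simp
  have R1z: "R1 i = ord_zero" if "i \<in> ?PP2 \<union> {7, 8, 10, 11, 12}" for i
    by (rule R1(5)) (use that k1 in \<open>auto simp: off2_def off1_def\<close>)
  have wcH: "wc ?H i = 0" if "i \<notin> ?PP2" "i \<notin> {8, 11, 12}" for i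
  proof -
    have "wc ?call i = (if i = 11 then 1 else 0)"
      by (rule call_wc) (use k2 that in \<open>auto simp: off2_def off1_def\<close>)
    then show ?thesis using that by simp
  qed
  have hook: "\<exists>T. Exec ?H y R T (if R off1 \<in> x \<longleftrightarrow> R off1 \<in> y then R else R(8 := ord_one))"
    if R: "\<And>i. i \<notin> ?PP1 \<Longrightarrow> R i = R1 i" for R y
  proof -
    have R': "R 6 = \<rho>" "R 8 = ord_zero" "R 11 = ord_zero" "R 12 = ord_zero" "R 14 = ord_zero" "R 15 = ord_one"
      using R[of 6] R[of 8] R[of 11] R[of 12] R[of 14] R[of 15] R1(2) R1z R1(4)[of 0] R1(4)[of 1]
      by (auto simp: off1_def N_def num_0 num_1)
    let ?v = "if R off1 \<in> x then ord_one else ord_zero"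
    let ?q = "if R off1 \<in> y then ord_one else ord_zero"
    have "\<exists>T. R \<in> T \<and> Exec ?call y R T (R(11 := ?v))"
    proof (rule Exec_call[where N = N])
      show "halts_with P {} [R off1, R 6] ?v" unfolding R' by (rule P)
      have "R (14 + l) = num l" if "l \<le> N" for l using R[of "14 + l"] R1(4)[OF that] that unfolding off1_def by auto
      then show "kconsts 14 N R" unfolding kconsts_def by simp
      show "R i = ord_zero" if "i \<in> ?PP2" for i
        using that R[of i] R1z[of i] k1 unfolding off2_def off1_def by auto
      show "R 10 = ord_zero" using R[of 10] R1z[of 10] unfolding off1_def by auto
    qed (use k1 k2 in \<open>auto simp: N_def off2_def off1_def\<close>)
    then obtain T where T: "Exec ?call y R T (R(11 := ?v))" by blast
    define Ra where "Ra = R(11 := ?v)"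
    define Rb where "Rb = Ra(12 := Ra off1)"
    define Rc where "Rc = Rb(12 := if Rb 12 \<in> y then ord_one else ord_zero)"
    define Rd where "Rd = (if Rc 11 = Rc 12 then Rc else Rc(8 := Rc 15))"
    define Re where "Re = Rd(11 := Rd 14)"
    define Rf where "Rf = Re(12 := Re 14)"
    have o: "off1 \<noteq> 11" "off1 \<noteq> 12" unfolding off1_def by auto
    have "\<exists>T. Exec (Cond 11 12 SKIP (COPY 15 8)) y Rc T Rd"
    proof (cases "Rc 11 = Rc 12")
      case True
      show ?thesis unfolding Rd_def by (rule Exec_ex[OF Exec_Cond_True[OF Exec_SKIP True]]) (simp add: True)
    next
      case False
      show ?thesis unfolding Rd_def by (rule Exec_ex[OF Exec_Cond_False[OF Exec_COPY False]]) (simp add: False)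
    qed
    then obtain Td where Td: "Exec (Cond 11 12 SKIP (COPY 15 8)) y Rc Td Rd" by blast
    have e: "Exec (COPY off1 12) y Ra {Ra} Rb" "Exec (QUERY 12) y Rb {Rb} Rc" "Exec (COPY 14 11) y Rd {Rd} Re"
      "Exec (COPY 14 12) y Re {Re} Rf"
      unfolding Rb_def Rc_def Re_def Rf_def by (rule Exec_COPY Exec_QUERY)+
    have Rc: "Rc = R(11 := ?v, 12 := ?q)" unfolding Rc_def Rb_def Ra_def using o by auto
    have "Rf = (if R off1 \<in> x \<longleftrightarrow> R off1 \<in> y then R else R(8 := ord_one))"
      unfolding Rf_def Re_def Rd_def Rc using R' by (auto simp: fun_eq_iff)
    then show ?thesis
      by (intro Exec_ex[OF Exec_Seq[OF T[folded Ra_def] Exec_Seq[OF e(1) Exec_Seq[OF e(2)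
        Exec_Seq[OF Td Exec_Seq[OF e(3) e(4)]]]]]])
  qed
  have "halts_with (code 0 ((d ;; mkconsts 14 N) ;; COPY 5 off1 ;; ?M ;; Cond 8 15 (COPY 14 0) (COPY 15 0))) y [p]
     (if y = x then ord_one else ord_zero)" for y
  proof -
    \<comment> \<open>The simulation ends at \<open>u0\<close>, the first mismatch or else the
      halting stage of the search. As the search shows every ordinal, there is no mismatch exactly
      if the oracle is \<open>x\<close>.\<close>
    define bad where "bad u \<longleftrightarrow> u < h \<and> (snd (the (?C u)) 0 \<in> x \<longleftrightarrow> snd (the (?C u)) 0 \<notin> y)" for u
    define u0 where "u0 = (LEAST u. u = h \<or> bad u)"
    have u0: "u0 = h \<or> bad u0" unfolding u0_def by (rule LeastI[of _ h]) simp
    have good: "\<not> bad u" if "u < u0" for u using not_less_Least[OF that[unfolded u0_def]] by blast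
    have u0h: "u0 \<le> h" unfolding u0_def by (rule Least_le) simp
    have yx: "y = x \<longleftrightarrow> u0 = h"
    proof
      assume "y = x"
      then show "u0 = h" using u0 unfolding bad_def by blast
    next
      assume eq: "u0 = h"
      have "\<iota> \<in> y \<longleftrightarrow> \<iota> \<in> x" for \<iota>
      proof -
        obtain t c' where t: "?C t = Some c'" "\<not> halted Q c'" "snd c' 0 = \<iota>" using Q(2) by blast
        have "t < h"
        proof (rule ccontr)
          assume "\<not> t < h"
          then have "?C t = Some c" using traj_halted[OF traj_run c, of t] by simp
          then show False using t c by simp
        qed
        then have "\<not> bad t" using good eq by simp
        then show ?thesis using t \<open>t < h\<close> unfolding bad_def by auto
      qed
      then show "y = x" by blast
    qed
    have Rk1: "R off1 = snd cc 0" if "rep off1 7 k1 (length Q) cc R" for cc R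
      using that k1 unfolding rep_def by fastforce
    have "\<exists>K R. Iter 7 (14 + length Q) (simbody off1 7 14 8 (COPY 14) ?H Q) y R1 K R \<and>
      rep off1 7 k1 (length Q) (the (?C u0)) R \<and> (\<forall>j. j \<notin> ?PP1 \<longrightarrow> R j = R1 j) \<and>
      (\<forall>u j. ord_zero \<le> u \<longrightarrow> u < u0 \<longrightarrow> Q ! fst (the (?C u)) = Query j \<longrightarrow>
         (\<exists>Tq Rq. Tq \<subseteq> K \<and> Rq (off1 + j) = snd (the (?C u)) j \<and> True))"
    proof (rule sim_simple[where W = "\<lambda>_ _ _. True", OF traj_run])
      show "?C u0 \<noteq> None" using traj_defined[OF traj_run _, of Q "{}" "[\<xi>]" h u0] c(1) u0h
        by (cases "u0 = h") auto
      show "fst (the (?C u)) < length Q" if "u < u0" for u using line[of u] that u0h by simp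
      show "kconsts 14 (length Q) R1" using kc unfolding kconsts_def N_def by simp
      show "R1 (14 + 1) = ord_one" using R1(4)[of 1] by (simp add: N_def num_1)
      show "R1 8 = ord_zero" using R1z by simp
      show "rep off1 7 k1 (length Q) (the (?C ord_zero)) R1"
        unfolding run_zero option.sel
      proof (rule rep_init)
        show "R1 7 = ord_zero" using R1z by simp
        show "R1 (off1 + i) = (if i < length [\<xi>] then [\<xi>] ! i else ord_zero)" for i
          using R1(3) R1(5)[of "off1 + i"] by (cases i) (auto simp: off1_def)
      qed
    next
      fix u R assume u: "ord_zero \<le> u" "u < u0" and R: "rep off1 7 k1 (length Q) (the (?C u)) R"
        "\<And>j. j \<notin> ?PP1 \<Longrightarrow> R j = R1 j"
      have "R off1 \<in> x \<longleftrightarrow> R off1 \<in> y" using good[OF u(2)] u(2) u0h Rk1[OF R(1)] unfolding bad_def by auto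
      then show "\<exists>T. Exec ?H y R T R" using hook[where R = R and y = y, OF R(2)] by simp
    next
      show "wc ?H i = 0" if "i \<in> ?PP1" for i by (rule wcH) (use that in \<open>auto simp: off2_def off1_def\<close>)
    next
      fix R j assume j: "j < k1" and R: "\<And>i. i \<notin> ?PP1 \<Longrightarrow> R i = R1 i"
      have "R 14 = ord_zero" using R[of 14] R1(4)[of 0] by (auto simp: off1_def num_0)
      then show "\<exists>T. Exec (COPY 14 (off1 + j)) y R T (R(off1 + j := if R (off1 + j) \<in> {} then ord_one else ord_zero)) \<and> True"
        using Exec_COPY[of 14 "off1 + j" y R] by auto
    next
      fix i assume i: "i \<notin> ?PP1" "R1 i \<noteq> ord_zero"
      have "wc ?H i = 0" by (rule wcH) (use i R1z in auto)
      moreover have "i \<noteq> off1 + j" if "j < k1" for j using i that by auto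
      ultimately show "wc ?H i = 0 \<and> (\<forall>j<k1. wc (COPY 14 (off1 + j)) i = 0)" by simp
    qed (use k1 k2 in \<open>auto simp: N_def off1_def\<close>)
    then obtain K R where KR: "Iter 7 (14 + length Q) (simbody off1 7 14 8 (COPY 14) ?H Q) y R1 K R"
      "rep off1 7 k1 (length Q) (the (?C u0)) R" and KR3': "\<forall>j. j \<notin> ?PP1 \<longrightarrow> R j = R1 j"
      by (elim exE conjE)
    note KR3 = KR3'[rule_format]
    have Rk: "R (14 + l) = num l" if "l \<le> N" for l using KR3[of "14 + l"] R1(4)[OF that] that by (auto simp: off1_def)
    have R8: "R 8 = ord_zero" using KR3[of 8] R1z by (auto simp: off1_def)
    have "\<exists>T R'. Exec ?M y R1 T R' \<and> R' 8 = (if y = x then ord_zero else ord_one) \<and> R' 14 = ord_zero \<and> R' 15 = ord_one"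
    proof (cases "u0 = h")
      case True
      then have "R 7 = num (length Q)" using rep_halted[OF KR(2)] c by (simp add: halted_def)
      then have "R 7 = R (14 + length Q)" using Rk[of "length Q"] by (simp add: N_def)
      from sim_halt[OF KR(1) refl this] show ?thesis
        using True yx R8 Rk[of 0] Rk[of 1] by (auto simp: N_def num_0 num_1)
    next
      case False
      then have b: "bad u0" using u0 by simp
      then have "\<not> (R off1 \<in> x \<longleftrightarrow> R off1 \<in> y)" using Rk1[OF KR(2)] unfolding bad_def by auto
      then obtain T where T: "Exec ?H y R T (R(8 := ord_one))" using hook[where R = R and y = y, OF KR3] by auto
      have "R 7 \<noteq> R (14 + length Q)"
        using rep_halted[OF KR(2)] line[of u0] b Rk[of "length Q"] unfolding bad_def by (simp add: N_def)
      then have "\<exists>K'. K \<subseteq> K' \<and> Exec ?M y R1 K' ((R(8 := ord_one))(7 := (R(8 := ord_one)) (14 + length Q)))"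
        by (intro sim_stop[OF KR(1) refl _ T]) (use Rk[of 1] in \<open>auto simp: N_def num_1\<close>)
      then obtain K' where K': "Exec ?M y R1 K' ((R(8 := ord_one))(7 := (R(8 := ord_one)) (14 + length Q)))" by blast
      have "y \<noteq> x" using False yx by simp
      then show ?thesis using Rk[of 0] Rk[of 1]
        by (intro exI[of _ K'] exI[of _ "(R(8 := ord_one))(7 := (R(8 := ord_one)) (14 + length Q))"] conjI K')
          (auto simp: N_def num_0 num_1)
    qed
    then obtain T R' where R': "Exec ?M y R1 T R'" "R' 8 = (if y = x then ord_zero else ord_one)"
      "R' 14 = ord_zero" "R' 15 = ord_one" by blast
    have "\<exists>T. Exec (Cond 8 15 (COPY 14 0) (COPY 15 0)) y R' T (R'(0 := if y = x then ord_one else ord_zero))"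
    proof (cases "y = x")
      case True
      then have "R' 8 \<noteq> R' 15" using R' by simp
      show ?thesis by (rule Exec_ex[OF Exec_Cond_False[OF Exec_COPY \<open>R' 8 \<noteq> R' 15\<close>]]) (simp add: True R')
    next
      case False
      then have "R' 8 = R' 15" using R' by simp
      show ?thesis by (rule Exec_ex[OF Exec_Cond_True[OF Exec_COPY \<open>R' 8 = R' 15\<close>]]) (simp add: False R')
    qed
    then obtain T2 where T2: "Exec (Cond 8 15 (COPY 14 0) (COPY 15 0)) y R' T2 (R'(0 := if y = x then ord_one else ord_zero))"
      by blast
    obtain T0 where T0: "Exec (d ;; mkconsts 14 N) y (snd (init_config [p])) T0 R0"
      using pd[of y] unfolding R0_def[abs_def] by blast
    have "Exec (COPY 5 off1) y R0 {R0} R1" unfolding R1_def by (rule Exec_COPY)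
    from run_code(1)[OF Exec_Seq[OF T0 Exec_Seq[OF this Exec_Seq[OF R'(1) T2]]]] show ?thesis by simp
  qed
  then show ?thesis unfolding RECOG_def wITRM_recognizable_def by blast
qed

text \<open>Registers cannot skip values: a copy brings nothing new, an increment adds 1, the empty
  oracle yields 0, and an inferior limit of values below \<iota> is at most \<iota>. So a value
  above \<iota> appears only after \<iota> has been reached.\<close>

lemma searchable_not_u_weak:
  assumes s: "wITRM_searchable TYPE('a)"
  shows "\<not> u_weak TYPE('a)"
proof
  assume w: "u_weak TYPE('a)"
  obtain Q \<xi> where Q: "halts Q {} [\<xi> :: 'a]"
    "\<And>\<iota> :: 'a. \<exists>(t :: 'a stage) c. run Q {} [\<xi>] t = Some c \<and> \<not> halted Q c \<and> snd c 0 = \<iota>"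
    using s unfolding wITRM_searchable_def by blast
  let ?C = "run Q {} [\<xi>] :: 'a \<Rightarrow> 'a config option"
  obtain t :: 'a where t: "halted_by Q {} [\<xi>] t" using w Q(1) unfolding u_weak_def by blast
  define t0 where "t0 = (LEAST t :: 'a. halted_by Q {} [\<xi>] t)"
  have "halted_by Q {} [\<xi>] t0" unfolding t0_def using t by (rule LeastI)
  then obtain c0 where c0: "?C t0 = Some c0" "halted Q c0" unfolding halted_by_def by blast
  have def: "?C v \<noteq> None" if "v < t0" for v
    by (rule traj_defined[OF traj_run _ that]) (use c0 in simp)
  have line: "fst (the (?C v)) \<le> length Q" if "v < t0" for v
  proof -
    have "\<not> halted_by Q {} [\<xi>] v" using not_less_Least[OF that[unfolded t0_def]] .
    then have "\<not> halted Q (the (?C v))" using def[OF that] unfolding halted_by_def by auto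
    then show ?thesis by (simp add: halted_def)
  qed
  define val where "val v i = snd (the (?C v)) i" for v i
  have vis: "\<exists>v<t0. val v 0 = \<iota>" for \<iota>
  proof -
    obtain s :: "'a stage" and c where s: "run Q {} [\<xi>] s = Some c" "\<not> halted Q c" "snd c 0 = \<iota>" using Q(2) by blast
    have h: "run Q {} [\<xi>] (stg t0) = Some c0" using c0(1) by (simp add: run_stg)
    have "s < stg t0"
    proof (rule ccontr)
      assume "\<not> s < stg t0"
      then have "run Q {} [\<xi>] s = Some c0" using traj_halted[OF traj_run h c0(2), of s] by simp
      then show False using s c0 by simp
    qed
    then obtain v where "v < t0" "s = stg v" using stg_initial by blast
    then show ?thesis using s unfolding val_def by (intro exI[of _ v]) (simp add: run_stg)
  qed
  define \<phi> where "\<phi> \<iota> = (LEAST v. \<exists>i. \<iota> \<le> val v i)" for \<iota>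
  have ex: "\<exists>i. \<iota> \<le> val (\<phi> \<iota>) i" and lt: "\<phi> \<iota> < t0" for \<iota>
  proof -
    obtain v where v: "v < t0" "val v 0 = \<iota>" using vis by blast
    then have v': "\<exists>i. \<iota> \<le> val v i" by (intro exI[of _ 0]) simp
    show "\<exists>i. \<iota> \<le> val (\<phi> \<iota>) i" unfolding \<phi>_def by (rule LeastI[of _ v]) (rule v')
    have "\<phi> \<iota> \<le> v" unfolding \<phi>_def by (rule Least_le) (rule v')
    then show "\<phi> \<iota> < t0" using v(1) by simp
  qed
  have least: "val w i < \<iota>" if "w < \<phi> \<iota>" for w i \<iota>
    using not_less_Least[OF that[unfolded \<phi>_def]] by (meson not_le)
  \<comment> \<open>Values up to \<open>\<xi>\<close> are excluded because the parameter stands in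
    register 0 from the beginning.\<close>
  have mono: "\<phi> \<iota> < \<phi> \<iota>'" if \<iota>: "\<xi> < \<iota>" "\<iota> < \<iota>'" for \<iota> \<iota>'
  proof (rule ccontr)
    assume "\<not> \<phi> \<iota> < \<phi> \<iota>'"
    then have le: "\<phi> \<iota>' \<le> \<phi> \<iota>" by simp
    define v where "v = \<phi> \<iota>'"
    have below: "val w i < \<iota>" if "w < v" for w i using least[of w \<iota>] that le unfolding v_def by simp
    obtain i where i: "\<iota>' \<le> val v i" using ex unfolding v_def by blast
    have vt: "v < t0" unfolding v_def by (rule lt)
    have "val v i \<le> \<iota>"
    proof (cases "is_limit v")
      case True
      then obtain w where w: "w < v" unfolding is_limit_def by blast
      obtain c where c: "?C v = Some c" using def[OF vt] by blast
      have "limit_config v ?C = Some (fst c, snd c)" using run_limit[OF True, of Q "{}" "[\<xi>]"] c by simp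
      from limit_configD(2)[OF w this, of "length Q" i]
      have "is_lim w v (\<lambda>u. {val u i}) (val v i)" using line vt c unfolding val_def by fastforce
      then show ?thesis by (rule is_lim_le) (use below in \<open>auto intro: less_imp_le\<close>)
    next
      case nl: False
      show ?thesis
      proof (cases "\<exists>w. covers w v")
        case True
        then obtain w where w: "covers w v" by blast
        then have wv: "w < v" unfolding covers_def by simp
        obtain l R where c: "?C w = Some (l, R)" using def[OF less_trans[OF wv vt]] by auto
        have vw: "R j < \<iota>" for j using below[OF wv, of j] c unfolding val_def by simp
        have "?C v = Some (step Q {} (l, R))" using run_covers[OF w, of Q "{}" "[\<xi>]"] c by simp
        then have vv: "val v i = snd (step Q {} (l, R)) i" unfolding val_def by simp
        show ?thesis
        proof (cases "halted Q (l, R)")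
          case True
          then show ?thesis using vv vw[of i] by (simp add: step_halted less_imp_le)
        next
          case False
          then have l: "l < length Q" by (simp add: halted_def)
          show ?thesis using vv vw unfolding step_config[OF l]
            by (cases "Q ! l") (auto simp: ord_suc_le_iff intro: less_imp_le)
        qed
      next
        case False
        then have "\<not> s < v" for s using nl unfolding is_limit_def by blast
        then have "?C v = Some (init_config [\<xi>])" by (rule run_start)
        then show ?thesis using \<iota>(1) unfolding val_def init_config_def by (auto intro: less_imp_le)
      qed
    qed
    with i \<iota>(2) show False by simp
  qed
  obtain B where B: "\<xi> < B" "t0 < B" "ord_one < B"
  proof -
    obtain B where "max \<xi> (max t0 ord_one) < B" using no_max by blast
    then have "\<xi> < B" "t0 < B" "ord_one < B" by simp_all
    then show ?thesis by (rule that)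
  qed
  show False
  \<comment> \<open>Ordinals up to \<open>\<xi>\<close> are placed in row 0 as themselves, the
    others in row 1 at their first time.\<close>
  proof (rule no_lex[of "\<lambda>\<iota>. if \<iota> \<le> \<xi> then ord_zero else ord_one" B "\<lambda>\<iota>. if \<iota> \<le> \<xi> then \<iota> else \<phi> \<iota>"])
    show "(if v \<le> \<xi> then ord_zero else ord_one) < B" for v
      using B(3) less_trans[OF zero_less_one B(3)] by simp
    show "(if v \<le> \<xi> then v else \<phi> v) < B" for v using B lt[of v] by (auto intro: less_trans le_less_trans)
    show "lexl (if v \<le> \<xi> then ord_zero else ord_one, if v \<le> \<xi> then v else \<phi> v)
       (if w \<le> \<xi> then ord_zero else ord_one, if w \<le> \<xi> then w else \<phi> w)" if "v < w" for v w
      using that mono[of v w] by (auto simp: lexl_def)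
  qed
qed

text \<open>The counter \<open>c\<close> starts at 0, moves up one at a time and is reset only when
  \<open>w\<close> grows. If it missed \<iota>, it would stay below \<iota>; then the increasing
  pairs of \<open>w\<close> and \<open>c\<close> would live in a bounded square for \<alpha> many
  steps.\<close>

lemma coverage:
  fixes w c :: "'a stage \<Rightarrow> 'a"
  assumes s: "s < top_stage" and start: "c s = ord_zero"
    and step: "\<And>u. s \<le> u \<Longrightarrow> u < top_stage \<Longrightarrow>
      w (ord_suc u) = w u \<and> c (ord_suc u) = ord_suc (c u) \<or> w u < w (ord_suc u) \<and> c (ord_suc u) = ord_zero"
    and lim: "\<And>l. is_limit l \<Longrightarrow> s < l \<Longrightarrow> l < top_stage \<Longrightarrow>
      is_lim s l (\<lambda>u. {w u}) (w l) \<and> is_lim s l (\<lambda>u. {c u}) (c l)"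
    and bd: "\<And>u. s \<le> u \<Longrightarrow> u < top_stage \<Longrightarrow> w u \<le> B"
  shows "\<exists>u. s \<le> u \<and> u < top_stage \<and> c u = \<iota>"
proof (rule ccontr)
  assume "\<not> ?thesis"
  then have no: "c u \<noteq> \<iota>" if "s \<le> u" "u < top_stage" for u using that by blast
  have less: "u < top_stage \<longrightarrow> c u < \<iota>" if "s \<le> u" for u
    using that
  proof (induction u rule: stage_interval_induct)
    case start
    show ?case using no[of s] s assms(2) by (metis neq_ord_zero_iff order_refl)
  next
    case (suc u)
    show ?case
    proof
      assume l: "ord_suc u < top_stage"
      then have u: "u < top_stage" by (rule less_trans[OF stage_suc_gt])
      have "c (ord_suc u) \<le> \<iota>" using step[OF suc.hyps u] suc.IH u by (auto simp: ord_suc_le_iff)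
      then show "c (ord_suc u) < \<iota>" using no[OF stage_le_suc[OF suc.hyps] l] by simp
    qed
  next
    case (limit l)
    show ?case
    proof
      assume l: "l < top_stage"
      have "c l \<le> \<iota>"
      proof (rule is_lim_le[OF conjunct2[OF lim[OF limit(1,2) l]]])
        fix u y assume u: "s \<le> u" "u < l" "y \<in> {c u}"
        have "u < top_stage" using u(2) l by (rule less_trans)
        then show "y \<le> \<iota>" using limit(3)[OF u(1,2)] u(3) by simp
      qed simp
      then show "c l < \<iota>" using no[OF less_imp_le[OF limit(2)] l] by simp
    qed
  qed
  have lex: "lexl (w u, c u) (w u', c u')" if "s \<le> u" "u < u'" "u' < top_stage" for u u'
  proof (rule lex_increasing[OF _ lim that])
    fix u assume u: "s \<le> u" "ord_suc u < top_stage"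
    have "u < top_stage" using u(2) by (rule less_trans[OF stage_suc_gt])
    then show "w (ord_suc u) = w u \<and> c (ord_suc u) = ord_suc (c u) \<or> w u < w (ord_suc u)" using step[OF u(1)] by blast
  qed
  obtain z where z: "s = stg z" using less_top_ex[OF s] by blast
  obtain M where M: "ord_suc B < M" "z < M" "\<iota> < M"
  proof -
    obtain M where "max (ord_suc B) (max z \<iota>) < M" using no_max by blast
    then have "ord_suc B < M" "z < M" "\<iota> < M" by simp_all
    then show ?thesis by (rule that)
  qed
  \<comment> \<open>The times before \<open>s\<close> fill row 0; the row numbers \<open>w\<close>
    are shifted by one to make room.\<close>
  let ?f = "\<lambda>v. if v < z then ord_zero else ord_suc (w (stg v))" and ?g = "\<lambda>v. if v < z then v else c (stg v)"
  show False
  proof (rule no_lex[of ?f M ?g])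
    fix v
    have b: "w (stg v) \<le> B" "c (stg v) < \<iota>" if "\<not> v < z"
      using that bd[of "stg v"] less[of "stg v"] z by auto
    show "?f v < M"
    proof (cases "v < z")
      case True
      have "(ord_zero :: 'a) < M" using M(2) by (rule le_less_trans[OF ord_zero_le])
      then show ?thesis using True by simp
    next
      case False
      then have "ord_suc (w (stg v)) \<le> ord_suc B" using b(1) by (simp add: ord_suc_le_iff less_ord_suc_iff)
      then show ?thesis using False M(1) by simp
    qed
    show "?g v < M" using b M by (auto intro: less_trans)
  next
    fix v v' :: 'a assume vv: "v < v'"
    show "lexl (?f v, ?g v) (?f v', ?g v')"
    proof (cases "v' < z")
      case True
      then have "v < z" using vv by simp
      then show ?thesis using True vv by (simp add: lexl_def)
    next
      case v': False
      show ?thesis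
      proof (cases "v < z")
        case True
        have "ord_zero < ord_suc (w (stg v'))" by (rule le_less_trans[OF ord_zero_le ord_suc_gt])
        then show ?thesis using v' True by (simp add: lexl_def)
      next
        case False
        have "lexl (w (stg v), c (stg v)) (w (stg v'), c (stg v'))"
          by (rule lex) (use False vv z in auto)
        then show ?thesis using v' False by (auto simp: lexl_def ord_suc_mono)
      qed
    qed
  qed
qed

end

text \<open>A finite-memory device which detects that each of the conditions \<open>q i\<close> holds cofinally often.\<close>
locale flags = exp_closed ty for ty :: "'a::wellorder itself" +
  fixes f :: "nat \<Rightarrow> 'a stage \<Rightarrow> 'a" and q :: "nat \<Rightarrow> 'a stage \<Rightarrow> bool" and k :: nat and s l :: "'a stage"
  assumes l: "is_limit l" "s < l"
    and two: "\<And>i u. i \<le> k \<Longrightarrow> s \<le> u \<Longrightarrow> u < l \<Longrightarrow> f i u = ord_zero \<or> f i u = ord_one"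
    and clear: "\<And>u i. s \<le> u \<Longrightarrow> u < l \<Longrightarrow> (\<And>i. i \<le> k \<Longrightarrow> f i u = ord_one) \<Longrightarrow> i \<le> k \<Longrightarrow> f i (ord_suc u) = ord_zero"
    and change: "\<And>u i j. s \<le> u \<Longrightarrow> u < l \<Longrightarrow> j \<le> k \<Longrightarrow> f j u \<noteq> ord_one \<Longrightarrow> i \<le> k \<Longrightarrow>
       f i (ord_suc u) = f i u \<or> f i (ord_suc u) = ord_one \<and> q i u"
    and set: "\<And>u i. s \<le> u \<Longrightarrow> u < l \<Longrightarrow> i \<le> k \<Longrightarrow> f i u \<noteq> ord_one \<Longrightarrow> (\<And>j. j < i \<Longrightarrow> f j u = ord_one) \<Longrightarrow> q i u \<Longrightarrow>
       f i (ord_suc u) = ord_one"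
    and lim: "\<And>l' i. is_limit l' \<Longrightarrow> s < l' \<Longrightarrow> l' < l \<Longrightarrow> i \<le> k \<Longrightarrow> is_lim s l' (\<lambda>u. {f i u}) (f i l')"
begin

definition "full u \<longleftrightarrow> (\<forall>i\<le>k. f i u = ord_one)"

lemma persist:
  assumes a: "s \<le> a" "i \<le> k" "f i a = y"
    and keep: "\<And>u. a \<le> u \<Longrightarrow> u < l \<Longrightarrow> f i u = y \<Longrightarrow> f i (ord_suc u) = y"
  shows "a \<le> u \<Longrightarrow> u < l \<Longrightarrow> f i u = y"
proof -
  have "u < l \<longrightarrow> f i u = y" if "a \<le> u" for u
    using that
  proof (induction u rule: stage_interval_induct)
    case (suc u)
    show ?case
    proof
      assume "ord_suc u < l"
      then have "u < l" by (rule less_trans[OF stage_suc_gt])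
      then show "f i (ord_suc u) = y" using suc keep by blast
    qed
  next
    case (limit m)
    show ?case
    proof
      assume m: "m < l"
      have sm: "s < m" using a(1) limit(2) by simp
      have "is_lim a m (\<lambda>u. {f i u}) (f i m)"
        by (rule is_lim_tail[OF lim[OF limit(1) sm m a(2)] sm limit(2)])
      moreover have "is_lim a m (\<lambda>u. {f i u}) y"
      proof (rule is_lim_const[OF limit(2)])
        fix r assume r: "a \<le> r" "r < m"
        then have "r < l" using m by simp
        then show "{f i r} = {y}" using limit(3)[OF r] by simp
      qed
      ultimately show "f i m = y" by (rule is_lim_unique)
    qed
  qed (use a in simp)
  then show "a \<le> u \<Longrightarrow> u < l \<Longrightarrow> f i u = y" by blast
qed

text \<open>When all flags are up they are cleared at the next step, and flag \<open>i\<close> rises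
  again only at a stage with \<open>q i\<close>.\<close>

lemma full_cofinal_imp:
  assumes cof: "\<And>u. s \<le> u \<Longrightarrow> u < l \<Longrightarrow> \<exists>v. u \<le> v \<and> v < l \<and> full v" and i: "i \<le> k" and u: "s \<le> u" "u < l"
  shows "\<exists>v. u \<le> v \<and> v < l \<and> q i v"
proof (rule ccontr)
  assume no: "\<not> ?thesis"
  obtain a where a: "u \<le> a" "a < l" "full a" using cof u by blast
  have sa: "s \<le> ord_suc a" "ord_suc a < l" using a u is_limit_suc[OF l(1)] by (auto intro: stage_le_suc)
  have z: "f i (ord_suc a) = ord_zero" by (rule clear[OF _ a(2)]) (use a u i in \<open>auto simp: full_def\<close>)
  have keep: "f i (ord_suc v) = ord_zero" if v: "ord_suc a \<le> v" "v < l" "f i v = ord_zero" for v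
  proof -
    have uv: "u \<le> v" "s \<le> v" using v a u by (meson less_imp_le order_trans stage_suc_gt)+
    have "f i v \<noteq> ord_one" using v(3) by simp
    from change[OF uv(2) v(2) i this i] show ?thesis using no uv v by auto
  qed
  obtain b where b: "ord_suc a \<le> b" "b < l" "full b" using cof[OF sa] by blast
  have "f i b = ord_zero" using persist[OF sa(1) i z keep b(1,2)] .
  then show False using b(3) i by (simp add: full_def)
qed

text \<open>If the flags were never all up from \<open>u\<close> on, none would be lowered again.
  They are raised in order, so by induction on \<open>i\<close> the first \<open>i\<close> flags
  eventually stay up, and finally all of them do.\<close>

lemma full_cofinal:
  assumes cof: "\<And>i u. i \<le> k \<Longrightarrow> s \<le> u \<Longrightarrow> u < l \<Longrightarrow> \<exists>v. u \<le> v \<and> v < l \<and> q i v" and u: "s \<le> u" "u < l"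
  shows "\<exists>v. u \<le> v \<and> v < l \<and> full v"
proof (rule ccontr)
  assume no: "\<not> ?thesis"
  have keep1: "f i v = ord_one" if "u \<le> a" "i \<le> k" "f i a = ord_one" "a \<le> v" "v < l" for i a v
  proof (rule persist[OF _ that(2,3) _ that(4,5)])
    show "s \<le> a" using that u by simp
    fix w assume w: "a \<le> w" "w < l" "f i w = ord_one"
    have "\<not> full w" using no w that(1) by (meson order_trans)
    then obtain j where "j \<le> k" "f j w \<noteq> ord_one" unfolding full_def by blast
    moreover have "s \<le> w" using w(1) that(1) u(1) by (meson order_trans)
    ultimately show "f i (ord_suc w) = ord_one" using change[of w j i] w that(2) by auto
  qed
  have "i \<le> Suc k \<longrightarrow> (\<exists>a. u \<le> a \<and> a < l \<and> (\<forall>j<i. \<forall>v. a \<le> v \<longrightarrow> v < l \<longrightarrow> f j v = ord_one))" for i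
  proof (induction i)
    case 0
    show ?case using u by auto
  next
    case (Suc i)
    show ?case
    proof
      assume "Suc i \<le> Suc k"
      then have i: "i \<le> k" by simp
      with Suc obtain a where a: "u \<le> a" "a < l" "\<And>j v. j < i \<Longrightarrow> a \<le> v \<Longrightarrow> v < l \<Longrightarrow> f j v = ord_one" by auto
      obtain b where b: "a \<le> b" "b < l" "q i b" using cof[OF i, of a] a u by (meson order_trans)
      have sb: "s \<le> b" "u \<le> b" using b a u by (meson order_trans)+
      have "f i (ord_suc b) = ord_one"
      proof (cases "f i b = ord_one")
        case True
        show ?thesis by (rule keep1[OF sb(2) i True]) (use is_limit_suc[OF l(1) b(2)] in \<open>auto intro: less_imp_le\<close>)
      next
        case False
        show ?thesis by (rule set[OF sb(1) b(2) i False _ b(3)]) (use a b in auto)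
      qed
      then have "f i v = ord_one" if "ord_suc b \<le> v" "v < l" for v
        using keep1[of "ord_suc b" i v] that sb i by (auto intro: stage_le_suc)
      moreover have "f j v = ord_one" if "j < i" "ord_suc b \<le> v" "v < l" for j v
        using a(3)[OF that(1) _ that(3)] that(2) b(1) by (meson less_imp_le order_trans stage_suc_gt)
      ultimately show "\<exists>a. u \<le> a \<and> a < l \<and> (\<forall>j<Suc i. \<forall>v. a \<le> v \<longrightarrow> v < l \<longrightarrow> f j v = ord_one)"
        using sb(2) is_limit_suc[OF l(1) b(2)]
        by (intro exI[of _ "ord_suc b"]) (auto simp: less_Suc_eq intro: stage_le_suc)
    qed
  qed
  from this[of "Suc k"] obtain a where "u \<le> a" "a < l" "\<forall>j<Suc k. \<forall>v. a \<le> v \<longrightarrow> v < l \<longrightarrow> f j v = ord_one" by blast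
  then have "full a" unfolding full_def by (simp add: less_Suc_eq_le)
  then show False using no \<open>u \<le> a\<close> \<open>a < l\<close> by blast
qed

end

section \<open>Comparing configurations\<close>

fun eqall :: "(nat \<times> nat) list \<Rightarrow> com \<Rightarrow> com \<Rightarrow> com" where
  "eqall [] c d = c"
| "eqall ((i, j) # L) c d = Cond i j (eqall L c d) d"

lemma eqall_wc: "wc (eqall L c d) i \<le> max (wc c i) (wc d i)"
  by (induction L c d rule: eqall.induct) auto

context exp_closed begin

lemma Exec_eqall_True:
  assumes "\<And>i j. (i, j) \<in> set L \<Longrightarrow> R i = R j" "Exec c x R T R'"
  shows "\<exists>T'. T \<subseteq> T' \<and> T' \<subseteq> insert R T \<and> Exec (eqall L c d) x R T' R'"
  using assms(1)
proof (induction L)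
  case Nil
  then show ?case using assms(2) by auto
next
  case (Cons p L)
  obtain i j where p: "p = (i, j)" by (cases p)
  obtain T' where T': "T \<subseteq> T'" "T' \<subseteq> insert R T" "Exec (eqall L c d) x R T' R'" using Cons by auto
  have "R i = R j" using Cons.prems p by simp
  from Exec_Cond_True[OF T'(3) this] show ?case unfolding p eqall.simps
    by (intro exI[of _ "insert R T'"] conjI) (use T'(1,2) in auto)
qed

lemma Exec_eqall_False:
  assumes "(i, j) \<in> set L" "R i \<noteq> R j" "Exec d x R T R'"
  shows "\<exists>T'. T \<subseteq> T' \<and> T' \<subseteq> insert R (insert R' T) \<and> Exec (eqall L c d) x R T' R'"
  using assms(1)
proof (induction L)
  case (Cons p L)
  obtain a b where p: "p = (a, b)" by (cases p)
  show ?case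
  proof (cases "R a = R b")
    case True
    then have "(i, j) \<in> set L" using Cons.prems p assms(2) by auto
    then obtain T' where T': "T \<subseteq> T'" "T' \<subseteq> insert R (insert R' T)" "Exec (eqall L c d) x R T' R'"
      using Cons.IH by blast
    from Exec_Cond_True[OF T'(3) True] show ?thesis unfolding p eqall.simps
      by (intro exI[of _ "insert R T'"] conjI) (use T'(1,2) in auto)
  next
    case False
    from Exec_Cond_False[OF assms(3) False] show ?thesis unfolding p eqall.simps
      by (intro exI[of _ "insert R (insert R' T)"] conjI) auto
  qed
qed simp

end

section \<open>Computations of length at least \<open>\<alpha>\<close>\<close>

locale long_run = exp_closed ty for ty :: "'a::wellorder itself" +
  fixes P :: program and k :: nat and \<rho> :: 'a and h :: "'a stage" and ch :: "'a config"
  assumes P: "regs_below k P" "1 \<le> k"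
    and h: "run P {} [\<rho>] h = Some ch" "halted P ch"
    and line: "\<And>u. u < h \<Longrightarrow> fst (the (run P {} [\<rho>] u)) < length P"
    and top: "top_stage \<le> h"
begin

abbreviation C :: "'a stage \<Rightarrow> 'a config option" where "C \<equiv> run P {} [\<rho>]"

lemma Cdef: "u \<le> h \<Longrightarrow> C u \<noteq> None"
  using traj_defined[OF traj_run, of P "{}" "[\<rho>]" h u] h(1) by (cases "u = h") auto

lemma Csome: "u \<le> h \<Longrightarrow> C u = Some (fst (the (C u)), snd (the (C u)))"
  using Cdef by fastforce

text \<open>No instruction mentions these registers. Hence line and first \<open>k\<close> registers
  determine a configuration, and finitely many comparisons recognize the one at time
  \<alpha>.\<close>

lemma unused: "u \<le> h \<Longrightarrow> k \<le> i \<Longrightarrow> snd (the (C u)) i = ord_zero"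
proof -
  have "k \<le> i \<longrightarrow> u \<le> h \<longrightarrow> snd (the (C u)) i = ord_zero" for u
  proof -
    have "ord_zero \<le> u" by simp
    then show ?thesis
    proof (induction u rule: stage_interval_induct)
      case start
      show ?case using P(2) by (auto simp: run_zero init_config_def)
    next
      case (suc u)
      show ?case
      proof (intro impI)
        assume i: "k \<le> i" and "ord_suc u \<le> h"
        then have u: "u < h" by (simp add: stage_suc_le_iff)
        obtain l R where lR: "C u = Some (l, R)" using Csome[OF less_imp_le[OF u]] by blast
        have l: "l < length P" using line[OF u] lR by simp
        have Ri: "R i = ord_zero" using suc.IH i u lR by simp
        have "C (ord_suc u) = Some (exec (P ! l) {} (l, R))"
          using traj_exec[OF traj_run lR l] .
        moreover have "i \<notin> iregs (P ! l)" using P(1) l i unfolding regs_below_def by (meson leD nth_mem)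
        ultimately show "snd (the (C (ord_suc u))) i = ord_zero" using Ri by (cases "P ! l") auto
      qed
    next
      case (limit l)
      show ?case
      proof (intro impI)
        assume i: "k \<le> i" and lh: "l \<le> h"
        have "is_lim ord_zero l (\<lambda>u. {snd (the (C u)) i}) (snd (the (C l)) i)"
          by (rule traj_limitD(2)[OF traj_run limit(1,2), of P "{}" "[\<rho>]" _ "length P"])
            (use Csome[OF lh] line lh in \<open>auto intro: less_imp_le\<close>)
        moreover have "is_lim ord_zero l (\<lambda>u. {snd (the (C u)) i}) ord_zero"
        proof (rule is_lim_const[OF limit(2)])
          fix u assume u: "ord_zero \<le> u" "u < l"
          then show "{snd (the (C u)) i} = {ord_zero}" using limit(3)[OF u] i lh by simp
        qed
        ultimately show "snd (the (C l)) i = ord_zero" by (rule is_lim_unique)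
      qed
    qed
  qed
  then show "u \<le> h \<Longrightarrow> k \<le> i \<Longrightarrow> snd (the (C u)) i = ord_zero" by blast
qed

definition ls :: nat where "ls = fst (the (C top_stage))"
definition r :: "nat \<Rightarrow> 'a" where "r = snd (the (C top_stage))"

lemma C_top: "C top_stage = Some (ls, r)"
  using Csome[OF top] unfolding ls_def r_def .

lemma C_lim:
  assumes "is_limit l" "l \<le> h" "s < l"
  shows "is_lim s l (\<lambda>u. {fst (the (C u))}) (fst (the (C l)))" "is_lim s l (\<lambda>u. {snd (the (C u)) i}) (snd (the (C l)) i)"
proof -
  obtain c where c: "C l = Some c" using Cdef[OF assms(2)] by blast
  have ln: "fst (the (C u)) \<le> length P" if "s \<le> u" "u < l" for u
  proof -
    have "u < h" using that(2) assms(2) by simp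
    then show ?thesis using line by (simp add: less_imp_le)
  qed
  show "is_lim s l (\<lambda>u. {fst (the (C u))}) (fst (the (C l)))" "is_lim s l (\<lambda>u. {snd (the (C u)) i}) (snd (the (C l)) i)"
    using traj_limitD[OF traj_run assms(1,3) c ln] c by auto
qed

text \<open>Before \<alpha> the active line is below \<open>length P\<close>, and so is the inferior
  limit of these finitely many indices. A program never halts at a limit time by itself, so the
  halting stage lies strictly beyond \<alpha>.\<close>

lemma ls_less: "ls < length P" and top_less: "top_stage < h"
proof -
  have z: "ord_zero < top_stage" using top_is_limit unfolding is_limit_def by (metis neq_ord_zero_iff not_less_ord_zero)
  have ln: "fst (the (C u)) < length P" if "u < top_stage" for u using line[of u] that top by simp
  have "ls \<le> length P - 1"
    unfolding ls_def by (rule is_lim_le[OF C_lim(1)[OF top_is_limit top z]]) (use ln in fastforce)+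
  then show 1: "ls < length P" using ln[OF z] by simp
  then have "top_stage \<noteq> h" using h C_top by (auto simp: halted_def)
  then show "top_stage < h" using top by simp
qed

lemma is_lim_attained_le:
  assumes L: "is_lim s l (\<lambda>u. {f u}) v" and "\<And>u. s \<le> u \<Longrightarrow> u < l \<Longrightarrow> \<exists>w. u \<le> w \<and> w < l \<and> f w = y"
  shows "v \<le> y"
proof (rule ccontr)
  assume "\<not> v \<le> y"
  then have "y < v" by simp
  from is_limD1[OF L this] obtain u where u: "s \<le> u" "u < l" "\<forall>r z. u \<le> r \<longrightarrow> r < l \<longrightarrow> z \<in> {f r} \<longrightarrow> y < z" by blast
  from assms(2)[OF u(1,2)] obtain w where "u \<le> w" "w < l" "f w = y" by blast
  with u(3) show False by auto
qed

text \<open>If the configuration at time \<open>\<alpha>\<close> occurred cofinally often before, the segment between two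
  of its occurrences would be repeated forever.\<close>
lemma no_recurrence: "\<exists>\<zeta><top_stage. \<forall>s. \<zeta> \<le> s \<longrightarrow> s < top_stage \<longrightarrow> C s \<noteq> C top_stage"
proof (rule ccontr)
  assume "\<not> ?thesis"
  then have cof: "\<exists>s. z \<le> s \<and> s < top_stage \<and> C s = C top_stage" if "z < top_stage" for z using that by blast
  have z0: "ord_zero < top_stage" using top_is_limit unfolding is_limit_def by (metis neq_ord_zero_iff not_less_ord_zero)
  obtain s0 where s0: "s0 < top_stage" "C s0 = C top_stage" using cof[OF z0] by blast
  define N where "N s = (LEAST s'. s < s' \<and> C s' = C top_stage)" for s
  have N: "s < N s" "C (N s) = C top_stage" "N s < top_stage" if "s < top_stage" for s
  proof -
    have "ord_suc s < top_stage" by (rule is_limit_suc[OF top_is_limit that])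
    from cof[OF this] obtain s' where s': "s < s'" "s' < top_stage" "C s' = C top_stage" by (auto simp: stage_suc_le_iff)
    have "s < N s \<and> C (N s) = C top_stage" unfolding N_def by (rule LeastI[of _ s']) (use s' in simp)
    moreover have "N s \<le> s'" unfolding N_def by (rule Least_le) (use s' in simp)
    ultimately show "s < N s" "C (N s) = C top_stage" "N s < top_stage" using s' by auto
  qed
  have N_least: "N s \<le> s'" if "s < s'" "C s' = C top_stage" for s s'
    unfolding N_def by (rule Least_le) (use that in simp)
  let ?s1 = "N s0"
  have lineh: "fst (the (C u)) \<le> length P" if "u < h" for u using line[OF that] by simp
  \<comment> \<open>The segment between two successive occurrences starts from the same
    configuration every time, so each configuration of the first segment occurs again after any
    given stage below \<alpha>.\<close>
  have recur: "\<exists>w. u \<le> w \<and> w < top_stage \<and> C w = C v" if v: "s0 \<le> v" "v < ?s1" and u: "u < top_stage" for u v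
  proof -
    obtain s where s: "u \<le> s" "s < top_stage" "C s = C top_stage" using cof[OF u] by blast
    note Ns = N[OF s(2)]
    have "\<exists>\<tau>. \<tau> s = s0 \<and> (\<forall>u. s \<le> u \<longrightarrow> u \<le> N s \<longrightarrow> C (\<tau> u) = C u) \<and>
      (\<forall>u v. s \<le> u \<longrightarrow> u < v \<longrightarrow> v \<le> N s \<longrightarrow> \<tau> u < \<tau> v) \<and>
      (\<forall>u r. s \<le> u \<longrightarrow> u \<le> N s \<longrightarrow> s0 \<le> r \<longrightarrow> r < \<tau> u \<longrightarrow> (\<exists>v. s \<le> v \<and> v < u \<and> r = \<tau> v))"
    proof (rule traj_shift[OF traj_run traj_run, where n = "length P"])
      show "s \<le> N s" using Ns(1) by simp
      show "C s0 = C s" using s0 s by simp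
      show "C (N s) \<noteq> None" using Ns C_top by simp
      show "fst (the (C u)) \<le> length P" if "s \<le> u" "u < N s" for u
        by (rule lineh) (use that Ns top in \<open>meson less_le_trans less_trans\<close>)
    qed
    then obtain \<tau> where \<tau>: "\<tau> s = s0" "\<forall>u. s \<le> u \<longrightarrow> u \<le> N s \<longrightarrow> C (\<tau> u) = C u"
      "\<forall>u v. s \<le> u \<longrightarrow> u < v \<longrightarrow> v \<le> N s \<longrightarrow> \<tau> u < \<tau> v"
      "\<forall>u r. s \<le> u \<longrightarrow> u \<le> N s \<longrightarrow> s0 \<le> r \<longrightarrow> r < \<tau> u \<longrightarrow> (\<exists>v. s \<le> v \<and> v < u \<and> r = \<tau> v)"
      by (elim exE conjE)
    have "s0 < \<tau> (N s)" using \<tau>(1) \<tau>(3)[rule_format, of s "N s"] Ns by simp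
    moreover have "C (\<tau> (N s)) = C top_stage" using \<tau>(2)[rule_format, of "N s"] Ns by simp
    ultimately have "?s1 \<le> \<tau> (N s)" by (rule N_least)
    then have "v < \<tau> (N s)" using v(2) by simp
    from \<tau>(4)[rule_format, OF less_imp_le[OF Ns(1)] order_refl v(1) this] obtain w where
      w: "s \<le> w" "w < N s" "v = \<tau> w" by blast
    have "C w = C v" using \<tau>(2)[rule_format, of w] w by simp
    moreover have "u \<le> w" "w < top_stage" using w s Ns by auto
    ultimately show ?thesis by blast
  qed
  \<comment> \<open>The configuration at \<alpha> is an inferior limit, so it is componentwise at
    most anything that recurs cofinally.\<close>
  have ge: "ls \<le> fst (the (C v))" "r i \<le> snd (the (C v)) i" if v: "s0 \<le> v" "v < ?s1" for v i
  proof -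
    show "ls \<le> fst (the (C v))"
      unfolding ls_def by (rule is_lim_attained_le[OF C_lim(1)[OF top_is_limit top z0]]) (metis recur[OF v])
    show "r i \<le> snd (the (C v)) i"
      unfolding r_def by (rule is_lim_attained_le[OF C_lim(2)[OF top_is_limit top z0]]) (metis recur[OF v])
  qed
  let ?Q = "\<lambda>u s s'. \<forall>q. s \<le> q \<longrightarrow> q < s' \<longrightarrow> (\<exists>v. s0 \<le> v \<and> v < ?s1 \<and> C q = C v)"
  \<comment> \<open>The coarse sequence is constant, each coarse step being one passage of the
    segment. At limits of such passages nothing falls below \<open>(ls, r)\<close>, which itself
    recurs; so it is the limit configuration again, and the passages continue.\<close>
  have "\<exists>\<tau>. \<tau> ord_zero = s0 \<and> (\<forall>u. ord_zero \<le> u \<longrightarrow> u \<le> h \<longrightarrow> C (\<tau> u) = Some (ls, r)) \<and>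
    (\<forall>u v. ord_zero \<le> u \<longrightarrow> u < v \<longrightarrow> v \<le> h \<longrightarrow> \<tau> u < \<tau> v) \<and>
    (\<forall>u. ord_zero \<le> u \<longrightarrow> u < h \<longrightarrow> ?Q u (\<tau> u) (\<tau> (ord_suc u))) \<and>
    (\<forall>u r. ord_zero \<le> u \<longrightarrow> u \<le> h \<longrightarrow> s0 \<le> r \<longrightarrow> r < \<tau> u \<longrightarrow>
       (\<exists>v. ord_zero \<le> v \<and> v < u \<and> \<tau> v \<le> r \<and> r < \<tau> (ord_suc v)))"
  proof (rule simulation[where Q = ?Q and c = "\<lambda>_. (ls, r)" and D = C])
    show "C s0 = Some (ls, r)" using s0 C_top by simp
    show "(ord_zero :: 'a stage) \<le> h" by simp
  next
    fix u s :: "'a stage" assume s: "C s = Some (ls, r)"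
    have "\<exists>\<tau>. \<tau> s0 = s \<and> (\<forall>u. s0 \<le> u \<longrightarrow> u \<le> ?s1 \<longrightarrow> C (\<tau> u) = C u) \<and>
      (\<forall>u v. s0 \<le> u \<longrightarrow> u < v \<longrightarrow> v \<le> ?s1 \<longrightarrow> \<tau> u < \<tau> v) \<and>
      (\<forall>u r. s0 \<le> u \<longrightarrow> u \<le> ?s1 \<longrightarrow> s \<le> r \<longrightarrow> r < \<tau> u \<longrightarrow> (\<exists>v. s0 \<le> v \<and> v < u \<and> r = \<tau> v))"
    proof (rule traj_shift[OF traj_run traj_run, where n = "length P"])
      show "s0 \<le> ?s1" using N(1)[OF s0(1)] by simp
      show "C s = C s0" using s0 s C_top by simp
      show "C ?s1 \<noteq> None" using N(2)[OF s0(1)] C_top by simp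
      show "fst (the (C u)) \<le> length P" if "s0 \<le> u" "u < ?s1" for u
        by (rule lineh) (use that N(3)[OF s0(1)] top in \<open>meson less_le_trans less_trans\<close>)
    qed
    then obtain \<tau> where \<tau>: "\<tau> s0 = s" "\<forall>u. s0 \<le> u \<longrightarrow> u \<le> ?s1 \<longrightarrow> C (\<tau> u) = C u"
      "\<forall>u v. s0 \<le> u \<longrightarrow> u < v \<longrightarrow> v \<le> ?s1 \<longrightarrow> \<tau> u < \<tau> v"
      "\<forall>u r. s0 \<le> u \<longrightarrow> u \<le> ?s1 \<longrightarrow> s \<le> r \<longrightarrow> r < \<tau> u \<longrightarrow> (\<exists>v. s0 \<le> v \<and> v < u \<and> r = \<tau> v)"
      by (elim exE conjE)
    note N0 = N[OF s0(1)]
    have "s < \<tau> ?s1" using \<tau>(1) \<tau>(3)[rule_format, of s0 ?s1] N0 by simp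
    moreover have "C (\<tau> ?s1) = Some (ls, r)" using \<tau>(2)[rule_format, of ?s1] N0 C_top by simp
    moreover have "\<exists>v. s0 \<le> v \<and> v < ?s1 \<and> C q = C v" if q: "s \<le> q" "q < \<tau> ?s1" for q
    proof -
      from \<tau>(4)[rule_format, OF less_imp_le[OF N0(1)] order_refl q] obtain v where v: "s0 \<le> v" "v < ?s1" "q = \<tau> v" by blast
      then show ?thesis using \<tau>(2)[rule_format, of v] by auto
    qed
    ultimately show "\<exists>s'>s. C s' = Some (ls, r) \<and> ?Q u s s'" by blast
  next
    fix l t \<tau> assume l: "is_limit l" "ord_zero < l" "l \<le> h" and t: "is_limit t" "s0 < t" "\<tau> ord_zero = s0"
      and \<tau>: "\<And>v. ord_zero \<le> v \<Longrightarrow> v < l \<Longrightarrow> \<tau> v < t \<and> C (\<tau> v) = Some (ls, r) \<and> ?Q v (\<tau> v) (\<tau> (ord_suc v))"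
      and mono: "\<And>v w. ord_zero \<le> v \<Longrightarrow> v < w \<Longrightarrow> w < l \<Longrightarrow> \<tau> v < \<tau> w"
      and cover: "\<And>r. s0 \<le> r \<Longrightarrow> r < t \<Longrightarrow> \<exists>v. ord_zero \<le> v \<and> v < l \<and> \<tau> v \<le> r \<and> r < \<tau> (ord_suc v)"
    have inK: "\<exists>v. s0 \<le> v \<and> v < ?s1 \<and> C q = C v" if q: "s0 \<le> q" "q < t" for q
    proof -
      obtain v where v: "ord_zero \<le> v" "v < l" "\<tau> v \<le> q" "q < \<tau> (ord_suc v)" using cover[OF q] by blast
      then show ?thesis using \<tau>[OF v(1,2)] by blast
    qed
    have hit: "\<exists>q'. q \<le> q' \<and> q' < t \<and> C q' = Some (ls, r)" if q: "s0 \<le> q" "q < t" for q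
    proof -
      obtain v where v: "ord_zero \<le> v" "v < l" "\<tau> v \<le> q" "q < \<tau> (ord_suc v)" using cover[OF q] by blast
      have "ord_suc v < l" by (rule is_limit_suc[OF l(1) v(2)])
      from \<tau>[OF ord_zero_le this] v(4) show ?thesis by (intro exI[of _ "\<tau> (ord_suc v)"]) simp
    qed
    have lim: "is_lim s0 t (\<lambda>u. {g (the (C u))}) (g (ls, r))"
      if g: "\<And>v. s0 \<le> v \<Longrightarrow> v < ?s1 \<Longrightarrow> g (ls, r) \<le> g (the (C v))" for g :: "'a config \<Rightarrow> 'd::wellorder"
    proof (rule is_limI)
      fix w assume w: "w < g (ls, r)"
      have "w < g (the (C q))" if "s0 \<le> q" "q < t" for q
        using inK[OF that] g w by (metis less_le_trans)
      then show "\<exists>u\<ge>s0. u < t \<and> (\<forall>r. u \<le> r \<and> r < t \<longrightarrow> (\<forall>y\<in>{g (the (C r))}. w < y))"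
        using t(2) by (intro exI[of _ s0]) simp
    next
      fix q assume "s0 \<le> q" "q < t"
      from hit[OF this] show "\<exists>p y. q \<le> p \<and> p < t \<and> y \<in> {g (the (C p))} \<and> y \<le> g (ls, r)"
        by (metis insertI1 option.sel order_refl)
    qed
    show "C t = Some (ls, r)"
    proof (rule traj_limitI[OF traj_run t(1,2)])
      show "C q \<noteq> None" if q: "s0 \<le> q" "q < t" for q
      proof -
        obtain v where v: "s0 \<le> v" "v < ?s1" "C q = C v" using inK[OF q] by blast
        have "v < top_stage" using v(2) N(3)[OF s0(1)] by (rule less_trans)
        then show ?thesis using v(3) Cdef[of v] top by simp
      qed
      show "is_lim s0 t (\<lambda>u. {fst (the (C u))}) ls" using lim[of fst] ge(1) by simp
      show "is_lim s0 t (\<lambda>u. {snd (the (C u)) i}) (r i)" for i using lim[of "\<lambda>c. snd c i"] ge(2) by simp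
    qed
  qed
  then obtain \<tau> where \<tau>: "\<forall>u. ord_zero \<le> u \<longrightarrow> u \<le> h \<longrightarrow> C (\<tau> u) = Some (ls, r)"
    "\<forall>u v. ord_zero \<le> u \<longrightarrow> u < v \<longrightarrow> v \<le> h \<longrightarrow> \<tau> u < \<tau> v" by (elim exE conjE)
  \<comment> \<open>After \<open>h\<close> passages the time is at least \<open>h\<close>, where the
    run has halted, but the configuration is still the one at \<alpha>, whose line exists.\<close>
  have "u \<le> h \<longrightarrow> u \<le> \<tau> u" for u
  proof (induction u rule: less_induct)
    case (less u)
    show ?case
    proof (intro impI leI notI)
      assume u: "u \<le> h" "\<tau> u < u"
      then have "\<tau> (\<tau> u) < \<tau> u" using \<tau>(2) by simp
      moreover have "\<tau> u \<le> \<tau> (\<tau> u)" using less[OF u(2)] u by simp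
      ultimately show False by simp
    qed
  qed
  then have "C (\<tau> h) = Some ch" using traj_halted[OF traj_run h] by blast
  then have "ch = (ls, r)" using \<tau>(1) by simp
  then show False using h(2) ls_less by (simp add: halted_def)
qed

lemma C_eq_top:
  assumes "s \<le> h" "fst (the (C s)) = ls" "\<And>i. i < k \<Longrightarrow> snd (the (C s)) i = r i"
  shows "C s = C top_stage"
proof -
  have "snd (the (C s)) i = r i" for i
    using assms unused[OF assms(1), of i] unused[OF top, of i] unfolding r_def by (cases "i < k") auto
  then have "snd (the (C s)) = r" by blast
  then show ?thesis using Csome[OF assms(1)] assms(2) C_top by simp
qed

end

text \<open>A triple names two registers to compare and a flag. Only the first flag that is down is
  examined, so that a run changes at most one flag, unless all are up and \<open>F\<close> is
  executed.\<close>

fun flag_step :: "nat \<Rightarrow> (nat \<times> nat \<times> nat) list \<Rightarrow> com \<Rightarrow> com" where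
  "flag_step one [] F = F"
| "flag_step one ((i, j, f) # L) F = Cond f one (flag_step one L F) (Cond i j (COPY one f) SKIP)"

lemma flag_step_wc:
  "wc (flag_step one L F) m \<le> max (wc F m) (if m \<in> (\<lambda>(i, j, f). f) ` set L then 1 else 0)"
  by (induction one L F rule: flag_step.induct) (auto simp: max_def split: if_splits)

context exp_closed begin

lemma Exec_flag_step_full:
  assumes "\<And>i j f. (i, j, f) \<in> set L \<Longrightarrow> R f = R one" "Exec F x R T R'"
  shows "\<exists>T'. T \<subseteq> T' \<and> Exec (flag_step one L F) x R T' R'"
  using assms(1)
proof (induction L)
  case Nil
  then show ?case using assms(2) by auto
next
  case (Cons p L)
  obtain i j f where p: "p = (i, j, f)" by (cases p)
  obtain T' where T': "T \<subseteq> T'" "Exec (flag_step one L F) x R T' R'" using Cons by auto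
  have "R f = R one" using Cons.prems[of i j f] p by simp
  from Exec_Cond_True[OF T'(2) this] show ?case unfolding p flag_step.simps
    by (intro exI[of _ "insert R T'"] conjI) (use T'(1) in auto)
qed

lemma Exec_flag_step:
  assumes "\<And>i j f. (i, j, f) \<in> set L1 \<Longrightarrow> R f = R one" "R f \<noteq> R one"
  shows "\<exists>T'. T' \<subseteq> {R, R(f := R one)} \<and>
    Exec (flag_step one (L1 @ (i, j, f) # L2) F) x R T' (if R i = R j then R(f := R one) else R)"
  using assms(1)
proof (induction L1)
  case Nil
  show ?case
  proof (cases "R i = R j")
    case True
    show ?thesis unfolding append_Nil flag_step.simps if_P[OF True]
      by (intro exI[of _ "insert R (insert (R(f := R one)) (insert R {R}))"] conjI
        Exec_Cond_False[OF Exec_Cond_True[OF Exec_COPY True] assms(2)]) auto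
  next
    case False
    show ?thesis unfolding append_Nil flag_step.simps if_not_P[OF False]
      by (intro exI[of _ "insert R (insert R (insert R (insert R {})))"] conjI
        Exec_Cond_False[OF Exec_Cond_False[OF Exec_SKIP False] assms(2)]) auto
  qed
next
  case (Cons p L)
  obtain i' j' f' where p: "p = (i', j', f')" by (cases p)
  let ?R = "if R i = R j then R(f := R one) else R"
  have pre: "R f'' = R one" if "(i'', j'', f'') \<in> set L" for i'' j'' f''
    using Cons.prems[of i'' j'' f''] that by simp
  have "\<exists>T'. T' \<subseteq> {R, R(f := R one)} \<and> Exec (flag_step one (L @ (i, j, f) # L2) F) x R T' ?R"
    by (rule Cons.IH) (rule pre)
  then obtain T' where T': "T' \<subseteq> {R, R(f := R one)}" "Exec (flag_step one (L @ (i, j, f) # L2) F) x R T' ?R"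
    by (elim exE conjE)
  have "R f' = R one" using Cons.prems[of i' j' f'] p by simp
  from Exec_Cond_True[OF T'(2) this]
  have ex: "Exec (flag_step one ((p # L) @ (i, j, f) # L2) F) x R (insert R T') ?R"
    unfolding p append_Cons flag_step.simps .
  have "insert R T' \<subseteq> {R, R(f := R one)}" using T'(1) by blast
  with ex show ?case by (intro exI[of _ "insert R T'"] conjI)
qed

end

text \<open>From \<open>\<zeta>\<close> on, the configuration at time \<alpha> is seen for the first
  time at \<alpha>. Simulations therefore start at \<open>\<zeta>\<close>, from a configuration
  handed over as a parameter, and recognize \<alpha> by comparing with the one at \<alpha>.\<close>

locale long_run_from = long_run +
  fixes \<zeta> :: "'a stage"
  assumes zeta: "\<zeta> < top_stage" and norec: "\<And>s. \<zeta> \<le> s \<Longrightarrow> s < top_stage \<Longrightarrow> C s \<noteq> C top_stage"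
begin

text \<open>Layout: register 0 is the search register. The registers of the configuration at time \<open>\<zeta>\<close>
  and of that at time \<open>\<alpha>\<close> are the parameters, starting at 5 and at \<open>rb\<close>.\<close>

abbreviation n :: nat where "n \<equiv> length P"
definition rb :: nat where "rb = 5 + k"
definition e :: nat where "e = 5 + 2 * k"
definition pc :: nat where "pc = e"
definition st :: nat where "st = e + 1"
definition aux :: nat where "aux = e + 2"
definition pc2 :: nat where "pc2 = e + 3"
definition st2 :: nat where "st2 = e + 4"
definition res :: nat where "res = e + 5"
definition kb :: nat where "kb = e + 6"
definition fb :: nat where "fb = e + n + 8"
definition off :: nat where "off = e + n + k + 9"
definition off2 :: nat where "off2 = e + n + 2 * k + 9"

lemmas layout = rb_def pc_def st_def aux_def pc2_def st2_def res_def kb_def fb_def off_def off2_def e_def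

abbreviation PP :: "nat set" where "PP \<equiv> insert pc {off..<off+k}"
abbreviation PP2 :: "nat set" where "PP2 \<equiv> insert pc2 {off2..<off2+k}"

definition base :: "(nat \<Rightarrow> 'a) \<Rightarrow> bool" where
  "base R \<longleftrightarrow> (\<forall>l\<le>n+1. R (kb + l) = num l) \<and> (\<forall>i<k. R (rb + i) = r i) \<and>
     (\<forall>j\<in>PP2 \<union> {st, st2, res}. R j = ord_zero)"

definition start :: "nat \<Rightarrow> 'a" where
  "start j = (if j \<in> {kb..kb+(n+1)} then num (j - kb)
     else if j \<in> {5..<rb} then snd (the (C \<zeta>)) (j - 5) else if j \<in> {rb..<rb+k} then r (j - rb)
     else if j = pc then num (fst (the (C \<zeta>))) else if j \<in> {off..<off+k} then snd (the (C \<zeta>)) (j - off)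
     else ord_zero)"

lemma zeta_line: "fst (the (C \<zeta>)) < n"
  using line less_trans[OF zeta top_less] by blast

lemma base_start: "base start"
  unfolding base_def start_def by (auto simp: layout)

lemma rep_start: "rep off pc k n (the (C \<zeta>)) start"
  using zeta_line unfolding rep_def start_def by (auto simp: layout min_def)

lemma base_frame:
  assumes "base R0" "\<And>j. j \<notin> PP \<Longrightarrow> j \<notin> insert 0 (insert aux {fb..fb+k}) \<Longrightarrow> R j = R0 j"
  shows "base R"
  unfolding base_def
proof (intro conjI allI impI ballI)
  show "R (kb + l) = num l" if "l \<le> n + 1" for l
    using assms(1) assms(2)[of "kb + l"] that unfolding base_def by (auto simp: layout)
  show "R (rb + i) = r i" if "i < k" for i
    using assms(1) assms(2)[of "rb + i"] that unfolding base_def by (auto simp: layout)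
  show "R j = ord_zero" if j: "j \<in> PP2 \<union> {st, st2, res}" for j
  proof -
    have "j \<notin> PP" "j \<notin> insert 0 (insert aux {fb..fb+k})" using j by (auto simp: layout)
    then show ?thesis using assms j unfolding base_def by auto
  qed
qed

definition eqs :: "nat \<Rightarrow> nat \<Rightarrow> (nat \<times> nat) list" where
  "eqs o' p = map (\<lambda>i. (o' + i, rb + i)) [0..<k] @ [(p, kb + ls)]"

lemma eqs_top:
  assumes R: "rep o' p k n (the (C u)) R" and b: "\<forall>l\<le>n+1. R (kb + l) = num l" "\<forall>i<k. R (rb + i) = r i"
    and u: "C u = C top_stage" and ij: "(i, j) \<in> set (eqs o' p)"
  shows "R i = R j"
  using ij R b ls_less unfolding eqs_def rep_def u C_top by (auto simp: min_def)

lemma eqs_not_top: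
  assumes R: "rep o' p k n (the (C u)) R" and b: "\<forall>l\<le>n+1. R (kb + l) = num l" "\<forall>i<k. R (rb + i) = r i"
    and u: "u < h" "C u \<noteq> C top_stage"
  shows "\<exists>(i, j)\<in>set (eqs o' p). R i \<noteq> R j"
proof (rule ccontr)
  assume "\<not> ?thesis"
  then have eq: "\<And>i j. (i, j) \<in> set (eqs o' p) \<Longrightarrow> R i = R j" by blast
  have "R p = num (fst (the (C u)))" using R line[OF u(1)] unfolding rep_def by (simp add: min_def)
  moreover have "R (kb + ls) = num ls" using b(1) ls_less by simp
  moreover have "R p = R (kb + ls)" by (rule eq) (simp add: eqs_def)
  ultimately have "fst (the (C u)) = ls" by simp
  moreover have "snd (the (C u)) i = r i" if "i < k" for i
  proof -
    have "R (o' + i) = R (rb + i)" by (rule eq) (use that in \<open>auto simp: eqs_def\<close>)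
    then show ?thesis using R b(2) that unfolding rep_def by simp
  qed
  ultimately show False using C_eq_top[OF less_imp_le[OF u(1)]] u(2) by blast
qed

text \<open>Common end of both cases: a simulation from \<open>\<zeta>\<close> that reaches \<alpha>
  without overflow and shows every ordinal in register 0. The \<open>2 * k\<close> register values
  at \<open>\<zeta>\<close> and \<alpha> form the parameter list; the two line indices are finite
  and stand in the program text.\<close>

lemma finish:
  assumes I: "Iter pc (kb + n) (simbody off pc kb st (COPY kb) H P) {} start K R"
    and R: "rep off pc k n (the (C top_stage)) R" "base R"
    and H: "Exec H {} R T R'" "R' st = R' (kb + 1)"
    and K: "\<And>\<iota>. \<exists>S\<in>K. S 0 = \<iota>"
  shows "wITRM_searchable TYPE('a)"
proof -
  let ?vs = "map (snd (the (C \<zeta>))) [0..<k] @ map r [0..<k]"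
  have lv: "5 + length ?vs = e" by (simp add: layout)
  obtain p d where pd: "\<And>x. \<exists>T. Exec (d ;; mkconsts kb (n + 1)) x (snd (init_config [p])) T
     (\<lambda>j. if j \<in> {kb..kb+(n+1)} then num (j - kb) else if j \<in> {5..<5 + length ?vs} then ?vs ! (j - 5) else ord_zero)"
    using prologue[of ?vs kb "n + 1"] unfolding lv by (auto simp: layout)
  define R0 where "R0 = (\<lambda>j. if j \<in> {kb..kb+(n+1)} then num (j - kb) else if j \<in> {5..<5 + length ?vs} then ?vs ! (j - 5) else ord_zero)"
  obtain T0 where T0: "Exec (d ;; mkconsts kb (n + 1)) {} (snd (init_config [p])) T0 R0"
    using pd[of "{}"] unfolding R0_def by blast
  have "{5..<5+k} \<inter> {off..<off+k} = {}" by (auto simp: layout)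
  from Exec_copy_block[OF this, of "{}" R0] obtain T1 where
    T1: "Exec (copy_block 5 off k) {} R0 T1 (\<lambda>j. if j \<in> {off..<off+k} then R0 (5 + (j - off)) else R0 j)" by blast
  let ?R1 = "\<lambda>j. if j \<in> {off..<off+k} then R0 (5 + (j - off)) else R0 j"
  let ?l = "fst (the (C \<zeta>))"
  have "?R1(pc := ?R1 (kb + ?l)) = start"
  proof
    fix j
    have v1: "?vs ! i = snd (the (C \<zeta>)) i" if "i < k" for i using that by (simp add: nth_append)
    have v2: "?vs ! i = r (i - k)" if "k \<le> i" "i < 2 * k" for i using that by (simp add: nth_append)
    have kbl: "?R1 (kb + ?l) = num ?l" using zeta_line unfolding R0_def by (auto simp: layout)
    consider "j = pc" | "j \<in> {off..<off+k}" | "j \<in> {kb..kb+(n+1)}" | "j \<in> {5..<5+k}" | "j \<in> {rb..<rb+k}" |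
      "j \<noteq> pc" "j \<notin> {off..<off+k}" "j \<notin> {kb..kb+(n+1)}" "j \<notin> {5..<5+k}" "j \<notin> {rb..<rb+k}" by blast
    then show "(?R1(pc := ?R1 (kb + ?l))) j = start j"
    proof cases
      case 1
      then show ?thesis using kbl unfolding start_def by (auto simp: layout)
    next
      case 2
      then have "R0 (5 + (j - off)) = ?vs ! (j - off)" unfolding R0_def by (auto simp: layout)
      then show ?thesis using 2 v1[of "j - off"] unfolding start_def by (auto simp: layout)
    next
      case 3
      then show ?thesis unfolding start_def R0_def by (auto simp: layout)
    next
      case 4
      then have "R0 j = ?vs ! (j - 5)" unfolding R0_def by (auto simp: layout)
      then show ?thesis using 4 v1[of "j - 5"] unfolding start_def by (auto simp: layout)
    next
      case 5
      then have "R0 j = ?vs ! (j - 5)" unfolding R0_def by (auto simp: layout)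
      then show ?thesis using 5 v2[of "j - 5"] unfolding start_def by (auto simp: layout)
    next
      case 6
      then show ?thesis unfolding start_def R0_def by (auto simp: layout)
    qed
  qed
  then have T2: "Exec (COPY (kb + ?l) pc) {} ?R1 {?R1} start"
    using Exec_COPY[of "kb + ?l" pc "{}" ?R1] by simp
  have "R pc \<noteq> R (kb + n)"
    using rep_halted[OF R(1)] R(2) ls_less unfolding C_top base_def by simp
  then have "\<exists>K'. K \<subseteq> K' \<and> Exec (simcom off pc kb st (COPY kb) H P) {} start K' (R'(pc := R' (kb + n)))"
    by (rule sim_stop[OF I refl _ H]) (simp add: layout)
  then obtain K' where K': "K \<subseteq> K'" "Exec (simcom off pc kb st (COPY kb) H P) {} start K' (R'(pc := R' (kb + n)))"
    by blast
  note main = Exec_Seq[OF T0 Exec_Seq[OF T1 Exec_Seq[OF T2 K'(2)]]]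
  let ?M = "code 0 ((d ;; mkconsts kb (n + 1)) ;; copy_block 5 off k ;; COPY (kb + ?l) pc ;;
      simcom off pc kb st (COPY kb) H P)"
  have "\<exists>(t :: 'a stage) c. run ?M {} [p] t = Some c \<and> \<not> halted ?M c \<and> snd c 0 = \<iota>" for \<iota>
  proof -
    obtain S where S: "S \<in> K" "S 0 = \<iota>" using K by blast
    then have "S \<in> T0 \<union> (T1 \<union> ({?R1} \<union> K'))" using K'(1) by auto
    from run_code(2)[OF main this] obtain t :: "'a stage" and l where
      "run ?M {} [p] t = Some (l, S)" "l < length ?M" by blast
    then show ?thesis using S(2) by (intro exI[of _ t] exI[of _ "(l, S)"]) (simp add: halted_def)
  qed
  moreover have "halts ?M {} [p]" using run_code(1)[OF main]
    unfolding halts_with_def halts_def halted_by_def by blast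
  ultimately show ?thesis unfolding wITRM_searchable_def by blast
qed

section \<open>A register with unattained inferior limit\<close>

text \<open>Two reasons to stop: register \<open>d\<close> has the value of \<open>aux\<close>,
  which sets \<open>res\<close>, or the configuration is that of time \<alpha>, so that the value
  does not occur below \<alpha> any more.\<close>

definition test_hook :: "nat \<Rightarrow> com" where
  "test_hook d = Cond (off2 + d) aux (COPY (kb + 1) res ;; COPY (kb + 1) st2) (eqall (eqs off2 pc2) (COPY (kb + 1) st2) SKIP)"

text \<open>Tests whether register \<open>d\<close> of \<open>P\<close> takes the value in \<open>aux\<close> at some later time below \<open>\<alpha>\<close>.\<close>
definition test :: "nat \<Rightarrow> com" where
  "test d = copy_block off off2 k ;; COPY pc pc2 ;; simcom off2 pc2 kb st2 (COPY kb) (test_hook d) P ;;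
     fill_block kb off2 k ;; COPY kb pc2 ;; COPY kb st2"

lemma test_hook_wc: "j \<notin> {res, st2} \<Longrightarrow> wc (test_hook d) j = 0"
  using eqall_wc[of "eqs off2 pc2" "COPY (kb + 1) st2" SKIP j] unfolding test_hook_def by auto

lemma test_wc:
  assumes "j \<notin> PP2" "j \<notin> {res, st2}"
  shows "wc (test d) j = 0"
proof -
  have "pc2 \<notin> {off2..<off2+k}" by (auto simp: layout)
  from simcom_wc[OF this P(1) assms(1), of kb st2 "test_hook d"] test_hook_wc[OF assms(2), of d] assms
  show ?thesis unfolding test_def by (auto simp: copy_block_wc fill_block_wc)
qed

text \<open>A second copy of the current configuration is run ahead, leaving the first untouched.
  All working registers are cleared, so in the outer loop this counts as a computation with scratch
  registers only.\<close>

lemma Exec_test: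
  assumes R: "base R" "rep off pc k n (the (C u)) R" and u: "\<zeta> \<le> u" "u < top_stage"
    and d: "d < k" "R aux < r d"
  shows "\<exists>T. Exec (test d) {} R T
    (R(res := if \<exists>s. u \<le> s \<and> s < top_stage \<and> snd (the (C s)) d = R aux then ord_one else ord_zero))"
proof -
  have "{off..<off+k} \<inter> {off2..<off2+k} = {}" by (auto simp: layout)
  from Exec_copy_block[OF this, of "{}" R] obtain T1 where
    T1: "Exec (copy_block off off2 k) {} R T1 (\<lambda>j. if j \<in> {off2..<off2+k} then R (off + (j - off2)) else R j)" by blast
  define R1 where "R1 = (\<lambda>j. if j \<in> {off2..<off2+k} then R (off + (j - off2)) else R j)"
  define R2 where "R2 = R1(pc2 := R1 pc)"
  have R2: "R2 j = R j" if "j \<notin> PP2" for j using that unfolding R2_def R1_def by auto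
  have kbP: "kb + l \<notin> PP2" if "l \<le> n + 1" for l using that by (auto simp: layout)
  have rbP: "rb + i \<notin> PP2" if "i < k" for i using that by (auto simp: layout)
  have R2b: "\<forall>l\<le>n+1. R2 (kb + l) = num l" "\<forall>i<k. R2 (rb + i) = r i" "R2 st2 = ord_zero" "R2 res = ord_zero"
    "R2 aux = R aux"
    using R(1) R2 kbP rbP unfolding base_def by (auto simp: layout)
  have rep2: "rep off2 pc2 k n (the (C u)) R2"
    using R(2) unfolding rep_def R2_def R1_def by (auto simp: layout)
  let ?hit = "\<lambda>s. snd (the (C s)) d = R aux"
  \<comment> \<open>The look-ahead stops at the first occurrence of the value, or at \<alpha> if
    there is none.\<close>
  define u0 where "u0 = (LEAST s. s = top_stage \<or> u \<le> s \<and> s < top_stage \<and> ?hit s)"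
  have u0: "u0 = top_stage \<or> u \<le> u0 \<and> u0 < top_stage \<and> ?hit u0" unfolding u0_def by (rule LeastI[of _ top_stage]) simp
  have nohit: "\<not> ?hit s" if "u \<le> s" "s < u0" for s
  proof
    assume "?hit s"
    moreover have "\<not> (s = top_stage \<or> u \<le> s \<and> s < top_stage \<and> ?hit s)" using not_less_Least[OF that(2)[unfolded u0_def]] .
    ultimately have "top_stage < s" using that(1) by (metis linorder_neqE)
    moreover have "u0 \<le> top_stage" unfolding u0_def by (rule Least_le) simp
    ultimately show False using that(2) by simp
  qed
  have u0t: "u0 \<le> top_stage" "u \<le> u0" using u0 u(2) by auto
  have u0h: "u0 < h" using u0t(1) top_less by (rule le_less_trans)
  have "\<exists>K R'. Iter pc2 (kb + n) (simbody off2 pc2 kb st2 (COPY kb) (test_hook d) P) {} R2 K R' \<and>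
    rep off2 pc2 k n (the (C u0)) R' \<and> (\<forall>j. j \<notin> PP2 \<longrightarrow> R' j = R2 j) \<and>
    (\<forall>u' j. u \<le> u' \<longrightarrow> u' < u0 \<longrightarrow> P ! fst (the (C u')) = Query j \<longrightarrow>
       (\<exists>Tq Rq. Tq \<subseteq> K \<and> Rq (off2 + j) = snd (the (C u')) j \<and> True))"
  proof (rule sim_simple[where W = "\<lambda>_ _ _. True", OF traj_run u0t(2)])
    show "C u0 \<noteq> None" by (rule Cdef) (use u0h in simp)
    show "fst (the (C u')) < n" if "u' < u0" for u' using line[OF less_trans[OF that u0h]] .
    show "kconsts kb n R2" unfolding kconsts_def using R2b(1) by simp
    show "R2 (kb + 1) = ord_one" using R2b(1)[rule_format, of 1] by (simp add: num_1)
    show "R2 st2 = ord_zero" by (rule R2b)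
    show "rep off2 pc2 k n (the (C u)) R2" by (rule rep2)
  next
    fix u' R' assume u': "u \<le> u'" "u' < u0" and R': "rep off2 pc2 k n (the (C u')) R'"
      "\<And>j. j \<notin> PP2 \<Longrightarrow> R' j = R2 j"
    have b: "\<forall>l\<le>n+1. R' (kb + l) = num l" "\<forall>i<k. R' (rb + i) = r i" "R' aux = R aux"
      using R2b R'(2) kbP rbP by (auto simp: layout)
    have "R' (off2 + d) = snd (the (C u')) d" using R'(1) d(1) unfolding rep_def by simp
    then have neq: "R' (off2 + d) \<noteq> R' aux" using nohit[OF u'] b(3) by simp
    have "C u' \<noteq> C top_stage" by (rule norec) (use u' u u0t in auto)
    then obtain i j where ij: "(i, j) \<in> set (eqs off2 pc2)" "R' i \<noteq> R' j"
      using eqs_not_top[OF R'(1) b(1,2) less_trans[OF u'(2) u0h]] by blast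
    from Exec_eqall_False[OF ij Exec_SKIP] obtain T where
      "Exec (eqall (eqs off2 pc2) (COPY (kb + 1) st2) SKIP) {} R' T R'" by blast
    from Exec_Cond_False[OF this neq] show "\<exists>T. Exec (test_hook d) {} R' T R'" unfolding test_hook_def by blast
  next
    show "wc (test_hook d) i = 0" if "i \<in> PP2" for i by (rule test_hook_wc) (use that in \<open>auto simp: layout\<close>)
  next
    fix R' j assume "\<And>i. i \<notin> PP2 \<Longrightarrow> R' i = R2 i"
    then have "R' kb = ord_zero" using kbP[of 0] R2b(1)[rule_format, of 0] by (simp add: num_0)
    then show "\<exists>T. Exec (COPY kb (off2 + j)) {} R' T (R'(off2 + j := if R' (off2 + j) \<in> {} then ord_one else ord_zero)) \<and> True"
      using Exec_COPY[of kb "off2 + j" "{}" R'] by auto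
  next
    fix i assume i: "i \<notin> PP2" "R2 i \<noteq> ord_zero"
    then have "i \<notin> {res, st2}" using R2b by auto
    then show "wc (test_hook d) i = 0 \<and> (\<forall>j<k. wc (COPY kb (off2 + j)) i = 0)" using test_hook_wc i(1) by auto
  qed (use P in \<open>auto simp: layout\<close>)
  then obtain K R3 where R3: "Iter pc2 (kb + n) (simbody off2 pc2 kb st2 (COPY kb) (test_hook d) P) {} R2 K R3"
    "rep off2 pc2 k n (the (C u0)) R3" and R3': "\<forall>j. j \<notin> PP2 \<longrightarrow> R3 j = R2 j" by (elim exE conjE)
  have b3: "\<forall>l\<le>n+1. R3 (kb + l) = num l" "\<forall>i<k. R3 (rb + i) = r i" "R3 aux = R aux" "R3 res = ord_zero"
    using R2b R3' kbP rbP by (auto simp: layout)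
  have R3d: "R3 (off2 + d) = snd (the (C u0)) d" using R3(2) d(1) unfolding rep_def by simp
  let ?v = "if \<exists>s. u \<le> s \<and> s < top_stage \<and> ?hit s then ord_one else ord_zero"
  let ?R4 = "R3(res := ?v, st2 := ord_one)"
  have one: "R3 (kb + 1) = ord_one" using b3(1)[rule_format, of 1] by (simp add: num_1)
  have "\<exists>T. Exec (test_hook d) {} R3 T ?R4"
  proof (cases "u0 = top_stage")
    case True
    then have "\<not> (\<exists>s. u \<le> s \<and> s < top_stage \<and> ?hit s)" using nohit by blast
    then have v: "?v = ord_zero" by (rule if_not_P)
    \<comment> \<open>At \<alpha> register \<open>d\<close> holds \<open>r d\<close>, which exceeds
      \<open>aux\<close>; so the comparison with the configuration at \<alpha> is reached and not
      mistaken for an occurrence.\<close>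
    have "R3 (off2 + d) \<noteq> R3 aux" using R3d b3(3) d(2) unfolding True C_top by auto
    moreover have eq: "R3 i = R3 j" if "(i, j) \<in> set (eqs off2 pc2)" for i j
      by (rule eqs_top[OF R3(2) b3(1,2) _ that]) (simp add: True)
    obtain T where "Exec (eqall (eqs off2 pc2) (COPY (kb + 1) st2) SKIP) {} R3 T (R3(st2 := R3 (kb + 1)))"
      using Exec_eqall_True[where L = "eqs off2 pc2" and R = R3 and c = "COPY (kb + 1) st2" and d = SKIP and x = "{}",
        OF eq Exec_COPY] by blast
    moreover have "R3(st2 := R3 (kb + 1)) = ?R4" unfolding v one using b3(4) by (auto simp: fun_eq_iff)
    ultimately show ?thesis unfolding test_hook_def using Exec_ex[OF Exec_Cond_False] by blast
  next
    case False
    then have hit: "u \<le> u0 \<and> u0 < top_stage \<and> ?hit u0" using u0 by blast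
    then have v: "?v = ord_one" by auto
    have eq: "R3 (off2 + d) = R3 aux" using R3d b3(3) hit by simp
    have "(R3(res := R3 (kb + 1)))(st2 := (R3(res := R3 (kb + 1))) (kb + 1)) = ?R4"
      unfolding v using one by (auto simp: fun_eq_iff layout)
    then show ?thesis unfolding test_hook_def by (rule Exec_ex[OF Exec_Cond_True[OF Exec_Seq[OF Exec_COPY Exec_COPY] eq]])
  qed
  then obtain T4 where T4: "Exec (test_hook d) {} R3 T4 ?R4" by blast
  have line0: "fst (the (C u0)) < n" by (rule line[OF u0h])
  have neq: "R3 pc2 \<noteq> R3 (kb + n)" using rep_halted[OF R3(2)] line0 b3(1) by simp
  have "\<exists>K'. K \<subseteq> K' \<and> Exec (simcom off2 pc2 kb st2 (COPY kb) (test_hook d) P) {} R2 K' (?R4(pc2 := ?R4 (kb + n)))"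
    by (rule sim_stop[OF R3(1) refl neq T4]) (use one in \<open>auto simp: layout\<close>)
  then obtain K' where K': "Exec (simcom off2 pc2 kb st2 (COPY kb) (test_hook d) P) {} R2 K' (?R4(pc2 := ?R4 (kb + n)))" by blast
  define R5 where "R5 = ?R4(pc2 := ?R4 (kb + n))"
  have "kb \<notin> {off2..<off2+k}" by (auto simp: layout)
  from Exec_fill_block[OF this, of "{}" R5] obtain T6 where
    T6: "Exec (fill_block kb off2 k) {} R5 T6 (\<lambda>j. if j \<in> {off2..<off2+k} then R5 kb else R5 j)" by blast
  define R6 where "R6 = (\<lambda>j. if j \<in> {off2..<off2+k} then R5 kb else R5 j)"
  define R7 where "R7 = R6(pc2 := R6 kb)"
  define R8 where "R8 = R7(st2 := R7 kb)"
  have ex: "Exec (COPY pc pc2) {} R1 {R1} R2" "Exec (COPY kb pc2) {} R6 {R6} R7" "Exec (COPY kb st2) {} R7 {R7} R8"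
    unfolding R2_def R7_def R8_def by (rule Exec_COPY)+
  have kb0: "R5 kb = ord_zero" unfolding R5_def using b3(1)[rule_format, of 0] by (auto simp: layout num_0)
  have "R8 j = (R(res := ?v)) j" for j
  proof -
    consider "j \<in> PP2" | "j = st2" | "j = res" | "j \<notin> PP2" "j \<noteq> st2" "j \<noteq> res" by blast
    then show ?thesis
    proof cases
      case 1
      then have "R j = ord_zero" "j \<noteq> st2" "j \<noteq> res" using R(1) unfolding base_def by (auto simp: layout)
      then show ?thesis using 1 kb0 unfolding R8_def R7_def R6_def by (auto simp: layout)
    next
      case 2
      then have "R j = ord_zero" using R(1) unfolding base_def by auto
      then show ?thesis using 2 kb0 unfolding R8_def R7_def R6_def by (auto simp: layout)
    next
      case 3
      then show ?thesis unfolding R8_def R7_def R6_def R5_def by (auto simp: layout)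
    next
      case 4
      then show ?thesis using R3' R2 unfolding R8_def R7_def R6_def R5_def by auto
    qed
  qed
  then have "R8 = R(res := ?v)" by blast
  then show ?thesis unfolding test_def
    by (rule Exec_ex[OF Exec_Seq[OF T1[folded R1_def] Exec_Seq[OF ex(1) Exec_Seq[OF K'[folded R5_def]
      Exec_Seq[OF T6[folded R6_def] Exec_Seq[OF ex(2) ex(3)]]]]]])
qed

text \<open>\<open>aux\<close> climbs one by one towards the minimum of the later values of register
  \<open>d\<close>. While its value still occurs, the counter in register 0 advances; once it does
  not, \<open>aux\<close> advances and the counter is reset.\<close>

definition unattained_event :: "nat \<Rightarrow> com" where
  "unattained_event d = test d ;; Cond res (kb + 1) (INC 0) (COPY kb 0 ;; INC aux) ;; COPY kb res"

definition unattained_hook :: "nat \<Rightarrow> com" where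
  "unattained_hook d = eqall (eqs off pc) (COPY (kb + 1) st) (unattained_event d)"

lemma unattained_hook_wc:
  "j \<notin> PP2 \<Longrightarrow> j \<notin> {res, st2, st, 0, aux} \<Longrightarrow> wc (unattained_hook d) j = 0"
  "j \<in> {0, aux} \<Longrightarrow> wc (unattained_hook d) j \<le> 1"
proof -
  have le: "wc (unattained_hook d) j \<le> max (wc (COPY (kb + 1) st) j) (wc (unattained_event d) j)" for j
    unfolding unattained_hook_def by (rule eqall_wc)
  show "wc (unattained_hook d) j = 0" if "j \<notin> PP2" "j \<notin> {res, st2, st, 0, aux}"
    using le[of j] test_wc[of j d] that unfolding unattained_event_def by auto
  show "wc (unattained_hook d) j \<le> 1" if "j \<in> {0, aux}"
  proof -
    have "j \<notin> PP2" "j \<notin> {res, st2}" "j \<noteq> st" using that by (auto simp: layout)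
    then show ?thesis using le[of j] test_wc[of j d] that unfolding unattained_event_def by (auto simp: layout)
  qed
qed

lemma Exec_hook_top:
  assumes R: "base R" "rep off pc k n (the (C top_stage)) R"
  shows "\<exists>T. Exec (eqall (eqs off pc) (COPY (kb + 1) st) c) {} R T (R(st := R (kb + 1)))"
proof -
  have "R i = R j" if "(i, j) \<in> set (eqs off pc)" for i j
    by (rule eqs_top[OF R(2) _ _ refl that]) (use R(1) in \<open>auto simp: base_def\<close>)
  from Exec_eqall_True[where L = "eqs off pc" and R = R and d = c and x = "{}", OF this Exec_COPY]
  show ?thesis by blast
qed

lemma Exec_hook_below:
  assumes R: "base R" "rep off pc k n (the (C u)) R" and u: "\<zeta> \<le> u" "u < top_stage"
    and c: "Exec c {} R T R'"
  shows "\<exists>T'. T \<subseteq> T' \<and> T' \<subseteq> insert R (insert R' T) \<and> Exec (eqall (eqs off pc) (COPY (kb + 1) st) c) {} R T' R'"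
proof -
  have "\<exists>(i, j)\<in>set (eqs off pc). R i \<noteq> R j"
    by (rule eqs_not_top[OF R(2) _ _ less_trans[OF u(2) top_less] norec[OF u]]) (use R(1) in \<open>auto simp: base_def\<close>)
  then obtain i j where "(i, j) \<in> set (eqs off pc)" "R i \<noteq> R j" by blast
  from Exec_eqall_False[OF this c] show ?thesis by blast
qed

lemma qc_zero:
  assumes "base R"
  shows "\<exists>T. Exec (COPY kb j) {} R T (R(j := if R j \<in> {} then ord_one else ord_zero)) \<and> True"
proof -
  have "R kb = ord_zero" using assms unfolding base_def by (metis add_0_right num_0 zero_le)
  then show ?thesis using Exec_COPY[of kb j "{}" R] by auto
qed

lemma kconsts_start: "kconsts kb n start" "start (kb + 1) = ord_one" "start st = ord_zero"
proof -
  have "start (kb + 1) = num 1" using base_start unfolding base_def by auto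
  then show "start (kb + 1) = ord_one" by (simp add: num_1)
qed (use base_start in \<open>auto simp: base_def kconsts_def\<close>)

lemma start_zero: "j \<in> PP2 \<union> {st, st2, res, 0, aux} \<union> {fb..fb+k} \<Longrightarrow> start j = ord_zero"
  unfolding start_def by (auto simp: layout)

lemma searchable_if_unattained:
  assumes d: "d < k" and B: "\<And>s. s < top_stage \<Longrightarrow> \<exists>s'. s \<le> s' \<and> s' < top_stage \<and> snd (the (C s')) d < r d"
  shows "wITRM_searchable TYPE('a)"
proof -
  define val where "val s = snd (the (C s)) d" for s
  \<comment> \<open>The first bound prevents an overflow of the counter before \<alpha>. The second
    keeps \<open>aux\<close> at most every later value of register \<open>d\<close>, hence below
    \<open>r d\<close>.\<close>
  define E where "E u R \<longleftrightarrow> (u < top_stage \<longrightarrow> stg (R 0) \<le> u \<and> (\<forall>s. u \<le> s \<longrightarrow> s < top_stage \<longrightarrow> R aux \<le> val s))"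
    for u and R :: "nat \<Rightarrow> 'a"
  define occ where "occ u y \<longleftrightarrow> (\<exists>s. u \<le> s \<and> s < top_stage \<and> val s = y)" for u and y :: 'a
  define G where "G u R T R' \<longleftrightarrow> (if occ u (R aux) then R' aux = R aux \<and> R' 0 = ord_suc (R 0)
      else R' aux = ord_suc (R aux) \<and> R' 0 = ord_zero)" for u and R R' :: "nat \<Rightarrow> 'a" and T :: "(nat \<Rightarrow> 'a) set"
  let ?X = "{0, aux}"
  have EB: "R aux < r d" if "E u R" "u < top_stage" for u R
    using B[OF that(2)] that unfolding E_def val_def by (meson le_less_trans)
  have z0: "ord_zero < top_stage" using le_less_trans[OF ord_zero_le zeta] .
  have val_cof: "\<exists>w. u \<le> w \<and> w < top_stage \<and> val w \<le> r d" if "u < top_stage" for u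
    using B[OF that] unfolding val_def by (meson less_imp_le)
  interpret S: simulation_layout ty off pc kb st n k P "COPY kb" "unattained_hook d" "{}" "{}" ?X start C \<zeta> top_stage E G "\<lambda>_ _ _. True"
  proof
    show "traj P {} C" by (rule traj_run)
    show "\<zeta> \<le> top_stage" using zeta by simp
    show "C top_stage \<noteq> None" using C_top by simp
    show "fst (the (C u)) < n" if "u < top_stage" for u using line[OF less_trans[OF that top_less]] .
    show "regs_below k P" by (rule P)
    show "kconsts kb n start" "start (kb + 1) = ord_one" "start st = ord_zero" by (rule kconsts_start)+
    show "rep off pc k n (the (C \<zeta>)) start" by (rule rep_start)
    show "E \<zeta> start" unfolding E_def using start_zero[of 0] start_zero[of aux] by (simp add: stg_zero)
  next
    fix u R assume u: "\<zeta> \<le> u" "u < top_stage" and R: "rep off pc k n (the (C u)) R"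
      "\<And>j. j \<notin> PP \<Longrightarrow> j \<notin> ?X \<Longrightarrow> R j = start j" and E: "E u R"
    have b: "base R" by (rule base_frame[OF base_start]) (use R(2) in auto)
    let ?R1 = "R(res := if occ u (R aux) then ord_one else ord_zero)"
    obtain T1 where T1: "Exec (test d) {} R T1 ?R1"
      using Exec_test[OF b R(1) u d EB[OF E u(2)]] unfolding occ_def val_def by blast
    let ?R2 = "if occ u (R aux) then ?R1(0 := ord_suc (?R1 0)) else (?R1(0 := ?R1 kb))(aux := ord_suc ((?R1(0 := ?R1 kb)) aux))"
    have kbs: "R (kb + 1) = ord_one" "R kb = ord_zero" "R res = ord_zero"
      using b unfolding base_def by (auto simp: num_1[symmetric] num_0[symmetric] dest: spec[of _ 0] spec[of _ 1])
    have "\<exists>T. Exec (Cond res (kb + 1) (INC 0) (COPY kb 0 ;; INC aux)) {} ?R1 T ?R2"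
    proof (cases "occ u (R aux)")
      case True
      then have eq: "?R1 res = ?R1 (kb + 1)" using kbs by (simp add: layout)
      show ?thesis by (rule Exec_ex[OF Exec_Cond_True[OF Exec_INC eq]]) (simp only: True if_True)
    next
      case False
      then have neq: "?R1 res \<noteq> ?R1 (kb + 1)" using kbs by (simp add: layout)
      show ?thesis by (rule Exec_ex[OF Exec_Cond_False[OF Exec_Seq[OF Exec_COPY Exec_INC] neq]]) (simp only: False if_False)
    qed
    then obtain T2 where T2: "Exec (Cond res (kb + 1) (INC 0) (COPY kb 0 ;; INC aux)) {} ?R1 T2 ?R2" by blast
    let ?R3 = "?R2(res := ?R2 kb)"
    have ev: "Exec (unattained_event d) {} R (T1 \<union> (T2 \<union> {?R2})) ?R3"
      unfolding unattained_event_def by (rule Exec_Seq[OF T1 Exec_Seq[OF T2 Exec_COPY]])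
    obtain T where T: "Exec (unattained_hook d) {} R T ?R3"
      using Exec_hook_below[OF b R(1) u ev] unfolding unattained_hook_def by blast
    have dist: "res \<noteq> 0" "aux \<noteq> 0" "kb \<noteq> 0" "res \<noteq> aux" "kb \<noteq> aux" "kb \<noteq> res" by (simp_all add: layout)
    define R' where "R' = (if occ u (R aux) then R(0 := ord_suc (R 0)) else R(0 := ord_zero, aux := ord_suc (R aux)))"
    have R3eq: "?R3 = R'"
    proof (cases "occ u (R aux)")
      case True
      show ?thesis unfolding R'_def if_P[OF True] using kbs dist dist[symmetric] by (auto simp: fun_eq_iff)
    next
      case False
      show ?thesis unfolding R'_def if_not_P[OF False] using kbs dist dist[symmetric] by (auto simp: fun_eq_iff)
    qed
    have T': "Exec (unattained_hook d) {} R T R'" using T by (rule back_subst[of "Exec (unattained_hook d) {} R T", OF _ R3eq])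
    have R3: "R' j = R j" if "j \<notin> ?X" for j unfolding R'_def using that by auto
    have R3': "R' 0 = (if occ u (R aux) then ord_suc (R 0) else ord_zero)"
      "R' aux = (if occ u (R aux) then R aux else ord_suc (R aux))"
      unfolding R'_def using dist by auto
    have "G u R T R'" unfolding G_def using R3' by simp
    moreover have "E (ord_suc u) R'"
      unfolding E_def
    proof (intro impI conjI allI)
      have "stg (R 0) \<le> u" using E u(2) unfolding E_def by simp
      then show "stg (R' 0) \<le> ord_suc u" unfolding R3' by (simp add: stg_suc stg_zero stage_suc_le_iff stage_less_suc_iff)
      fix s assume s: "ord_suc u \<le> s" "s < top_stage"
      then have us: "u \<le> s" by (meson less_imp_le order_trans stage_suc_gt)
      have "R aux \<le> val s" using E u(2) s(2) us unfolding E_def by simp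
      moreover have "R aux \<noteq> val s" if "\<not> occ u (R aux)" using that us s(2) unfolding occ_def by metis
      ultimately show "R' aux \<le> val s" unfolding R3' by (cases "occ u (R aux)") (auto simp: ord_suc_le_iff)
    qed
    ultimately show "\<exists>T R1. Exec (unattained_hook d) {} R T R1 \<and> (\<forall>j. j \<notin> ?X \<longrightarrow> R1 j = R j) \<and> G u R T R1 \<and> E (ord_suc u) R1"
      using T' R3 by blast
  next
    show "wc (unattained_hook d) i = 0" if "i \<in> PP" for i
      by (rule unattained_hook_wc) (use that in \<open>auto simp: layout\<close>)
  next
    fix R :: "nat \<Rightarrow> 'a" and j assume "\<And>i. i \<notin> PP \<Longrightarrow> i \<notin> ?X \<Longrightarrow> R i = start i"
    then have "base R" by (intro base_frame[OF base_start]) auto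
    then show "\<exists>T. Exec (COPY kb (off + j)) {} R T (R(off + j := if R (off + j) \<in> {} then ord_one else ord_zero)) \<and> True"
      by (rule qc_zero)
  next
    fix i assume i: "i \<notin> PP" "i \<notin> ?X" "start i \<noteq> ord_zero"
    have "i \<notin> PP2" "i \<notin> {res, st2, st, 0, aux}" using i start_zero[of i] by auto
    then have "wc (unattained_hook d) i = 0" by (rule unattained_hook_wc)
    then show "wc (unattained_hook d) i = 0 \<and> (\<forall>j<k. wc (COPY kb (off + j)) i = 0)" using i by auto
  next
    show "E u R'" if "E u R" "\<And>j. j \<in> ?X \<Longrightarrow> R j = R' j" for u R R'
      using that unfolding E_def by simp
    show "G u R T' R'" if "G u R T R1" "\<And>j. j \<in> ?X \<Longrightarrow> R' j = R1 j" for u R T T' R1 R'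
      using that unfolding G_def by simp
  next
    fix l R T assume l: "is_limit l" "\<zeta> < l" "l \<le> top_stage"
      and fam: "\<And>u. \<zeta> \<le> u \<Longrightarrow> u < l \<Longrightarrow> rep off pc k n (the (C u)) (R u) \<and> E u (R u) \<and>
          Exec (simbody off pc kb st (COPY kb) (unattained_hook d) P) {} (R u) (T u) (R (ord_suc u)) \<and> G u (R u) (T u) (R (ord_suc u))"
      and lims: "\<And>l' j. is_limit l' \<Longrightarrow> \<zeta> < l' \<Longrightarrow> l' < l \<Longrightarrow> is_lim \<zeta> l' (trc R T j) (R l' j)"
    have wcb: "wc (simbody off pc kb st (COPY kb) (unattained_hook d) P) j \<le> 1" if "j \<in> ?X" for j
    proof -
      have "wc (simbody off pc kb st (COPY kb) (unattained_hook d) P) j = wc (unattained_hook d) j"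
        by (rule simbody_wc(2)[where k = k]) (use that P in \<open>auto simp: layout\<close>)
      then show ?thesis using unattained_hook_wc(2)[OF that] by simp
    qed
    have two: "is_lim \<zeta> l' (trc R T j) y \<longleftrightarrow> is_lim \<zeta> l' (\<lambda>u. {R u j}) y" if "j \<in> ?X" "is_limit l'" "l' \<le> l" for j y l'
    proof (rule trc_two_valued[where x = "{}", OF that(2) _ wcb[OF that(1)]])
      fix u assume u: "\<zeta> \<le> u" "u < l'"
      then have "u < l" using that(3) by simp
      then show "Exec (simbody off pc kb st (COPY kb) (unattained_hook d) P) {} (R u) (T u) (R (ord_suc u))" using fam u(1) by blast
    qed
    have tl: "u < top_stage" if "u < l" for u using that l(3) by simp
    have auxlim: "\<exists>v\<le>r d. is_lim \<zeta> l (\<lambda>u. {R u aux}) v"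
    proof (rule is_lim_ex)
      fix u assume u: "\<zeta> \<le> u" "u < l"
      have "R u aux < r d" using EB fam[OF u] tl[OF u(2)] by blast
      then show "\<exists>q y. u \<le> q \<and> q < l \<and> y \<in> {R q aux} \<and> y \<le> r d" using u by (auto intro: less_imp_le)
    qed
    then obtain va where va: "va \<le> r d" "is_lim \<zeta> l (\<lambda>u. {R u aux}) va" by blast
    have "\<exists>vc. is_lim \<zeta> l (\<lambda>u. {R u 0}) vc \<and> (l < top_stage \<longrightarrow> stg vc \<le> l)"
    proof (cases "l < top_stage")
      case True
      then obtain b where b: "l = stg b" using less_top_ex by blast
      have "\<exists>v\<le>b. is_lim \<zeta> l (\<lambda>u. {R u 0}) v"
      proof (rule is_lim_ex)
        fix u assume u: "\<zeta> \<le> u" "u < l"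
        have "stg (R u 0) \<le> u" using fam[OF u] tl[OF u(2)] unfolding E_def by blast
        then have "R u 0 \<le> b" using u(2) b by (metis less_imp_le order_trans stg_le_iff)
        then show "\<exists>q y. u \<le> q \<and> q < l \<and> y \<in> {R q 0} \<and> y \<le> b" using u by auto
      qed
      then show ?thesis using b by auto
    next
      case False
      then have lt: "l = top_stage" using l(3) by simp
      \<comment> \<open>At \<alpha> the counter must have inferior limit 0. Without resets from
        \<open>u\<close> on, \<open>aux\<close> would be constant and its value attained cofinally
        often by register \<open>d\<close>; then \<open>r d\<close> would be at most
        \<open>aux\<close>.\<close>
      have cof: "\<exists>q. u \<le> q \<and> q < l \<and> R q 0 = ord_zero" if u: "\<zeta> \<le> u" "u < l" for u
      proof (rule ccontr)
        assume no: "\<not> ?thesis"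
        have occs: "occ q (R q aux)" if q: "u \<le> q" "q < l" for q
        proof (rule ccontr)
          assume "\<not> occ q (R q aux)"
          moreover have "G q (R q) (T q) (R (ord_suc q))" using fam q u(1) by (meson order_trans)
          ultimately have "R (ord_suc q) 0 = ord_zero" unfolding G_def by simp
          then show False using no q is_limit_suc[OF l(1) q(2)] by (meson stage_le_suc)
        qed
        have const: "q < l \<longrightarrow> R q aux = R u aux" if "u \<le> q" for q
          using that
        proof (induction q rule: stage_interval_induct)
          case (suc q)
          have zq: "\<zeta> \<le> q" using suc.hyps u(1) by simp
          show ?case
          proof
            assume "ord_suc q < l"
            then have q: "q < l" by (rule less_trans[OF stage_suc_gt])
            have "G q (R q) (T q) (R (ord_suc q))" using fam[OF zq q] by blast
            then show "R (ord_suc q) aux = R u aux" using occs[OF suc.hyps q] suc.IH q unfolding G_def by simp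
          qed
        next
          case (limit m)
          show ?case
          proof
            assume m: "m < l"
            have zm: "\<zeta> < m" using u(1) limit(2) by simp
            have "is_lim \<zeta> m (\<lambda>u. {R u aux}) (R m aux)" using iffD1[OF two[OF _ limit(1) less_imp_le[OF m]] lims[OF limit(1) zm m]] by blast
            then have "is_lim u m (\<lambda>u. {R u aux}) (R m aux)" by (rule is_lim_tail[OF _ zm limit(2)])
            moreover have "is_lim u m (\<lambda>u. {R u aux}) (R u aux)"
            proof (rule is_lim_const[OF limit(2)])
              fix q assume q: "u \<le> q" "q < m"
              have "q < l" using q(2) m by (rule less_trans)
              then show "{R q aux} = {R u aux}" using limit(3)[OF q] by blast
            qed
            ultimately show "R m aux = R u aux" by (rule is_lim_unique)
          qed
        qed simp
        have "r d \<le> R u aux"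
          unfolding r_def
        proof (rule is_lim_attained_le[OF C_lim(2)[OF top_is_limit top u(2)[unfolded lt]]])
          fix q assume q: "u \<le> q" "q < top_stage"
          have "occ q (R u aux)" using occs[of q] const[OF q(1)] q lt by simp
          then show "\<exists>w. q \<le> w \<and> w < top_stage \<and> snd (the (C w)) d = R u aux" unfolding occ_def val_def .
        qed
        moreover have "R u aux < r d" using EB fam[OF u] tl[OF u(2)] by blast
        ultimately show False by simp
      qed
      have "is_lim \<zeta> l (\<lambda>u. {R u 0}) ord_zero" by (rule is_lim_zero) (use cof in \<open>metis insertI1\<close>)
      then show ?thesis using lt by auto
    qed
    then obtain vc where vc: "is_lim \<zeta> l (\<lambda>u. {R u 0}) vc" "l < top_stage \<Longrightarrow> stg vc \<le> l" by blast
    let ?g = "\<lambda>j. if j = 0 then vc else va"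
    have "\<forall>j\<in>?X. is_lim \<zeta> l (trc R T j) (?g j)"
      using two[OF _ l(1) order_refl] vc(1) va(2) by (auto simp: layout)
    moreover have "E l R'" if "\<forall>j\<in>?X. R' j = ?g j" for R'
      unfolding E_def
    proof (intro impI conjI allI)
      assume "l < top_stage"
      then show "stg (R' 0) \<le> l" using vc(2) that by simp
      fix s assume s: "l \<le> s" "s < top_stage"
      have "va \<le> val s"
      proof (rule is_lim_le[OF va(2)])
        fix u y assume u: "\<zeta> \<le> u" "u < l" "y \<in> {R u aux}"
        have "u \<le> s" using u(2) s(1) by simp
        then show "y \<le> val s" using fam[OF u(1,2)] tl[OF u(2)] s(2) u(3) unfolding E_def by simp
      qed simp
      then show "R' aux \<le> val s" using that by (simp add: layout)
    qed
    ultimately show "\<exists>g. (\<forall>j\<in>?X. is_lim \<zeta> l (trc R T j) (g j)) \<and> (\<forall>R'. (\<forall>j\<in>?X. R' j = g j) \<longrightarrow> E l R')"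
      by (intro exI[of _ ?g] conjI allI impI)
  qed (auto simp: layout)
  from S.sim_iter obtain R T where R0: "R \<zeta> = start" and
    inv: "\<forall>u. \<zeta> \<le> u \<longrightarrow> u \<le> top_stage \<longrightarrow> S.Inv u (R u)" and
    st: "\<forall>u. \<zeta> \<le> u \<longrightarrow> u < top_stage \<longrightarrow> Exec S.body {} (R u) (T u) (R (ord_suc u)) \<and> S.Qs u (R u) (T u) (R (ord_suc u))" and
    lims: "\<forall>l j. is_limit l \<longrightarrow> \<zeta> < l \<longrightarrow> l \<le> top_stage \<longrightarrow> is_lim \<zeta> l (trc R T j) (R l j)" and
    iter: "Iter pc (kb + n) S.body {} start (\<Union>u\<in>{\<zeta>..<top_stage}. insert (R u) (insert (R (ord_suc u)) (T u))) (R top_stage)"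
    by (elim exE conjE)
  have top': "rep off pc k n (the (C top_stage)) (R top_stage)" "base (R top_stage)"
  proof -
    have I: "S.Inv top_stage (R top_stage)" using inv zeta by simp
    then show "rep off pc k n (the (C top_stage)) (R top_stage)" unfolding S.Inv_def by blast
    show "base (R top_stage)" by (rule base_frame[OF base_start]) (use I in \<open>auto simp: S.Inv_def\<close>)
  qed
  obtain Te where Te: "Exec (unattained_hook d) {} (R top_stage) Te ((R top_stage)(st := R top_stage (kb + 1)))"
    using Exec_hook_top[OF top'(2,1)] unfolding unattained_hook_def by blast
  have wcb: "wc S.body j \<le> 1" if "j \<in> ?X" for j
    using S.body_wc(2)[OF that] unattained_hook_wc(2)[OF that] by simp
  have lim2: "is_lim \<zeta> l (\<lambda>u. {R u j}) (R l j)" if "j \<in> ?X" "is_limit l" "\<zeta> < l" "l < top_stage" for j l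
  proof -
    have "is_lim \<zeta> l (trc R T j) (R l j) \<longleftrightarrow> is_lim \<zeta> l (\<lambda>u. {R u j}) (R l j)"
    proof (rule trc_two_valued[where x = "{}", OF that(2) _ wcb[OF that(1)]])
      fix u assume u: "\<zeta> \<le> u" "u < l"
      then have "u < top_stage" using that(4) by simp
      then show "Exec S.body {} (R u) (T u) (R (ord_suc u))" using st u(1) by blast
    qed
    then show ?thesis using lims that by simp
  qed
  show ?thesis
  proof (rule finish[OF iter top' Te])
    show "((R top_stage)(st := R top_stage (kb + 1))) st = ((R top_stage)(st := R top_stage (kb + 1))) (kb + 1)"
      by (simp add: layout)
    fix \<iota> :: 'a
    have "\<exists>u. \<zeta> \<le> u \<and> u < top_stage \<and> R u 0 = \<iota>"
    \<comment> \<open>\<open>aux\<close> plays the slow component, bounded by \<open>r d\<close>,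
      and its increases are exactly the resets of the counter.\<close>
    proof (rule coverage[where w = "\<lambda>u. R u aux" and c = "\<lambda>u. R u 0", OF zeta])
      show "R \<zeta> 0 = ord_zero" using R0 start_zero[of 0] by simp
      fix u assume u: "\<zeta> \<le> u" "u < top_stage"
      have "G u (R u) (T u) (R (ord_suc u))" using st u unfolding S.Qs_def by blast
      then show "R (ord_suc u) aux = R u aux \<and> R (ord_suc u) 0 = ord_suc (R u 0) \<or>
         R u aux < R (ord_suc u) aux \<and> R (ord_suc u) 0 = ord_zero"
        unfolding G_def by (auto split: if_splits)
      have "E u (R u)" using inv u unfolding S.Inv_def by simp
      then show "R u aux \<le> r d" using EB u(2) by (simp add: less_imp_le)
    qed (use lim2 in auto)
    then show "\<exists>S\<in>(\<Union>u\<in>{\<zeta>..<top_stage}. insert (R u) (insert (R (ord_suc u)) (T u))). S 0 = \<iota>" by fastforce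
  qed
qed

section \<open>Attained inferior limits\<close>

text \<open>The search register is set to 0 for a moment, which forces its inferior limit at time \<open>\<alpha>\<close> to be 0.\<close>
definition flash :: com where
  "flash = COPY 0 aux ;; COPY kb 0 ;; COPY aux 0 ;; COPY kb aux ;; fill_block kb fb (Suc k)"

text \<open>Index \<open>k\<close> stands for the active line, so there are \<open>k + 1\<close>
  flags.\<close>

definition comparison :: "nat \<Rightarrow> nat \<times> nat \<times> nat" where
  "comparison i = (if i < k then off + i else pc, if i < k then rb + i else kb + ls, fb + i)"

definition attained_event :: com where
  "attained_event = flag_step (kb + 1) (map comparison [0..<Suc k]) flash ;; INC 0"

definition attained_hook :: com where
  "attained_hook = eqall (eqs off pc) (COPY (kb + 1) st) attained_event"

definition agrees :: "nat \<Rightarrow> 'a stage \<Rightarrow> bool" where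
  "agrees i u \<longleftrightarrow> (if i < k then snd (the (C u)) i = r i else fst (the (C u)) = ls)"

definition all_set :: "(nat \<Rightarrow> 'a) \<Rightarrow> bool" where
  "all_set R \<longleftrightarrow> (\<forall>i\<le>k. R (fb + i) = ord_one)"

text \<open>The clauses on \<open>T\<close> separate the two effects on register 0: a momentary 0
  when all flags are up, and otherwise no value besides those before and after the step.\<close>

definition flag_transition :: "'a stage \<Rightarrow> (nat \<Rightarrow> 'a) \<Rightarrow> (nat \<Rightarrow> 'a) set \<Rightarrow> (nat \<Rightarrow> 'a) \<Rightarrow> bool" where
  "flag_transition u R T R' \<longleftrightarrow> R' 0 = ord_suc (R 0) \<and>
     (if all_set R then (\<forall>i\<le>k. R' (fb + i) = ord_zero) \<and> (\<exists>S\<in>T. S 0 = ord_zero)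
      else (\<forall>S\<in>T. S 0 = R 0 \<or> S 0 = R' 0) \<and>
        (\<forall>i\<le>k. R' (fb + i) = R (fb + i) \<or> R' (fb + i) = ord_one \<and> agrees i u) \<and>
        (\<forall>i\<le>k. R (fb + i) \<noteq> ord_one \<longrightarrow> (\<forall>j<i. R (fb + j) = ord_one) \<longrightarrow> agrees i u \<longrightarrow> R' (fb + i) = ord_one))"

definition flagged :: "(nat \<Rightarrow> 'a) \<Rightarrow> bool" where
  "flagged R \<longleftrightarrow> R aux = ord_zero \<and> (\<forall>i\<le>k. R (fb + i) = ord_zero \<or> R (fb + i) = ord_one)"

abbreviation flag_regs :: "nat set" where "flag_regs \<equiv> {0, aux} \<union> {fb..fb+k}"

lemma attained_hook_wc:
  "j \<notin> insert st flag_regs \<Longrightarrow> wc attained_hook j = 0"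
  "j \<in> {fb..fb+k} \<Longrightarrow> wc attained_hook j \<le> 1"
proof -
  have le: "wc attained_hook j \<le> max (wc (COPY (kb + 1) st) j) (wc attained_event j)" for j
    unfolding attained_hook_def by (rule eqall_wc)
  have im: "(\<lambda>(i, j, f). f) ` set (map comparison [0..<Suc k]) = {fb..fb+k}"
  proof -
    have "(\<lambda>(i, j, f). f) ` set (map comparison [0..<Suc k]) = (\<lambda>i. fb + i) ` {0..<Suc k}"
      unfolding set_map image_image set_upt by (simp add: comparison_def)
    also have "\<dots> = {fb..fb+k}" by (simp only: image_add_atLeastLessThan) auto
    finally show ?thesis .
  qed
  have fw: "wc (flag_step (kb + 1) (map comparison [0..<Suc k]) flash) j \<le> max (wc flash j) (if j \<in> {fb..fb+k} then 1 else 0)" for j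
    using flag_step_wc[of "kb + 1" "map comparison [0..<Suc k]" flash j] unfolding im .
  show "wc attained_hook j = 0" if "j \<notin> insert st flag_regs"
  proof -
    have "wc flash j = 0" using that unfolding flash_def by (auto simp: fill_block_wc)
    then show ?thesis using le[of j] fw[of j] that unfolding attained_event_def by auto
  qed
  show "wc attained_hook j \<le> 1" if j: "j \<in> {fb..fb+k}"
  proof -
    have ne: "j \<noteq> 0" "j \<noteq> aux" "j \<noteq> st" using j by (auto simp: layout)
    then have "wc flash j \<le> 1" unfolding flash_def by (auto simp: fill_block_wc)
    then show ?thesis using le[of j] fw[of j] ne unfolding attained_event_def by (auto split: if_splits)
  qed
qed

lemma Exec_flash:
  assumes "R kb = ord_zero" "R aux = ord_zero"
  shows "\<exists>T. Exec flash {} R T (\<lambda>j. if j \<in> {fb..<fb+Suc k} then ord_zero else R j) \<and> (\<exists>S\<in>T. S 0 = ord_zero)"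
proof -
  define R1 where "R1 = R(aux := R 0)"
  define R2 where "R2 = R1(0 := R1 kb)"
  define R3 where "R3 = R2(0 := R2 aux)"
  define R4 where "R4 = R3(aux := R3 kb)"
  have ex: "Exec (COPY 0 aux) {} R {R} R1" "Exec (COPY kb 0) {} R1 {R1} R2" "Exec (COPY aux 0) {} R2 {R2} R3"
    "Exec (COPY kb aux) {} R3 {R3} R4"
    unfolding R1_def R2_def R3_def R4_def by (rule Exec_COPY)+
  have R4: "R4 = R"
    using assms unfolding R4_def R3_def R2_def R1_def by (auto simp: fun_eq_iff layout)
  have "R2 0 = ord_zero" using assms unfolding R2_def R1_def by (simp add: layout)
  moreover have "kb \<notin> {fb..<fb+Suc k}" by (auto simp: layout)
  from Exec_fill_block[OF this, of "{}" R4] obtain T where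
    T: "Exec (fill_block kb fb (Suc k)) {} R4 T (\<lambda>j. if j \<in> {fb..<fb+Suc k} then R4 kb else R4 j)" by blast
  from Exec_Seq[OF ex(1) Exec_Seq[OF ex(2) Exec_Seq[OF ex(3) Exec_Seq[OF ex(4) T]]]]
  have "Exec flash {} R ({R} \<union> ({R1} \<union> ({R2} \<union> ({R3} \<union> T)))) (\<lambda>j. if j \<in> {fb..<fb+Suc k} then ord_zero else R j)"
    unfolding flash_def R4 assms(1) .
  ultimately show ?thesis by (intro exI conjI) auto
qed

lemma comparison_iff:
  assumes R: "base R" "rep off pc k n (the (C u)) R" and u: "u < top_stage" and i: "i \<le> k"
  shows "R (fst (comparison i)) = R (fst (snd (comparison i))) \<longleftrightarrow> agrees i u"
proof (cases "i < k")
  case True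
  then show ?thesis using R unfolding base_def rep_def comparison_def agrees_def by simp
next
  case False
  have "fst (the (C u)) < n" by (rule line[OF less_trans[OF u top_less]])
  moreover have "R (kb + ls) = num ls" using R(1) ls_less unfolding base_def by simp
  ultimately show ?thesis using False R(2) unfolding rep_def comparison_def agrees_def by (simp add: min_def)
qed

lemma Exec_attained_event:
  assumes R: "base R" "rep off pc k n (the (C u)) R" and u: "u < top_stage" and fl: "flagged R"
  shows "\<exists>T R'. Exec attained_event {} R T R' \<and> (\<forall>j. j \<notin> flag_regs \<longrightarrow> R' j = R j) \<and> flag_transition u R T R' \<and> flagged R'"
proof -
  have one: "R (kb + 1) = ord_one"
  proof -
    have "R (kb + 1) = num 1" using R(1) unfolding base_def by auto
    then show ?thesis by (simp add: num_1)
  qed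
  have zero: "R kb = ord_zero" using R(1) unfolding base_def by (metis add_0_right num_0 zero_le)
  have aux0: "aux \<noteq> 0" "fb + i \<noteq> 0" "fb + i \<noteq> aux" for i by (simp_all add: layout)
  have aux1: "fb \<noteq> 0" by (simp add: layout)
  show ?thesis
  proof (cases "all_set R")
    case True
    obtain T where T: "Exec flash {} R T (\<lambda>j. if j \<in> {fb..<fb+Suc k} then ord_zero else R j)" "\<exists>S\<in>T. S 0 = ord_zero"
      using Exec_flash[where R = R, OF zero] fl unfolding flagged_def by blast
    define R1 where "R1 = (\<lambda>j. if j \<in> {fb..<fb+Suc k} then ord_zero else R j)"
    have "\<exists>T'. T \<subseteq> T' \<and> Exec (flag_step (kb + 1) (map comparison [0..<Suc k]) flash) {} R T' R1"
    proof (rule Exec_flag_step_full[OF _ T(1)[folded R1_def]])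
      show "R f = R (kb + 1)" if "(i, j, f) \<in> set (map comparison [0..<Suc k])" for i j f
        using that True one unfolding all_set_def comparison_def by auto
    qed
    then obtain T' where T': "T \<subseteq> T'" "Exec (flag_step (kb + 1) (map comparison [0..<Suc k]) flash) {} R T' R1" by (elim exE conjE)
    let ?R' = "R1(0 := ord_suc (R1 0))"
    have ev: "Exec attained_event {} R (T' \<union> {R1}) ?R'" unfolding attained_event_def by (rule Exec_Seq[OF T'(2) Exec_INC])
    have R10: "R1 0 = R 0" "R1 aux = ord_zero" using fl unfolding R1_def flagged_def by (auto simp: layout)
    have R1f: "R1 (fb + i) = ord_zero" if "i \<le> k" for i using that unfolding R1_def by simp
    have "flag_transition u R (T' \<union> {R1}) ?R'" unfolding flag_transition_def if_P[OF True]
      using T(2) T'(1) R10 R1f aux0 aux1 by auto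
    moreover have "flagged ?R'" unfolding flagged_def using R10 R1f aux0 aux1 by simp
    moreover have "\<forall>j. j \<notin> flag_regs \<longrightarrow> ?R' j = R j" unfolding R1_def by auto
    ultimately show ?thesis using ev by (intro exI conjI)
  next
    case False
    \<comment> \<open>The first flag that is down is the only one that \<open>flag_step\<close> may
      raise.\<close>
    define i0 where "i0 = (LEAST i. R (fb + i) \<noteq> ord_one)"
    obtain i where i: "i \<le> k" "R (fb + i) \<noteq> ord_one" using False unfolding all_set_def by blast
    have i0: "R (fb + i0) \<noteq> ord_one" unfolding i0_def using i(2) by (rule LeastI)
    have "i0 \<le> i" unfolding i0_def using i(2) by (rule Least_le)
    then have i0k: "i0 \<le> k" using i(1) by simp
    have before: "R (fb + j) = ord_one" if "j < i0" for j using not_less_Least[OF that[unfolded i0_def]] by simp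
    have split: "map comparison [0..<Suc k] = map comparison [0..<i0] @ comparison i0 # map comparison [Suc i0..<Suc k]"
    proof -
      have "[0..<Suc k] = [0..<i0] @ [i0..<Suc k]" using upt_add_eq_append[of 0 i0 "Suc k - i0"] i0k by simp
      also have "[i0..<Suc k] = i0 # [Suc i0..<Suc k]" using i0k by (simp only: upt_conv_Cons less_Suc_eq_le)
      finally show ?thesis by simp
    qed
    obtain a b where ab: "comparison i0 = (a, b, fb + i0)" unfolding comparison_def by blast
    have eq: "R a = R b \<longleftrightarrow> agrees i0 u" using comparison_iff[OF R u i0k] unfolding ab by simp
    let ?R1 = "if R a = R b then R(fb + i0 := R (kb + 1)) else R"
    have pre: "R f = R (kb + 1)" if "(i, j, f) \<in> set (map comparison [0..<i0])" for i j f
      using that before one unfolding comparison_def by auto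
    have "\<exists>T'. T' \<subseteq> {R, R(fb + i0 := R (kb + 1))} \<and>
      Exec (flag_step (kb + 1) (map comparison [0..<i0] @ (a, b, fb + i0) # map comparison [Suc i0..<Suc k]) flash) {} R T' ?R1"
      by (rule Exec_flag_step) (use pre i0 one in \<open>blast, simp\<close>)
    then obtain T where T: "T \<subseteq> {R, R(fb + i0 := R (kb + 1))}"
      "Exec (flag_step (kb + 1) (map comparison [0..<Suc k]) flash) {} R T ?R1"
      unfolding split ab by (elim exE conjE)
    define R1 where "R1 = ?R1"
    have R1: "R1 = (if agrees i0 u then R(fb + i0 := ord_one) else R)" unfolding R1_def eq one ..
    let ?R' = "R1(0 := ord_suc (R1 0))"
    have ev: "Exec attained_event {} R (T \<union> {R1}) ?R'"
      unfolding attained_event_def by (rule Exec_Seq[OF T(2)[folded R1_def] Exec_INC])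
    have R10: "R1 0 = R 0" "R1 aux = ord_zero" using fl aux0(2,3)[of i0] unfolding R1 flagged_def by auto
    have R1f: "R1 (fb + i) = (if i = i0 \<and> agrees i0 u then ord_one else R (fb + i))" for i unfolding R1 by simp
    have "S 0 = R 0" if "S \<in> T \<union> {R1}" for S using that T(1) R10(1) aux0(2)[of i0] by auto
    moreover have "?R' (fb + i) = R (fb + i) \<or> ?R' (fb + i) = ord_one \<and> agrees i u" for i using R1f[of i] aux1 by auto
    moreover have "?R' (fb + i) = ord_one"
      if "R (fb + i) \<noteq> ord_one" "\<forall>j<i. R (fb + j) = ord_one" "agrees i u" for i
    proof -
      have "i = i0" using that before i0 by (metis linorder_neqE_nat)
      then show ?thesis using R1f[of i] aux1 that(3) by simp
    qed
    ultimately have "flag_transition u R (T \<union> {R1}) ?R'" unfolding flag_transition_def if_not_P[OF False] using R10(1) aux1 by simp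
    moreover have "flagged ?R'" unfolding flagged_def using R10(2) R1f aux0 aux1 fl[unfolded flagged_def] by auto
    moreover have "\<forall>j. j \<notin> flag_regs \<longrightarrow> ?R' j = R j" using i0k unfolding R1 by auto
    ultimately show ?thesis using ev by (intro exI conjI)
  qed
qed

lemma flags_fam:
  assumes l: "is_limit l" "\<zeta> < l"
    and fam: "\<forall>u. \<zeta> \<le> u \<longrightarrow> u < l \<longrightarrow> flagged (R u) \<and> flag_transition u (R u) (T u) (R (ord_suc u))"
    and lim: "\<forall>l' i. is_limit l' \<longrightarrow> \<zeta> < l' \<longrightarrow> l' < l \<longrightarrow> i \<le> k \<longrightarrow> is_lim \<zeta> l' (\<lambda>u. {R u (fb + i)}) (R l' (fb + i))"
  shows "flags (\<lambda>i u. R u (fb + i)) agrees k \<zeta> l"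
proof
  show "is_limit l" "\<zeta> < l" by (rule l)+
next
  fix i u assume "i \<le> k" "\<zeta> \<le> u" "u < l"
  then show "R u (fb + i) = ord_zero \<or> R u (fb + i) = ord_one" using fam unfolding flagged_def by blast
next
  fix u i assume u: "\<zeta> \<le> u" "u < l" and all: "\<And>i. i \<le> k \<Longrightarrow> R u (fb + i) = ord_one" and i: "i \<le> k"
  have "all_set (R u)" unfolding all_set_def using all by blast
  moreover have "flag_transition u (R u) (T u) (R (ord_suc u))" using fam u by blast
  ultimately show "R (ord_suc u) (fb + i) = ord_zero" using i unfolding flag_transition_def by simp
next
  fix u i j assume u: "\<zeta> \<le> u" "u < l" and j: "j \<le> k" "R u (fb + j) \<noteq> ord_one" and i: "i \<le> k"
  have "\<not> all_set (R u)" unfolding all_set_def using j by blast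
  moreover have "flag_transition u (R u) (T u) (R (ord_suc u))" using fam u by blast
  ultimately show "R (ord_suc u) (fb + i) = R u (fb + i) \<or> R (ord_suc u) (fb + i) = ord_one \<and> agrees i u"
    using i unfolding flag_transition_def by simp
next
  fix u i assume u: "\<zeta> \<le> u" "u < l" and i: "i \<le> k" "R u (fb + i) \<noteq> ord_one"
    and j: "\<And>j. j < i \<Longrightarrow> R u (fb + j) = ord_one" and q: "agrees i u"
  have "\<not> all_set (R u)" unfolding all_set_def using i by blast
  moreover have "flag_transition u (R u) (T u) (R (ord_suc u))" using fam u by blast
  ultimately show "R (ord_suc u) (fb + i) = ord_one" using i j q unfolding flag_transition_def by simp
next
  fix l' i assume "is_limit l'" "\<zeta> < l'" "l' < l" "i \<le> k"
  then show "is_lim \<zeta> l' (\<lambda>u. {R u (fb + i)}) (R l' (fb + i))" using lim by blast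
qed

text \<open>Agreement of each component cofinally often below \<open>l\<close> bounds the inferior
  limits at \<open>l\<close> from above by \<open>r\<close> and \<open>ls\<close>; applying
  \<open>ge\<close> at \<open>l\<close> itself gives the other inequality. The configuration at
  \<alpha> would thus occur at \<open>l\<close>.\<close>

lemma no_flash:
  assumes ge: "\<And>s i. \<zeta> \<le> s \<Longrightarrow> s < top_stage \<Longrightarrow> i < k \<Longrightarrow> r i \<le> snd (the (C s)) i"
    "\<And>s. \<zeta> \<le> s \<Longrightarrow> s < top_stage \<Longrightarrow> ls \<le> fst (the (C s))"
    and F: "flags (\<lambda>i u. R u (fb + i)) agrees k \<zeta> l" and l: "l < top_stage"
  shows "\<exists>u. \<zeta> \<le> u \<and> u < l \<and> (\<forall>v. u \<le> v \<longrightarrow> v < l \<longrightarrow> \<not> all_set (R v))"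
proof (rule ccontr)
  assume no: "\<not> ?thesis"
  interpret F: flags ty "\<lambda>i u. R u (fb + i)" agrees k \<zeta> l by (rule F)
  have cof: "\<exists>v. u \<le> v \<and> v < l \<and> F.full v" if "\<zeta> \<le> u" "u < l" for u
    using no that unfolding F.full_def all_set_def by blast
  have q: "\<exists>v. u \<le> v \<and> v < l \<and> agrees i v" if "i \<le> k" "\<zeta> \<le> u" "u < l" for i u
    by (rule F.full_cofinal_imp[OF cof that])
  have lh: "l \<le> h" using l top_less by simp
  have zl: "\<zeta> \<le> l" using F.l(2) by simp
  have "fst (the (C l)) = ls"
  proof (rule antisym)
    show "fst (the (C l)) \<le> ls"
      by (rule is_lim_attained_le[OF C_lim(1)[OF F.l(1) lh F.l(2)]]) (use q[of k] in \<open>simp add: agrees_def\<close>)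
    show "ls \<le> fst (the (C l))" by (rule ge(2)[OF zl l])
  qed
  moreover have "snd (the (C l)) i = r i" if "i < k" for i
  proof (rule antisym)
    show "snd (the (C l)) i \<le> r i"
      by (rule is_lim_attained_le[OF C_lim(2)[OF F.l(1) lh F.l(2)]]) (use q[of i] that in \<open>simp add: agrees_def\<close>)
    show "r i \<le> snd (the (C l)) i" by (rule ge(1)[OF zl l that])
  qed
  ultimately have "C l = C top_stage" by (rule C_eq_top[OF lh])
  then show False using norec[OF zl l] by blast
qed

text \<open>Each component at \<alpha> is an inferior limit, so values up to it recur cofinally; by
  \<open>ge\<close> these values are equal to it. This is where the limits have to be
  attained.\<close>

lemma flash_cofinal:
  assumes ge: "\<And>s i. \<zeta> \<le> s \<Longrightarrow> s < top_stage \<Longrightarrow> i < k \<Longrightarrow> r i \<le> snd (the (C s)) i"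
    "\<And>s. \<zeta> \<le> s \<Longrightarrow> s < top_stage \<Longrightarrow> ls \<le> fst (the (C s))"
    and F: "flags (\<lambda>i u. R u (fb + i)) agrees k \<zeta> top_stage" and u: "\<zeta> \<le> u" "u < top_stage"
  shows "\<exists>v. u \<le> v \<and> v < top_stage \<and> all_set (R v)"
proof -
  interpret F: flags ty "\<lambda>i u. R u (fb + i)" agrees k \<zeta> top_stage by (rule F)
  have "\<exists>v. u \<le> v \<and> v < top_stage \<and> agrees i v" if iu: "i \<le> k" "\<zeta> \<le> u" "u < top_stage" for i u
  proof (cases "i < k")
    case True
    obtain v where v: "u \<le> v" "v < top_stage" "snd (the (C v)) i \<le> r i"
      using is_limD2[OF C_lim(2)[OF top_is_limit top iu(3), of i] order_refl iu(3)] unfolding r_def by blast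
    have "r i \<le> snd (the (C v)) i" by (rule ge(1)) (use v iu True in auto)
    then show ?thesis using v True unfolding agrees_def by (intro exI[of _ v]) simp
  next
    case False
    obtain v where v: "u \<le> v" "v < top_stage" "fst (the (C v)) \<le> ls"
      using is_limD2[OF C_lim(1)[OF top_is_limit top iu(3)] order_refl iu(3)] unfolding ls_def by blast
    have "ls \<le> fst (the (C v))" by (rule ge(2)) (use v iu in auto)
    then show ?thesis using v False unfolding agrees_def by (intro exI[of _ v]) simp
  qed
  from F.full_cofinal[OF this u] show ?thesis unfolding F.full_def all_set_def .
qed

lemma searchable_if_attained:
  assumes ge: "\<And>s i. \<zeta> \<le> s \<Longrightarrow> s < top_stage \<Longrightarrow> i < k \<Longrightarrow> r i \<le> snd (the (C s)) i"
    "\<And>s. \<zeta> \<le> s \<Longrightarrow> s < top_stage \<Longrightarrow> ls \<le> fst (the (C s))"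
  shows "wITRM_searchable TYPE('a)"
proof -
  define E where "E u R \<longleftrightarrow> flagged R \<and> (u < top_stage \<longrightarrow> stg (R 0) \<le> u)" for u and R :: "nat \<Rightarrow> 'a"
  let ?F = "{fb..fb+k}"
  let ?body = "simbody off pc kb st (COPY kb) attained_hook P"
  have body_wc: "wc ?body j \<le> 1" if "j \<in> ?F" for j
  proof -
    have "wc ?body j = wc attained_hook j"
      by (rule simbody_wc(2)[where k = k]) (use that P in \<open>auto simp: layout\<close>)
    then show ?thesis using attained_hook_wc(2)[OF that] by simp
  qed
  have heads: "is_lim \<zeta> l (trc R T j) y \<longleftrightarrow> is_lim \<zeta> l (\<lambda>u. {R u j}) y"
    if j: "j \<in> ?F" and l: "is_limit l"
      and ex: "\<And>u. \<zeta> \<le> u \<Longrightarrow> u < l \<Longrightarrow> Exec ?body {} (R u) (T u) (R (ord_suc u))" for l j y R T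
    by (rule trc_two_valued[where x = "{}" and R = R and T = T, OF l ex body_wc[OF j]])
  have fl: "flags (\<lambda>i u. R u (fb + i)) agrees k \<zeta> l"
    if l: "is_limit l" "\<zeta> < l"
      and fam: "\<forall>u. \<zeta> \<le> u \<longrightarrow> u < l \<longrightarrow> flagged (R u) \<and> flag_transition u (R u) (T u) (R (ord_suc u)) \<and>
         Exec ?body {} (R u) (T u) (R (ord_suc u))"
      and lims: "\<forall>l' j. is_limit l' \<longrightarrow> \<zeta> < l' \<longrightarrow> l' < l \<longrightarrow> is_lim \<zeta> l' (trc R T j) (R l' j)" for l R T
  proof (rule flags_fam[OF l])
    show "\<forall>u. \<zeta> \<le> u \<longrightarrow> u < l \<longrightarrow> flagged (R u) \<and> flag_transition u (R u) (T u) (R (ord_suc u))" using fam by blast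
    show "\<forall>l' i. is_limit l' \<longrightarrow> \<zeta> < l' \<longrightarrow> l' < l \<longrightarrow> i \<le> k \<longrightarrow> is_lim \<zeta> l' (\<lambda>u. {R u (fb + i)}) (R l' (fb + i))"
    proof (intro allI impI)
      fix l' i assume l': "is_limit l'" "\<zeta> < l'" "l' < l" and i: "i \<le> k"
      have j: "fb + i \<in> ?F" using i by simp
      have ex: "Exec ?body {} (R u) (T u) (R (ord_suc u))" if "\<zeta> \<le> u" "u < l'" for u
        using fam that less_trans[OF that(2) l'(3)] by blast
      show "is_lim \<zeta> l' (\<lambda>u. {R u (fb + i)}) (R l' (fb + i))"
        using iffD1[OF heads[where R = R and T = T, OF j l'(1) ex] lims[rule_format, OF l']] by simp
    qed
  qed
  interpret S: simulation_layout ty off pc kb st n k P "COPY kb" attained_hook "{}" "{}" flag_regs start C \<zeta> top_stage E flag_transition "\<lambda>_ _ _. True"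
  proof
    show "traj P {} C" by (rule traj_run)
    show "\<zeta> \<le> top_stage" using zeta by simp
    show "C top_stage \<noteq> None" using C_top by simp
    show "fst (the (C u)) < n" if "u < top_stage" for u using line[OF less_trans[OF that top_less]] .
    show "regs_below k P" by (rule P)
    show "kconsts kb n start" "start (kb + 1) = ord_one" "start st = ord_zero" by (rule kconsts_start)+
    show "rep off pc k n (the (C \<zeta>)) start" by (rule rep_start)
    show "E \<zeta> start" unfolding E_def flagged_def using start_zero by (simp add: stg_zero)
  next
    fix u R assume u: "\<zeta> \<le> u" "u < top_stage" and R: "rep off pc k n (the (C u)) R"
      "\<And>j. j \<notin> PP \<Longrightarrow> j \<notin> flag_regs \<Longrightarrow> R j = start j" and E: "E u R"
    have b: "base R" by (rule base_frame[OF base_start]) (use R(2) in auto)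
    have "flagged R" using E unfolding E_def by blast
    from Exec_attained_event[OF b R(1) u(2) this] obtain T R' where
      T: "Exec attained_event {} R T R'" "\<forall>j. j \<notin> flag_regs \<longrightarrow> R' j = R j" "flag_transition u R T R'" "flagged R'" by (elim exE conjE)
    obtain T' where T': "T \<subseteq> T'" "T' \<subseteq> insert R (insert R' T)" "Exec attained_hook {} R T' R'"
      using Exec_hook_below[OF b R(1) u T(1)] unfolding attained_hook_def by blast
    have "flag_transition u R T' R'"
    proof (cases "all_set R")
      case True
      then show ?thesis using T(3) T'(1) unfolding flag_transition_def if_P[OF True] by blast
    next
      case False
      have "\<forall>S\<in>T'. S 0 = R 0 \<or> S 0 = R' 0" using T(3) T'(2) unfolding flag_transition_def if_not_P[OF False] by blast
      then show ?thesis using T(3) unfolding flag_transition_def if_not_P[OF False] by blast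
    qed
    moreover have "E (ord_suc u) R'"
    proof -
      have "stg (R 0) \<le> u" using E u(2) unfolding E_def by simp
      moreover have "R' 0 = ord_suc (R 0)" using T(3) unfolding flag_transition_def by blast
      ultimately show ?thesis using T(4) unfolding E_def by (simp add: stg_suc stage_suc_le_iff stage_less_suc_iff)
    qed
    ultimately show "\<exists>T R1. Exec attained_hook {} R T R1 \<and> (\<forall>j. j \<notin> flag_regs \<longrightarrow> R1 j = R j) \<and> flag_transition u R T R1 \<and> E (ord_suc u) R1"
      using T'(3) T(2) by blast
  next
    show "wc attained_hook i = 0" if "i \<in> PP" for i
      by (rule attained_hook_wc) (use that in \<open>auto simp: layout\<close>)
  next
    fix R :: "nat \<Rightarrow> 'a" and j assume "\<And>i. i \<notin> PP \<Longrightarrow> i \<notin> flag_regs \<Longrightarrow> R i = start i"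
    then have "base R" by (intro base_frame[OF base_start]) auto
    then show "\<exists>T. Exec (COPY kb (off + j)) {} R T (R(off + j := if R (off + j) \<in> {} then ord_one else ord_zero)) \<and> True"
      by (rule qc_zero)
  next
    fix i assume i: "i \<notin> PP" "i \<notin> flag_regs" "start i \<noteq> ord_zero"
    have "i \<notin> insert st flag_regs" using i start_zero[of i] by auto
    then have "wc attained_hook i = 0" by (rule attained_hook_wc)
    then show "wc attained_hook i = 0 \<and> (\<forall>j<k. wc (COPY kb (off + j)) i = 0)" using i by auto
  next
    fix u R R' assume E: "E u R" and eq: "\<And>j. j \<in> flag_regs \<Longrightarrow> R j = R' j"
    have "R' 0 = R 0" "R' aux = R aux" "\<And>i. i \<le> k \<Longrightarrow> R' (fb + i) = R (fb + i)" using eq by simp_all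
    then show "E u R'" using E unfolding E_def flagged_def by simp
  next
    fix u R T T' R1 R' assume G: "flag_transition u R T R1" and T: "T \<subseteq> T'" and eq: "\<And>j. j \<in> flag_regs \<Longrightarrow> R' j = R1 j"
      and S: "\<And>S. S \<in> T' \<Longrightarrow> (\<exists>S'\<in>insert R1 T. \<forall>j\<in>flag_regs. S j = S' j)"
    have eqs: "R' 0 = R1 0" "\<And>i. i \<le> k \<Longrightarrow> R' (fb + i) = R1 (fb + i)" using eq by simp_all
    have "\<exists>S'\<in>insert R1 T. S 0 = S' 0" if "S \<in> T'" for S using S[OF that] by auto
    then have *: "S 0 = R1 0 \<or> (\<exists>S'\<in>T. S 0 = S' 0)" if "S \<in> T'" for S using that by blast
    show "flag_transition u R T' R'"
    proof (cases "all_set R")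
      case True
      have "\<exists>S\<in>T'. S 0 = ord_zero" using G T unfolding flag_transition_def if_P[OF True] by blast
      then show ?thesis using G unfolding flag_transition_def if_P[OF True] by (simp add: eqs)
    next
      case False
      have "\<forall>S\<in>T. S 0 = R 0 \<or> S 0 = R1 0" using G unfolding flag_transition_def if_not_P[OF False] by blast
      then have "\<forall>S\<in>T'. S 0 = R 0 \<or> S 0 = R1 0" using * by metis
      then show ?thesis using G unfolding flag_transition_def if_not_P[OF False] by (simp add: eqs)
    qed
  next
    fix l R T assume l: "is_limit l" "\<zeta> < l" "l \<le> top_stage"
      and fam: "\<And>u. \<zeta> \<le> u \<Longrightarrow> u < l \<Longrightarrow> rep off pc k n (the (C u)) (R u) \<and> E u (R u) \<and>
          Exec ?body {} (R u) (T u) (R (ord_suc u)) \<and> flag_transition u (R u) (T u) (R (ord_suc u))"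
      and lims: "\<And>l' j. is_limit l' \<Longrightarrow> \<zeta> < l' \<Longrightarrow> l' < l \<Longrightarrow> is_lim \<zeta> l' (trc R T j) (R l' j)"
    have fam': "\<forall>u. \<zeta> \<le> u \<longrightarrow> u < l \<longrightarrow> flagged (R u) \<and> flag_transition u (R u) (T u) (R (ord_suc u)) \<and>
         Exec ?body {} (R u) (T u) (R (ord_suc u))" using fam unfolding E_def by blast
    have F: "flags (\<lambda>i u. R u (fb + i)) agrees k \<zeta> l" by (rule fl[OF l(1,2) fam']) (use lims in blast)
    have aux: "is_lim \<zeta> l (trc R T aux) ord_zero"
    proof (rule is_lim_zero)
      fix u assume u: "\<zeta> \<le> u" "u < l"
      then have "R u aux = ord_zero" using fam' unfolding flagged_def by blast
      then show "\<exists>q. u \<le> q \<and> q < l \<and> ord_zero \<in> trc R T aux q"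
        using u unfolding trc_def by (intro exI[of _ u]) (auto simp: image_iff)
    qed
    have "\<exists>v\<le> ord_one. is_lim \<zeta> l (trc R T (fb + i)) v \<and> (v = ord_zero \<or> v = ord_one)" if i: "i \<le> k" for i
    proof -
      have "\<exists>v\<le> ord_one. is_lim \<zeta> l (trc R T (fb + i)) v"
      proof (rule is_lim_ex)
        fix u assume u: "\<zeta> \<le> u" "u < l"
        then have "R u (fb + i) = ord_zero \<or> R u (fb + i) = ord_one" using fam' i unfolding flagged_def by blast
        then have "R u (fb + i) \<le> ord_one" by auto
        then show "\<exists>q y. u \<le> q \<and> q < l \<and> y \<in> trc R T (fb + i) q \<and> y \<le> ord_one"
          using u unfolding trc_def by (intro exI[of _ u] exI[of _ "R u (fb + i)"]) auto
      qed
      then obtain v where v: "v \<le> ord_one" "is_lim \<zeta> l (trc R T (fb + i)) v" by blast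
      moreover have "v = ord_zero \<or> v = ord_one" using v(1) unfolding ord_one_def
        by (metis less_ord_suc_iff not_less_ord_zero order_le_less le_less_trans neq_ord_zero_iff)
      ultimately show ?thesis by blast
    qed
    then have "\<forall>i. \<exists>v. i \<le> k \<longrightarrow> is_lim \<zeta> l (trc R T (fb + i)) v \<and> (v = ord_zero \<or> v = ord_one)" by blast
    from choice[OF this] obtain vf where
      vf: "\<forall>i. i \<le> k \<longrightarrow> is_lim \<zeta> l (trc R T (fb + i)) (vf i) \<and> (vf i = ord_zero \<or> vf i = ord_one)" by blast
    have "\<exists>vc. is_lim \<zeta> l (trc R T 0) vc \<and> (l < top_stage \<longrightarrow> stg vc \<le> l)"
    proof (cases "l < top_stage")
      case True
      then obtain b where b: "l = stg b" using less_top_ex by blast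
      have "\<exists>v\<le>b. is_lim \<zeta> l (trc R T 0) v"
      proof (rule is_lim_ex)
        fix u assume u: "\<zeta> \<le> u" "u < l"
        have "stg (R u 0) \<le> u" using fam[OF u] less_trans[OF u(2) True] unfolding E_def by blast
        then have "R u 0 \<le> b" using u(2) b by (metis less_imp_le order_trans stg_le_iff)
        then show "\<exists>q y. u \<le> q \<and> q < l \<and> y \<in> trc R T 0 q \<and> y \<le> b"
          using u unfolding trc_def by (intro exI[of _ u] exI[of _ "R u 0"]) auto
      qed
      then show ?thesis using b by auto
    next
      case False
      then have lt: "l = top_stage" using l(3) by simp
      \<comment> \<open>At \<alpha> the momentary zeros are cofinal and prevent the overflow of the
        counter, which is never reset at a loop head.\<close>
      have "is_lim \<zeta> l (trc R T 0) ord_zero"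
      proof (rule is_lim_zero)
        fix u assume u: "\<zeta> \<le> u" "u < l"
        from flash_cofinal[OF ge F[unfolded lt] u(1) u(2)[unfolded lt]] obtain v where
          v: "u \<le> v" "v < l" "all_set (R v)" unfolding lt by blast
        have "flag_transition v (R v) (T v) (R (ord_suc v))" using fam' v u(1) by (meson order_trans)
        then obtain S where S: "S \<in> T v" "S 0 = ord_zero" using v(3) unfolding flag_transition_def by auto
        have "ord_zero \<in> trc R T 0 v" unfolding trc_def by (rule image_eqI[where x = S]) (simp_all add: S)
        then show "\<exists>q. u \<le> q \<and> q < l \<and> ord_zero \<in> trc R T 0 q" using v by blast
      qed
      then show ?thesis using lt by auto
    qed
    then obtain vc where vc: "is_lim \<zeta> l (trc R T 0) vc" "l < top_stage \<Longrightarrow> stg vc \<le> l" by blast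
    define g where "g j = (if j = 0 then vc else if j = aux then ord_zero else vf (j - fb))" for j
    have g: "g 0 = vc" "g aux = ord_zero" "g (fb + i) = vf i" for i unfolding g_def by (simp_all add: layout)
    have "\<forall>j\<in>flag_regs. is_lim \<zeta> l (trc R T j) (g j)"
    proof
      fix j assume "j \<in> flag_regs"
      then consider "j = 0" | "j = aux" | i where "i \<le> k" "j = fb + i"
        by (auto simp: le_iff_add)
      then show "is_lim \<zeta> l (trc R T j) (g j)" using g vc(1) aux vf by cases auto
    qed
    moreover have "E l R'" if R': "\<forall>j\<in>flag_regs. R' j = g j" for R'
    proof -
      have "R' 0 = vc" "R' aux = ord_zero" "\<And>i. i \<le> k \<Longrightarrow> R' (fb + i) = vf i" using R' g by simp_all
      then show ?thesis unfolding E_def flagged_def using vc(2) vf by simp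
    qed
    ultimately show "\<exists>g. (\<forall>j\<in>flag_regs. is_lim \<zeta> l (trc R T j) (g j)) \<and> (\<forall>R'. (\<forall>j\<in>flag_regs. R' j = g j) \<longrightarrow> E l R')"
      by (intro exI[of _ g] conjI allI impI)
  qed (auto simp: layout P)
  from S.sim_iter obtain R T where R0: "R \<zeta> = start" and
    inv: "\<forall>u. \<zeta> \<le> u \<longrightarrow> u \<le> top_stage \<longrightarrow> S.Inv u (R u)" and
    st: "\<forall>u. \<zeta> \<le> u \<longrightarrow> u < top_stage \<longrightarrow> Exec S.body {} (R u) (T u) (R (ord_suc u)) \<and> S.Qs u (R u) (T u) (R (ord_suc u))" and
    lims: "\<forall>l j. is_limit l \<longrightarrow> \<zeta> < l \<longrightarrow> l \<le> top_stage \<longrightarrow> is_lim \<zeta> l (trc R T j) (R l j)" and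
    iter: "Iter pc (kb + n) S.body {} start (\<Union>u\<in>{\<zeta>..<top_stage}. insert (R u) (insert (R (ord_suc u)) (T u))) (R top_stage)"
    by (elim exE conjE)
  have top': "rep off pc k n (the (C top_stage)) (R top_stage)" "base (R top_stage)"
  proof -
    have I: "S.Inv top_stage (R top_stage)" using inv zeta by simp
    then show "rep off pc k n (the (C top_stage)) (R top_stage)" unfolding S.Inv_def by blast
    show "base (R top_stage)" by (rule base_frame[OF base_start]) (use I[unfolded S.Inv_def] in auto)
  qed
  obtain Te where Te: "Exec attained_hook {} (R top_stage) Te ((R top_stage)(st := R top_stage (kb + 1)))"
    using Exec_hook_top[OF top'(2,1)] unfolding attained_hook_def by blast
  have fam: "flagged (R u) \<and> flag_transition u (R u) (T u) (R (ord_suc u)) \<and> Exec ?body {} (R u) (T u) (R (ord_suc u))"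
    if u: "\<zeta> \<le> u" "u < top_stage" for u
  proof -
    have "S.Inv u (R u)" using inv u by simp
    then show ?thesis using st u unfolding S.Inv_def S.Qs_def E_def by blast
  qed
  \<comment> \<open>The code writes register 0 several times, so \<open>wc\<close> is of no help.
    But below \<open>l\<close> there is a stage after which no flash happens, and from there on only
    the increment changes the register.\<close>
  have lim0: "is_lim \<zeta> l (\<lambda>u. {R u 0}) (R l 0)" if l: "is_limit l" "\<zeta> < l" "l < top_stage" for l
  proof -
    have fl': "flags (\<lambda>i u. R u (fb + i)) agrees k \<zeta> l"
    proof (rule fl[OF l(1,2)])
      show "\<forall>u. \<zeta> \<le> u \<longrightarrow> u < l \<longrightarrow> flagged (R u) \<and> flag_transition u (R u) (T u) (R (ord_suc u)) \<and>
         Exec ?body {} (R u) (T u) (R (ord_suc u))" using fam less_trans[OF _ l(3)] by blast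
      show "\<forall>l' j. is_limit l' \<longrightarrow> \<zeta> < l' \<longrightarrow> l' < l \<longrightarrow> is_lim \<zeta> l' (trc R T j) (R l' j)"
        using lims l(3) by (meson less_imp_le less_trans)
    qed
    from no_flash[OF ge fl' l(3)] obtain u where
      u: "\<zeta> \<le> u" "u < l" "\<forall>v. u \<le> v \<longrightarrow> v < l \<longrightarrow> \<not> all_set (R v)" by blast
    have "is_lim \<zeta> l (trc R T 0) (R l 0)" using lims l by (simp add: less_imp_le)
    then have L: "is_lim u l (trc R T 0) (R l 0)" using l(2) u(2) by (rule is_lim_tail)
    have "is_lim u l (trc R T 0) (R l 0) \<longleftrightarrow> is_lim u l (\<lambda>u. {R u 0}) (R l 0)"
    proof (rule is_lim_two_valued[OF l(1)])
      show "R v 0 \<in> trc R T 0 v" for v unfolding trc_def by simp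
      show "y = R v 0 \<or> y = R (ord_suc v) 0" if v: "u \<le> v" "v < l" "y \<in> trc R T 0 v" for v y
      proof -
        have "flag_transition v (R v) (T v) (R (ord_suc v))" using fam v u(1) less_trans[OF v(2) l(3)] by (meson order_trans)
        moreover have nf: "\<not> all_set (R v)" using u(3) v by blast
        ultimately have "\<forall>S\<in>T v. S 0 = R v 0 \<or> S 0 = R (ord_suc v) 0" unfolding flag_transition_def if_not_P[OF nf] by blast
        then show ?thesis using v(3) unfolding trc_def by auto
      qed
    qed
    with L have "is_lim u l (\<lambda>u. {R u 0}) (R l 0)" by blast
    then show ?thesis using u(2) l(2) by (rule is_lim_tail)
  qed
  show ?thesis
  proof (rule finish[OF iter top' Te])
    show "((R top_stage)(st := R top_stage (kb + 1))) st = ((R top_stage)(st := R top_stage (kb + 1))) (kb + 1)"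
      by (simp add: layout)
    fix \<iota> :: 'a
    have "\<exists>u. \<zeta> \<le> u \<and> u < top_stage \<and> R u 0 = \<iota>"
    \<comment> \<open>Without resets the slow component is constant: at the loop heads below
      \<alpha> the counter simply increases.\<close>
    proof (rule coverage[where w = "\<lambda>u. ord_zero" and c = "\<lambda>u. R u 0" and B = ord_zero, OF zeta])
      show "R \<zeta> 0 = ord_zero" using R0 start_zero[of 0] by simp
      fix u assume u: "\<zeta> \<le> u" "u < top_stage"
      have "R (ord_suc u) 0 = ord_suc (R u 0)" using fam[OF u] unfolding flag_transition_def by blast
      then show "(ord_zero :: 'a) = ord_zero \<and> R (ord_suc u) 0 = ord_suc (R u 0) \<or>
         (ord_zero :: 'a) < ord_zero \<and> R (ord_suc u) 0 = ord_zero" by simp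
    next
      fix l assume l: "is_limit l" "\<zeta> < l" "l < top_stage"
      show "is_lim \<zeta> l (\<lambda>u. {ord_zero}) ord_zero \<and> is_lim \<zeta> l (\<lambda>u. {R u 0}) (R l 0)"
        using lim0[OF l] is_lim_const[OF l(2), of "\<lambda>u. {ord_zero}" ord_zero] by blast
    qed simp
    then show "\<exists>S\<in>(\<Union>u\<in>{\<zeta>..<top_stage}. insert (R u) (insert (R (ord_suc u)) (T u))). S 0 = \<iota>" by fastforce
  qed
qed

end

section \<open>The two cases put together\<close>

context long_run begin

lemma searchable: "wITRM_searchable TYPE('a)"
proof -
  obtain \<zeta>0 where z0: "\<zeta>0 < top_stage" "\<And>s. \<zeta>0 \<le> s \<Longrightarrow> s < top_stage \<Longrightarrow> C s \<noteq> C top_stage"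
    using no_recurrence by blast
  show ?thesis
  proof (cases "\<exists>d<k. \<forall>s<top_stage. \<exists>s'. s \<le> s' \<and> s' < top_stage \<and> snd (the (C s')) d < r d")
    case True
    then obtain d where d: "d < k" "\<And>s. s < top_stage \<Longrightarrow> \<exists>s'. s \<le> s' \<and> s' < top_stage \<and> snd (the (C s')) d < r d"
      by blast
    interpret long_run_from ty P k \<rho> h ch \<zeta>0 by unfold_locales (fact z0)+
    show ?thesis using d by (rule searchable_if_unattained)
  next
    case False
    \<comment> \<open>Each of the finitely many registers has a stage from which on it is at least
      its value at \<alpha>; the maximum serves for all of them.\<close>
    have regs: "m \<le> k \<Longrightarrow> \<exists>z<top_stage. \<zeta>0 \<le> z \<and>
        (\<forall>s. z \<le> s \<longrightarrow> s < top_stage \<longrightarrow> (\<forall>i<m. r i \<le> snd (the (C s)) i))" for m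
    proof (induction m)
      case 0
      then show ?case using z0(1) by blast
    next
      case (Suc m)
      then obtain z where z: "z < top_stage" "\<zeta>0 \<le> z"
        "\<forall>s. z \<le> s \<longrightarrow> s < top_stage \<longrightarrow> (\<forall>i<m. r i \<le> snd (the (C s)) i)" by auto
      obtain z' where z': "z' < top_stage" "\<forall>s. z' \<le> s \<longrightarrow> s < top_stage \<longrightarrow> r m \<le> snd (the (C s)) m"
        using False Suc.prems by (meson Suc_le_eq not_le)
      show ?case
        using z z' by (intro exI[of _ "max z z'"]) (auto simp: less_Suc_eq le_max_iff_disj)
    qed
    obtain z where z: "z < top_stage" "\<zeta>0 \<le> z"
      "\<forall>s. z \<le> s \<longrightarrow> s < top_stage \<longrightarrow> (\<forall>i<k. r i \<le> snd (the (C s)) i)"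
      using regs[OF order_refl] by blast
    \<comment> \<open>The line cannot approach its inferior limit strictly from below, because it is
      a natural number: eventually exceeding \<open>ls - 1\<close> means being at least
      \<open>ls\<close>. So only registers can fall under the first case.\<close>
    have "\<exists>z'<top_stage. \<forall>s. z' \<le> s \<longrightarrow> s < top_stage \<longrightarrow> ls \<le> fst (the (C s))"
    proof (cases "ls = 0")
      case True
      then show ?thesis using z(1) by auto
    next
      case False
      then have "ls - 1 < fst (the (C top_stage))" unfolding ls_def by simp
      from is_limD1[OF C_lim(1)[OF top_is_limit top z(1)] this] obtain z' where
        z': "z' < top_stage" "\<forall>s y. z' \<le> s \<longrightarrow> s < top_stage \<longrightarrow> y \<in> {fst (the (C s))} \<longrightarrow> ls - 1 < y" by blast
      have "ls \<le> fst (the (C s))" if "z' \<le> s" "s < top_stage" for s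
        using z'(2)[rule_format, OF that, of "fst (the (C s))"] by simp
      then show ?thesis using z'(1) by blast
    qed
    then obtain z' where z': "z' < top_stage" "\<forall>s. z' \<le> s \<longrightarrow> s < top_stage \<longrightarrow> ls \<le> fst (the (C s))" by blast
    interpret long_run_from ty P k \<rho> h ch "max z z'"
    proof
      show "max z z' < top_stage" using z z' by simp
      show "C s \<noteq> C top_stage" if "max z z' \<le> s" "s < top_stage" for s
        by (rule z0(2)) (use that z(2) in auto)
    qed
    show ?thesis by (rule searchable_if_attained) (use z z' in auto)
  qed
qed

end

lemma (in exp_closed) searchable_if_not_u_weak:
  assumes "\<not> u_weak TYPE('a)"
  shows "wITRM_searchable TYPE('a)"
proof -
  obtain P and \<rho> :: 'a where halts: "halts P {} [\<rho>]" and no: "\<And>t :: 'a. \<not> halted_by P {} [\<rho>] t"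
    using assms unfolding u_weak_def by blast
  obtain v where "halts_with P {} [\<rho>] v"
    using halts unfolding halts_def halts_with_def halted_by_def by blast
  then obtain h :: "'a stage" and c where h: "run P {} [\<rho>] h = Some c" "halted P c"
    "\<And>s. s < h \<Longrightarrow> fst (the (run P {} [\<rho>] s)) < length P"
    by (rule halts_with_first) blast
  have "top_stage \<le> h"
  proof (rule ccontr)
    assume "\<not> top_stage \<le> h"
    then have "h < top_stage" by simp
    then obtain w where "h = stg w" using less_top_ex by blast
    then have "run P {} [\<rho>] w = Some c" using h(1) by (simp add: run_stg)
    then show False using no[of w] h(2) unfolding halted_by_def by blast
  qed
  moreover obtain k where "regs_below k P" "1 \<le> k" using regs_below_ex by blast
  ultimately interpret long_run ty P k \<rho> h c using h by unfold_locales
  show ?thesis by (rule searchable)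
qed

theorem corollary5:
  assumes "exponentially_closed TYPE('a::wellorder)"
  shows "((COMP :: 'a set set) \<subseteq> RECOG \<longleftrightarrow> ({} :: 'a set) \<in> RECOG) \<and>
         (({} :: 'a set) \<in> RECOG \<longleftrightarrow> (COMP :: 'a set set) \<inter> RECOG \<noteq> {}) \<and>
         ((COMP :: 'a set set) \<inter> RECOG \<noteq> {} \<longleftrightarrow> \<not> u_weak TYPE('a)) \<and>
         (\<not> u_weak TYPE('a) \<longleftrightarrow> wITRM_searchable TYPE('a))"
proof -
  interpret exp_closed "TYPE('a)" by unfold_locales (rule assms)
  have 12: "({} :: 'a set) \<in> RECOG" if "(COMP :: 'a set set) \<subseteq> RECOG" using that empty_computable by blast
  have 23: "(COMP :: 'a set set) \<inter> RECOG \<noteq> {}" if "({} :: 'a set) \<in> RECOG" using that empty_computable by blast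
  have 35: "wITRM_searchable TYPE('a)" if "(COMP :: 'a set set) \<inter> RECOG \<noteq> {}"
    using that searchable_if_recognized by blast
  have 51: "(COMP :: 'a set set) \<subseteq> RECOG" if "wITRM_searchable TYPE('a)"
    using recognizable_if_searchable[OF that] by blast
  have 45: "\<not> u_weak TYPE('a) \<longleftrightarrow> wITRM_searchable TYPE('a)"
    using searchable_not_u_weak searchable_if_not_u_weak by blast
  show ?thesis using 12 23 35 51 45 by blast
qed

end
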